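(* Let $F=\{F_\omega\}_{\omega\in\Omega}$ be the random tower map on $\Delta=\{\Delta_\omega\}_{\omega\in\Omega}$ associated with a random tower satisfying (P1)--(P7) (all defined in the context). Then for $P$-almost every $\omega\in\Omega$ there is an absolutely continuous probability measure $\nu_\omega=h_\omega m$ on $\Delta_\omega$ such that the family $\{\nu_\omega\}$ is $F$-equivariant, i.e. $(F_\omega)_*\nu_\omega=\nu_{\sigma\omega}$ for $P$-a.e. $\omega$, and the fibered system $(F,\nu)$ is exact, and hence mixing. Moreover, there exists a random variable $K_\omega:\Omega\to\mathbb R_+$ with $\inf_\Omega K_\omega>0$ and $P\{\omega: K_\omega>n\}\le e^{-un^v}$ for all $n\in\mathbb N$ (with $u,v$ the constants of (P4)) such that $h_\omega\in\mathcal F_\gamma^{K_\omega}\cap\mathcal F_\gamma^+$ for almost every $\omega\in\Omega$, i.e. the conditions defining these spaces hold for almost every $\omega$.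
   Context: Setting. Let $(\mathbb A,\mathcal F,p)$ be a Borel probability space, $\Omega=\mathbb A^{\mathbb Z}$, $P=p^{\mathbb Z}$, and $\sigma:\Omega\to\Omega$ the two-sided shift. Let $X$ be a measurable space with a reference measure $m$ (and a metric, used for diameters in (P3)), and let $f_u:X\to X$ ($p$-a.e. $u\in\mathbb A$) be measurable maps, nonsingular with respect to $m$, such that $(x,\omega)\mapsto (f_\omega(x),\sigma\omega)$ is measurable, where $f_\omega:=f_{\omega_0}$ depends only on the zeroth coordinate of $\omega$. Put $f^n_\omega=f_{\sigma^{n-1}\omega}\circ\cdots\circ f_\omega$. Random tower. $\Lambda\subset X$ is measurable with $m(\Lambda)=1$. For a.e. $\omega$ there are a countable partition $\{\Lambda_j(\omega)\}_j$ of $\Lambda$ and a return time $R_\omega:\Lambda\to\mathbb N$, constant on each $\Lambda_j(\omega)$, with $f_\omega^{R_\omega(x)}(x)\in\Lambda$ for a.e. $\omega$ and $m$-a.e. $x\in\Lambda$. Define $\Delta_\omega=\{(x,\ell)\in\Lambda\times\mathbb Z_+: x\in\bigcup_j\Lambda_j(\sigma^{-\ell}\omega),\ 0\le\ell\le R_{\sigma^{-\ell}\omega}(x)-1\}$ and $F_\omega:\Delta_\omega\to\Delta_{\sigma\omega}$ by $F_\omega(x,\ell)=(x,\ell+1)$ if $\ell+1<R_{\sigma^{-\ell}\omega}(x)$ and $F_\omega(x,\ell)=(f^{\ell+1}_{\sigma^{-\ell}\omega}(x),0)$ if $\ell+1=R_{\sigma^{-\ell}\omega}(x)$; $F^n_\omega=F_{\sigma^{n-1}\omega}\circ\cdots\circ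 F_\omega$. The level $\Delta_{\omega,\ell}=\{(x,\ell)\in\Delta_\omega\}$ is a copy of $\{R_{\sigma^{-\ell}\omega}>\ell\}\subset\Lambda$; $\Delta_{\omega,0}=\Lambda$. The measure $m$ and the $\sigma$-algebra of $\Lambda$ lift to $\Delta_\omega$; the lifts are denoted $m$ and $\mathcal B_\omega$. Let $\mathcal P_\omega=\{F^\ell_{\sigma^{-\ell}\omega}(\Lambda_j(\sigma^{-\ell}\omega)): R_{\sigma^{-\ell}\omega}|_{\Lambda_j(\sigma^{-\ell}\omega)}\ge\ell+1,\ \ell\in\mathbb Z_+\}$, a countable partition of $\Delta_\omega$. Separation time: $s(z_1,z_2)=0$ if $z_1,z_2$ lie in different towers; if $z_1,z_2\in\Delta_\omega$, $s(z_1,z_2)$ is the smallest $n\ge0$ such that the points reached by $z_1$ and $z_2$ at their $n$-th return to the base (for $n=0$: $z_1,z_2$ themselves) lie in distinct elements of the partition $\mathcal P$ of the corresponding fibre ($\infty$ if there is none). Assumptions: (P1) For each $\Lambda_j(\omega)$, $F_\omega^{R_\omega}|_{\Lambda_j(\omega)}:\Lambda_j(\omega)\to\Lambda$ is a bijection. (P2) There are $D>0$, $0<\gamma<1$ such that for all $\omega$ and each $\Lambda_j(\omega)$ the map $F_\omega^{R_\omega}|_{\Lambda_j(\omega)}$ and its inverse are nonsingular with respect to $m$, with positive Jacobian $JF_\omega^{R_\omega}$, and for $x,y\in\Lambda_j(\omega)$, $\left|\frac{JF_\omega^{R_\omega}(x)}{JF_\omega^{R_\omega}(y)}-1\right|\le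 D\gamma^{s(F_\omega^{R_\omega}(x,0),F_\omega^{R_\omega}(y,0))}$. (P3) $\mathcal P_\omega$ is generating: the diameters of $\bigvee_{j=0}^nF_\omega^{-j}\mathcal P_{\sigma^j\omega}$ tend to $0$ as $n\to\infty$. (P4) There are $C>0$, $a>1$, $b\ge0$, $u>0$, $v>0$, a full measure set $\Omega_1\subset\Omega$ and a random variable $n_1:\Omega_1\to\mathbb N$ with $m\{x\in\Lambda:R_\omega(x)>n\}\le C\frac{(\log n)^b}{n^a}$ whenever $n\ge n_1(\omega)$, and $P\{n_1(\omega)>n\}\le Ce^{-un^v}$. (P5) There are $N\in\mathbb N$, $t_1,\dots,t_N\in\mathbb Z_+$ with $\gcd\{t_i\}=1$ and $\epsilon_i>0$ such that for a.e. $\omega$ and all $i$, $m\{x\in\Lambda:R_\omega(x)=t_i\}>\epsilon_i$. (P6) There is $M>0$ with $m(\Delta_\omega)\le M$ for all $\omega$. (P7) There are $C>0$, $\hat b\ge0$ such that, with $a>1$ as in (P4), $(P\times m)\{(\omega,x)\in\Omega\times\Lambda:R_\omega(x)=n\}\le C\frac{(\log n)^{\hat b}}{n^{a+1}}$ for $n\ge2$. Function spaces (families $\varphi=\{\varphi_\omega:\Delta_\omega\to\mathbb R\}$; constants independent of $\omega$). $\mathcal F_\gamma^+$: there is $C_\varphi>0$ such that for each $I_\omega\in\mathcal P_\omega$ either $\varphi_\omega|_{I_\omega}\equiv0$, or $\varphi_\omega|_{I_\omega}>0$ and $|\log(\varphi_\omega(x)/\varphi_\omega(y))|\le C_\varphi\gamma^{s(x,y)}$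 for all $x,y\in I_\omega$. $\mathcal L_\infty^{K_\omega}$: there is $C'_\varphi>0$ with $\sup_{x\in\Delta_\omega}|\varphi_\omega(x)|\le C'_\varphi K_\omega$. $\mathcal F_\gamma^{K_\omega}$: those $\varphi\in\mathcal L_\infty^{K_\omega}$ for which there is $C_\varphi>0$ with $|\varphi_\omega(x)-\varphi_\omega(y)|\le C_\varphi K_\omega\gamma^{s(x,y)}$ for all $x,y\in\Delta_\omega$. Exactness and mixing. $\mathcal B$ is the $\sigma$-algebra on $\Delta$ of sets $B$ with $B_\omega=B\cap\Delta_\omega\in\mathcal B_\omega$ for each $\omega$; $\nu_\omega(B)$ means $\nu_\omega(B_\omega)$. The fibered system $(F,\nu)=(F_\omega,\nu_\omega)_{\omega\in\Omega}$ is exact if $\bigcap_{n\ge0}F^{-n}\mathcal B$ is trivial, i.e. for any $B\in\bigcap_{n\ge0}F^{-n}\mathcal B$, either for almost all $\omega$, $\nu_\omega(B)=0$, or for almost all $\omega$, $\nu_\omega(B)=1$. With $\nu(A)=\int_\Omega\nu_\omega(A_\omega)\,dP(\omega)$, $(F,\nu)$ is mixing if for all $\varphi,\psi\in L^2(\nu)$, $\lim_{n\to\infty}\left|\int_\Omega\int_{\Delta_\omega}\varphi_{\sigma^n\omega}\circ F_\omega^n\cdot\psi_\omega\,d\nu_\omega dP-\int_\Omega\int_{\Delta_\omega}\varphi_\omega\,d\nu_\omega dP\int_\Omega\int_{\Delta_\omega}\psi_\omega\,d\nu_\omega dP\right|=0$.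
   Formalization: Exactness is fibrewise: for each tail set B, for almost every ω, ν_ω(B) is 0 or 1 (one alternative for almost all ω at once fails for unions of whole fibres over S with 0<P(S)<1). X carries the Borel σ-algebra of its metric. *)

theory Defs
  imports "HOL-Probability.Probability"
begin

(* Data of a random tower: the probability p on the alphabet, the reference measure m, the maps f_u,
   the base Lambda, the partitions {Lambda_j(omega)}_j (as sets of sets) and the return times
   R_omega. *)
record ('a, 'x) random_tower =
  noise :: "'a measure"
  ref :: "'x measure"
  fmap :: "'a \<Rightarrow> 'x \<Rightarrow> 'x"
  base :: "'x set"
  part :: "(int \<Rightarrow> 'a) \<Rightarrow> 'x set set"
  rtime :: "(int \<Rightarrow> 'a) \<Rightarrow> 'x \<Rightarrow> nat"

definition shift :: "int \<Rightarrow> (int \<Rightarrow> 'a) \<Rightarrow> int \<Rightarrow> 'a" where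
  "shift k \<omega> = (\<lambda>i. \<omega> (i + k))"

definition Pm :: "('a, 'x) random_tower \<Rightarrow> (int \<Rightarrow> 'a) measure" where
  "Pm T = PiM UNIV (\<lambda>_. noise T)"

primrec fiter :: "('a, 'x) random_tower \<Rightarrow> nat \<Rightarrow> (int \<Rightarrow> 'a) \<Rightarrow> 'x \<Rightarrow> 'x" where
  "fiter T 0 \<omega> x = x"
| "fiter T (Suc n) \<omega> x = fmap T (shift (int n) \<omega> 0) (fiter T n \<omega> x)"

(* One-sided convention: preimages of null sets are null. *)
definition nonsingular :: "'x measure \<Rightarrow> 'y measure \<Rightarrow> ('x \<Rightarrow> 'y) \<Rightarrow> bool" where
  "nonsingular M N g \<longleftrightarrow> g \<in> measurable M N \<and> absolutely_continuous N (distr M N g)"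

definition Delta :: "('a, 'x) random_tower \<Rightarrow> (int \<Rightarrow> 'a) \<Rightarrow> ('x \<times> nat) set" where
  "Delta T \<omega> = {(x, l). x \<in> base T \<and> x \<in> \<Union> (part T (shift (- int l) \<omega>))
                         \<and> l < rtime T (shift (- int l) \<omega>) x}"

definition Fmap :: "('a, 'x) random_tower \<Rightarrow> (int \<Rightarrow> 'a) \<Rightarrow> 'x \<times> nat \<Rightarrow> 'x \<times> nat" where
  "Fmap T \<omega> = (\<lambda>(x, l).
     if l + 1 < rtime T (shift (- int l) \<omega>) x then (x, l + 1)
     else (fiter T (l + 1) (shift (- int l) \<omega>) x, 0))"

primrec Fiter :: "('a, 'x) random_tower \<Rightarrow> nat \<Rightarrow> (int \<Rightarrow> 'a) \<Rightarrow> 'x \<times> nat \<Rightarrow> 'x \<times> nat" where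
  "Fiter T 0 \<omega> z = z"
| "Fiter T (Suc n) \<omega> z = Fmap T (shift (int n) \<omega>) (Fiter T n \<omega> z)"

definition base_measure :: "('a, 'x) random_tower \<Rightarrow> 'x measure" where
  "base_measure T = restrict_space (ref T) (base T)"

definition tower_measure :: "('a, 'x) random_tower \<Rightarrow> (int \<Rightarrow> 'a) \<Rightarrow> ('x \<times> nat) measure" where
  "tower_measure T \<omega> = restrict_space (base_measure T \<Otimes>\<^sub>M count_space UNIV) (Delta T \<omega>)"

definition cells :: "('a, 'x) random_tower \<Rightarrow> (int \<Rightarrow> 'a) \<Rightarrow> ('x \<times> nat) set set" where
  "cells T \<omega> = {Fiter T l (shift (- int l) \<omega>) ` (A \<times> {0}) | A l.
     A \<in> part T (shift (- int l) \<omega>) \<and> (\<forall>x\<in>A. l + 1 \<le> rtime T (shift (- int l) \<omega>) x)}"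

(* The elements of the join of the F_omega^{-j} P_{sigma^j omega}, j = 0..n. *)
definition cell_join :: "('a, 'x) random_tower \<Rightarrow> nat \<Rightarrow> (int \<Rightarrow> 'a) \<Rightarrow> ('x \<times> nat) set set" where
  "cell_join T n \<omega> = {{z \<in> Delta T \<omega>. \<forall>j\<le>n. Fiter T j \<omega> z \<in> I j} | I.
     \<forall>j\<le>n. I j \<in> cells T (shift (int j) \<omega>)}"

definition return_map ::
  "('a, 'x) random_tower \<Rightarrow> (int \<Rightarrow> 'a) \<times> ('x \<times> nat) \<Rightarrow> (int \<Rightarrow> 'a) \<times> ('x \<times> nat)" where
  "return_map T = (\<lambda>(\<omega>, z).
     let k = (LEAST k. 1 \<le> k \<and> snd (Fiter T k \<omega> z) = 0)
     in (shift (int k) \<omega>, Fiter T k \<omega> z))"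

definition same_cell ::
  "('a, 'x) random_tower \<Rightarrow> (int \<Rightarrow> 'a) \<times> ('x \<times> nat) \<Rightarrow> (int \<Rightarrow> 'a) \<times> ('x \<times> nat) \<Rightarrow> bool" where
  "same_cell T = (\<lambda>(\<omega>1, z1) (\<omega>2, z2).
     \<omega>1 = \<omega>2 \<and> (\<exists>I\<in>cells T \<omega>1. z1 \<in> I \<and> z2 \<in> I))"

(* The infimum of the empty set is infinity; points of different towers are separated at n = 0. *)
definition sep ::
  "('a, 'x) random_tower \<Rightarrow> (int \<Rightarrow> 'a) \<times> ('x \<times> nat) \<Rightarrow> (int \<Rightarrow> 'a) \<times> ('x \<times> nat) \<Rightarrow> enat" where
  "sep T w1 w2 =
     (INF n\<in>{n. \<not> same_cell T ((return_map T ^^ n) w1) ((return_map T ^^ n) w2)}. enat n)"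

definition gpow :: "real \<Rightarrow> enat \<Rightarrow> real" where
  "gpow \<gamma> s = (case s of enat n \<Rightarrow> \<gamma> ^ n | \<infinity> \<Rightarrow> 0)"

(* F_omega^{R_omega} on the base, seen as a map into Lambda. *)
definition base_return :: "('a, 'x) random_tower \<Rightarrow> (int \<Rightarrow> 'a) \<Rightarrow> 'x \<Rightarrow> 'x" where
  "base_return T \<omega> x = fst (Fiter T (rtime T \<omega> x) \<omega> (x, 0))"

definition jacobian_on :: "'x measure \<Rightarrow> 'x set \<Rightarrow> ('x \<Rightarrow> 'x) \<Rightarrow> ('x \<Rightarrow> real) \<Rightarrow> bool" where
  "jacobian_on M A g J \<longleftrightarrow>
     J \<in> borel_measurable (restrict_space M A) \<and> (\<forall>x\<in>A. 0 < J x) \<and>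
     (\<forall>B\<in>sets M. B \<subseteq> A \<longrightarrow> emeasure M (g ` B) = (\<integral>\<^sup>+x\<in>B. ennreal (J x) \<partial>M))"

(* The sigma-algebra of X is the Borel sigma-algebra of its metric.  Joint measurability of
   (omega, x) |-> R_omega(x) is what the product measure in P7 presupposes. *)
definition tower_setting :: "('a :: topological_space, 'x :: metric_space) random_tower \<Rightarrow> bool" where
  "tower_setting T \<longleftrightarrow>
     prob_space (noise T) \<and> sets (noise T) = sets borel \<and> sets (ref T) = sets borel \<and>
     (AE u in noise T. nonsingular (ref T) (ref T) (fmap T u)) \<and>
     (\<lambda>(x, \<omega>). (fmap T (\<omega> 0) x, shift 1 \<omega>))
        \<in> measurable (ref T \<Otimes>\<^sub>M Pm T) (ref T \<Otimes>\<^sub>M Pm T) \<and>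
     base T \<in> sets (ref T) \<and> emeasure (ref T) (base T) = 1 \<and>
     (\<lambda>(\<omega>, x). rtime T \<omega> x) \<in> measurable (Pm T \<Otimes>\<^sub>M base_measure T) (count_space UNIV) \<and>
     (AE \<omega> in Pm T. countable (part T \<omega>) \<and> partition_on (base T) (part T \<omega>) \<and>
        part T \<omega> \<subseteq> sets (ref T) \<and>
        (\<forall>A\<in>part T \<omega>. rtime T \<omega> constant_on A) \<and>
        (\<forall>x\<in>base T. 1 \<le> rtime T \<omega> x)) \<and>
     (AE \<omega> in Pm T. AE x in ref T. x \<in> base T \<longrightarrow> fiter T (rtime T \<omega> x) \<omega> x \<in> base T)"

(* The partitions exist only for almost every omega, so "for all omega" below is "for almost
   every omega". *)

definition P1 :: "('a, 'x) random_tower \<Rightarrow> bool" where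
  "P1 T \<longleftrightarrow> (AE \<omega> in Pm T. \<forall>A\<in>part T \<omega>. bij_betw (base_return T \<omega>) A (base T))"

definition P2 :: "('a, 'x) random_tower \<Rightarrow> real \<Rightarrow> bool" where
  "P2 T \<gamma> \<longleftrightarrow> 0 < \<gamma> \<and> \<gamma> < 1 \<and> (\<exists>D>0. AE \<omega> in Pm T. \<forall>A\<in>part T \<omega>.
     nonsingular (restrict_space (ref T) A) (base_measure T) (base_return T \<omega>) \<and>
     nonsingular (base_measure T) (restrict_space (ref T) A) (inv_into A (base_return T \<omega>)) \<and>
     (\<exists>J. jacobian_on (ref T) A (base_return T \<omega>) J \<and>
       (\<forall>x\<in>A. \<forall>y\<in>A. \<bar>J x / J y - 1\<bar> \<le> D * gpow \<gamma> (sep T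
          (shift (int (rtime T \<omega> x)) \<omega>, Fiter T (rtime T \<omega> x) \<omega> (x, 0))
          (shift (int (rtime T \<omega> y)) \<omega>, Fiter T (rtime T \<omega> y) \<omega> (y, 0))))))"

(* Every cell of the join lies in a single level, so its diameter is that of its projection to X. *)
definition P3 :: "('a, 'x :: metric_space) random_tower \<Rightarrow> bool" where
  "P3 T \<longleftrightarrow> (AE \<omega> in Pm T. \<forall>\<epsilon>>0. \<exists>n0. \<forall>n\<ge>n0. \<forall>E\<in>cell_join T n \<omega>.
     bounded (fst ` E) \<and> diameter (fst ` E) \<le> \<epsilon>)"

(* (log n)^b with the convention 0^0 = 1, whereas 0 powr 0 = 0. *)
definition logpow :: "nat \<Rightarrow> real \<Rightarrow> real" where
  "logpow n b = (if b = 0 then 1 else ln (real n) powr b)"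

definition P4 :: "('a, 'x) random_tower \<Rightarrow> real \<Rightarrow> real \<Rightarrow> real \<Rightarrow> bool" where
  "P4 T a u v \<longleftrightarrow> 1 < a \<and> 0 < u \<and> 0 < v \<and> (\<exists>C>0. \<exists>b\<ge>0. \<exists>\<Omega>1\<in>sets (Pm T). \<exists>n1.
     measure (Pm T) \<Omega>1 = 1 \<and>
     n1 \<in> measurable (restrict_space (Pm T) \<Omega>1) (count_space UNIV) \<and>
     (\<forall>\<omega>\<in>\<Omega>1. 1 \<le> n1 \<omega>) \<and>
     (\<forall>\<omega>\<in>\<Omega>1. \<forall>n\<ge>n1 \<omega>.
        measure (ref T) {x \<in> base T. rtime T \<omega> x > n} \<le> C * logpow n b / real n powr a) \<and>
     (\<forall>n\<ge>1. measure (Pm T) {\<omega> \<in> \<Omega>1. n1 \<omega> > n} \<le> C * exp (- u * real n powr v)))"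

definition P5 :: "('a, 'x) random_tower \<Rightarrow> bool" where
  "P5 T \<longleftrightarrow> (\<exists>N::nat. \<exists>t::nat \<Rightarrow> nat. \<exists>\<epsilon>::nat \<Rightarrow> real.
     Gcd (t ` {1..N}) = 1 \<and> (\<forall>i\<in>{1..N}. 0 < \<epsilon> i) \<and>
     (AE \<omega> in Pm T. \<forall>i\<in>{1..N}. measure (ref T) {x \<in> base T. rtime T \<omega> x = t i} > \<epsilon> i))"

definition P6 :: "('a, 'x) random_tower \<Rightarrow> bool" where
  "P6 T \<longleftrightarrow> (\<exists>M>0. AE \<omega> in Pm T. emeasure (tower_measure T \<omega>) (Delta T \<omega>) \<le> ennreal M)"

definition P7 :: "('a, 'x) random_tower \<Rightarrow> real \<Rightarrow> bool" where
  "P7 T a \<longleftrightarrow> (\<exists>C>0. \<exists>b\<ge>0. \<forall>n\<ge>2.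
     measure (Pm T \<Otimes>\<^sub>M base_measure T) {(\<omega>, x). \<omega> \<in> space (Pm T) \<and> x \<in> base T \<and> rtime T \<omega> x = n}
       \<le> C * logpow n b / real n powr (a + 1))"

definition F_plus ::
  "('a, 'x) random_tower \<Rightarrow> real \<Rightarrow> ((int \<Rightarrow> 'a) \<Rightarrow> 'x \<times> nat \<Rightarrow> real) set" where
  "F_plus T \<gamma> = {\<phi>. \<exists>C>0. AE \<omega> in Pm T. \<forall>I\<in>cells T \<omega>.
     (\<forall>x\<in>I. \<phi> \<omega> x = 0) \<or>
     ((\<forall>x\<in>I. \<phi> \<omega> x > 0) \<and>
      (\<forall>x\<in>I. \<forall>y\<in>I. \<bar>ln (\<phi> \<omega> x / \<phi> \<omega> y)\<bar> \<le> C * gpow \<gamma> (sep T (\<omega>, x) (\<omega>, y))))}"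

definition L_inf ::
  "('a, 'x) random_tower \<Rightarrow> ((int \<Rightarrow> 'a) \<Rightarrow> real) \<Rightarrow> ((int \<Rightarrow> 'a) \<Rightarrow> 'x \<times> nat \<Rightarrow> real) set" where
  "L_inf T K = {\<phi>. \<exists>C>0. AE \<omega> in Pm T. \<forall>x\<in>Delta T \<omega>. \<bar>\<phi> \<omega> x\<bar> \<le> C * K \<omega>}"

definition F_gamma ::
  "('a, 'x) random_tower \<Rightarrow> real \<Rightarrow> ((int \<Rightarrow> 'a) \<Rightarrow> real) \<Rightarrow> ((int \<Rightarrow> 'a) \<Rightarrow> 'x \<times> nat \<Rightarrow> real) set" where
  "F_gamma T \<gamma> K = {\<phi> \<in> L_inf T K. \<exists>C>0. AE \<omega> in Pm T. \<forall>x\<in>Delta T \<omega>. \<forall>y\<in>Delta T \<omega>.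
     \<bar>\<phi> \<omega> x - \<phi> \<omega> y\<bar> \<le> C * K \<omega> * gpow \<gamma> (sep T (\<omega>, x) (\<omega>, y))}"

definition fibre_measure ::
  "('a, 'x) random_tower \<Rightarrow> ((int \<Rightarrow> 'a) \<Rightarrow> 'x \<times> nat \<Rightarrow> real) \<Rightarrow> (int \<Rightarrow> 'a) \<Rightarrow> ('x \<times> nat) measure" where
  "fibre_measure T h \<omega> = density (tower_measure T \<omega>) (\<lambda>z. ennreal (h \<omega> z))"

definition total_tower :: "('a, 'x) random_tower \<Rightarrow> ((int \<Rightarrow> 'a) \<times> ('x \<times> nat)) set" where
  "total_tower T = {(\<omega>, z). \<omega> \<in> space (Pm T) \<and> z \<in> Delta T \<omega>}"

(* Jointly measurable subsets of the total tower, the domain of nu(A) = int nu_omega(A_omega) dP. *)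
definition joint_sets :: "('a, 'x) random_tower \<Rightarrow> ((int \<Rightarrow> 'a) \<times> ('x \<times> nat)) set set" where
  "joint_sets T =
     sets (restrict_space (Pm T \<Otimes>\<^sub>M (base_measure T \<Otimes>\<^sub>M count_space UNIV)) (total_tower T))"

definition measurable_family ::
  "('a, 'x) random_tower \<Rightarrow> ((int \<Rightarrow> 'a) \<Rightarrow> ('x \<times> nat) measure) \<Rightarrow> bool" where
  "measurable_family T \<nu> \<longleftrightarrow>
     (\<forall>A\<in>joint_sets T. (\<lambda>\<omega>. emeasure (\<nu> \<omega>) (Pair \<omega> -` A)) \<in> borel_measurable (Pm T))"

definition total_measure ::
  "('a, 'x) random_tower \<Rightarrow> ((int \<Rightarrow> 'a) \<Rightarrow> ('x \<times> nat) measure) \<Rightarrow> ((int \<Rightarrow> 'a) \<times> ('x \<times> nat)) measure" where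
  "total_measure T \<nu> = measure_of (total_tower T) (joint_sets T)
     (\<lambda>A. \<integral>\<^sup>+\<omega>. emeasure (\<nu> \<omega>) (Pair \<omega> -` A) \<partial>Pm T)"

definition fibre_algebra :: "('a, 'x) random_tower \<Rightarrow> ((int \<Rightarrow> 'a) \<times> ('x \<times> nat)) set set" where
  "fibre_algebra T = {B. B \<subseteq> total_tower T \<and>
     (\<forall>\<omega>\<in>space (Pm T). Pair \<omega> -` B \<in> sets (tower_measure T \<omega>))}"

definition tail_algebra :: "('a, 'x) random_tower \<Rightarrow> ((int \<Rightarrow> 'a) \<times> ('x \<times> nat)) set set" where
  "tail_algebra T = (\<Inter>n. {{(\<omega>, z) \<in> total_tower T. (shift (int n) \<omega>, Fiter T n \<omega> z) \<in> B} | B.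
     B \<in> fibre_algebra T})"

(* Triviality of the tail algebra is relative to the base: the algebra contains every union of whole
   fibres over a subset S of Omega (the base map is invertible), so the alternative 0 or 1 can only
   be asked for in almost every fibre, not uniformly over almost all fibres. *)
definition exact_system ::
  "('a, 'x) random_tower \<Rightarrow> ((int \<Rightarrow> 'a) \<Rightarrow> ('x \<times> nat) measure) \<Rightarrow> bool" where
  "exact_system T \<nu> \<longleftrightarrow> (\<forall>B\<in>tail_algebra T. AE \<omega> in Pm T.
     emeasure (\<nu> \<omega>) (Pair \<omega> -` B) = 0 \<or> emeasure (\<nu> \<omega>) (Pair \<omega> -` B) = 1)"

definition L2 :: "'z measure \<Rightarrow> ('z \<Rightarrow> real) set" where
  "L2 M = {\<phi>. \<phi> \<in> borel_measurable M \<and> integrable M (\<lambda>z. (\<phi> z)\<^sup>2)}"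

definition mixing_system ::
  "('a, 'x) random_tower \<Rightarrow> ((int \<Rightarrow> 'a) \<Rightarrow> ('x \<times> nat) measure) \<Rightarrow> bool" where
  "mixing_system T \<nu> \<longleftrightarrow> (\<forall>\<phi>\<in>L2 (total_measure T \<nu>). \<forall>\<psi>\<in>L2 (total_measure T \<nu>).
     (\<lambda>n. \<bar>(LINT \<omega>|Pm T. LINT z|\<nu> \<omega>. \<phi> (shift (int n) \<omega>, Fiter T n \<omega> z) * \<psi> (\<omega>, z))
          - (LINT \<omega>|Pm T. LINT z|\<nu> \<omega>. \<phi> (\<omega>, z)) * (LINT \<omega>|Pm T. LINT z|\<nu> \<omega>. \<psi> (\<omega>, z))\<bar>)
       \<longlonglongrightarrow> 0)"

definition equivariant ::
  "('a, 'x) random_tower \<Rightarrow> ((int \<Rightarrow> 'a) \<Rightarrow> ('x \<times> nat) measure) \<Rightarrow> bool" where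
  "equivariant T \<nu> \<longleftrightarrow> (AE \<omega> in Pm T.
     Fmap T \<omega> \<in> measurable (tower_measure T \<omega>) (tower_measure T (shift 1 \<omega>)) \<and>
     distr (\<nu> \<omega>) (tower_measure T (shift 1 \<omega>)) (Fmap T \<omega>) = \<nu> (shift 1 \<omega>))"

end

theory Submission
  imports Defs
begin

text \<open>
  By (P2) and (P6), the densities of the normalised push-forwards of \<open>m\<close> have log-oscillation at most
  \<open>2 D / (1 - \<gamma>)\<close> on each level and are bounded uniformly in \<open>\<omega>\<close>, so that \<open>K = 1\<close> is an
  admissible bound.

  For almost every \<open>\<omega>\<close> the argument runs along the single orbit \<open>(\<sigma>^i \<omega>)\<close>, \<open>i\<close> an integer. The
  transfer operators preserve the cone of densities that are log-regular on the levels. By (P6) the mass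
  above level \<open>L\<close> tends to 0 as \<open>L\<close> grows, and by Poincare recurrence it is small infinitely often along
  the orbit, in both time directions. At such a time a density has a definite part of its mass at
  bounded height, and a bounded number of steps later (P5), through the renewal equation and
  \<open>gcd t_i = 1\<close>, makes the base carry a fixed fraction of the mass. There log-regularity bounds the
  density from below by a constant, which can be subtracted from any two densities of equal mass without
  leaving the cone. Since this happens infinitely often, the transfer operators forget the initial
  density. Applied to the past, this gives convergence of the pull-back densities to the equivariant
  density \<open>h\<close>.

  Applied to the future, and extended from cylinders to integrable functions, it shows that
  \<open>\<integral> (\<phi> \<circ> F^n) \<psi> d\<nu>\<close> is close to \<open>(\<integral> \<phi> \<circ> F^n d\<nu>) (\<integral> \<psi> d\<nu>)\<close> on almost
  every fibre, uniformly in \<open>0 \<le> \<phi> \<le> 1\<close>. For a tail set \<open>B\<close> this yields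
  \<open>\<nu>(B) = \<nu>(B)\<^sup>2\<close> on almost every fibre, which is exactness. For mixing it reduces the
  correlations of the skew product to those of the fibre averages under the Bernoulli shift.
\<close>

text \<open>Towers vary from fibre to fibre, and the times at which they are short are not
  controlled uniformly in \<omega>; each orbit only offers infinitely many of them. The coupling
  therefore counts good times instead of steps, and the convergence obtained is qualitative. Once a
  part of two densities is matched it evolves identically, so only the unmatched remainders must
  stay in the cone. They do have to stay there: log-regularity turns small mass into small values on
  the base, and this is what makes the pull-backs converge pointwise and not merely in L1. One
  return turns a log-regularity exponent Q into \<gamma> Q + D. The fixed point of this map is D /
  (1 - \<gamma>); twice that value leaves the slack needed to remove a constant. The exponent
  remains a parameter throughout, because the functions that approximate general observables are
  built from cylinders, and deep cylinders need large exponents. Cylinders generate the Borel sets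
  by (P3).\<close>

section \<open>Functionals vanishing on a generator, and mixing\<close>

text \<open>An approximation scheme used three times: twice for mixing, where each
  \<open>I n\<close> is a singleton, and once for loss of memory, where \<open>I n\<close> consists
  of all test functions on the n-th fibre. As the L1 bound does not depend on n and i, tending to 0
  uniformly over \<open>I n\<close> is a closed linear condition on f, and testing it on a
  generating pi-system is enough.\<close>

locale vanishing_functionals =
  fixes M :: "'a measure" and I :: "nat \<Rightarrow> 'i set" and a :: "nat \<Rightarrow> 'i \<Rightarrow> ('a \<Rightarrow> real) \<Rightarrow> real" and C :: real
  assumes fin: "finite_measure M"
    and add: "i \<in> I n \<Longrightarrow> integrable M f \<Longrightarrow> integrable M g \<Longrightarrow> a n i (\<lambda>x. f x + g x) = a n i f + a n i g"
    and cmult: "i \<in> I n \<Longrightarrow> integrable M f \<Longrightarrow> a n i (\<lambda>x. c * f x) = c * a n i f"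
    and bound: "i \<in> I n \<Longrightarrow> integrable M f \<Longrightarrow> \<bar>a n i f\<bar> \<le> C * (\<integral>x. \<bar>f x\<bar> \<partial>M)"
    and C_nonneg: "0 \<le> C"
begin

sublocale finite_measure M by (rule fin)

definition vanishes :: "('a \<Rightarrow> real) \<Rightarrow> bool" where
  "vanishes f \<longleftrightarrow> integrable M f \<and> (\<forall>e>0. \<exists>n0. \<forall>n\<ge>n0. \<forall>i\<in>I n. \<bar>a n i f\<bar> \<le> e)"

lemma vanishes_singleton:
  assumes "\<And>n. I n = {j}"
  shows "vanishes f \<longleftrightarrow> integrable M f \<and> (\<lambda>n. a n j f) \<longlonglongrightarrow> 0"
proof -
  have "(\<forall>e>0. \<exists>n0. \<forall>n\<ge>n0. \<bar>a n j f\<bar> \<le> e) \<longleftrightarrow> (\<lambda>n. a n j f) \<longlonglongrightarrow> 0"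
  proof
    assume *: "\<forall>e>0. \<exists>n0. \<forall>n\<ge>n0. \<bar>a n j f\<bar> \<le> e"
    show "(\<lambda>n. a n j f) \<longlonglongrightarrow> 0"
    proof (rule LIMSEQ_I)
      fix r :: real assume r: "0 < r"
      then obtain n0 where "\<And>n. n \<ge> n0 \<Longrightarrow> \<bar>a n j f\<bar> \<le> r / 2"
        using *[rule_format, of "r / 2"] by auto
      then show "\<exists>n0. \<forall>n\<ge>n0. norm (a n j f - 0) < r"
        using r by (intro exI[of _ n0]) fastforce
    qed
  next
    assume *: "(\<lambda>n. a n j f) \<longlonglongrightarrow> 0"
    show "\<forall>e>0. \<exists>n0. \<forall>n\<ge>n0. \<bar>a n j f\<bar> \<le> e"
    proof (intro allI impI)
      fix e :: real assume "0 < e"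
      from LIMSEQ_D[OF * this] obtain n0 where "\<forall>n\<ge>n0. norm (a n j f - 0) < e" ..
      then show "\<exists>n0. \<forall>n\<ge>n0. \<bar>a n j f\<bar> \<le> e" by (intro exI[of _ n0]) (simp add: less_imp_le)
    qed
  qed
  then show ?thesis unfolding vanishes_def assms by simp
qed

lemma vanishes_add:
  assumes f: "vanishes f" and g: "vanishes g"
  shows "vanishes (\<lambda>x. f x + g x)"
  unfolding vanishes_def
proof (intro conjI allI impI)
  have fi: "integrable M f" "integrable M g" using f g by (auto simp: vanishes_def)
  then show "integrable M (\<lambda>x. f x + g x)" by simp
  fix e :: real assume "0 < e"
  then have e2: "0 < e / 2" by simp
  obtain n0 where n0: "\<And>n i. n \<ge> n0 \<Longrightarrow> i \<in> I n \<Longrightarrow> \<bar>a n i f\<bar> \<le> e / 2"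
    using f e2 unfolding vanishes_def by blast
  obtain n1 where n1: "\<And>n i. n \<ge> n1 \<Longrightarrow> i \<in> I n \<Longrightarrow> \<bar>a n i g\<bar> \<le> e / 2"
    using g e2 unfolding vanishes_def by blast
  show "\<exists>n0. \<forall>n\<ge>n0. \<forall>i\<in>I n. \<bar>a n i (\<lambda>x. f x + g x)\<bar> \<le> e"
  proof (intro exI[of _ "max n0 n1"] allI impI ballI)
    fix n i assume n: "max n0 n1 \<le> n" and i: "i \<in> I n"
    show "\<bar>a n i (\<lambda>x. f x + g x)\<bar> \<le> e"
      using n0[of n i] n1[of n i] n i unfolding add[OF i fi] by linarith
  qed
qed

lemma vanishes_cmult:
  assumes f: "vanishes f"
  shows "vanishes (\<lambda>x. c * f x)"
  unfolding vanishes_def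
proof (intro conjI allI impI)
  have fi: "integrable M f" using f by (simp add: vanishes_def)
  then show "integrable M (\<lambda>x. c * f x)" by simp
  fix e :: real assume "0 < e"
  then have "0 < e / (\<bar>c\<bar> + 1)" by simp
  then obtain n0 where n0: "\<And>n i. n \<ge> n0 \<Longrightarrow> i \<in> I n \<Longrightarrow> \<bar>a n i f\<bar> \<le> e / (\<bar>c\<bar> + 1)"
    using f unfolding vanishes_def by blast
  show "\<exists>n0. \<forall>n\<ge>n0. \<forall>i\<in>I n. \<bar>a n i (\<lambda>x. c * f x)\<bar> \<le> e"
  proof (intro exI[of _ n0] allI impI ballI)
    fix n i assume n: "n0 \<le> n" and i: "i \<in> I n"
    have "\<bar>c\<bar> * \<bar>a n i f\<bar> \<le> (\<bar>c\<bar> + 1) * (e / (\<bar>c\<bar> + 1))"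
      using n0[OF n i] by (intro mult_mono) auto
    then show "\<bar>a n i (\<lambda>x. c * f x)\<bar> \<le> e" by (simp add: cmult[OF i fi] abs_mult)
  qed
qed

text \<open>The property is closed in L1: a function and its approximation have values differing by
  at most \<open>C\<close> times their distance, for all n and i at once.\<close>

lemma vanishes_approx:
  assumes f: "integrable M f"
    and approx: "\<And>e. 0 < e \<Longrightarrow> \<exists>g. vanishes g \<and> (\<integral>x. \<bar>f x - g x\<bar> \<partial>M) \<le> e"
  shows "vanishes f"
  unfolding vanishes_def
proof (intro conjI allI impI f)
  fix e :: real assume e: "0 < e"
  \<comment> \<open>Half of e is spent on the approximation; \<open>C + 1\<close> avoids a division
    by 0.\<close>
  define d where "d = e / (2 * (C + 1))"
  have d: "0 < d" using e C_nonneg by (simp add: d_def)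
  then obtain g where g: "vanishes g" "(\<integral>x. \<bar>f x - g x\<bar> \<partial>M) \<le> d"
    using approx[of d] by auto
  obtain n0 where n0: "\<And>n i. n \<ge> n0 \<Longrightarrow> i \<in> I n \<Longrightarrow> \<bar>a n i g\<bar> \<le> e / 2"
    using g(1) half_gt_zero[OF e] unfolding vanishes_def by blast
  have gi: "integrable M g" using g(1) by (simp add: vanishes_def)
  have "C * (\<integral>x. \<bar>f x - g x\<bar> \<partial>M) \<le> (C + 1) * d"
    using g(2) C_nonneg d by (intro mult_mono) auto
  also have "\<dots> = e / 2" using C_nonneg by (simp add: d_def field_simps)
  finally have le: "C * (\<integral>x. \<bar>f x - g x\<bar> \<partial>M) \<le> e / 2" .
  show "\<exists>n0. \<forall>n\<ge>n0. \<forall>i\<in>I n. \<bar>a n i f\<bar> \<le> e"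
  proof (intro exI[of _ n0] allI impI ballI)
    fix n i assume n: "n0 \<le> n" and i: "i \<in> I n"
    have fg: "integrable M (\<lambda>x. f x - g x)" using f gi by simp
    have "a n i (\<lambda>x. g x + (f x - g x)) = a n i g + a n i (\<lambda>x. f x - g x)"
      by (rule add[OF i gi fg])
    moreover have "\<bar>a n i (\<lambda>x. f x - g x)\<bar> \<le> C * (\<integral>x. \<bar>f x - g x\<bar> \<partial>M)"
      by (rule bound[OF i fg])
    moreover have "\<bar>a n i g\<bar> \<le> e / 2" by (rule n0[OF n i])
    ultimately show "\<bar>a n i f\<bar> \<le> e" using le by simp
  qed
qed

text \<open>Nothing says that the functionals ignore values outside \<open>space M\<close>, but
  functions that agree on \<open>space M\<close> have L1 distance 0, so the L1 bound settles
  it.\<close>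

lemma vanishes_cong:
  assumes f: "vanishes f" and eq: "\<And>x. x \<in> space M \<Longrightarrow> f x = g x"
  shows "vanishes g"
proof (rule vanishes_approx)
  show "integrable M g"
    using f eq Bochner_Integration.integrable_cong[of M M f g] by (simp add: vanishes_def)
  have "(\<integral>x. \<bar>g x - f x\<bar> \<partial>M) = (\<integral>x. 0 \<partial>M)"
    using eq by (intro Bochner_Integration.integral_cong) auto
  then show "\<exists>f'. vanishes f' \<and> (\<integral>x. \<bar>g x - f' x\<bar> \<partial>M) \<le> e" if "0 < e" for e
    using f that by (intro exI[of _ f]) auto
qed

lemma integrable_indicator_finite: "B \<in> sets M \<Longrightarrow> integrable M (indicator B :: _ \<Rightarrow> real)"
  by (rule integrable_const_bound[where B = 1]) auto

text \<open>Additivity handles the partial unions; the remainder is small in L1 because the tails of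
  a disjoint sequence in a finite measure space have measure tending to 0.\<close>

lemma vanishes_disjoint_UN:
  fixes A :: "nat \<Rightarrow> 'a set"
  assumes dis: "disjoint_family A" and A: "\<And>n. vanishes (indicator (A n))" "\<And>n. A n \<in> sets M"
  shows "vanishes (indicator (\<Union>n. A n))"
proof (rule vanishes_approx)
  have UA: "(\<Union>n. A n) \<in> sets M" using A(2) by auto
  show "integrable M (indicator (\<Union>n. A n) :: _ \<Rightarrow> real)" by (rule integrable_indicator_finite[OF UA])
  have sumind: "indicator (\<Union>n<k. A n) z = (\<Sum>n<k. indicator (A n) z :: real)" for k z
    by (rule indicator_UN_disjoint) (use dis in \<open>auto intro: disjoint_family_on_mono\<close>)
  have part: "vanishes (indicator (\<Union>n<k. A n))" for k
  proof (induction k)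
    case 0
    show ?case by (rule vanishes_cong[OF vanishes_cmult[OF A(1)[of 0], of 0]]) simp
  next
    case (Suc k)
    from vanishes_add[OF this A(1)[of k]] show ?case
      by (rule vanishes_cong) (simp add: sumind)
  qed
  have lim: "(\<lambda>k. measure M (\<Union>n. A (n + k))) \<longlonglongrightarrow> 0"
  proof -
    have "(\<lambda>k. measure M (\<Union>n. A (n + k))) \<longlonglongrightarrow> measure M (\<Inter>k. \<Union>n. A (n + k))"
    proof (rule finite_Lim_measure_decseq)
      show "range (\<lambda>k. \<Union>n. A (n + k)) \<subseteq> sets M" using A(2) by auto
      show "decseq (\<lambda>k. \<Union>n. A (n + k))"
        unfolding decseq_Suc_iff
      proof safe
        fix k z n assume "z \<in> A (n + Suc k)"
        then show "z \<in> (\<Union>n. A (n + k))" by (intro UN_I[of "Suc n"]) auto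
      qed
    qed
    \<comment> \<open>A point in every tail would lie in two different members of the disjoint
      sequence.\<close>
    also have "(\<Inter>k. \<Union>n. A (n + k)) = {}"
    proof (rule equals0I)
      fix z assume z: "z \<in> (\<Inter>k. \<Union>n. A (n + k))"
      then obtain n where n: "z \<in> A n" by auto
      from z obtain n' where n': "z \<in> A (n' + Suc n)" by blast
      have "n' + Suc n \<noteq> n" by simp
      then show False using n n' disjoint_family_onD[OF dis, of "n' + Suc n" n] by blast
    qed
    finally show ?thesis by simp
  qed
  fix e :: real assume "0 < e"
  then have "\<forall>\<^sub>F k in sequentially. measure M (\<Union>n. A (n + k)) < e"
    by (rule order_tendstoD(2)[OF lim])
  then obtain k where k: "measure M (\<Union>n. A (n + k)) < e"
    by (auto simp: eventually_sequentially)
  have "(\<integral>z. \<bar>indicator (\<Union>n. A n) z - indicator (\<Union>n<k. A n) z :: real\<bar> \<partial>M) \<le>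
      (\<integral>z. indicator (\<Union>n. A (n + k)) z \<partial>M)"
  proof (intro integral_mono integrable_abs Bochner_Integration.integrable_diff integrable_indicator_finite)
    fix z
    have "z \<in> (\<Union>n. A (n + k))" if z: "z \<in> (\<Union>n. A n)" "z \<notin> (\<Union>n<k. A n)"
    proof -
      obtain n where n: "z \<in> A n" using z(1) by blast
      then have "k \<le> n" using z(2) by (meson UN_I lessThan_iff not_le)
      then show ?thesis using n by (intro UN_I[of "n - k"]) auto
    qed
    then show "\<bar>indicator (\<Union>n. A n) z - indicator (\<Union>n<k. A n) z :: real\<bar> \<le> indicator (\<Union>n. A (n + k)) z"
      by (auto simp: indicator_def)
  qed (use A(2) in auto)
  also have "\<dots> = measure M ((\<Union>n. A (n + k)) \<inter> space M)"
    by (rule Bochner_Integration.integral_indicator)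
  also have "(\<Union>n. A (n + k)) \<inter> space M = (\<Union>n. A (n + k))"
    using A(2) by (intro sets.Int_space_eq2) auto
  also have "measure M (\<Union>n. A (n + k)) \<le> e" using k by simp
  finally show "\<exists>g. vanishes g \<and> (\<integral>z. \<bar>indicator (\<Union>n. A n) z - g z\<bar> \<partial>M) \<le> e"
    using part by blast
qed

text \<open>Dynkin's pi-lambda argument. The whole space is treated separately because it need not
  belong to \<open>G\<close>, and complements are formed by subtracting from it.\<close>

lemma vanishes_sigma_sets:
  assumes G: "Int_stable G" "G \<subseteq> Pow (space M)" "sigma_sets (space M) G = sets M"
    and basic: "\<And>A. A \<in> G \<Longrightarrow> vanishes (indicator A)" and top: "vanishes (indicator (space M))"
    and A: "A \<in> sets M"
  shows "vanishes (indicator A)"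
proof -
  have "A \<in> sigma_sets (space M) G" using A G(3) by simp
  then show ?thesis
  proof (rule sigma_sets_induct_disjoint[OF G(1,2)])
    show "vanishes (indicator A)" if "A \<in> G" for A by (rule basic[OF that])
    show "vanishes (indicator {})"
      by (rule vanishes_cong[OF vanishes_cmult[OF top, of 0]]) simp
    show "vanishes (indicator (space M - A))" if "A \<in> sigma_sets (space M) G" "vanishes (indicator A)" for A
    proof -
      have "vanishes (\<lambda>x. indicator (space M) x + (-1) * indicator A x)"
        by (intro vanishes_add vanishes_cmult that top)
      then show ?thesis by (rule vanishes_cong) (auto simp: indicator_def)
    qed
    show "vanishes (indicator (\<Union>n. A n))"
      if "disjoint_family A" "range A \<subseteq> sigma_sets (space M) G" "\<And>n. vanishes (indicator (A n))" for A :: "nat \<Rightarrow> 'a set"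
      using that(2) G(3) by (intro vanishes_disjoint_UN that) auto
  qed
qed

text \<open>The approximating simple functions satisfy |s n| \<le> 2 |f|, so 3 |f| dominates |f - s
  n| and the approximation takes place in L1.\<close>

lemma vanishes_integrable:
  assumes ind: "\<And>A. A \<in> sets M \<Longrightarrow> vanishes (indicator A)" and f: "integrable M f"
  shows "vanishes f"
  using f
proof (induction rule: integrable_induct)
  case (base A c)
  show ?case
    by (rule vanishes_cong[OF vanishes_cmult[OF ind[OF base(1)], of c]]) (simp add: mult.commute)
next
  case (add f g) then show ?case using vanishes_add by blast
next
  case (lim f s)
  have si: "integrable M (s n)" "vanishes (s n)" for n using lim by auto
  have slim: "(\<lambda>n. s n z) \<longlonglongrightarrow> f z" "norm (s n z) \<le> 2 * norm (f z)" if "z \<in> space M" for n z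
    using lim that by auto
  have fi: "integrable M f" using lim by auto
  show ?case
  proof (rule vanishes_approx[OF fi])
    fix e :: real assume e: "0 < e"
    have "(\<lambda>n. \<integral>z. \<bar>f z - s n z\<bar> \<partial>M) \<longlonglongrightarrow> (\<integral>z. 0 \<partial>M)"
    proof (rule integral_dominated_convergence[where w = "\<lambda>z. 3 * \<bar>f z\<bar>"])
      show "(\<lambda>z. \<bar>f z - s n z\<bar>) \<in> borel_measurable M" for n using si(1)[of n] fi by measurable
      show "integrable M (\<lambda>z. 3 * \<bar>f z\<bar>)" using fi by simp
      show "AE z in M. (\<lambda>n. \<bar>f z - s n z\<bar>) \<longlonglongrightarrow> 0"
      proof (intro AE_I2)
        fix z assume "z \<in> space M"
        from tendsto_rabs[OF tendsto_diff[OF tendsto_const[of "f z"] slim(1)[OF this]]]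
        show "(\<lambda>n. \<bar>f z - s n z\<bar>) \<longlonglongrightarrow> 0" by simp
      qed
      show "AE z in M. norm \<bar>f z - s n z\<bar> \<le> 3 * \<bar>f z\<bar>" for n
      proof (intro AE_I2)
        fix z assume "z \<in> space M"
        from slim(2)[OF this, of n] show "norm \<bar>f z - s n z\<bar> \<le> 3 * \<bar>f z\<bar>" by simp
      qed
    qed simp
    then have "(\<lambda>n. \<integral>z. \<bar>f z - s n z\<bar> \<partial>M) \<longlonglongrightarrow> 0" by simp
    then have "\<forall>\<^sub>F n in sequentially. (\<integral>z. \<bar>f z - s n z\<bar> \<partial>M) < e"
      by (rule order_tendstoD(2)[OF _ e])
    then obtain n where "(\<integral>z. \<bar>f z - s n z\<bar> \<partial>M) < e" by (auto simp: eventually_sequentially)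
    then show "\<exists>g. vanishes g \<and> (\<integral>z. \<bar>f z - g z\<bar> \<partial>M) \<le> e"
      using si(2) by (intro exI[of _ "s n"]) auto
  qed
qed

end

text \<open>A Borel-Cantelli style argument that uses only that each \<open>s n\<close> preserves
  the measure; neither ergodicity nor a semigroup law enters. For fixed \<delta>, a point that is
  bad for every L from some time on lies in a set whose measure is at most that of {f L > \<delta>},
  for all L, and this tends to 0. The L obtained depends on the point.\<close>

lemma (in prob_space) AE_infinitely_often_small:
  fixes f :: "nat \<Rightarrow> 'a \<Rightarrow> ennreal" and s :: "nat \<Rightarrow> 'a \<Rightarrow> 'a"
  assumes s: "\<And>n. s n \<in> measurable M M" "\<And>n. distr M M (s n) = M"
    and f: "\<And>L. f L \<in> borel_measurable M"
    and mono: "\<And>L L' x. x \<in> space M \<Longrightarrow> L \<le> L' \<Longrightarrow> f L' x \<le> f L x"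
    and lim: "AE x in M. (\<lambda>L. f L x) \<longlonglongrightarrow> 0"
  shows "AE x in M. \<forall>\<delta>>0. \<exists>L. infinite {n. f L (s n x) \<le> ennreal \<delta>}"
proof -
  have one: "AE x in M. \<exists>L. infinite {n. f L (s n x) \<le> ennreal \<delta>}" if \<delta>: "0 < \<delta>" for \<delta>
  proof -
    define E where "E L = {x \<in> space M. ennreal \<delta> < f L x}" for L
    have Es: "E L \<in> sets M" for L unfolding E_def using f by measurable
    have "(\<lambda>L. prob (E L)) \<longlonglongrightarrow> prob (\<Inter>L. E L)"
    proof (rule finite_Lim_measure_decseq)
      show "range E \<subseteq> sets M" using Es by auto
      show "decseq E" unfolding decseq_def E_def using mono by (auto intro: less_le_trans)
    qed
    moreover have "prob (\<Inter>L. E L) = 0"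
    proof -
      have "AE x in M. x \<notin> (\<Inter>L. E L)" using lim
      proof eventually_elim
        case (elim x)
        then have "\<forall>\<^sub>F L in sequentially. f L x < ennreal \<delta>"
          by (rule order_tendstoD(2)) (use \<delta> in simp)
        then obtain L where "f L x < ennreal \<delta>" by (auto simp: eventually_sequentially)
        then have "x \<notin> E L" by (simp add: E_def not_less less_imp_le)
        then show ?case by blast
      qed
      then show ?thesis using Es by (subst prob_eq_0) auto
    qed
    ultimately have Elim: "(\<lambda>L. prob (E L)) \<longlonglongrightarrow> 0" by simp
    \<comment> \<open>The points that fail at level L from time m on. They lie in the preimage of
      \<open>E L\<close> under \<open>s m\<close>, so their measure is at most that of
      \<open>E L\<close>, whatever m is.\<close>
    define W where "W L m = {x \<in> space M. \<forall>n\<ge>m. ennreal \<delta> < f L (s n x)}" for L m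
    have Ws: "W L m \<in> sets M" for L m
    proof -
      have [measurable]: "(\<lambda>x. f L (s n x)) \<in> borel_measurable M" for n
        by (rule measurable_compose[OF s(1) f])
      show ?thesis unfolding W_def by measurable
    qed
    have Wle: "prob (\<Union>m. W L m) \<le> prob (E L)" for L
    proof -
      have "(\<lambda>m. prob (W L m)) \<longlonglongrightarrow> prob (\<Union>m. W L m)"
      proof (rule finite_Lim_measure_incseq)
        show "range (W L) \<subseteq> sets M" using Ws by auto
        show "incseq (W L)" unfolding incseq_def W_def by auto
      qed
      moreover have "prob (W L m) \<le> prob (E L)" for m
      proof -
        have "W L m \<subseteq> s m -` E L \<inter> space M"
          unfolding W_def E_def using measurable_space[OF s(1)] by auto
        then have "prob (W L m) \<le> prob (s m -` E L \<inter> space M)"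
          using measurable_sets[OF s(1) Es] by (intro finite_measure_mono) auto
        also have "\<dots> = measure (distr M M (s m)) (E L)"
          using s(1) Es by (simp add: measure_distr)
        finally show ?thesis by (simp add: s(2))
      qed
      ultimately show ?thesis by (intro LIMSEQ_le_const2) auto
    qed
    have WUs: "(\<Inter>L. \<Union>m. W L m) \<in> sets M" using Ws by auto
    have "prob (\<Inter>L. \<Union>m. W L m) \<le> prob (E L)" for L
    proof -
      have "prob (\<Inter>L. \<Union>m. W L m) \<le> prob (\<Union>m. W L m)"
        using Ws by (intro finite_measure_mono) auto
      then show ?thesis using Wle[of L] by simp
    qed
    then have "prob (\<Inter>L. \<Union>m. W L m) \<le> 0"
      using Elim by (intro LIMSEQ_le_const[OF Elim]) auto
    then have "prob (\<Inter>L. \<Union>m. W L m) = 0" by (simp add: measure_le_0_iff)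
    then have "(\<Inter>L. \<Union>m. W L m) \<in> null_sets M"
      using WUs by (intro null_setsI) (simp_all add: emeasure_eq_measure)
    then have "AE x in M. x \<notin> (\<Inter>L. \<Union>m. W L m)" by (rule AE_not_in)
    then show ?thesis using AE_space
    proof eventually_elim
      case (elim x)
      then obtain L where L: "\<And>m. x \<notin> W L m" by blast
      have "\<exists>n\<ge>m. f L (s n x) \<le> ennreal \<delta>" for m
        using L[of m] elim(2) unfolding W_def by (auto simp: not_less)
      then show ?case by (intro exI[of _ L]) (auto simp: infinite_nat_iff_unbounded_le)
    qed
  qed
  \<comment> \<open>Countably many values of \<delta> yield one exceptional null set for all of
    them.\<close>
  have "AE x in M. \<forall>j::nat. \<exists>L. infinite {n. f L (s n x) \<le> ennreal (1 / real (Suc j))}"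
    unfolding AE_all_countable by (intro allI one) simp
  then show ?thesis
  proof eventually_elim
    case (elim x)
    show ?case
    proof (intro allI impI)
      fix \<delta> :: real assume "0 < \<delta>"
      then obtain j where j: "1 / real (Suc j) < \<delta>" using nat_approx_posE[of \<delta>] by metis
      obtain L where "infinite {n. f L (s n x) \<le> ennreal (1 / real (Suc j))}" using elim[rule_format, of j] ..
      moreover have "{n. f L (s n x) \<le> ennreal (1 / real (Suc j))} \<subseteq> {n. f L (s n x) \<le> ennreal \<delta>}"
        using order_trans[OF _ ennreal_leI[OF less_imp_le[OF j]]] by blast
      ultimately have "infinite {n. f L (s n x) \<le> ennreal \<delta>}" using infinite_super by blast
      then show "\<exists>L. infinite {n. f L (s n x) \<le> ennreal \<delta>}" ..
    qed
  qed
qed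

section \<open>Mixing of measure-preserving maps from a generating pi-system\<close>

lemma (in prob_space) integral_comp_preserving:
  fixes f :: "'a \<Rightarrow> real"
  assumes "s \<in> measurable M M" "distr M M s = M" "f \<in> borel_measurable M"
  shows "(\<integral>x. f (s x) \<partial>M) = (\<integral>x. f x \<partial>M)" "integrable M (\<lambda>x. f (s x)) \<longleftrightarrow> integrable M f"
  using integral_distr[OF assms(1,3)] integrable_distr_eq[OF assms(1,3)] assms(2) by simp_all

text \<open>Two passes of the approximation scheme. With the indicator of a generator set in the
  moved place, the other factor is extended to L1; then, with a bounded g in the unmoved place, the
  moved factor is extended to L1. The different assumptions on f and g are those under which the
  functionals of the second pass are bounded in L1.\<close>

lemma (in prob_space) mixing_from_generator:
  fixes f g :: "'a \<Rightarrow> real" and s :: "nat \<Rightarrow> 'a \<Rightarrow> 'a"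
  assumes s: "\<And>n. s n \<in> measurable M M" "\<And>n. distr M M (s n) = M"
    and G: "Int_stable G" "G \<subseteq> Pow (space M)" "sigma_sets (space M) G = sets M"
    and gen: "\<And>A B. A \<in> G \<Longrightarrow> B \<in> G \<Longrightarrow> (\<lambda>n. prob (A \<inter> (s n -` B \<inter> space M))) \<longlonglongrightarrow> prob A * prob B"
    and f: "integrable M f" and g: "g \<in> borel_measurable M" "\<And>x. x \<in> space M \<Longrightarrow> \<bar>g x\<bar> \<le> c"
  shows "(\<lambda>n. \<integral>x. f (s n x) * g x \<partial>M) \<longlonglongrightarrow> (\<integral>x. f x \<partial>M) * (\<integral>x. g x \<partial>M)"
proof -
  have Gs: "A \<in> sets M" if "A \<in> G" for A using G(3) that by (metis sigma_sets.Basic)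
  have indint: "integrable M (indicator A :: _ \<Rightarrow> real)" if "A \<in> sets M" for A
    by (rule integrable_const_bound[where B = 1]) (use that in auto)
  have inner: "(\<lambda>n. \<integral>x. indicator B (s n x) * f x \<partial>M) \<longlonglongrightarrow> prob B * (\<integral>x. f x \<partial>M)"
    if B: "B \<in> G" and f: "integrable M f" for B and f :: "'a \<Rightarrow> real"
  proof -
    have Bs: "B \<in> sets M" by (rule Gs[OF B])
    have Bm: "(\<lambda>x. indicator B (s n x) :: real) \<in> borel_measurable M" for n
      by (rule measurable_compose[OF s(1)[of n]]) (use Bs in simp)
    have Bi: "integrable M (\<lambda>x. indicator B (s n x) * f x)" if "integrable M f" for n and f :: "'a \<Rightarrow> real"
      by (rule Bochner_Integration.integrable_bound[OF that])
        (use Bm[of n] that in \<open>auto simp: indicator_def\<close>)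
    interpret v: vanishing_functionals M "\<lambda>_. {()}" "\<lambda>n _ f. (\<integral>x. indicator B (s n x) * f x \<partial>M) - prob B * (\<integral>x. f x \<partial>M)" 2
    proof (rule vanishing_functionals.intro)
      show "finite_measure M" by (rule finite_measure_axioms)
      fix n :: nat and f :: "'a \<Rightarrow> real" and c :: real
      assume f: "integrable M f"
      show "(\<integral>x. indicator B (s n x) * (c * f x) \<partial>M) - prob B * (\<integral>x. c * f x \<partial>M) =
          c * ((\<integral>x. indicator B (s n x) * f x \<partial>M) - prob B * (\<integral>x. f x \<partial>M))"
        by (simp add: mult.left_commute[of _ c] right_diff_distrib)
      have "\<bar>\<integral>x. indicator B (s n x) * f x \<partial>M\<bar> \<le> (\<integral>x. \<bar>indicator B (s n x) * f x\<bar> \<partial>M)"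
        by (rule integral_abs_bound)
      also have "\<dots> \<le> (\<integral>x. \<bar>f x\<bar> \<partial>M)"
        using Bi[OF f] f by (intro integral_mono integrable_abs) (auto simp: indicator_def)
      finally have 1: "\<bar>\<integral>x. indicator B (s n x) * f x \<partial>M\<bar> \<le> (\<integral>x. \<bar>f x\<bar> \<partial>M)" .
      have "prob B * \<bar>\<integral>x. f x \<partial>M\<bar> \<le> 1 * (\<integral>x. \<bar>f x\<bar> \<partial>M)" by (intro mult_mono integral_abs_bound) auto
      then have "\<bar>prob B * (\<integral>x. f x \<partial>M)\<bar> \<le> (\<integral>x. \<bar>f x\<bar> \<partial>M)" by (simp add: abs_mult)
      with 1 show "\<bar>(\<integral>x. indicator B (s n x) * f x \<partial>M) - prob B * (\<integral>x. f x \<partial>M)\<bar> \<le> 2 * (\<integral>x. \<bar>f x\<bar> \<partial>M)" by linarith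
      fix g :: "'a \<Rightarrow> real" assume g: "integrable M g"
      show "(\<integral>x. indicator B (s n x) * (f x + g x) \<partial>M) - prob B * (\<integral>x. f x + g x \<partial>M) =
          (\<integral>x. indicator B (s n x) * f x \<partial>M) - prob B * (\<integral>x. f x \<partial>M) +
          ((\<integral>x. indicator B (s n x) * g x \<partial>M) - prob B * (\<integral>x. g x \<partial>M))"
        using Bi f g by (simp add: distrib_left)
    qed simp_all
    have vi: "v.vanishes f \<longleftrightarrow> integrable M f \<and> (\<lambda>n. \<integral>x. indicator B (s n x) * f x \<partial>M) \<longlonglongrightarrow> prob B * (\<integral>x. f x \<partial>M)" for f
      by (simp add: v.vanishes_singleton[of "()"] LIM_zero_iff)
    have "v.vanishes (indicator A)" if "A \<in> sets M" for A
    proof (rule v.vanishes_sigma_sets[OF G _ _ that])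
      fix A assume A: "A \<in> G"
      have "(\<integral>x. indicator B (s n x) * indicator A x \<partial>M) = prob (A \<inter> (s n -` B \<inter> space M))" for n
      proof -
        have "(\<integral>x. indicator B (s n x) * indicator A x \<partial>M) = (\<integral>x. (indicator (A \<inter> (s n -` B \<inter> space M)) x :: real) \<partial>M)"
          by (intro Bochner_Integration.integral_cong) (auto simp: indicator_def)
        also have "\<dots> = prob ((A \<inter> (s n -` B \<inter> space M)) \<inter> space M)" by (rule Bochner_Integration.integral_indicator)
        also have "(A \<inter> (s n -` B \<inter> space M)) \<inter> space M = A \<inter> (s n -` B \<inter> space M)" by auto
        finally show ?thesis .
      qed
      then show "v.vanishes (indicator A)"
        unfolding vi using gen[OF A B] Gs[OF A] indint by (simp add: mult.commute)
    next
      have "(\<integral>x. indicator B (s n x) * indicator (space M) x \<partial>M) = (\<integral>x. (indicator B (s n x) :: real) \<partial>M)" for n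
        by (intro Bochner_Integration.integral_cong) auto
      moreover have "(\<integral>x. indicator B (s n x) \<partial>M) = prob B" for n
        using integral_comp_preserving(1)[OF s, of "indicator B" n] Bs by simp
      ultimately show "v.vanishes (indicator (space M))"
        unfolding vi using indint[OF sets.top] by (simp add: prob_space)
    qed
    then show ?thesis using v.vanishes_integrable[OF _ f] unfolding vi by blast
  qed
  have c0: "0 \<le> c" using g(2) not_empty by (meson abs_ge_zero all_not_in_conv order_trans)
  have gi: "integrable M g" by (rule integrable_const_bound[of _ c]) (use g in auto)
  have fm: "(\<lambda>x. f (s n x)) \<in> borel_measurable M" if "f \<in> borel_measurable M" for n and f :: "'a \<Rightarrow> real"
    by (rule measurable_compose[OF s(1) that])
  have fi: "integrable M (\<lambda>x. f (s n x) * g x)" if f: "integrable M f" for n and f :: "'a \<Rightarrow> real"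
  proof (rule Bochner_Integration.integrable_bound[of M "\<lambda>x. c * f (s n x)"])
    show "integrable M (\<lambda>x. c * f (s n x))"
      using integral_comp_preserving(2)[OF s, of f n] f by auto
    show "(\<lambda>x. f (s n x) * g x) \<in> borel_measurable M" using fm[of f n] f g by measurable
    show "AE x in M. norm (f (s n x) * g x) \<le> norm (c * f (s n x))"
      using g(2) c0 by (intro AE_I2) (auto simp: abs_mult mult.commute intro!: mult_right_mono)
  qed
  interpret v: vanishing_functionals M "\<lambda>_. {()}" "\<lambda>n _ f. (\<integral>x. f (s n x) * g x \<partial>M) - (\<integral>x. f x \<partial>M) * (\<integral>x. g x \<partial>M)" "2 * c"
  proof (rule vanishing_functionals.intro)
    show "finite_measure M" by (rule finite_measure_axioms)
    fix n :: nat and f :: "'a \<Rightarrow> real" and d :: real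
    assume f: "integrable M f"
    show "(\<integral>x. d * f (s n x) * g x \<partial>M) - (\<integral>x. d * f x \<partial>M) * (\<integral>x. g x \<partial>M) =
        d * ((\<integral>x. f (s n x) * g x \<partial>M) - (\<integral>x. f x \<partial>M) * (\<integral>x. g x \<partial>M))"
      by (simp add: mult.assoc right_diff_distrib)
    have "\<bar>\<integral>x. f (s n x) * g x \<partial>M\<bar> \<le> (\<integral>x. \<bar>f (s n x) * g x\<bar> \<partial>M)"
      by (rule integral_abs_bound)
    also have "\<dots> \<le> (\<integral>x. c * \<bar>f (s n x)\<bar> \<partial>M)"
      using fi[OF f] integral_comp_preserving(2)[OF s, of f n] f g(2)
      by (intro integral_mono integrable_abs) (auto simp: abs_mult mult.commute intro!: mult_right_mono)
    also have "\<dots> = c * (\<integral>x. \<bar>f x\<bar> \<partial>M)"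
      using integral_comp_preserving(1)[OF s, of "\<lambda>x. \<bar>f x\<bar>" n] f by simp
    finally have 1: "\<bar>\<integral>x. f (s n x) * g x \<partial>M\<bar> \<le> c * (\<integral>x. \<bar>f x\<bar> \<partial>M)" .
    have "\<bar>\<integral>x. g x \<partial>M\<bar> \<le> (\<integral>x. \<bar>g x\<bar> \<partial>M)" by (rule integral_abs_bound)
    also have "\<dots> \<le> (\<integral>x. c \<partial>M)" using g gi by (intro integral_mono) auto
    finally have "\<bar>\<integral>x. g x \<partial>M\<bar> \<le> c" by (simp add: prob_space)
    then have "\<bar>\<integral>x. f x \<partial>M\<bar> * \<bar>\<integral>x. g x \<partial>M\<bar> \<le> (\<integral>x. \<bar>f x\<bar> \<partial>M) * c"
      using c0 by (intro mult_mono integral_abs_bound) auto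
    then have "\<bar>(\<integral>x. f x \<partial>M) * (\<integral>x. g x \<partial>M)\<bar> \<le> c * (\<integral>x. \<bar>f x\<bar> \<partial>M)" by (simp add: abs_mult mult.commute)
    with 1 show "\<bar>(\<integral>x. f (s n x) * g x \<partial>M) - (\<integral>x. f x \<partial>M) * (\<integral>x. g x \<partial>M)\<bar> \<le> 2 * c * (\<integral>x. \<bar>f x\<bar> \<partial>M)" by linarith
    fix f' :: "'a \<Rightarrow> real" assume f': "integrable M f'"
    show "(\<integral>x. (f (s n x) + f' (s n x)) * g x \<partial>M) - (\<integral>x. f x + f' x \<partial>M) * (\<integral>x. g x \<partial>M) =
        (\<integral>x. f (s n x) * g x \<partial>M) - (\<integral>x. f x \<partial>M) * (\<integral>x. g x \<partial>M) +
        ((\<integral>x. f' (s n x) * g x \<partial>M) - (\<integral>x. f' x \<partial>M) * (\<integral>x. g x \<partial>M))"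
      using fi[OF f, of n] fi[OF f', of n] f f' by (simp add: distrib_right)
  qed (use c0 in simp_all)
  have vi: "v.vanishes f \<longleftrightarrow> integrable M f \<and> (\<lambda>n. \<integral>x. f (s n x) * g x \<partial>M) \<longlonglongrightarrow> (\<integral>x. f x \<partial>M) * (\<integral>x. g x \<partial>M)" for f
    by (simp add: v.vanishes_singleton[of "()"] LIM_zero_iff)
  have "v.vanishes (indicator A)" if "A \<in> sets M" for A
  proof (rule v.vanishes_sigma_sets[OF G _ _ that])
    show "v.vanishes (indicator A)" if "A \<in> G" for A
      unfolding vi using inner[OF that gi] Gs[OF that] indint by simp
    have "(\<integral>x. indicator (space M) (s n x) * g x \<partial>M) = (\<integral>x. g x \<partial>M)" for n
      using measurable_space[OF s(1)] by (intro Bochner_Integration.integral_cong) auto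
    then show "v.vanishes (indicator (space M))"
        unfolding vi using indint[OF sets.top] by (simp add: prob_space)
  qed
  then show ?thesis using v.vanishes_integrable[OF _ f] unfolding vi by blast
qed

section \<open>Truncation: from bounded to square-integrable functions\<close>

lemma abs_mult_le_scaled: "0 < r \<Longrightarrow> \<bar>a * b\<bar> \<le> r * a\<^sup>2 + b\<^sup>2 / (r :: real)"
proof -
  assume r: "0 < r"
  have "0 \<le> (r * \<bar>a\<bar> - \<bar>b\<bar>)\<^sup>2" by simp
  then have "2 * (r * \<bar>a\<bar> * \<bar>b\<bar>) \<le> (r * a)\<^sup>2 + b\<^sup>2"
    by (simp add: power2_diff power_mult_distrib)
  moreover have "0 \<le> r * \<bar>a\<bar> * \<bar>b\<bar>" using r by simp
  ultimately have "r * (\<bar>a\<bar> * \<bar>b\<bar>) \<le> (r * a)\<^sup>2 + b\<^sup>2" by (simp add: mult.assoc)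
  then have "\<bar>a\<bar> * \<bar>b\<bar> \<le> ((r * a)\<^sup>2 + b\<^sup>2) / r" using r by (simp add: pos_le_divide_eq mult.commute)
  also have "\<dots> = r * a\<^sup>2 + b\<^sup>2 / r" using r by (simp add: add_divide_distrib power2_eq_square)
  finally show ?thesis by (simp add: abs_mult)
qed

definition clip :: "nat \<Rightarrow> real \<Rightarrow> real" where
  "clip k x = max (- real k) (min (real k) x)"

lemma clip: "\<bar>clip k x\<bar> \<le> real k" "\<bar>clip k x\<bar> \<le> \<bar>x\<bar>" "\<bar>x - clip k x\<bar> \<le> \<bar>x\<bar>" "(\<lambda>k. clip k x) \<longlonglongrightarrow> x"
proof -
  show "\<bar>clip k x\<bar> \<le> real k" "\<bar>clip k x\<bar> \<le> \<bar>x\<bar>" "\<bar>x - clip k x\<bar> \<le> \<bar>x\<bar>" unfolding clip_def by auto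
  obtain K where "\<bar>x\<bar> \<le> real K" using real_arch_simple by blast
  then have "clip k x = x" if "K \<le> k" for k using that unfolding clip_def by auto
  then show "(\<lambda>k. clip k x) \<longlonglongrightarrow> x"
    by (intro tendsto_eventually) (auto simp: eventually_sequentially)
qed

lemma clip_measurable [measurable]: "clip k \<in> borel_measurable borel"
  unfolding clip_def[abs_def] by measurable

lemma (in prob_space) square_integrable_integrable:
  fixes f :: "'a \<Rightarrow> real"
  assumes "f \<in> borel_measurable M" "integrable M (\<lambda>x. (f x)\<^sup>2)"
  shows "integrable M f"
proof (rule Bochner_Integration.integrable_bound[of M "\<lambda>x. 1 + (f x)\<^sup>2"])
  show "AE x in M. norm (f x) \<le> norm (1 + (f x)\<^sup>2)"
    using abs_mult_le_scaled[of 1 "f x" 1 for x] by (intro AE_I2) (simp add: add.commute)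
qed (use assms in auto)

text \<open>Truncating both factors at height k leaves two error terms, each a product of a fixed
  and a small function. The weighted Young inequality, in place of Cauchy-Schwarz, bounds such a
  term by r times the small square integral plus 1 / r times the fixed one. Hence r is chosen before
  k.\<close>

lemma (in prob_space) mixing_L2_from_bounded:
  fixes f g :: "'a \<Rightarrow> real" and s :: "nat \<Rightarrow> 'a \<Rightarrow> 'a"
  assumes s: "\<And>n. s n \<in> measurable M M" "\<And>n. distr M M (s n) = M"
    and bounded: "\<And>f g c. f \<in> borel_measurable M \<Longrightarrow> g \<in> borel_measurable M \<Longrightarrow> (\<And>x. \<bar>f x\<bar> \<le> c) \<Longrightarrow> (\<And>x. \<bar>g x\<bar> \<le> (c :: real)) \<Longrightarrow>
        (\<lambda>n. \<integral>x. f (s n x) * g x \<partial>M) \<longlonglongrightarrow> (\<integral>x. f x \<partial>M) * (\<integral>x. g x \<partial>M)"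
    and f: "f \<in> borel_measurable M" "integrable M (\<lambda>x. (f x)\<^sup>2)"
    and g: "g \<in> borel_measurable M" "integrable M (\<lambda>x. (g x)\<^sup>2)"
  shows "integrable M (\<lambda>x. f (s n x) * g x)"
    and "(\<lambda>n. \<integral>x. f (s n x) * g x \<partial>M) \<longlonglongrightarrow> (\<integral>x. f x \<partial>M) * (\<integral>x. g x \<partial>M)"
proof -
  have prod_int: "integrable M (\<lambda>x. p (s n x) * q x)" and
    prod_le: "0 < r \<Longrightarrow> \<bar>\<integral>x. p (s n x) * q x \<partial>M\<bar> \<le> r * (\<integral>x. (p x)\<^sup>2 \<partial>M) + (\<integral>x. (q x)\<^sup>2 \<partial>M) / r"
    if p: "p \<in> borel_measurable M" "integrable M (\<lambda>x. (p x)\<^sup>2)"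
      and q: "q \<in> borel_measurable M" "integrable M (\<lambda>x. (q x)\<^sup>2)" for p q :: "'a \<Rightarrow> real" and n r
  proof -
    have p2: "integrable M (\<lambda>x. (p (s n x))\<^sup>2)" "(\<integral>x. (p (s n x))\<^sup>2 \<partial>M) = (\<integral>x. (p x)\<^sup>2 \<partial>M)"
      using integral_comp_preserving[OF s, of "\<lambda>x. (p x)\<^sup>2" n] p by auto
    have pm: "(\<lambda>x. p (s n x)) \<in> borel_measurable M" by (rule measurable_compose[OF s(1) p(1)])
    show int: "integrable M (\<lambda>x. p (s n x) * q x)"
    proof (rule Bochner_Integration.integrable_bound[of M "\<lambda>x. 1 * (p (s n x))\<^sup>2 + (q x)\<^sup>2 / 1"])
      show "integrable M (\<lambda>x. 1 * (p (s n x))\<^sup>2 + (q x)\<^sup>2 / 1)" using p2 q by simp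
      show "(\<lambda>x. p (s n x) * q x) \<in> borel_measurable M" using pm q by measurable
      show "AE x in M. norm (p (s n x) * q x) \<le> norm (1 * (p (s n x))\<^sup>2 + (q x)\<^sup>2 / 1)"
      proof (intro AE_I2)
        fix x show "norm (p (s n x) * q x) \<le> norm (1 * (p (s n x))\<^sup>2 + (q x)\<^sup>2 / 1)"
          using abs_mult_le_scaled[of 1 "p (s n x)" "q x"] by simp
      qed
    qed
    assume r: "0 < r"
    have "\<bar>\<integral>x. p (s n x) * q x \<partial>M\<bar> \<le> (\<integral>x. \<bar>p (s n x) * q x\<bar> \<partial>M)" by (rule integral_abs_bound)
    also have "\<dots> \<le> (\<integral>x. r * (p (s n x))\<^sup>2 + (q x)\<^sup>2 / r \<partial>M)"
      using int p2 q abs_mult_le_scaled[OF r] by (intro integral_mono) auto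
    also have "\<dots> = r * (\<integral>x. (p x)\<^sup>2 \<partial>M) + (\<integral>x. (q x)\<^sup>2 \<partial>M) / r" using p2 q by simp
    finally show "\<bar>\<integral>x. p (s n x) * q x \<partial>M\<bar> \<le> r * (\<integral>x. (p x)\<^sup>2 \<partial>M) + (\<integral>x. (q x)\<^sup>2 \<partial>M) / r" .
  qed
  show "integrable M (\<lambda>x. f (s n x) * g x)" by (rule prod_int[OF f g])
  have clip_m: "(\<lambda>x. clip k (p x)) \<in> borel_measurable M" if "p \<in> borel_measurable M" for k p
    using that by measurable
  have clip_sq: "integrable M (\<lambda>x. (clip k (p x))\<^sup>2)" "integrable M (\<lambda>x. (p x - clip k (p x))\<^sup>2)"
    if p: "p \<in> borel_measurable M" "integrable M (\<lambda>x. (p x)\<^sup>2)" for k p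
  proof -
    show "integrable M (\<lambda>x. (clip k (p x))\<^sup>2)"
      by (rule Bochner_Integration.integrable_bound[OF p(2)])
        (use clip_m[OF p(1)] clip(2) in \<open>auto intro!: AE_I2 simp: abs_le_square_iff[symmetric]\<close>)
    show "integrable M (\<lambda>x. (p x - clip k (p x))\<^sup>2)"
      by (rule Bochner_Integration.integrable_bound[OF p(2)])
        (use clip_m[OF p(1)] p(1) clip(3) in \<open>auto intro!: AE_I2 simp: abs_le_square_iff[symmetric]\<close>)
  qed
  have clip_lim: "(\<lambda>k. \<integral>x. (p x - clip k (p x))\<^sup>2 \<partial>M) \<longlonglongrightarrow> 0"
    if p: "p \<in> borel_measurable M" "integrable M (\<lambda>x. (p x)\<^sup>2)" for p
  proof -
    have "(\<lambda>k. \<integral>x. (p x - clip k (p x))\<^sup>2 \<partial>M) \<longlonglongrightarrow> (\<integral>x. 0 \<partial>M)"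
    proof (rule integral_dominated_convergence[where w = "\<lambda>x. (p x)\<^sup>2"])
      show "(\<lambda>x. (p x - clip k (p x))\<^sup>2) \<in> borel_measurable M" for k using clip_sq(2)[OF p] by auto
      show "AE x in M. (\<lambda>k. (p x - clip k (p x))\<^sup>2) \<longlonglongrightarrow> 0"
      proof (intro AE_I2)
        fix x
        from tendsto_power[OF tendsto_diff[OF tendsto_const[of "p x"] clip(4)[of "p x"]], of 2]
        show "(\<lambda>k. (p x - clip k (p x))\<^sup>2) \<longlonglongrightarrow> 0" by simp
      qed
      show "AE x in M. norm ((p x - clip k (p x))\<^sup>2) \<le> (p x)\<^sup>2" for k
        using clip(3) by (intro AE_I2) (simp add: abs_le_square_iff[symmetric])
    qed (use p in auto)
    then show ?thesis by simp
  qed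
  have clip_int: "(\<lambda>k. \<integral>x. clip k (p x) \<partial>M) \<longlonglongrightarrow> (\<integral>x. p x \<partial>M)"
    if p: "p \<in> borel_measurable M" "integrable M (\<lambda>x. (p x)\<^sup>2)" for p
    by (rule integral_dominated_convergence[where w = "\<lambda>x. \<bar>p x\<bar>"])
      (use p clip(2,4) clip_m[OF p(1)] square_integrable_integrable[OF p] in auto)
  define F G where "F = (\<integral>x. (f x)\<^sup>2 \<partial>M)" and "G = (\<integral>x. (g x)\<^sup>2 \<partial>M)"
  have FG: "0 \<le> F" "0 \<le> G" unfolding F_def G_def by auto
  define \<Gamma> where "\<Gamma> k = (\<integral>x. clip k (f x) \<partial>M) * (\<integral>x. clip k (g x) \<partial>M)" for k
  have \<Gamma>lim: "\<Gamma> \<longlonglongrightarrow> (\<integral>x. f x \<partial>M) * (\<integral>x. g x \<partial>M)"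
    unfolding \<Gamma>_def by (intro tendsto_mult clip_int f g)
  show "(\<lambda>n. \<integral>x. f (s n x) * g x \<partial>M) \<longlonglongrightarrow> (\<integral>x. f x \<partial>M) * (\<integral>x. g x \<partial>M)"
  proof (rule LIMSEQ_I)
    fix e :: real assume e: "0 < e"
    \<comment> \<open>This weight makes (F + G) / r at most e / 16; the summand 1 keeps it positive
      when both integrals vanish.\<close>
    define r where "r = 16 * (F + G + 1) / e"
    have r: "0 < r" "(F + G) / r \<le> e / 16"
    proof -
      show "0 < r" unfolding r_def using FG e by simp
      then show "(F + G) / r \<le> e / 16" unfolding r_def using FG e by (simp add: divide_simps)
    qed
    have "(\<lambda>k. r * (\<integral>x. (f x - clip k (f x))\<^sup>2 \<partial>M)) \<longlonglongrightarrow> r * 0"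
         "(\<lambda>k. r * (\<integral>x. (g x - clip k (g x))\<^sup>2 \<partial>M)) \<longlonglongrightarrow> r * 0"
      by (intro tendsto_mult_left clip_lim f g)+
    then have "\<forall>\<^sub>F k in sequentially. r * (\<integral>x. (f x - clip k (f x))\<^sup>2 \<partial>M) < e / 8"
         "\<forall>\<^sub>F k in sequentially. r * (\<integral>x. (g x - clip k (g x))\<^sup>2 \<partial>M) < e / 8"
      using e by (auto dest!: order_tendstoD(2)[where a = "e / 8"])
    moreover have "\<forall>\<^sub>F k in sequentially. \<bar>\<Gamma> k - (\<integral>x. f x \<partial>M) * (\<integral>x. g x \<partial>M)\<bar> < e / 8"
      using tendstoD[OF \<Gamma>lim, of "e / 8"] e by (simp add: dist_real_def)
    ultimately have "\<forall>\<^sub>F k in sequentially. r * (\<integral>x. (f x - clip k (f x))\<^sup>2 \<partial>M) < e / 8 \<and>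
        r * (\<integral>x. (g x - clip k (g x))\<^sup>2 \<partial>M) < e / 8 \<and> \<bar>\<Gamma> k - (\<integral>x. f x \<partial>M) * (\<integral>x. g x \<partial>M)\<bar> < e / 8"
      by (intro eventually_conj)
    then obtain k where k: "r * (\<integral>x. (f x - clip k (f x))\<^sup>2 \<partial>M) < e / 8"
        "r * (\<integral>x. (g x - clip k (g x))\<^sup>2 \<partial>M) < e / 8" "\<bar>\<Gamma> k - (\<integral>x. f x \<partial>M) * (\<integral>x. g x \<partial>M)\<bar> < e / 8"
      by (auto simp: eventually_sequentially)
    have fk: "(\<lambda>x. clip k (f x)) \<in> borel_measurable M" "(\<lambda>x. f x - clip k (f x)) \<in> borel_measurable M"
      and gk: "(\<lambda>x. clip k (g x)) \<in> borel_measurable M" "(\<lambda>x. g x - clip k (g x)) \<in> borel_measurable M"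
      using f g by measurable
    have klim: "(\<lambda>n. \<integral>x. clip k (f (s n x)) * clip k (g x) \<partial>M) \<longlonglongrightarrow> \<Gamma> k"
      unfolding \<Gamma>_def by (rule bounded[of "\<lambda>x. clip k (f x)" "\<lambda>x. clip k (g x)" "real k"]) (use fk gk clip(1) in auto)
    have "0 < e / 8" using e by simp
    then obtain n0 where n0: "\<And>n. n \<ge> n0 \<Longrightarrow> norm ((\<integral>x. clip k (f (s n x)) * clip k (g x) \<partial>M) - \<Gamma> k) < e / 8"
      using LIMSEQ_D[OF klim] by blast
    show "\<exists>n0. \<forall>n\<ge>n0. norm ((\<integral>x. f (s n x) * g x \<partial>M) - (\<integral>x. f x \<partial>M) * (\<integral>x. g x \<partial>M)) < e"
    proof (intro exI[of _ n0] allI impI)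
      fix n assume n: "n0 \<le> n"
      note sq = clip_sq[OF f, of k] clip_sq[OF g, of k]
      have "(\<integral>x. (g x)\<^sup>2 \<partial>M) / r \<le> e / 16"
        using r FG by (smt (verit, best) G_def divide_right_mono)
      then have 1: "\<bar>\<integral>x. (f (s n x) - clip k (f (s n x))) * g x \<partial>M\<bar> \<le> e / 8 + e / 16"
        using prod_le[OF fk(2) sq(2) g r(1), of n] k(1) by linarith
      have "(\<integral>x. (clip k (f x))\<^sup>2 \<partial>M) \<le> F"
        unfolding F_def using sq f clip(2) by (intro integral_mono) (auto simp: abs_le_square_iff[symmetric])
      then have F4: "(\<integral>x. (clip k (f x))\<^sup>2 \<partial>M) / r \<le> e / 16"
        using r FG by (smt (verit, best) divide_right_mono)
      have 2: "\<bar>\<integral>x. clip k (f (s n x)) * (g x - clip k (g x)) \<partial>M\<bar> \<le> e / 8 + e / 16"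
      proof -
        \<comment> \<open>Here the small factor stands in the second place, so the inverse weight is
          used.\<close>
        have "0 < 1 / r" using r by simp
        from prod_le[OF fk(1) sq(1) gk(2) sq(4) this, of n]
        have "\<bar>\<integral>x. clip k (f (s n x)) * (g x - clip k (g x)) \<partial>M\<bar> \<le>
            (\<integral>x. (clip k (f x))\<^sup>2 \<partial>M) / r + r * (\<integral>x. (g x - clip k (g x))\<^sup>2 \<partial>M)"
          using r by (simp add: mult.commute)
        then show ?thesis using F4 k(2) by linarith
      qed
      \<comment> \<open>Telescoping: the moved factor is truncated first, then the unmoved one, and
        the last term is the bounded correlation.\<close>
      have "(\<integral>x. f (s n x) * g x \<partial>M) = (\<integral>x. (f (s n x) - clip k (f (s n x))) * g x +
          (clip k (f (s n x)) * (g x - clip k (g x)) + clip k (f (s n x)) * clip k (g x)) \<partial>M)"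
        by (intro Bochner_Integration.integral_cong) (auto simp: algebra_simps)
      also have "\<dots> = (\<integral>x. (f (s n x) - clip k (f (s n x))) * g x \<partial>M) +
          ((\<integral>x. clip k (f (s n x)) * (g x - clip k (g x)) \<partial>M) + (\<integral>x. clip k (f (s n x)) * clip k (g x) \<partial>M))"
        using prod_int[OF fk(2) sq(2) g, of n] prod_int[OF fk(1) sq(1) gk(2) sq(4), of n] prod_int[OF fk(1) sq(1) gk(1) sq(3), of n]
        by simp
      finally show "norm ((\<integral>x. f (s n x) * g x \<partial>M) - (\<integral>x. f x \<partial>M) * (\<integral>x. g x \<partial>M)) < e"
        using 1 2 k(3) n0[OF n] e unfolding real_norm_def by linarith
    qed
  qed
qed

section \<open>Transfer operators along one orbit\<close>

text \<open>Differences of elements form a subgroup of the integers; it is generated by its least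
  positive element, which divides every element of \<open>S\<close> and hence divides the gcd, so
  that it is 1. Thus \<open>S\<close> contains consecutive numbers b and b + 1, and these generate
  every large number.\<close>

lemma nat_semigroup_cofinite:
  fixes S G :: "nat set"
  assumes zero: "0 \<in> S" and add: "\<And>a b. a \<in> S \<Longrightarrow> b \<in> S \<Longrightarrow> a + b \<in> S"
    and sub: "G \<subseteq> S" and gcd: "Gcd G = 1"
  shows "\<exists>k0. \<forall>k\<ge>k0. k \<in> S"
proof -
  have mult: "n * a \<in> S" if "a \<in> S" for n a
    by (induction n) (use zero add that in auto)
  define H where "H = {int a - int b | a b. a \<in> S \<and> b \<in> S}"
  have H_add: "x + y \<in> H" if xy: "x \<in> H" "y \<in> H" for x y
  proof -
    obtain a b c d where *: "x = int a - int b" "y = int c - int d" "a \<in> S" "b \<in> S" "c \<in> S" "d \<in> S"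
      using xy unfolding H_def by blast
    have "x + y = int (a + c) - int (b + d)" using * by simp
    moreover have "a + c \<in> S" "b + d \<in> S" using * add by auto
    ultimately show ?thesis unfolding H_def by blast
  qed
  have H_neg: "- x \<in> H" if x: "x \<in> H" for x
  proof -
    obtain a b where "x = int a - int b" "a \<in> S" "b \<in> S" using x unfolding H_def by blast
    then have "- x = int b - int a" by simp
    with \<open>a \<in> S\<close> \<open>b \<in> S\<close> show ?thesis unfolding H_def by blast
  qed
  have S_H: "int a \<in> H" if "a \<in> S" for a
    unfolding H_def using that zero by (intro CollectI exI[of _ a] exI[of _ 0]) auto
  have H_mult: "int n * x \<in> H" if "x \<in> H" for n x
    by (induction n) (use S_H[OF zero] H_add that in \<open>auto simp: algebra_simps\<close>)
  obtain t where t: "t \<in> G" "t \<noteq> 0"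
  proof -
    have "\<not> G \<subseteq> {0}" using gcd by (metis Gcd_0_iff zero_neq_one)
    then show ?thesis using that by blast
  qed
  define d where "d = (LEAST d. 0 < d \<and> int d \<in> H)"
  have ex: "0 < t \<and> int t \<in> H" using t sub S_H by auto
  have d: "0 < d" "int d \<in> H" unfolding d_def using LeastI[of "\<lambda>d. 0 < d \<and> int d \<in> H", OF ex] by auto
  have d_least: "d \<le> e" if "0 < e" "int e \<in> H" for e
    unfolding d_def using that by (intro Least_le) auto
  have "d dvd s" if "s \<in> S" for s
  proof -
    have "int (s mod d) = int s + - (int (s div d) * int d)"
      by (simp add: zmod_int zdiv_int minus_div_mult_eq_mod [symmetric])
    also have "\<dots> \<in> H" using H_add[OF S_H[OF that] H_neg[OF H_mult[OF d(2)]]] .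
    finally have "int (s mod d) \<in> H" .
    with d_least[of "s mod d"] d(1) have "s mod d = 0"
      by (metis mod_less_divisor not_gr_zero not_less)
    then show ?thesis by auto
  qed
  then have "d dvd Gcd G" using sub by (intro Gcd_greatest) auto
  then have "d = 1" using gcd by simp
  then obtain a b where ab: "a \<in> S" "b \<in> S" "1 = int a - int b" using d(2) unfolding H_def by auto
  then have a: "a = b + 1" by simp
  \<comment> \<open>For k = q b + r with r < b \<le> q one has k = (q - r) b + r (b + 1); the bound
    b * b is what gives b \<le> q.\<close>
  show ?thesis
  proof (intro exI[of _ "b * b"] allI impI)
    fix k assume k: "k \<ge> b * b"
    show "k \<in> S"
    proof (cases "b = 0")
      case True then show ?thesis using mult[OF ab(1), of k] a by simp
    next
      case False
      define q r where "q = k div b" and "r = k mod b"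
      have kq: "k = q * b + r" and r: "r < b" using False unfolding q_def r_def by auto
      have "q \<ge> b" using k False unfolding q_def by (simp add: less_eq_div_iff_mult_less_eq)
      then obtain s where s: "q = r + s" using r by (metis le_Suc_ex less_imp_le_nat le_trans)
      have "k = s * b + r * a" using kq s a by (simp add: algebra_simps)
      then show ?thesis using mult ab add by metis
    qed
  qed
qed

section \<open>Integrals over countable index sets and over levels\<close>

lemma borel_measurable_nn_integral_count_space:
  assumes "countable A" "\<And>a. a \<in> A \<Longrightarrow> (\<lambda>x. f x a) \<in> borel_measurable M"
  shows "(\<lambda>x. \<integral>\<^sup>+a. f x a \<partial>count_space A) \<in> borel_measurable M"
proof -
  interpret sigma_finite_measure "count_space A"
    using assms(1) by (rule sigma_finite_measure_count_space_countable)
  have 1: "(\<lambda>(a, x). f x a) \<in> borel_measurable (count_space A \<Otimes>\<^sub>M M)"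
    using assms by (intro measurable_pair_measure_countable1) auto
  have "(\<lambda>p. (\<lambda>(a, x). f x a) (snd p, fst p)) \<in> borel_measurable (M \<Otimes>\<^sub>M count_space A)"
    by (rule measurable_compose[OF _ 1]) (rule measurable_Pair[OF measurable_snd measurable_fst])
  then show ?thesis by (intro borel_measurable_nn_integral) (simp add: case_prod_beta')
qed

lemma nn_integral_count_space_swap:
  assumes "countable A" "sigma_finite_measure M" "\<And>a. a \<in> A \<Longrightarrow> (\<lambda>x. f x a) \<in> borel_measurable M"
  shows "(\<integral>\<^sup>+x. \<integral>\<^sup>+a. f x a \<partial>count_space A \<partial>M) = (\<integral>\<^sup>+a. \<integral>\<^sup>+x. f x a \<partial>M \<partial>count_space A)"
proof -
  interpret A: sigma_finite_measure "count_space A"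
    using assms(1) by (rule sigma_finite_measure_count_space_countable)
  interpret M: sigma_finite_measure M by fact
  interpret pair_sigma_finite "count_space A" M ..
  have 1: "(\<lambda>(a, x). f x a) \<in> borel_measurable (count_space A \<Otimes>\<^sub>M M)"
    using assms by (intro measurable_pair_measure_countable1) auto
  show ?thesis by (rule Fubini'[OF 1])
qed

lemma nn_integral_count_space_partition:
  assumes "partition_on S P" "x \<in> S"
  shows "(\<integral>\<^sup>+A. c * indicator A x \<partial>count_space P) = (c :: ennreal)"
proof -
  obtain B where B: "B \<in> P" "x \<in> B" using assms by (auto simp: partition_on_def)
  have "indicator A x = (indicator {B} A :: ennreal)" if "A \<in> P" for A
    using disjointD[OF partition_onD2[OF assms(1)] that B(1)] B(2) by (auto simp: indicator_def)
  then have "(\<integral>\<^sup>+A. c * indicator A x \<partial>count_space P) = (\<integral>\<^sup>+A. c * indicator {B} A \<partial>count_space P)"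
    by (intro nn_integral_cong) simp
  also have "\<dots> = c" using B by (simp add: nn_integral_cmult_indicator)
  finally show ?thesis .
qed

lemma suminf_ennreal_split:
  fixes f :: "nat \<Rightarrow> ennreal"
  shows "(\<Sum>n. f n) = f 0 + (\<Sum>n. f (Suc n))"
proof -
  have "f sums ((\<Sum>n. f (Suc n)) + f 0)"
    by (intro sums_Suc summable_sums) auto
  then show ?thesis by (simp add: sums_iff add.commute)
qed

lemma measurable_pair_count_space_nat:
  "f \<in> borel_measurable (M \<Otimes>\<^sub>M count_space (UNIV :: nat set)) \<longleftrightarrow> (\<forall>l. (\<lambda>x. f (x, l)) \<in> borel_measurable M)"
proof (intro iffI allI)
  fix l assume f: "f \<in> borel_measurable (M \<Otimes>\<^sub>M count_space (UNIV :: nat set))"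
  show "(\<lambda>x. f (x, l)) \<in> borel_measurable M"
    by (rule measurable_compose[OF _ f]) (rule measurable_Pair2', simp)
next
  assume *: "\<forall>l. (\<lambda>x. f (x, l)) \<in> borel_measurable M"
  have 1: "(\<lambda>(l, x). f (x, l)) \<in> borel_measurable (count_space UNIV \<Otimes>\<^sub>M M)"
    using * by (intro measurable_pair_measure_countable1) auto
  have "(\<lambda>p. (\<lambda>(l, x). f (x, l)) (snd p, fst p)) \<in> borel_measurable (M \<Otimes>\<^sub>M count_space UNIV)"
    by (rule measurable_compose[OF _ 1]) (rule measurable_Pair[OF measurable_snd measurable_fst])
  then show "f \<in> borel_measurable (M \<Otimes>\<^sub>M count_space UNIV)" by simp
qed

text \<open>
  The bundle of towers over one two-sided orbit, indexed by the integers: \<open>g i\<close> is the return map from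
  the base of fibre \<open>i\<close>, \<open>xi i A\<close> the inverse of its branch on \<open>A\<close>, \<open>w i A\<close> the inverse Jacobian of
  that branch, and \<open>gb i x y\<close> stands for \<open>\<gamma>\<close> to the power of the separation time of base points.
\<close>
locale tower_orbit =
  fixes Mb :: "'x :: metric_space measure"
    and Pt :: "int \<Rightarrow> 'x set set"
    and R :: "int \<Rightarrow> 'x \<Rightarrow> nat"
    and g :: "int \<Rightarrow> 'x \<Rightarrow> 'x"
    and xi :: "int \<Rightarrow> 'x set \<Rightarrow> 'x \<Rightarrow> 'x"
    and w :: "int \<Rightarrow> 'x set \<Rightarrow> 'x \<Rightarrow> ennreal"
    and gb :: "int \<Rightarrow> 'x \<Rightarrow> 'x \<Rightarrow> real"
    and \<gamma> D M :: real
    and ts :: "nat set"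
  assumes prob: "prob_space Mb"
    and sets_Mb: "sets Mb = sets (restrict_space borel (space Mb))"
    and Pt_countable: "countable (Pt i)"
    and Pt_partition: "partition_on (space Mb) (Pt i)"
    and Pt_sets: "A \<in> Pt i \<Longrightarrow> A \<in> sets Mb"
    and R_const: "A \<in> Pt i \<Longrightarrow> x \<in> A \<Longrightarrow> y \<in> A \<Longrightarrow> R i x = R i y"
    and R_pos: "x \<in> space Mb \<Longrightarrow> 1 \<le> R i x"
    and R_meas: "R i \<in> measurable Mb (count_space UNIV)"
    and xi_in: "A \<in> Pt i \<Longrightarrow> y \<in> space Mb \<Longrightarrow> xi i A y \<in> A"
    and g_xi: "A \<in> Pt i \<Longrightarrow> y \<in> space Mb \<Longrightarrow> g i (xi i A y) = y"
    and g_meas: "g i \<in> measurable Mb Mb"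
    and xi_meas: "A \<in> Pt i \<Longrightarrow> xi i A \<in> measurable Mb Mb"
    and w_meas: "A \<in> Pt i \<Longrightarrow> w i A \<in> borel_measurable Mb"
    and change: "A \<in> Pt i \<Longrightarrow> \<phi> \<in> borel_measurable Mb \<Longrightarrow>
        (\<integral>\<^sup>+x. \<phi> x * indicator A x \<partial>Mb) = (\<integral>\<^sup>+y. \<phi> (xi i A y) * w i A y \<partial>Mb)"
    and w_dist: "A \<in> Pt i \<Longrightarrow> x \<in> A \<Longrightarrow> y \<in> space Mb \<Longrightarrow> z \<in> space Mb \<Longrightarrow>
        w i A y \<le> ennreal (1 + D * gb (i + int (R i x)) y z) * w i A z"
    and gb_bounds: "0 \<le> gb i x y" "gb i x y \<le> 1"
    and gb_same: "A \<in> Pt i \<Longrightarrow> x \<in> A \<Longrightarrow> y \<in> A \<Longrightarrow> gb i x y = \<gamma> * gb (i + int (R i x)) (g i x) (g i y)"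
    and gb_diff: "x \<in> space Mb \<Longrightarrow> y \<in> space Mb \<Longrightarrow> \<nexists>A. A \<in> Pt i \<and> x \<in> A \<and> y \<in> A \<Longrightarrow> gb i x y = 1"
    and gamma: "0 < \<gamma>" "\<gamma> < 1" and D_pos: "0 < D"
    and ts_gcd: "Gcd ts = 1"
    and ts_mass: "t \<in> ts \<Longrightarrow> \<exists>e>0. \<forall>i. ennreal e \<le> emeasure Mb {x \<in> space Mb. R i x = t}"
    and mass_bound: "(\<Sum>l. emeasure Mb {x \<in> space Mb. l < R (i - int l) x}) \<le> ennreal M"
    and visits: "0 < \<delta> \<Longrightarrow> \<exists>L.
        infinite {n::nat. (\<Sum>l. emeasure Mb {x \<in> space Mb. l + L < R (i + int n - int (l + L)) x}) \<le> ennreal \<delta>} \<and>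
        infinite {n::nat. (\<Sum>l. emeasure Mb {x \<in> space Mb. l + L < R (i - int n - int (l + L)) x}) \<le> ennreal \<delta>}"
    and gen: "0 < e \<Longrightarrow> \<exists>r>0. \<forall>x\<in>space Mb. \<forall>y\<in>space Mb. gb i x y < r \<longrightarrow> dist x y < e"
begin

sublocale Mb: prob_space Mb by (rule prob)

text \<open>Level l over fibre i belongs to the column that started at fibre i - l, so its height is
  governed by the return time of that earlier fibre.\<close>

definition H :: "int \<Rightarrow> nat \<Rightarrow> 'x set" where
  "H i l = {x \<in> space Mb. l < R (i - int l) x}"

definition Dl :: "int \<Rightarrow> ('x \<times> nat) set" where
  "Dl i = {(x, l). x \<in> space Mb \<and> l < R (i - int l) x}"

definition tw :: "int \<Rightarrow> ('x \<times> nat) measure" where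
  "tw i = restrict_space (Mb \<Otimes>\<^sub>M count_space UNIV) (Dl i)"

definition Fm :: "int \<Rightarrow> 'x \<times> nat \<Rightarrow> 'x \<times> nat" where
  "Fm i = (\<lambda>(x, l). if Suc l < R (i - int l) x then (x, Suc l) else (g (i - int l) x, 0))"

primrec Fit :: "nat \<Rightarrow> int \<Rightarrow> 'x \<times> nat \<Rightarrow> 'x \<times> nat" where
  "Fit 0 i z = z"
| "Fit (Suc n) i z = Fm (i + int n) (Fit n i z)"

text \<open>The transfer operator from the tower over i to the tower over i + 1. The base value
  collects, for every k, the branches of return time k + 1 of the column started at i - k, whose top
  is level k. Evaluating the return time at the single point \<open>xi\<close> is harmless because
  it is constant on A. Values in \<open>ennreal\<close> make all sums meaningful.\<close>

definition push :: "int \<Rightarrow> ('x \<times> nat \<Rightarrow> ennreal) \<Rightarrow> 'x \<times> nat \<Rightarrow> ennreal" where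
  "push i f = (\<lambda>(y, l). case l of
     0 \<Rightarrow> (\<Sum>k. \<integral>\<^sup>+A. (if R (i - int k) (xi (i - int k) A y) = Suc k
                    then f (xi (i - int k) A y, k) * w (i - int k) A y else 0) \<partial>count_space (Pt (i - int k)))
   | Suc k \<Rightarrow> f (y, k))"

primrec push_iter :: "nat \<Rightarrow> int \<Rightarrow> ('x \<times> nat \<Rightarrow> ennreal) \<Rightarrow> 'x \<times> nat \<Rightarrow> ennreal" where
  "push_iter 0 i f = f"
| "push_iter (Suc n) i f = push (i + int n) (push_iter n i f)"

text \<open>Measurability is asked on the whole product rather than on one tower. The condition then
  does not mention the fibre and is carried along by \<open>push\<close> unchanged.\<close>

abbreviation fm :: "('x \<times> nat \<Rightarrow> ennreal) \<Rightarrow> bool" where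
  "fm f \<equiv> f \<in> borel_measurable (Mb \<Otimes>\<^sub>M count_space UNIV)"

lemma push_0: "push i f (y, 0) = (\<Sum>k. \<integral>\<^sup>+A. (if R (i - int k) (xi (i - int k) A y) = Suc k
    then f (xi (i - int k) A y, k) * w (i - int k) A y else 0) \<partial>count_space (Pt (i - int k)))"
  and push_Suc [simp]: "push i f (y, Suc k) = f (y, k)"
  by (simp_all add: push_def)

lemma fm_iff: "fm f \<longleftrightarrow> (\<forall>l. (\<lambda>x. f (x, l)) \<in> borel_measurable Mb)"
  by (rule measurable_pair_count_space_nat)

lemma fm_level: "fm f \<Longrightarrow> (\<lambda>x. f (x, l)) \<in> borel_measurable Mb"
  by (simp add: fm_iff)

lemma Pt_space: "A \<in> Pt i \<Longrightarrow> x \<in> A \<Longrightarrow> x \<in> space Mb"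
  using Pt_partition[of i] by (auto simp: partition_on_def)

lemma Pt_cover: "x \<in> space Mb \<Longrightarrow> \<exists>A\<in>Pt i. x \<in> A"
  using Pt_partition[of i] by (auto simp: partition_on_def)

lemma g_space: "x \<in> space Mb \<Longrightarrow> g i x \<in> space Mb"
  by (rule measurable_space[OF g_meas])

lemma xi_space: "A \<in> Pt i \<Longrightarrow> y \<in> space Mb \<Longrightarrow> xi i A y \<in> space Mb"
  by (rule Pt_space[OF _ xi_in])

lemma Dl_H: "(x, l) \<in> Dl i \<longleftrightarrow> x \<in> H i l"
  by (auto simp: Dl_def H_def)

lemma H_0: "H i 0 = space Mb"
  using R_pos[of _ i] by (auto simp: H_def Suc_le_eq)

lemma H_sets [measurable]: "H i l \<in> sets Mb"
proof -
  have [measurable]: "R (i - int l) \<in> measurable Mb (count_space UNIV)" by (rule R_meas)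
  show ?thesis unfolding H_def by measurable
qed

lemma Dl_sets [measurable]: "Dl i \<in> sets (Mb \<Otimes>\<^sub>M count_space UNIV)"
proof -
  have "Dl i = (\<Union>l. H i l \<times> {l})" by (auto simp: Dl_H)
  then show ?thesis by simp
qed

lemma space_tw: "space (tw i) = Dl i"
  unfolding tw_def by (auto simp: space_restrict_space space_pair_measure Dl_def)

lemma fm_tw: "f \<in> borel_measurable (Mb \<Otimes>\<^sub>M count_space UNIV) \<Longrightarrow> f \<in> borel_measurable (tw i)"
  unfolding tw_def by (rule measurable_restrict_space1)

lemma nn_integral_tw:
  assumes "f \<in> borel_measurable (tw i)"
  shows "(\<integral>\<^sup>+z. f z \<partial>tw i) = (\<Sum>l. \<integral>\<^sup>+x. f (x, l) * indicator (H i l) x \<partial>Mb)"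
proof -
  interpret N: sigma_finite_measure "count_space (UNIV :: nat set)"
    by (rule sigma_finite_measure_count_space)
  interpret pair_sigma_finite Mb "count_space (UNIV :: nat set)" ..
  have m: "(\<lambda>z. f z * indicator (Dl i) z) \<in> borel_measurable (Mb \<Otimes>\<^sub>M count_space UNIV)"
    using assms unfolding tw_def by (subst (asm) borel_measurable_restrict_space_iff_ennreal) auto
  have "(\<integral>\<^sup>+z. f z \<partial>tw i) = (\<integral>\<^sup>+z. f z * indicator (Dl i) z \<partial>(Mb \<Otimes>\<^sub>M count_space UNIV))"
    unfolding tw_def by (intro nn_integral_restrict_space) auto
  also have "\<dots> = (\<integral>\<^sup>+l. \<integral>\<^sup>+x. f (x, l) * indicator (Dl i) (x, l) \<partial>Mb \<partial>count_space UNIV)"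
    by (rule nn_integral_snd[OF m, symmetric])
  also have "\<dots> = (\<Sum>l. \<integral>\<^sup>+x. f (x, l) * indicator (Dl i) (x, l) \<partial>Mb)"
    by (rule nn_integral_count_space_nat)
  finally show ?thesis by (simp add: indicator_def Dl_H)
qed

lemma fm_push:
  assumes "fm f" shows "fm (push i f)"
  unfolding fm_iff
proof
  fix l show "(\<lambda>x. push i f (x, l)) \<in> borel_measurable Mb"
  proof (cases l)
    case (Suc k) then show ?thesis using assms by (simp add: fm_level)
  next
    case 0
    have *: "(\<lambda>y. if R j (xi j A y) = Suc k then f (xi j A y, k) * w j A y else 0) \<in> borel_measurable Mb"
      if A: "A \<in> Pt j" for k j A
    proof -
      have [measurable]: "xi j A \<in> measurable Mb Mb" "w j A \<in> borel_measurable Mb"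
        "R j \<in> measurable Mb (count_space UNIV)" "(\<lambda>x. f (x, k)) \<in> borel_measurable Mb"
        using A xi_meas w_meas R_meas fm_level[OF assms] by auto
      show ?thesis by measurable
    qed
    show ?thesis unfolding 0 push_0
      by (intro borel_measurable_suminf_order borel_measurable_nn_integral_count_space Pt_countable *)
  qed
qed

lemma Fm_in: "z \<in> Dl i \<Longrightarrow> Fm i z \<in> Dl (i + 1)"
proof (cases z)
  case (Pair x l)
  assume z: "z \<in> Dl i"
  then have x: "x \<in> space Mb" by (simp add: Pair Dl_def)
  have "0 < R (i + 1) (g (i - int l) x)"
    using R_pos[OF g_space[OF x]] by (metis Suc_le_eq One_nat_def)
  with x show ?thesis by (simp add: Pair Fm_def Dl_def g_space)
qed

lemma Fit_in: "z \<in> Dl i \<Longrightarrow> Fit n i z \<in> Dl (i + int n)"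
proof (induction n)
  case (Suc n)
  have "Fm (i + int n) (Fit n i z) \<in> Dl (i + int n + 1)" by (rule Fm_in[OF Suc.IH[OF Suc.prems]])
  moreover have "i + int (Suc n) = i + int n + 1" by simp
  ultimately show ?case by (simp only: Fit.simps)
qed simp

lemma Fm_meas_prod: "Fm i \<in> measurable (Mb \<Otimes>\<^sub>M count_space UNIV) (Mb \<Otimes>\<^sub>M count_space UNIV)"
proof -
  have 1: "(\<lambda>x. Fm i (x, l)) \<in> measurable Mb (Mb \<Otimes>\<^sub>M count_space UNIV)" for l
  proof -
    have [measurable]: "R (i - int l) \<in> measurable Mb (count_space UNIV)"
       "g (i - int l) \<in> measurable Mb Mb" by (rule R_meas g_meas)+
    show ?thesis unfolding Fm_def by simp
  qed
  have 2: "(\<lambda>(l, x). Fm i (x, l)) \<in> measurable (count_space UNIV \<Otimes>\<^sub>M Mb) (Mb \<Otimes>\<^sub>M count_space UNIV)"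
    using 1 by (intro measurable_pair_measure_countable1) auto
  have "(\<lambda>p. (\<lambda>(l, x). Fm i (x, l)) (snd p, fst p)) \<in> measurable (Mb \<Otimes>\<^sub>M count_space UNIV) (Mb \<Otimes>\<^sub>M count_space UNIV)"
    by (rule measurable_compose[OF _ 2]) (rule measurable_Pair[OF measurable_snd measurable_fst])
  then show ?thesis by simp
qed

lemma Fm_meas: "Fm i \<in> measurable (tw i) (tw (i + 1))"
  unfolding tw_def
  by (rule measurable_restrict_space3[OF Fm_meas_prod]) (auto intro: Fm_in)

lemma Fit_meas: "Fit n i \<in> measurable (tw i) (tw (i + int n))"
proof (induction n)
  case (Suc n)
  have "(\<lambda>z. Fm (i + int n) (Fit n i z)) \<in> measurable (tw i) (tw (i + int n + 1))"
    by (rule measurable_compose[OF Suc Fm_meas])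
  moreover have "i + int (Suc n) = i + int n + 1" by simp
  ultimately show ?case by (simp only: Fit.simps)
qed (simp add: measurable_ident_sets)

text \<open>The duality between \<open>push\<close> and composition with the tower map: on the base
  it is the change of variables on each branch, above the base a renumbering of levels.\<close>

lemma nn_integral_push:
  assumes f: "fm f" and \<phi>: "\<phi> \<in> borel_measurable (tw (i + 1))"
  shows "(\<integral>\<^sup>+z. \<phi> z * push i f z \<partial>tw (i + 1)) = (\<integral>\<^sup>+z. \<phi> (Fm i z) * f z \<partial>tw i)"
proof -
  \<comment> \<open>Cutting \<phi> off outside the tower makes it measurable on the whole product,
    so that one can integrate level by level.\<close>
  define \<psi> where "\<psi> z = \<phi> z * indicator (Dl (i + 1)) z" for z
  have \<psi>: "fm \<psi>"
    using \<phi> unfolding \<psi>_def tw_def by (subst (asm) borel_measurable_restrict_space_iff_ennreal) auto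
  have "(\<integral>\<^sup>+z. \<phi> z * push i f z \<partial>tw (i + 1)) = (\<integral>\<^sup>+z. \<psi> z * push i f z \<partial>tw (i + 1))"
    by (intro nn_integral_cong) (simp add: \<psi>_def space_tw)
  also have "\<dots> = (\<Sum>l. \<integral>\<^sup>+x. \<psi> (x, l) * push i f (x, l) * indicator (H (i + 1) l) x \<partial>Mb)"
    by (intro nn_integral_tw fm_tw borel_measurable_times_ennreal \<psi> fm_push f)
  also have "\<dots> = (\<integral>\<^sup>+x. \<psi> (x, 0) * push i f (x, 0) * indicator (H (i + 1) 0) x \<partial>Mb) +
      (\<Sum>l. \<integral>\<^sup>+x. \<psi> (x, Suc l) * f (x, l) * indicator (H (i + 1) (Suc l)) x \<partial>Mb)" (is "_ = ?B + ?C")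
    by (subst suminf_ennreal_split) simp
  \<comment> \<open>The factor at the base point is moved inside the sums over columns and branches,
    so that the integral can be exchanged with both.\<close>
  also have "?B = (\<integral>\<^sup>+y. (\<Sum>k. \<integral>\<^sup>+A. (if R (i - int k) (xi (i - int k) A y) = Suc k
      then \<psi> (y, 0) * f (xi (i - int k) A y, k) * w (i - int k) A y else 0) \<partial>count_space (Pt (i - int k))) \<partial>Mb)"
  proof (intro nn_integral_cong)
    fix y assume y: "y \<in> space Mb"
    have "\<psi> (y, 0) * push i f (y, 0) * indicator (H (i + 1) 0) y = \<psi> (y, 0) * push i f (y, 0)"
      using y by (simp add: H_0)
    also have "\<dots> = (\<Sum>k. \<psi> (y, 0) * (\<integral>\<^sup>+A. (if R (i - int k) (xi (i - int k) A y) = Suc k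
      then f (xi (i - int k) A y, k) * w (i - int k) A y else 0) \<partial>count_space (Pt (i - int k))))"
      unfolding push_0 by simp
    also have "\<dots> = (\<Sum>k. \<integral>\<^sup>+A. (if R (i - int k) (xi (i - int k) A y) = Suc k
      then \<psi> (y, 0) * f (xi (i - int k) A y, k) * w (i - int k) A y else 0) \<partial>count_space (Pt (i - int k)))"
      by (subst nn_integral_cmult[symmetric]) (auto intro!: suminf_cong nn_integral_cong simp: mult.assoc)
    finally show "\<psi> (y, 0) * push i f (y, 0) * indicator (H (i + 1) 0) y = \<dots>" .
  qed
  also have "\<dots> = (\<Sum>k. \<integral>\<^sup>+A. (\<integral>\<^sup>+y. (if R (i - int k) (xi (i - int k) A y) = Suc k
      then \<psi> (y, 0) * f (xi (i - int k) A y, k) * w (i - int k) A y else 0) \<partial>Mb) \<partial>count_space (Pt (i - int k)))"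
  proof -
    have m: "(\<lambda>y. if R j (xi j A y) = Suc k then \<psi> (y, 0) * f (xi j A y, k) * w j A y else 0) \<in> borel_measurable Mb"
      if A: "A \<in> Pt j" for k j A
    proof -
      have [measurable]: "xi j A \<in> measurable Mb Mb" "w j A \<in> borel_measurable Mb"
        "R j \<in> measurable Mb (count_space UNIV)" "(\<lambda>x. f (x, k)) \<in> borel_measurable Mb"
        "(\<lambda>x. \<psi> (x, 0)) \<in> borel_measurable Mb"
        using A xi_meas w_meas R_meas fm_level[OF f] fm_level[OF \<psi>] by auto
      show ?thesis by measurable
    qed
    have "(\<integral>\<^sup>+y. (\<Sum>k. \<integral>\<^sup>+A. (if R (i - int k) (xi (i - int k) A y) = Suc k
        then \<psi> (y, 0) * f (xi (i - int k) A y, k) * w (i - int k) A y else 0) \<partial>count_space (Pt (i - int k))) \<partial>Mb) =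
      (\<Sum>k. \<integral>\<^sup>+y. (\<integral>\<^sup>+A. (if R (i - int k) (xi (i - int k) A y) = Suc k
        then \<psi> (y, 0) * f (xi (i - int k) A y, k) * w (i - int k) A y else 0) \<partial>count_space (Pt (i - int k))) \<partial>Mb)"
      by (rule nn_integral_suminf) (intro borel_measurable_nn_integral_count_space Pt_countable m)
    then show ?thesis
      by (simp only: nn_integral_count_space_swap[OF Pt_countable Mb.sigma_finite_measure_axioms m])
  qed
  \<comment> \<open>Substituting x for \<open>xi\<close> of y on one branch absorbs the inverse
    Jacobian and turns y into the image of x under the return map.\<close>
  also have "\<dots> = (\<Sum>k. \<integral>\<^sup>+A. (\<integral>\<^sup>+x. (if R (i - int k) x = Suc k
      then \<psi> (g (i - int k) x, 0) * f (x, k) else 0) * indicator A x \<partial>Mb) \<partial>count_space (Pt (i - int k)))"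
  proof (rule suminf_cong, rule nn_integral_cong)
    fix k A assume "A \<in> space (count_space (Pt (i - int k)))"
    then have A: "A \<in> Pt (i - int k)" by simp
    have [measurable]: "g (i - int k) \<in> measurable Mb Mb"
      "R (i - int k) \<in> measurable Mb (count_space UNIV)" "(\<lambda>x. f (x, k)) \<in> borel_measurable Mb"
      "(\<lambda>x. \<psi> (x, 0)) \<in> borel_measurable Mb"
      using g_meas R_meas fm_level[OF f] fm_level[OF \<psi>] by auto
    have "(\<lambda>x. if R (i - int k) x = Suc k then \<psi> (g (i - int k) x, 0) * f (x, k) else 0) \<in> borel_measurable Mb"
      by measurable
    from change[OF A this]
    show "(\<integral>\<^sup>+y. (if R (i - int k) (xi (i - int k) A y) = Suc k
      then \<psi> (y, 0) * f (xi (i - int k) A y, k) * w (i - int k) A y else 0) \<partial>Mb) =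
      (\<integral>\<^sup>+x. (if R (i - int k) x = Suc k then \<psi> (g (i - int k) x, 0) * f (x, k) else 0) * indicator A x \<partial>Mb)"
      by (simp add: g_xi[OF A] if_distrib[of "\<lambda>x. x * _"] cong: nn_integral_cong if_cong)
  qed
  also have "\<dots> = (\<Sum>k. \<integral>\<^sup>+x. (if R (i - int k) x = Suc k then \<psi> (g (i - int k) x, 0) * f (x, k) else 0) \<partial>Mb)"
  proof (intro suminf_cong)
    fix k
    have [measurable]: "g (i - int k) \<in> measurable Mb Mb"
      "R (i - int k) \<in> measurable Mb (count_space UNIV)" "(\<lambda>x. f (x, k)) \<in> borel_measurable Mb"
      "(\<lambda>x. \<psi> (x, 0)) \<in> borel_measurable Mb"
      using g_meas R_meas fm_level[OF f] fm_level[OF \<psi>] by auto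
    show "(\<integral>\<^sup>+A. (\<integral>\<^sup>+x. (if R (i - int k) x = Suc k
      then \<psi> (g (i - int k) x, 0) * f (x, k) else 0) * indicator A x \<partial>Mb) \<partial>count_space (Pt (i - int k))) =
      (\<integral>\<^sup>+x. (if R (i - int k) x = Suc k then \<psi> (g (i - int k) x, 0) * f (x, k) else 0) \<partial>Mb)"
    proof (subst nn_integral_count_space_swap[symmetric])
      show "sigma_finite_measure Mb" by (rule Mb.sigma_finite_measure_axioms)
      show "(\<lambda>x. (if R (i - int k) x = Suc k then \<psi> (g (i - int k) x, 0) * f (x, k) else 0) * indicator A x)
         \<in> borel_measurable Mb" if "A \<in> Pt (i - int k)" for A
      proof -
        have [measurable]: "A \<in> sets Mb" using that by (rule Pt_sets)
        show ?thesis by measurable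
      qed
    qed (auto intro!: Pt_countable nn_integral_cong nn_integral_count_space_partition[OF Pt_partition])
  qed
  \<comment> \<open>A point of level k either returns to the base or climbs to level k + 1; both
    contributions carry the same index k.\<close>
  also have "\<dots> + ?C = (\<Sum>k. (\<integral>\<^sup>+x. (if R (i - int k) x = Suc k then \<psi> (g (i - int k) x, 0) * f (x, k) else 0) \<partial>Mb) +
      (\<integral>\<^sup>+x. \<psi> (x, Suc k) * f (x, k) * indicator (H (i + 1) (Suc k)) x \<partial>Mb))"
    by (rule suminf_add) auto
  also have "\<dots> = (\<Sum>k. \<integral>\<^sup>+x. \<psi> (Fm i (x, k)) * f (x, k) * indicator (H i k) x \<partial>Mb)"
  proof (intro suminf_cong)
    fix k
    have [measurable]: "g (i - int k) \<in> measurable Mb Mb"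
      "R (i - int k) \<in> measurable Mb (count_space UNIV)" "(\<lambda>x. f (x, k)) \<in> borel_measurable Mb"
      "(\<lambda>x. \<psi> (x, 0)) \<in> borel_measurable Mb" "(\<lambda>x. \<psi> (x, Suc k)) \<in> borel_measurable Mb"
      using g_meas R_meas fm_level[OF f] fm_level[OF \<psi>] by auto
    have "(\<integral>\<^sup>+x. (if R (i - int k) x = Suc k then \<psi> (g (i - int k) x, 0) * f (x, k) else 0) \<partial>Mb) +
      (\<integral>\<^sup>+x. \<psi> (x, Suc k) * f (x, k) * indicator (H (i + 1) (Suc k)) x \<partial>Mb) =
      (\<integral>\<^sup>+x. (if R (i - int k) x = Suc k then \<psi> (g (i - int k) x, 0) * f (x, k) else 0) +
         \<psi> (x, Suc k) * f (x, k) * indicator (H (i + 1) (Suc k)) x \<partial>Mb)"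
      by (rule nn_integral_add[symmetric]) measurable
    also have "\<dots> = (\<integral>\<^sup>+x. \<psi> (Fm i (x, k)) * f (x, k) * indicator (H i k) x \<partial>Mb)"
      by (intro nn_integral_cong) (auto simp: Fm_def H_def indicator_def)
    finally show "(\<integral>\<^sup>+x. (if R (i - int k) x = Suc k then \<psi> (g (i - int k) x, 0) * f (x, k) else 0) \<partial>Mb) +
      (\<integral>\<^sup>+x. \<psi> (x, Suc k) * f (x, k) * indicator (H (i + 1) (Suc k)) x \<partial>Mb) = \<dots>" .
  qed
  also have "\<dots> = (\<integral>\<^sup>+z. \<psi> (Fm i z) * f z \<partial>tw i)"
    by (intro nn_integral_tw[symmetric] borel_measurable_times_ennreal fm_tw[OF f]
        fm_tw[OF measurable_compose[OF Fm_meas_prod \<psi>]])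
  also have "\<dots> = (\<integral>\<^sup>+z. \<phi> (Fm i z) * f z \<partial>tw i)"
    by (intro nn_integral_cong) (simp add: \<psi>_def space_tw Fm_in)
  finally show ?thesis .
qed

lemma fm_push_iter: "fm f \<Longrightarrow> fm (push_iter n i f)"
  by (induction n) (simp_all add: fm_push)

lemma nn_integral_push_iter:
  assumes f: "fm f"
  shows "\<phi> \<in> borel_measurable (tw (i + int n)) \<Longrightarrow>
    (\<integral>\<^sup>+z. \<phi> z * push_iter n i f z \<partial>tw (i + int n)) = (\<integral>\<^sup>+z. \<phi> (Fit n i z) * f z \<partial>tw i)"
proof (induction n arbitrary: \<phi>)
  case (Suc n)
  have e: "i + int (Suc n) = i + int n + 1" by simp
  have \<phi>: "\<phi> \<in> borel_measurable (tw (i + int n + 1))" using Suc.prems unfolding e .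
  have "(\<integral>\<^sup>+z. \<phi> z * push_iter (Suc n) i f z \<partial>tw (i + int (Suc n))) =
     (\<integral>\<^sup>+z. \<phi> (Fm (i + int n) z) * push_iter n i f z \<partial>tw (i + int n))"
    unfolding e push_iter.simps by (rule nn_integral_push[OF fm_push_iter[OF f] \<phi>])
  also have "\<dots> = (\<integral>\<^sup>+z. \<phi> (Fit (Suc n) i z) * f z \<partial>tw i)"
    using Suc.IH[OF measurable_compose[OF Fm_meas \<phi>]] by simp
  finally show ?case .
qed simp

lemma push_iter_add: "push_iter (m + n) i f = push_iter n (i + int m) (push_iter m i f)"
  by (induction n) (simp_all add: add.assoc)

end

lemma exp_minus_one_le:
  fixes t Q :: real
  assumes "0 \<le> t" "t \<le> 1"
  shows "exp (Q * t) - 1 \<le> t * (exp Q - 1)"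
proof -
  have "exp ((1 - t) *\<^sub>R 0 + t *\<^sub>R Q) \<le> (1 - t) * exp 0 + t * exp Q"
    using assms by (intro convex_onD[OF exp_convex]) auto
  then show ?thesis by (simp add: algebra_simps)
qed

text \<open>
  Subtracting a constant \<open>c\<close> costs regularity: by convexity of \<open>exp\<close>, the factor
  \<open>(Q - Q0) / (exp Q - 1)\<close> is what makes the loss from exponent \<open>Q0\<close> to \<open>Q\<close> pay for it uniformly in \<open>t\<close>.
\<close>
lemma exp_sub_ratio:
  fixes t Q0 Q a b c :: real
  assumes t: "0 \<le> t" "t \<le> 1" and Q: "0 \<le> Q0" "Q0 < Q"
    and a: "a \<le> exp (Q0 * t) * b" and c: "c \<le> (Q - Q0) / (exp Q - 1) * b" "0 \<le> b"
  shows "a - c \<le> exp (Q * t) * (b - c)"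
proof -
  have eQ: "exp Q - 1 > 0" using Q by simp
  have conv: "exp (Q * t) - 1 \<le> t * (exp Q - 1)" by (rule exp_minus_one_le[OF t])
  have "exp (Q * t) = exp (Q0 * t) * exp ((Q - Q0) * t)"
    by (simp add: exp_add[symmetric] algebra_simps)
  also have "\<dots> \<ge> exp (Q0 * t) * (1 + (Q - Q0) * t)"
    by (intro mult_left_mono exp_ge_add_one_self) auto
  finally have "exp (Q * t) - exp (Q0 * t) \<ge> exp (Q0 * t) * ((Q - Q0) * t)"
    by (simp add: algebra_simps)
  moreover have "1 * ((Q - Q0) * t) \<le> exp (Q0 * t) * ((Q - Q0) * t)"
    using t Q by (intro mult_right_mono) auto
  ultimately have diff: "(Q - Q0) * t \<le> exp (Q * t) - exp (Q0 * t)" by simp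
  have "c * (exp (Q * t) - 1) \<le> (Q - Q0) / (exp Q - 1) * b * (t * (exp Q - 1))"
  proof (cases "0 \<le> c")
    case True then show ?thesis using c conv Q t eQ by (intro mult_mono) auto
  next
    case False
    have "0 \<le> exp (Q * t) - 1" using Q t by simp
    then have "c * (exp (Q * t) - 1) \<le> 0" using False by (intro mult_nonpos_nonneg) auto
    also have "0 \<le> (Q - Q0) / (exp Q - 1) * b * (t * (exp Q - 1))"
      using c eQ t Q by auto
    finally show ?thesis .
  qed
  also have "\<dots> = ((Q - Q0) * t) * b" using eQ by (simp add: field_simps)
  also have "\<dots> \<le> (exp (Q * t) - exp (Q0 * t)) * b" using diff c by (intro mult_right_mono) auto
  finally show ?thesis using a by (simp add: algebra_simps)
qed

text \<open>Finiteness of b makes every quantity real. If c exceeds a, the left side is 0 by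
  truncated subtraction.\<close>

lemma ennreal_sub_ratio:
  fixes a b :: ennreal
  assumes t: "0 \<le> t" "t \<le> 1" and Q: "0 \<le> Q0" "Q0 < Q"
    and a: "a \<le> ennreal (exp (Q0 * t)) * b" and c: "ennreal c \<le> ennreal ((Q - Q0) / (exp Q - 1)) * b" "0 \<le> c"
    and b: "b < \<top>"
  shows "a - ennreal c \<le> ennreal (exp (Q * t)) * (b - ennreal c)"
proof -
  obtain b' where b': "b = ennreal b'" "0 \<le> b'" using b by (cases b) auto
  have "a < \<top>" using a b by (simp add: ennreal_mult_less_top order.strict_trans1)
  then obtain a' where a': "a = ennreal a'" "0 \<le> a'" by (cases a) auto
  have eQ: "exp Q - 1 > 0" using Q by simp
  have 1: "a' \<le> exp (Q0 * t) * b'"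
    using a b' a' by (simp add: ennreal_mult[symmetric] ennreal_le_iff)
  have "0 \<le> (Q - Q0) / (exp Q - 1)" using Q eQ by simp
  then have 2: "c \<le> (Q - Q0) / (exp Q - 1) * b'"
    using c b' by (simp add: ennreal_mult[symmetric] ennreal_le_iff del: times_divide_eq_left)
  show ?thesis
  proof (cases "c \<le> a'")
    case True
    have 3: "a' - c \<le> exp (Q * t) * (b' - c)" by (rule exp_sub_ratio[OF t Q 1 2 b'(2)])
    \<comment> \<open>This forces c \<le> b', so that the subtraction on the right is not truncated
      either.\<close>
    then have "0 \<le> exp (Q * t) * (b' - c)" using True by simp
    then have "0 \<le> b' - c" by (simp add: zero_le_mult_iff)
    then show ?thesis using 3 True a' b' c
      by (simp add: ennreal_minus ennreal_mult[symmetric] ennreal_le_iff)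
  next
    case False then show ?thesis using a' c by (simp add: ennreal_minus ennreal_eq_0_iff[THEN iffD2])
  qed
qed

section \<open>Log-regular densities under the transfer operator\<close>

context tower_orbit
begin

text \<open>The comparison runs over a whole level and not just over one cell: as \<open>gb\<close>
  is at most 1, the oscillation on a level is at most exp Q, and a density that vanishes at one
  point of a level vanishes on all of it. Separation is measured at fibre i - l because points of a
  column separate as the base points below them do.\<close>

definition log_regular :: "int \<Rightarrow> real \<Rightarrow> ('x \<times> nat \<Rightarrow> ennreal) \<Rightarrow> bool" where
  "log_regular i Q f \<longleftrightarrow> (\<forall>l. \<forall>x\<in>H i l. \<forall>y\<in>H i l.
     f (x, l) \<le> ennreal (exp (Q * gb (i - int l) x y)) * f (y, l))"

definition mass :: "int \<Rightarrow> ('x \<times> nat \<Rightarrow> ennreal) \<Rightarrow> ennreal" where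
  "mass i f = (\<integral>\<^sup>+z. f z \<partial>tw i)"

definition base_mass :: "('x \<times> nat \<Rightarrow> ennreal) \<Rightarrow> ennreal" where
  "base_mass f = (\<integral>\<^sup>+x. f (x, 0) \<partial>Mb)"

definition density_class :: "int \<Rightarrow> real \<Rightarrow> real \<Rightarrow> ('x \<times> nat \<Rightarrow> ennreal) \<Rightarrow> bool" where
  "density_class i Q B f \<longleftrightarrow> fm f \<and> log_regular i Q f \<and> (\<forall>z\<in>Dl i. f z \<le> ennreal B) \<and> mass i f \<le> 1"

definition tail :: "nat \<Rightarrow> int \<Rightarrow> ennreal" where
  "tail L j = (\<Sum>l. emeasure Mb (H j (l + L)))"

lemma regD: "log_regular i Q f \<Longrightarrow> x \<in> H i l \<Longrightarrow> y \<in> H i l \<Longrightarrow>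
    f (x, l) \<le> ennreal (exp (Q * gb (i - int l) x y)) * f (y, l)"
  by (auto simp: log_regular_def)

lemma H_space: "x \<in> H i l \<Longrightarrow> x \<in> space Mb"
  by (simp add: H_def)

text \<open>Preimages in a common branch need one more return to separate, which multiplies the old
  exponent by \<gamma>; the distortion of the inverse Jacobian adds D, through 1 + D s \<le> exp (D
  s). Both effects are the same for all branches and thus survive the summation.\<close>

lemma push_base_log_regular:
  assumes f: "log_regular i Q f" and Q: "0 \<le> Q" and x: "x \<in> space Mb" and y: "y \<in> space Mb"
  shows "push i f (x, 0) \<le> ennreal (exp ((\<gamma> * Q + D) * gb (i + 1) x y)) * push i f (y, 0)"
proof -
  have le: "(if R j (xi j A x) = Suc k then f (xi j A x, k) * w j A x else 0) \<le>
      ennreal (exp ((\<gamma> * Q + D) * gb (i + 1) x y)) *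
      (if R j (xi j A y) = Suc k then f (xi j A y, k) * w j A y else 0)"
    if j: "j = i - int k" and A: "A \<in> Pt j" for j k A
  proof (cases "R j (xi j A x) = Suc k")
    case True
    have xA: "xi j A x \<in> A" "xi j A y \<in> A" using A x y by (auto intro: xi_in)
    have Ry: "R j (xi j A y) = Suc k" using R_const[OF A xA] True by simp
    have jk: "j + int (Suc k) = i + 1" using j by simp
    have gbx: "gb j (xi j A x) (xi j A y) = \<gamma> * gb (i + 1) x y"
      using gb_same[OF A xA] g_xi[OF A x] g_xi[OF A y] unfolding True jk by simp
    have Hx: "xi j A x \<in> H i k" "xi j A y \<in> H i k"
      using True Ry xi_space[OF A] x y by (auto simp: H_def j)
    have 1: "f (xi j A x, k) \<le> ennreal (exp (Q * (\<gamma> * gb (i + 1) x y))) * f (xi j A y, k)"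
      using regD[OF f Hx] gbx unfolding j by simp
    have "w j A x \<le> ennreal (1 + D * gb (i + 1) x y) * w j A y"
      using w_dist[OF A xA(1) x y] unfolding True jk .
    also have "\<dots> \<le> ennreal (exp (D * gb (i + 1) x y)) * w j A y"
      by (intro mult_right_mono ennreal_leI exp_ge_add_one_self) auto
    finally have 2: "w j A x \<le> ennreal (exp (D * gb (i + 1) x y)) * w j A y" .
    have "f (xi j A x, k) * w j A x \<le> (ennreal (exp (Q * (\<gamma> * gb (i + 1) x y))) * f (xi j A y, k)) *
        (ennreal (exp (D * gb (i + 1) x y)) * w j A y)"
      by (intro mult_mono 1 2) auto
    also have "\<dots> = ennreal (exp ((\<gamma> * Q + D) * gb (i + 1) x y)) * (f (xi j A y, k) * w j A y)"
    proof -
      have "ennreal (exp ((\<gamma> * Q + D) * gb (i + 1) x y)) =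
        ennreal (exp (Q * (\<gamma> * gb (i + 1) x y))) * ennreal (exp (D * gb (i + 1) x y))"
        by (simp add: ennreal_mult[symmetric] exp_add[symmetric] algebra_simps)
      then show ?thesis by (simp add: ac_simps)
    qed
    finally show ?thesis using True Ry by simp
  qed simp
  have "push i f (x, 0) \<le> (\<Sum>k. \<integral>\<^sup>+A. ennreal (exp ((\<gamma> * Q + D) * gb (i + 1) x y)) *
      (if R (i - int k) (xi (i - int k) A y) = Suc k
       then f (xi (i - int k) A y, k) * w (i - int k) A y else 0) \<partial>count_space (Pt (i - int k)))"
    unfolding push_0 by (intro suminf_le nn_integral_mono le) auto
  also have "\<dots> = ennreal (exp ((\<gamma> * Q + D) * gb (i + 1) x y)) * push i f (y, 0)"
    unfolding push_0 by (subst nn_integral_cmult) auto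
  finally show ?thesis .
qed

lemma H_Suc: "x \<in> H (i + 1) (Suc k) \<Longrightarrow> x \<in> H i k"
  by (simp add: H_def)

lemma ennreal_exp_mono: "q \<le> q' \<Longrightarrow> 0 \<le> t \<Longrightarrow> ennreal (exp (q * t)) * c \<le> ennreal (exp (q' * t)) * c"
  by (intro mult_right_mono ennreal_leI) (auto intro: mult_right_mono)

lemma log_regular_mono: "log_regular i Q f \<Longrightarrow> Q \<le> Q' \<Longrightarrow> log_regular i Q' f"
  unfolding log_regular_def by (meson ennreal_exp_mono gb_bounds(1) order_trans)

text \<open>Above the base a push only renumbers levels, with the same base points and the same
  \<open>gb\<close>; so it is the base alone that requires \<gamma> Q + D \<le> Q.\<close>

lemma log_regular_push:
  assumes f: "log_regular i Q f" and Q: "0 \<le> Q" "\<gamma> * Q + D \<le> Q"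
  shows "log_regular (i + 1) Q (push i f)"
  unfolding log_regular_def
proof (intro allI ballI)
  fix l x y assume x: "x \<in> H (i + 1) l" and y: "y \<in> H (i + 1) l"
  show "push i f (x, l) \<le> ennreal (exp (Q * gb (i + 1 - int l) x y)) * push i f (y, l)"
  proof (cases l)
    case 0
    have "push i f (x, 0) \<le> ennreal (exp ((\<gamma> * Q + D) * gb (i + 1) x y)) * push i f (y, 0)"
      using x y by (intro push_base_log_regular[OF f Q(1)] H_space) auto
    also have "\<dots> \<le> ennreal (exp (Q * gb (i + 1) x y)) * push i f (y, 0)"
      by (rule ennreal_exp_mono[OF Q(2) gb_bounds(1)])
    finally show ?thesis by (simp add: 0)
  next
    case (Suc k)
    have "i + 1 - int l = i - int k" using Suc by simp
    then show ?thesis using regD[OF f H_Suc H_Suc, of x k y] x y Suc by simp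
  qed
qed

lemma log_regular_push_iter: "log_regular i Q f \<Longrightarrow> 0 \<le> Q \<Longrightarrow> \<gamma> * Q + D \<le> Q \<Longrightarrow> log_regular (i + int n) Q (push_iter n i f)"
proof (induction n)
  case (Suc n)
  have "i + int (Suc n) = i + int n + 1" by simp
  then show ?case using log_regular_push[OF Suc.IH] Suc.prems by (simp only: push_iter.simps)
qed simp

lemma mass_push_iter:
  assumes "fm f" shows "mass (i + int n) (push_iter n i f) = mass i f"
  using nn_integral_push_iter[OF assms, of "\<lambda>_. 1" i n] unfolding mass_def by simp

lemma mass_push:
  assumes "fm f" shows "mass (i + 1) (push i f) = mass i f"
  using mass_push_iter[OF assms, of i 1] by simp

lemma mass_levels: "fm f \<Longrightarrow> mass i f = (\<Sum>l. \<integral>\<^sup>+x. f (x, l) * indicator (H i l) x \<partial>Mb)"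
  unfolding mass_def by (rule nn_integral_tw[OF fm_tw])

lemma base_mass_le_mass:
  assumes "fm f" shows "base_mass f \<le> mass i f"
proof -
  have "base_mass f = (\<integral>\<^sup>+x. f (x, 0) * indicator (H i 0) x \<partial>Mb)"
    unfolding base_mass_def H_0 by (intro nn_integral_cong) simp
  also have "\<dots> \<le> mass i f"
    unfolding mass_levels[OF assms] by (subst suminf_ennreal_split) simp
  finally show ?thesis .
qed

lemma exp_gb_le: "0 \<le> Q \<Longrightarrow> ennreal (exp (Q * gb i x y)) * c \<le> ennreal (exp Q) * c"
  using gb_bounds[of i x y] by (intro mult_right_mono ennreal_leI) (auto simp: mult_left_le)

lemma base_ratio:
  assumes "log_regular i Q f" "0 \<le> Q" "x \<in> space Mb" "y \<in> space Mb"
  shows "f (x, 0) \<le> ennreal (exp Q) * f (y, 0)"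
  using regD[OF assms(1), of x 0 y] exp_gb_le[OF assms(2), of i x y "f (y, 0)"] assms
  by (simp add: H_0)

text \<open>Averaging the oscillation bound over the second point: the base is a probability space,
  so each value there is comparable with the mean.\<close>

lemma base_le_base_mass:
  assumes f: "fm f" "log_regular i Q f" "0 \<le> Q" and x: "x \<in> space Mb"
  shows "f (x, 0) \<le> ennreal (exp Q) * base_mass f"
proof -
  have "f (x, 0) = (\<integral>\<^sup>+y. f (x, 0) \<partial>Mb)" by (simp add: Mb.emeasure_space_1)
  also have "\<dots> \<le> (\<integral>\<^sup>+y. ennreal (exp Q) * f (y, 0) \<partial>Mb)"
    by (intro nn_integral_mono base_ratio[OF f(2,3) x])
  also have "\<dots> = ennreal (exp Q) * base_mass f"
    unfolding base_mass_def by (intro nn_integral_cmult fm_level f)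
  finally show ?thesis .
qed

lemma base_mass_le_base:
  assumes f: "fm f" "log_regular i Q f" "0 \<le> Q" and x: "x \<in> space Mb"
  shows "base_mass f \<le> ennreal (exp Q) * f (x, 0)"
proof -
  have "base_mass f \<le> (\<integral>\<^sup>+y. ennreal (exp Q) * f (x, 0) \<partial>Mb)"
    unfolding base_mass_def by (intro nn_integral_mono base_ratio[OF f(2,3) _ x])
  then show ?thesis by (simp add: Mb.emeasure_space_1)
qed

text \<open>Conservation of mass together with the oscillation bound limits the new base values by
  exp Q, and the values above are old ones. Therefore exp Q \<le> B keeps the bound for ever,
  independently of the fibre.\<close>

lemma density_class_push:
  assumes f: "density_class i Q B f" and Q: "0 \<le> Q" "\<gamma> * Q + D \<le> Q" "exp Q \<le> B"
  shows "density_class (i + 1) Q B (push i f)"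
proof -
  have fm: "fm f" and fr: "log_regular i Q f" and fB: "\<And>z. z \<in> Dl i \<Longrightarrow> f z \<le> ennreal B" and fmass: "mass i f \<le> 1"
    using f by (auto simp: density_class_def)
  have r: "log_regular (i + 1) Q (push i f)" by (rule log_regular_push[OF fr Q(1,2)])
  have "push i f z \<le> ennreal B" if z: "z \<in> Dl (i + 1)" for z
  proof (cases z)
    case (Pair x l)
    show ?thesis
    proof (cases l)
      case 0
      have "push i f (x, 0) \<le> ennreal (exp Q) * base_mass (push i f)"
        using z by (intro base_le_base_mass[OF fm_push[OF fm] r Q(1)]) (auto simp: Pair Dl_def)
      also have "\<dots> \<le> ennreal (exp Q) * 1"
        using base_mass_le_mass[OF fm_push[OF fm], of i "i + 1"] fmass unfolding mass_push[OF fm]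
        by (intro mult_left_mono) auto
      also have "\<dots> \<le> ennreal B" using Q by (simp add: ennreal_leI)
      finally show ?thesis by (simp add: Pair 0)
    next
      case (Suc k)
      then show ?thesis using z fB[of "(x, k)"] H_Suc[of x i k] by (simp add: Pair Dl_H)
    qed
  qed
  with r fm fmass show ?thesis by (simp add: density_class_def fm_push mass_push)
qed

lemma density_class_push_iter:
  assumes f: "density_class i Q B f" and Q: "0 \<le> Q" "\<gamma> * Q + D \<le> Q" "exp Q \<le> B"
  shows "density_class (i + int n) Q B (push_iter n i f)"
proof (induction n)
  case (Suc n)
  have "i + int (Suc n) = i + int n + 1" by simp
  then show ?case using density_class_push[OF Suc Q] by (simp only: push_iter.simps)
qed (use f in simp)

text \<open>Each value on a higher level is an earlier base value, which reduces pointwise estimates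
  on the tower to the base.\<close>

lemma push_iter_level: "push_iter (n + l) i f (x, l) = push_iter n i f (x, 0)"
  by (induction l) simp_all

lemma Fit_climb: "l < R i x \<Longrightarrow> Fit l i (x, 0) = (x, l)"
  by (induction l) (auto simp: Fm_def)

lemma Fit_return: "x \<in> space Mb \<Longrightarrow> Fit (R i x) i (x, 0) = (g i x, 0)"
  using R_pos[of x i] Fit_climb[of "R i x - 1" i x] by (cases "R i x") (auto simp: Fm_def)

section \<open>Coupling and loss of memory\<close>

text \<open>The times k that admit such a constant form an additive semigroup, because the constants
  multiply, and they include the return times in \<open>ts\<close>; the gcd condition makes them
  cofinite. The constant depends on k but neither on the fibre nor on the density, since (P5) is
  uniform over the fibres.\<close>

lemma renewal_lower:
  assumes Q: "0 \<le> Q" "\<gamma> * Q + D \<le> Q"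
  shows "\<exists>k0. \<forall>k\<ge>k0. \<exists>c>0. \<forall>i f. fm f \<longrightarrow> log_regular i Q f \<longrightarrow> ennreal c * base_mass f \<le> base_mass (push_iter k i f)"
proof -
  define S where "S = {k. \<exists>c>0. \<forall>i f. fm f \<longrightarrow> log_regular i Q f \<longrightarrow> ennreal c * base_mass f \<le> base_mass (push_iter k i f)}"
  have "\<exists>k0. \<forall>k\<ge>k0. k \<in> S"
  proof (rule nat_semigroup_cofinite)
    show "0 \<in> S" unfolding S_def by (auto intro!: exI[of _ 1])
    show "a + b \<in> S" if "a \<in> S" "b \<in> S" for a b
    proof -
      obtain c where c: "c > 0" "\<And>i f. fm f \<Longrightarrow> log_regular i Q f \<Longrightarrow> ennreal c * base_mass f \<le> base_mass (push_iter a i f)"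
        using \<open>a \<in> S\<close> unfolding S_def by auto
      obtain d where d: "d > 0" "\<And>i f. fm f \<Longrightarrow> log_regular i Q f \<Longrightarrow> ennreal d * base_mass f \<le> base_mass (push_iter b i f)"
        using \<open>b \<in> S\<close> unfolding S_def by auto
      have "ennreal (d * c) * base_mass f \<le> base_mass (push_iter (a + b) i f)" if f: "fm f" "log_regular i Q f" for i f
      proof -
        have "ennreal (d * c) * base_mass f = ennreal d * (ennreal c * base_mass f)"
          using c d by (simp add: ennreal_mult mult.assoc)
        also have "\<dots> \<le> ennreal d * base_mass (push_iter a i f)" by (intro mult_left_mono c f) auto
        also have "\<dots> \<le> base_mass (push_iter b (i + int a) (push_iter a i f))"
          by (intro d fm_push_iter f log_regular_push_iter Q)
        finally show ?thesis by (simp add: push_iter_add)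
      qed
      then show ?thesis unfolding S_def using c d by (auto intro!: exI[of _ "d * c"])
    qed
    show "Gcd ts = 1" by (rule ts_gcd)
    show "ts \<subseteq> S"
    proof
      fix t assume "t \<in> ts"
      then obtain e where e: "e > 0" "\<And>i. ennreal e \<le> emeasure Mb {x \<in> space Mb. R i x = t}"
        using ts_mass by blast
      \<comment> \<open>On the base f is at least exp (- Q) times its base mass, and the points
        returning at time t have measure at least e.\<close>
      have "ennreal (e * exp (- Q)) * base_mass f \<le> base_mass (push_iter t i f)" if f: "fm f" "log_regular i Q f" for i f
      proof -
        define E where "E = {x \<in> space Mb. R i x = t}"
        have [measurable]: "R i \<in> measurable Mb (count_space UNIV)" by (rule R_meas)
        have E [measurable]: "E \<in> sets Mb" unfolding E_def by measurable
        have fb [measurable]: "(\<lambda>x. f (x, 0)) \<in> borel_measurable Mb" by (rule fm_level[OF f(1)])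
        have low: "ennreal (exp (- Q)) * base_mass f \<le> f (x, 0)" if x: "x \<in> space Mb" for x
        proof -
          have "ennreal (exp (- Q)) * base_mass f \<le> ennreal (exp (- Q)) * (ennreal (exp Q) * f (x, 0))"
            by (intro mult_left_mono base_mass_le_base[OF f Q(1) x]) auto
          also have "\<dots> = f (x, 0)"
            by (simp add: mult.assoc[symmetric] ennreal_mult[symmetric] exp_minus)
          finally show ?thesis .
        qed
        have ind: "indicator (space Mb \<times> {0}) \<in> borel_measurable (tw j)" for j
          by (intro fm_tw borel_measurable_indicator) auto
        have "ennreal (e * exp (- Q)) * base_mass f = (ennreal (exp (- Q)) * base_mass f) * ennreal e"
          using e by (simp add: ennreal_mult ac_simps)
        also have "\<dots> \<le> (ennreal (exp (- Q)) * base_mass f) * emeasure Mb E"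
          unfolding E_def by (intro mult_left_mono e) auto
        also have "\<dots> = (\<integral>\<^sup>+x. (ennreal (exp (- Q)) * base_mass f) * indicator E x \<partial>Mb)"
          by (simp add: nn_integral_cmult_indicator)
        \<comment> \<open>At time t the points of \<open>E\<close> are back on level 0. With the
          indicator of level 0 as test function, duality turns this into a bound for the new base
          mass.\<close>
        also have "\<dots> \<le> (\<integral>\<^sup>+x. indicator (space Mb \<times> {0}) (Fit t i (x, 0)) * f (x, 0) * indicator (H i 0) x \<partial>Mb)"
          by (intro nn_integral_mono)
            (use low in \<open>auto simp: indicator_def E_def H_0 Fit_return g_space\<close>)
        also have "\<dots> \<le> (\<Sum>l. \<integral>\<^sup>+x. indicator (space Mb \<times> {0}) (Fit t i (x, l)) * f (x, l) * indicator (H i l) x \<partial>Mb)"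
          by (subst suminf_ennreal_split) simp
        also have "\<dots> = (\<integral>\<^sup>+z. indicator (space Mb \<times> {0}) (Fit t i z) * f z \<partial>tw i)"
          by (intro nn_integral_tw[symmetric] borel_measurable_times_ennreal fm_tw f
              measurable_compose[OF Fit_meas ind])
        also have "\<dots> = (\<integral>\<^sup>+z. indicator (space Mb \<times> {0}) z * push_iter t i f z \<partial>tw (i + int t))"
          by (rule nn_integral_push_iter[OF f(1) ind, symmetric])
        also have "\<dots> = (\<Sum>l. \<integral>\<^sup>+x. indicator (space Mb \<times> {0}) (x, l) * push_iter t i f (x, l) * indicator (H (i + int t) l) x \<partial>Mb)"
          by (intro nn_integral_tw borel_measurable_times_ennreal fm_tw[OF fm_push_iter[OF f(1)]] ind)
        also have "\<dots> = base_mass (push_iter t i f)"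
          by (subst suminf_ennreal_split)
            (auto simp: base_mass_def H_0 indicator_def intro!: nn_integral_cong)
        finally show ?thesis .
      qed
      then show "t \<in> S" unfolding S_def using e(1) by (auto intro!: exI[of _ "e * exp (- Q)"])
    qed
  qed
  then show ?thesis unfolding S_def by simp
qed

text \<open>At a time N with small tail at most r / 2 of the mass lies on the levels from L on,
  where the density is at most B; as the mass is at least r, half of it lies below L. That half was
  on the base at one of the times N - l with l < L, and from there \<open>renewal_lower\<close>
  brings a fixed fraction to the base at the common time N + k0.\<close>

lemma block_lower:
  assumes Q: "0 \<le> Q" "\<gamma> * Q + D \<le> Q" "exp Q \<le> B" and r: "0 < r"
  shows "\<exists>k0 \<beta>. 1 \<le> k0 \<and> 0 < \<beta> \<and> \<beta> \<le> 1 \<and> (\<forall>i f N. density_class i Q B f \<longrightarrow> ennreal r \<le> mass i f \<longrightarrow> L \<le> N \<longrightarrow>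
      tail L (i + int N) \<le> ennreal (r / (2 * B)) \<longrightarrow> ennreal \<beta> * mass i f \<le> base_mass (push_iter (N + k0) i f))"
proof -
  obtain k1 where k1: "\<And>k. k \<ge> k1 \<Longrightarrow> \<exists>c>0. \<forall>i f. fm f \<longrightarrow> log_regular i Q f \<longrightarrow> ennreal c * base_mass f \<le> base_mass (push_iter k i f)"
    using renewal_lower[OF Q(1,2)] by auto
  \<comment> \<open>The successor makes k0 positive, so that the density at time N + k0 is the
    result of a push.\<close>
  define k0 where "k0 = Suc k1"
  have "\<forall>k. \<exists>c. k \<ge> k0 \<longrightarrow> c > 0 \<and> (\<forall>i f. fm f \<longrightarrow> log_regular i Q f \<longrightarrow> ennreal c * base_mass f \<le> base_mass (push_iter k i f))"
    using k1 unfolding k0_def by (meson Suc_leD)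
  then obtain cc where cc: "\<And>k. k \<ge> k0 \<Longrightarrow> cc k > 0"
    "\<And>k i f. k \<ge> k0 \<Longrightarrow> fm f \<Longrightarrow> log_regular i Q f \<Longrightarrow> ennreal (cc k) * base_mass f \<le> base_mass (push_iter k i f)"
    by metis
  \<comment> \<open>A constant valid for all durations that occur below; the inserted 1 also gives c
    \<le> 1.\<close>
  define c where "c = Min (insert 1 (cc ` {k0..k0 + L}))"
  have c: "0 < c" "c \<le> 1" unfolding c_def using cc by auto
  have c_le: "c \<le> cc (k0 + l)" if "l < L" for l
    unfolding c_def using that by (intro Min_le) auto
  \<comment> \<open>The factor 2 accounts for the half of the mass on high levels,
    \<open>L + 1\<close> for summing over L levels while staying positive when L = 0.\<close>
  define \<beta> where "\<beta> = c / (2 * (real L + 1))"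
  have \<beta>: "0 < \<beta>" "\<beta> \<le> 1" using c unfolding \<beta>_def by (auto simp: field_simps)
  have B: "0 < B" using Q(3) by (meson exp_gt_zero less_le_trans)
  have "ennreal \<beta> * mass i f \<le> base_mass (push_iter (N + k0) i f)"
    if f: "density_class i Q B f" and mf: "ennreal r \<le> mass i f" and N: "L \<le> N"
      and tl: "tail L (i + int N) \<le> ennreal (r / (2 * B))" for i f N
  proof -
    have fm: "fm f" and fr: "log_regular i Q f" and m1: "mass i f \<le> 1" using f by (auto simp: density_class_def)
    define j where "j = i + int N"
    define F where "F = push_iter N i f"
    have F: "density_class j Q B F" unfolding j_def F_def by (rule density_class_push_iter[OF f Q])
    then have FB: "\<And>z. z \<in> Dl j \<Longrightarrow> F z \<le> ennreal B" and Fm: "fm F" by (auto simp: density_class_def)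
    have mF: "mass j F = mass i f" unfolding j_def F_def by (rule mass_push_iter[OF fm])
    define a where "a l = (\<integral>\<^sup>+x. F (x, l) * indicator (H j l) x \<partial>Mb)" for l
    have "mass i f = (\<Sum>l. a l)" unfolding mF[symmetric] mass_levels[OF Fm] a_def ..
    also have "\<dots> = (\<Sum>l. a (l + L)) + (\<Sum>l<L. a l)" by (rule suminf_offset) auto
    also have "(\<Sum>l. a (l + L)) \<le> (\<Sum>l. ennreal B * emeasure Mb (H j (l + L)))"
    proof (intro suminf_le)
      fix l
      have "a (l + L) \<le> (\<integral>\<^sup>+x. ennreal B * indicator (H j (l + L)) x \<partial>Mb)"
        unfolding a_def using FB by (intro nn_integral_mono) (auto simp: indicator_def Dl_H)
      then show "a (l + L) \<le> ennreal B * emeasure Mb (H j (l + L))"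
        by (simp add: nn_integral_cmult_indicator)
    qed auto
    also have "\<dots> = ennreal B * tail L j" by (simp add: tail_def)
    also have "\<dots> \<le> ennreal B * ennreal (r / (2 * B))" using tl unfolding j_def by (intro mult_left_mono) auto
    also have "\<dots> = ennreal (r / 2)" using B r by (simp add: ennreal_mult[symmetric])
    finally have 1: "mass i f \<le> ennreal (r / 2) + (\<Sum>l<L. a l)" by simp
    \<comment> \<open>Mass on level l at time N was on the base at time N - l; from there it takes
      k0 + l steps to reach time N + k0.\<close>
    have 2: "ennreal c * a l \<le> base_mass (push_iter (N + k0) i f)" if l: "l < L" for l
    proof -
      have "a l \<le> (\<integral>\<^sup>+x. push_iter (N - l) i f (x, 0) \<partial>Mb)"
        unfolding a_def F_def using push_iter_level[of "N - l" l i f] l N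
        by (intro nn_integral_mono) (auto simp: indicator_def)
      then have "a l \<le> base_mass (push_iter (N - l) i f)" by (simp add: base_mass_def)
      then have "ennreal c * a l \<le> ennreal (cc (k0 + l)) * base_mass (push_iter (N - l) i f)"
        using c_le[OF l] by (intro mult_mono ennreal_leI) auto
      also have "\<dots> \<le> base_mass (push_iter (k0 + l) (i + int (N - l)) (push_iter (N - l) i f))"
        by (intro cc fm_push_iter fm log_regular_push_iter fr Q) simp
      also have "push_iter (k0 + l) (i + int (N - l)) (push_iter (N - l) i f) = push_iter (N + k0) i f"
        using push_iter_add[of "N - l" "k0 + l" i f] l N by simp
      finally show ?thesis .
    qed
    have 3: "ennreal c * (\<Sum>l<L. a l) \<le> of_nat L * base_mass (push_iter (N + k0) i f)"
      unfolding sum_distrib_left using sum_bounded_above[of "{..<L}", OF 2] by simp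
    obtain s where s: "(\<Sum>l<L. a l) = ennreal s" "0 \<le> s"
    proof -
      have "(\<Sum>l<L. a l) \<le> mass i f"
        unfolding mF[symmetric] mass_levels[OF Fm] a_def by (rule sum_le_suminf) auto
      also have "\<dots> < \<top>" using m1 by (simp add: order.strict_trans1)
      finally show ?thesis using that by (cases "\<Sum>l<L. a l") auto
    qed
    obtain b where b: "base_mass (push_iter (N + k0) i f) = ennreal b" "0 \<le> b"
    proof -
      have "base_mass (push_iter (N + k0) i f) \<le> mass i f"
        using base_mass_le_mass[OF fm_push_iter[OF fm], of "N + k0" i "i + int (N + k0)"] unfolding mass_push_iter[OF fm] .
      also have "\<dots> < \<top>" using m1 by (simp add: order.strict_trans1)
      finally show ?thesis using that by (cases "base_mass (push_iter (N + k0) i f)") auto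
    qed
    obtain m where m: "mass i f = ennreal m" "0 \<le> m" using m1 by (cases "mass i f") (auto simp: top_unique)
    have "r \<le> m" using mf m r by (simp add: ennreal_le_iff)
    have "m \<le> r / 2 + s" using 1 m s r by (simp add: ennreal_plus[symmetric] ennreal_le_iff del: ennreal_plus)
    with \<open>r \<le> m\<close> have "m / 2 \<le> s" by simp
    have "c * s \<le> real L * b"
      using 3 s b c by (simp add: ennreal_mult[symmetric] ennreal_of_nat_eq_real_of_nat ennreal_le_iff)
    also have "\<dots> \<le> (real L + 1) * b" using b by (intro mult_right_mono) auto
    finally have "c * s \<le> (real L + 1) * b" .
    moreover have "c * (m / 2) \<le> c * s" using \<open>m / 2 \<le> s\<close> c by (intro mult_left_mono) auto
    ultimately have "c * (m / 2) \<le> (real L + 1) * b" by linarith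
    then have "\<beta> * m \<le> b" unfolding \<beta>_def by (simp add: field_simps)
    then show ?thesis using m b \<beta> by (simp add: ennreal_mult[symmetric] ennreal_le_iff)
  qed
  then show ?thesis using \<beta> by (intro exI[of _ k0] exI[of _ \<beta>]) (auto simp: k0_def)
qed

lemma push_cong:
  assumes "\<And>z. z \<in> Dl i \<Longrightarrow> f z = f' z" and z: "z \<in> Dl (i + 1)"
  shows "push i f z = push i f' z"
proof (cases z)
  case (Pair y l)
  show ?thesis
  proof (cases l)
    case 0
    have y: "y \<in> space Mb" using z by (simp add: Pair Dl_def)
    have "f (xi (i - int k) A y, k) = f' (xi (i - int k) A y, k)"
      if "R (i - int k) (xi (i - int k) A y) = Suc k" "A \<in> Pt (i - int k)" for k A
      using that xi_space[OF that(2) y] by (intro assms(1)) (simp add: Dl_def)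
    then show ?thesis unfolding Pair 0 push_0
      by (intro suminf_cong nn_integral_cong) auto
  next
    case (Suc k)
    then show ?thesis using assms(1)[of "(y, k)"] z H_Suc[of y i k] by (simp add: Pair Dl_H)
  qed
qed

lemma push_iter_cong:
  assumes "\<And>z. z \<in> Dl i \<Longrightarrow> f z = f' z"
  shows "z \<in> Dl (i + int n) \<Longrightarrow> push_iter n i f z = push_iter n i f' z"
proof (induction n arbitrary: z)
  case (Suc n)
  have "i + int (Suc n) = i + int n + 1" by simp
  with Suc.prems have "z \<in> Dl (i + int n + 1)" by (simp only:)
  then show ?case using push_cong[OF Suc.IH] by simp
qed (use assms in simp)

lemma push_add:
  "push i (\<lambda>z. f z + f' z) z = push i f z + push i f' z"
proof (cases z)
  case (Pair y l)
  show ?thesis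
  proof (cases l)
    case 0
    let ?t = "\<lambda>f k A. (if R (i - int k) (xi (i - int k) A y) = Suc k
       then f (xi (i - int k) A y, k) * w (i - int k) A y else 0)"
    have "push i f (y, 0) + push i f' (y, 0) =
        (\<Sum>k. (\<integral>\<^sup>+A. ?t f k A \<partial>count_space (Pt (i - int k))) + (\<integral>\<^sup>+A. ?t f' k A \<partial>count_space (Pt (i - int k))))"
      unfolding push_0 by (intro suminf_add) auto
    also have "\<dots> = (\<Sum>k. \<integral>\<^sup>+A. ?t f k A + ?t f' k A \<partial>count_space (Pt (i - int k)))"
      by (intro suminf_cong nn_integral_add[symmetric]) auto
    also have "\<dots> = push i (\<lambda>z. f z + f' z) (y, 0)"
      unfolding push_0 by (intro suminf_cong nn_integral_cong) (auto simp: distrib_right)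
    finally show ?thesis by (simp add: Pair 0)
  qed (simp add: Pair)
qed

lemma push_iter_plus: "push_iter n i (\<lambda>z. f z + f' z) = (\<lambda>z. push_iter n i f z + push_iter n i f' z)"
proof (induction n)
  case (Suc n)
  show ?case unfolding push_iter.simps Suc by (rule ext) (rule push_add)
qed simp

text \<open>\<open>F\<close> and \<open>G\<close> agree up to an unmatched part of mass at most \<open>e\<close>; the matched part \<open>p\<close> need not be log-regular.\<close>
definition near :: "int \<Rightarrow> real \<Rightarrow> real \<Rightarrow> ennreal \<Rightarrow> ('x \<times> nat \<Rightarrow> ennreal) \<Rightarrow> ('x \<times> nat \<Rightarrow> ennreal) \<Rightarrow> bool" where
  "near i Q B e F G \<longleftrightarrow> (\<exists>p f f'. fm p \<and> density_class i Q B f \<and> density_class i Q B f' \<and> mass i f = mass i f' \<and> mass i f \<le> e \<and>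
     (\<forall>z\<in>Dl i. F z = p z + f z \<and> G z = p z + f' z))"

lemma near_trivial:
  "density_class i Q B f \<Longrightarrow> density_class i Q B f' \<Longrightarrow> mass i f = mass i f' \<Longrightarrow> mass i f \<le> e \<Longrightarrow> near i Q B e f f'"
  unfolding near_def by (intro exI[of _ "\<lambda>_. 0"] exI[of _ f] exI[of _ f']) auto

lemma near_mono: "near i Q B e F G \<Longrightarrow> e \<le> e' \<Longrightarrow> near i Q B e' F G"
  unfolding near_def by (meson order_trans)

lemma near_sym: "near i Q B e F G \<Longrightarrow> near i Q B e G F"
  unfolding near_def by metis

text \<open>Right after a push the base has the smaller exponent Q0, and this slack pays for the
  subtraction. The other levels have no slack and are left alone.\<close>

lemma subtract_constant:
  assumes F: "density_class j Q B F" and Q: "0 \<le> Q0" "Q0 < Q"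
    and base: "\<And>x y. x \<in> space Mb \<Longrightarrow> y \<in> space Mb \<Longrightarrow> F (x, 0) \<le> ennreal (exp (Q0 * gb j x y)) * F (y, 0)"
    and c: "0 \<le> c" "\<And>y. y \<in> space Mb \<Longrightarrow> ennreal c \<le> ennreal ((Q - Q0) / (exp Q - 1)) * F (y, 0)"
  defines "F' \<equiv> (\<lambda>(x, l). if l = 0 then F (x, 0) - ennreal c else F (x, l))"
  shows "density_class j Q B F'" "mass j F = ennreal c + mass j F'"
    "\<And>z. z \<in> Dl j \<Longrightarrow> F z = (if snd z = 0 then ennreal c else 0) + F' z"
proof -
  have fm: "fm F" and fr: "log_regular j Q F" and FB: "\<And>z. z \<in> Dl j \<Longrightarrow> F z \<le> ennreal B" and m1: "mass j F \<le> 1"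
    using F by (auto simp: density_class_def)
  \<comment> \<open>The removable fraction is at most 1, so c never exceeds the base density and the
    subtraction is exact.\<close>
  have "Q \<le> exp Q - 1" using exp_ge_add_one_self[of Q] by linarith
  then have kap: "(Q - Q0) / (exp Q - 1) \<le> 1" using Q by (simp add: divide_le_eq)
  have cF: "ennreal c \<le> F (y, 0)" if "y \<in> space Mb" for y
  proof -
    have "ennreal ((Q - Q0) / (exp Q - 1)) * F (y, 0) \<le> 1 * F (y, 0)"
      using kap by (intro mult_right_mono) auto
    then show ?thesis using c(2)[OF that] by simp
  qed
  have fin: "F z < \<top>" if "z \<in> Dl j" for z using FB[OF that] by (simp add: order.strict_trans1)
  have fm': "fm F'" unfolding fm_iff
  proof
    fix l show "(\<lambda>x. F' (x, l)) \<in> borel_measurable Mb"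
      using fm_level[OF fm, of 0] fm_level[OF fm, of l] by (cases "l = 0") (auto simp: F'_def)
  qed
  show dec: "\<And>z. z \<in> Dl j \<Longrightarrow> F z = (if snd z = 0 then ennreal c else 0) + F' z"
    using cF by (auto simp: F'_def Dl_def add_diff_inverse_ennreal)
  have F'_le: "F' z \<le> F z" for z by (cases z) (auto simp: F'_def diff_le_self_ennreal)
  have "log_regular j Q F'" unfolding log_regular_def
  proof (intro allI ballI)
    fix l x y assume x: "x \<in> H j l" and y: "y \<in> H j l"
    show "F' (x, l) \<le> ennreal (exp (Q * gb (j - int l) x y)) * F' (y, l)"
    proof (cases l)
      case 0
      have xs: "x \<in> space Mb" "y \<in> space Mb" using x y by (auto dest: H_space)
      have "(y, 0) \<in> Dl j" using y by (simp add: 0 Dl_H)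
      then show ?thesis
        using ennreal_sub_ratio[OF gb_bounds[of j x y] Q base[OF xs] c(2)[OF xs(2)] c(1) fin] by (simp add: 0 F'_def)
    next
      case (Suc k) then show ?thesis using regD[OF fr x y] by (simp add: F'_def)
    qed
  qed
  moreover have "mass j F' \<le> mass j F" unfolding mass_def by (intro nn_integral_mono F'_le)
  ultimately show "density_class j Q B F'"
    using fm' m1 FB F'_le unfolding density_class_def by (meson order_trans)
  have ind: "(\<lambda>z. ennreal c * indicator (space Mb \<times> {0}) z) \<in> borel_measurable (tw j)"
    by (intro fm_tw borel_measurable_times_ennreal borel_measurable_indicator) auto
  have "mass j F = (\<integral>\<^sup>+z. ennreal c * indicator (space Mb \<times> {0}) z + F' z \<partial>tw j)"
    unfolding mass_def using dec
    by (intro nn_integral_cong) (auto simp: space_tw Dl_def indicator_def)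
  also have "\<dots> = (\<integral>\<^sup>+z. ennreal c * indicator (space Mb \<times> {0}) z \<partial>tw j) + mass j F'"
    unfolding mass_def by (intro nn_integral_add ind fm_tw fm')
  also have "(\<integral>\<^sup>+z. ennreal c * indicator (space Mb \<times> {0}) z \<partial>tw j) =
      (\<Sum>l. \<integral>\<^sup>+x. ennreal c * indicator (space Mb \<times> {0}) (x, l) * indicator (H j l) x \<partial>Mb)"
    by (rule nn_integral_tw[OF ind])
  also have "\<dots> = (\<integral>\<^sup>+x. ennreal c * indicator (space Mb) x \<partial>Mb)"
    by (subst suminf_ennreal_split) (auto simp: H_0 indicator_def intro!: nn_integral_cong)
  also have "\<dots> = ennreal c" by (simp add: nn_integral_cmult_indicator Mb.emeasure_space_1)
  finally show "mass j F = ennreal c + mass j F'" .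
qed

text \<open>Induction on the number k of coupling steps. A step waits for a usable good time, lets
  mass reach the base, removes the same constant from both densities there and continues with the
  remainders, whose mass has shrunk by the factor \<theta>. Good times enter only through their
  number, so the gaps between them do not matter.\<close>

lemma contract:
  assumes Q: "0 \<le> Q" "\<gamma> * Q + D < Q" "exp Q \<le> B" and r: "0 < r"
  shows "\<exists>v \<theta>. 1 \<le> v \<and> 0 \<le> \<theta> \<and> \<theta> < 1 \<and> (\<forall>k i n f g. density_class i Q B f \<longrightarrow> density_class i Q B g \<longrightarrow> mass i f = mass i g \<longrightarrow>
     k * v \<le> card {N. N \<le> n \<and> tail L (i + int N) \<le> ennreal (r / (2 * B))} \<longrightarrow>
     near (i + int n) Q B (max (ennreal r) (ennreal (\<theta> ^ k) * mass i f)) (push_iter n i f) (push_iter n i g))"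
proof -
  have Q': "\<gamma> * Q + D \<le> Q" using Q by simp
  obtain k0 \<beta> where k0: "1 \<le> k0" and \<beta>: "0 < \<beta>" "\<beta> \<le> 1" and block:
    "\<And>i f N. density_class i Q B f \<Longrightarrow> ennreal r \<le> mass i f \<Longrightarrow> L \<le> N \<Longrightarrow>
      tail L (i + int N) \<le> ennreal (r / (2 * B)) \<Longrightarrow> ennreal \<beta> * mass i f \<le> base_mass (push_iter (N + k0) i f)"
    using block_lower[OF Q(1) Q' Q(3) r, of L] by metis
  \<comment> \<open>The good times consumed by one step: up to L come too early for
    \<open>block_lower\<close>, up to k0 lie between the chosen time N and N + k0, and one more
    guarantees that the step ends no later than n.\<close>
  define v where "v = L + k0 + 1"
  define Q0 where "Q0 = \<gamma> * Q + D"
  have Q0: "0 \<le> Q0" "Q0 < Q" using Q gamma D_pos unfolding Q0_def by auto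
  define \<kappa> where "\<kappa> = (Q - Q0) / (exp Q - 1)"
  have eQ: "exp Q - 1 > 0" using Q0 by simp
  have \<kappa>: "0 < \<kappa>" "\<kappa> \<le> 1"
  proof -
    show "0 < \<kappa>" unfolding \<kappa>_def using Q0 eQ by simp
    have "Q \<le> exp Q - 1" using exp_ge_add_one_self[of Q] by linarith
    then show "\<kappa> \<le> 1" using Q0 eQ unfolding \<kappa>_def by (simp add: divide_le_eq)
  qed
  \<comment> \<open>The matched fraction of the mass: \<beta> reaches the base, exp (- Q) leads from
    the mean to the minimum there, and \<kappa> is the share of the minimum that can be
    removed.\<close>
  define \<theta> where "\<theta> = 1 - \<kappa> * exp (- Q) * \<beta>"
  have \<theta>1: "\<kappa> * exp (- Q) * \<beta> \<le> 1" using \<kappa> \<beta> Q by (intro mult_le_one) auto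
  have \<theta>: "0 \<le> \<theta>" "\<theta> < 1" using \<theta>1 \<kappa> \<beta> unfolding \<theta>_def by auto
  have main: "near (i + int n) Q B (max (ennreal r) (ennreal (\<theta> ^ k) * mass i f)) (push_iter n i f) (push_iter n i g)"
    if "density_class i Q B f" "density_class i Q B g" "mass i f = mass i g"
      "k * v \<le> card {N. N \<le> n \<and> tail L (i + int N) \<le> ennreal (r / (2 * B))}" for k i n f g
    using that
  proof (induction k arbitrary: i n f g)
    case 0
    have "fm f" "fm g" using 0 by (auto simp: density_class_def)
    with 0 show ?case
      by (intro near_trivial density_class_push_iter Q Q') (auto simp: mass_push_iter)
  next
    case (Suc k)
    have fm: "fm f" "fm g" and m1: "mass i f \<le> 1" using Suc.prems by (auto simp: density_class_def)
    show ?case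
    proof (cases "mass i f \<le> ennreal r")
      case True
      with Suc.prems fm show ?thesis
        by (intro near_trivial density_class_push_iter Q Q') (auto simp: mass_push_iter le_max_iff_disj)
    next
      case False
      then have mr: "ennreal r \<le> mass i f" by simp
      obtain \<rho> where \<rho>: "mass i f = ennreal \<rho>" "0 \<le> \<rho>" using m1 by (cases "mass i f") (auto simp: top_unique)
      define S where "S = {N. N \<le> n \<and> tail L (i + int N) \<le> ennreal (r / (2 * B))}"
      have finS: "finite S" unfolding S_def by (rule finite_subset[of _ "{..n}"]) auto
      have cardS: "Suc k * v \<le> card S" using Suc.prems(4) unfolding S_def .
      have "\<not> S \<subseteq> {..<L}"
      proof
        assume "S \<subseteq> {..<L}"
        then have "card S \<le> L" using card_mono[of "{..<L}" S] by simp
        then show False using cardS unfolding v_def by simp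
      qed
      then have ne: "{N\<in>S. L \<le> N} \<noteq> {}" by auto
      define N where "N = Min {N\<in>S. L \<le> N}"
      have N: "N \<in> S" "L \<le> N" "\<And>N'. N' \<in> S \<Longrightarrow> L \<le> N' \<Longrightarrow> N \<le> N'"
        unfolding N_def using Min_in[OF _ ne] finS by auto
      define t where "t = N + k0"
      define S' where "S' = {N. N \<le> n - t \<and> tail L (i + int t + int N) \<le> ennreal (r / (2 * B))}"
      have finS': "finite S'" unfolding S'_def by (rule finite_subset[of _ "{..n - t}"]) auto
      \<comment> \<open>By minimality of N there is no good time from L up to N. The good times from
        t on are those of the remaining run, counted from t.\<close>
      have sub: "S \<subseteq> {..<L} \<union> {N..<t} \<union> (\<lambda>m. t + m) ` S'"
      proof
        fix s assume s: "s \<in> S"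
        show "s \<in> {..<L} \<union> {N..<t} \<union> (\<lambda>m. t + m) ` S'"
        proof (cases "t \<le> s")
          case True
          then have "i + int t + int (s - t) = i + int s" by simp
          then have "s - t \<in> S'" using s True unfolding S_def S'_def by (simp add: diff_le_mono)
          then show ?thesis using True by (intro UnI2 image_eqI[of _ _ "s - t"]) auto
        qed (use s N(3)[of s] in force)
      qed
      have "card S \<le> card ({..<L} \<union> {N..<t} \<union> (\<lambda>m. t + m) ` S')"
        by (intro card_mono sub) (use finS' in auto)
      also have "\<dots> \<le> card {..<L} + card {N..<t} + card ((\<lambda>m. t + m) ` S')"
        by (intro order_trans[OF card_Un_le] add_mono card_Un_le order_refl)
      also have "\<dots> \<le> L + k0 + card S'"
        using card_image_le[OF finS'] unfolding t_def by simp
      finally have "Suc k * v \<le> L + k0 + card S'" using cardS by simp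
      then have cS': "k * v \<le> card S'" "1 \<le> card S'" unfolding v_def by simp_all
      have tn: "t \<le> n"
      proof (rule ccontr)
        assume "\<not> t \<le> n"
        then have "S \<subseteq> {..<L} \<union> {N..<t}"
          using N(3) unfolding S_def by (force simp: not_le not_less)
        then have "card S \<le> L + k0"
          using card_mono[of "{..<L} \<union> {N..<t}" S] card_Un_le[of "{..<L}" "{N..<t}"] unfolding t_def by simp
        then show False using cardS unfolding v_def by simp
      qed
      define j where "j = i + int t"
      define c where "c = \<kappa> * exp (- Q) * \<beta> * \<rho>"
      have c0: "0 \<le> c" unfolding c_def using \<kappa> \<beta> \<rho> by simp
      define sb where "sb F = (\<lambda>(x :: 'x, l :: nat). if l = 0 then F (x, 0 :: nat) - ennreal c else F (x, l) :: ennreal)" for F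
      have step: "density_class j Q B (sb (push_iter t i f)) \<and> mass i f = ennreal c + mass j (sb (push_iter t i f)) \<and>
        (\<forall>z\<in>Dl j. push_iter t i f z = (if snd z = 0 then ennreal c else 0) + sb (push_iter t i f) z)"
        if f: "density_class i Q B f" "mass i f = ennreal \<rho>" for f
      proof -
        have fm: "fm f" "log_regular i Q f" using f by (auto simp: density_class_def)
        have lt: "density_class j Q B (push_iter t i f)" unfolding j_def by (rule density_class_push_iter[OF f(1) Q(1) Q' Q(3)])
        have base: "push_iter t i f (x, 0) \<le> ennreal (exp (Q0 * gb j x y)) * push_iter t i f (y, 0)"
          if "x \<in> space Mb" "y \<in> space Mb" for x y
        proof -
          \<comment> \<open>As k0 is positive, time t ends with a push, after which the base has
            exponent Q0.\<close>
          obtain t' where t': "t = Suc t'" using k0 unfolding t_def by (cases "N + k0") auto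
          have "j = i + int t' + 1" unfolding j_def t' by simp
          then show ?thesis
            using push_base_log_regular[OF log_regular_push_iter[OF fm(2) Q(1) Q'] Q(1) that, of t'] unfolding t' Q0_def by simp
        qed
        have low: "ennreal c \<le> ennreal \<kappa> * push_iter t i f (y, 0)" if y: "y \<in> space Mb" for y
        proof -
          have "ennreal \<beta> * ennreal \<rho> \<le> base_mass (push_iter t i f)"
            using block[OF f(1) _ N(2)] mr N(1) unfolding t_def f(2) \<rho>(1) S_def by simp
          also have "\<dots> \<le> ennreal (exp Q) * push_iter t i f (y, 0)"
            using lt y Q(1) by (intro base_mass_le_base[where i = j]) (auto simp: density_class_def)
          finally have "ennreal (\<kappa> * exp (- Q)) * (ennreal \<beta> * ennreal \<rho>) \<le>
              ennreal (\<kappa> * exp (- Q)) * (ennreal (exp Q) * push_iter t i f (y, 0))"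
            by (intro mult_left_mono) auto
          also have "\<dots> = ennreal \<kappa> * push_iter t i f (y, 0)"
          proof -
            have "ennreal (\<kappa> * exp (- Q)) * ennreal (exp Q) = ennreal \<kappa>"
              using \<kappa> by (simp add: ennreal_mult[symmetric] exp_minus mult.assoc)
            then show ?thesis by (simp add: mult.assoc[symmetric])
          qed
          finally show ?thesis using \<kappa> \<beta> \<rho> unfolding c_def by (simp add: ennreal_mult[symmetric] mult.assoc)
        qed
        have mm: "mass j (push_iter t i f) = mass i f" unfolding j_def by (rule mass_push_iter[OF fm(1)])
        show ?thesis
          using subtract_constant[OF lt Q0 base c0 low[unfolded \<kappa>_def]] unfolding sb_def mm by blast
      qed
      note sf = step[OF Suc.prems(1) \<rho>(1)]
      note sg = step[OF Suc.prems(2) Suc.prems(3)[unfolded \<rho>(1), symmetric]]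
      have meq: "mass j (sb (push_iter t i f)) = mass j (sb (push_iter t i g))"
      proof -
        have "ennreal c + mass j (sb (push_iter t i f)) = ennreal c + mass j (sb (push_iter t i g))"
          using sf sg Suc.prems(3) by (elim conjE) (simp only:)
        then show ?thesis by (simp add: ennreal_add_left_cancel)
      qed
      have mnew: "mass j (sb (push_iter t i f)) \<le> ennreal (\<theta> * \<rho>)"
      proof -
        obtain s where s: "mass j (sb (push_iter t i f)) = ennreal s" "0 \<le> s"
          using sf \<rho> by (cases "mass j (sb (push_iter t i f))") auto
        have "\<rho> = c + s" using sf s \<rho> c0 by (simp add: ennreal_plus[symmetric] del: ennreal_plus)
        then have "s = \<theta> * \<rho>" unfolding c_def \<theta>_def by (simp add: algebra_simps)
        then show ?thesis using s by simp
      qed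
      have jn: "j + int (n - t) = i + int n" using tn unfolding j_def by simp
      have "near (j + int (n - t)) Q B (max (ennreal r) (ennreal (\<theta> ^ k) * mass j (sb (push_iter t i f))))
          (push_iter (n - t) j (sb (push_iter t i f))) (push_iter (n - t) j (sb (push_iter t i g)))"
        using sf sg meq cS' unfolding S'_def j_def by (intro Suc.IH) auto
      then obtain p f' g' where p: "fm p" "density_class (i + int n) Q B f'" "density_class (i + int n) Q B g'"
         "mass (i + int n) f' = mass (i + int n) g'"
         "mass (i + int n) f' \<le> max (ennreal r) (ennreal (\<theta> ^ k) * mass j (sb (push_iter t i f)))"
         "\<And>z. z \<in> Dl (i + int n) \<Longrightarrow> push_iter (n - t) j (sb (push_iter t i f)) z = p z + f' z"
         "\<And>z. z \<in> Dl (i + int n) \<Longrightarrow> push_iter (n - t) j (sb (push_iter t i g)) z = p z + g' z"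
        unfolding near_def jn by blast
      \<comment> \<open>This function is removed from both densities; its later images are therefore
        common to both and can be added to the matched part.\<close>
      define C where "C = (\<lambda>z :: 'x \<times> nat. if snd z = 0 then ennreal c else 0)"
      have fmC: "fm C" unfolding fm_iff C_def by simp
      have split: "push_iter n i h z = push_iter (n - t) j C z + push_iter (n - t) j (sb (push_iter t i h)) z"
        if "\<forall>z\<in>Dl j. push_iter t i h z = C z + sb (push_iter t i h) z" "z \<in> Dl (i + int n)" for h z
      proof -
        have "push_iter n i h z = push_iter (n - t) j (push_iter t i h) z"
          using push_iter_add[of t "n - t" i h] tn unfolding j_def by simp
        also have "\<dots> = push_iter (n - t) j (\<lambda>z. C z + sb (push_iter t i h) z) z"
          using that by (intro push_iter_cong) (auto simp: jn)
        finally show ?thesis by (simp add: push_iter_plus)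
      qed
      have "ennreal (\<theta> ^ k) * mass j (sb (push_iter t i f)) \<le> ennreal (\<theta> ^ k) * ennreal (\<theta> * \<rho>)"
        by (intro mult_left_mono mnew) auto
      also have "\<dots> = ennreal (\<theta> ^ Suc k) * mass i f"
        using \<theta> \<rho> by (simp add: ennreal_mult[symmetric] ac_simps)
      finally have le: "mass (i + int n) f' \<le> max (ennreal r) (ennreal (\<theta> ^ Suc k) * mass i f)"
        using p(5) by (meson max.mono order_refl order_trans)
      show ?thesis unfolding near_def
      proof (intro exI conjI ballI)
        show "fm (\<lambda>z. push_iter (n - t) j C z + p z)" by (intro borel_measurable_add fm_push_iter fmC p)
        show "density_class (i + int n) Q B f'" "density_class (i + int n) Q B g'" "mass (i + int n) f' = mass (i + int n) g'"
          by (fact p)+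
        show "mass (i + int n) f' \<le> max (ennreal r) (ennreal (\<theta> ^ Suc k) * mass i f)" by (rule le)
        fix z assume z: "z \<in> Dl (i + int n)"
        show "push_iter n i f z = push_iter (n - t) j C z + p z + f' z"
          using split[OF _ z, of f] sf p(6)[OF z] unfolding C_def by (simp add: add.assoc)
        show "push_iter n i g z = push_iter (n - t) j C z + p z + g' z"
          using split[OF _ z, of g] sg p(7)[OF z] unfolding C_def by (simp add: add.assoc)
      qed
    qed
  qed
  show ?thesis
    using \<theta> main by (intro exI[of _ v] exI[of _ \<theta>]) (auto simp: v_def)
qed

lemma visits_tail:
  assumes "0 < \<delta>"
  shows "\<exists>L. infinite {n::nat. tail L (i + int n) \<le> ennreal \<delta>} \<and> infinite {n::nat. tail L (i - int n) \<le> ennreal \<delta>}"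
  using visits[OF assms, of i] unfolding tail_def H_def .

lemma infinite_card_ge:
  fixes P :: "nat \<Rightarrow> bool"
  assumes "infinite {n. P n}"
  shows "\<exists>n0. \<forall>n\<ge>n0. K \<le> card {N. N \<le> n \<and> P N}"
proof -
  obtain T where T: "T \<subseteq> {n. P n}" "finite T" "card T = K"
    using infinite_arbitrarily_large[OF assms] by metis
  have "K \<le> card {N. N \<le> n \<and> P N}" if n: "n \<ge> Max (insert 0 T)" for n
  proof -
    have "T \<subseteq> {N. N \<le> n \<and> P N}"
    proof
      fix s assume s: "s \<in> T"
      then have "s \<le> Max (insert 0 T)" using T by (intro Max_ge) auto
      then show "s \<in> {N. N \<le> n \<and> P N}" using n s T by auto
    qed
    moreover have "finite {N. N \<le> n \<and> P N}" by (rule finite_subset[of _ "{..n}"]) auto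
    ultimately show ?thesis using card_mono T(3) by metis
  qed
  then show ?thesis by blast
qed

text \<open>The number of visits alone decides when memory is lost, so n0 is uniform over all pairs
  of densities in the class. In the second statement the starting fibre recedes while the final one
  is fixed, which is the form needed for pull-backs.\<close>

lemma memory_loss:
  assumes Q: "0 \<le> Q" "\<gamma> * Q + D < Q" "exp Q \<le> B" and e: "0 < e"
  shows "\<exists>n0. \<forall>n\<ge>n0. \<forall>f g. density_class i Q B f \<longrightarrow> density_class i Q B g \<longrightarrow> mass i f = mass i g \<longrightarrow>
      near (i + int n) Q B (ennreal e) (push_iter n i f) (push_iter n i g)" (is ?fwd)
    and "\<exists>n0. \<forall>n\<ge>n0. \<forall>f g. density_class (i - int n) Q B f \<longrightarrow> density_class (i - int n) Q B g \<longrightarrow>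
      mass (i - int n) f = mass (i - int n) g \<longrightarrow>
      near i Q B (ennreal e) (push_iter n (i - int n) f) (push_iter n (i - int n) g)" (is ?bwd)
proof -
  have B: "0 < B" using Q(3) by (meson exp_gt_zero less_le_trans)
  \<comment> \<open>The threshold that \<open>contract\<close> demands for r = e.\<close>
  then have "0 < e / (2 * B)" using e by simp
  then obtain L where L: "infinite {n::nat. tail L (i + int n) \<le> ennreal (e / (2 * B))}"
      "infinite {n::nat. tail L (i - int n) \<le> ennreal (e / (2 * B))}"
    using visits_tail by blast
  obtain v \<theta> where v: "0 \<le> \<theta>" "\<theta> < (1::real)" "\<And>k i n f g. density_class i Q B f \<Longrightarrow> density_class i Q B g \<Longrightarrow> mass i f = mass i g \<Longrightarrow>
     k * v \<le> card {N. N \<le> n \<and> tail L (i + int N) \<le> ennreal (e / (2 * B))} \<Longrightarrow>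
     near (i + int n) Q B (max (ennreal e) (ennreal (\<theta> ^ k) * mass i f)) (push_iter n i f) (push_iter n i g)"
    using contract[OF Q e, of L] by blast
  obtain k where k: "\<theta> ^ k < e" using real_arch_pow_inv[OF e v(2)] by blast
  have near_e: "near (j + int n) Q B (ennreal e) (push_iter n j f) (push_iter n j g)"
    if "density_class j Q B f" "density_class j Q B g" "mass j f = mass j g"
       "k * v \<le> card {N. N \<le> n \<and> tail L (j + int N) \<le> ennreal (e / (2 * B))}" for j n f g
  proof (rule near_mono[OF v(3)[OF that]])
    have "ennreal (\<theta> ^ k) * mass j f \<le> ennreal e * 1"
      using that k by (intro mult_mono ennreal_leI) (auto simp: density_class_def)
    then show "max (ennreal e) (ennreal (\<theta> ^ k) * mass j f) \<le> ennreal e" by simp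
  qed
  obtain n1 where n1: "\<And>n. n \<ge> n1 \<Longrightarrow> k * v \<le> card {N. N \<le> n \<and> tail L (i + int N) \<le> ennreal (e / (2 * B))}"
    using infinite_card_ge[OF L(1), of "k * v"] by blast
  show ?fwd
  proof (intro exI allI impI)
    fix n f g assume "n1 \<le> n" "density_class i Q B f" "density_class i Q B g" "mass i f = mass i g"
    then show "near (i + int n) Q B (ennreal e) (push_iter n i f) (push_iter n i g)"
      by (intro near_e n1)
  qed
  obtain n0 where n0: "\<And>n. n \<ge> n0 \<Longrightarrow> k * v \<le> card {N. N \<le> n \<and> tail L (i - int N) \<le> ennreal (e / (2 * B))}"
    using infinite_card_ge[OF L(2), of "k * v"] by blast
  \<comment> \<open>Reversal N to n - N: the visits between the fibres i - n and i are counted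
    either backwards from i or forwards from i - n.\<close>
  have refl: "card {N. N \<le> n \<and> tail L (i - int N) \<le> ennreal (e / (2 * B))} =
     card {N. N \<le> n \<and> tail L (i - int n + int N) \<le> ennreal (e / (2 * B))}" for n
  proof (rule bij_betw_same_card[of "\<lambda>N. n - N"], rule bij_betw_byWitness[where f' = "\<lambda>N. n - N"])
  qed (auto simp: of_nat_diff algebra_simps)
  show ?bwd
  proof (intro exI allI impI)
    fix n f g assume "n0 \<le> n" "density_class (i - int n) Q B f" "density_class (i - int n) Q B g" "mass (i - int n) f = mass (i - int n) g"
    with near_e[of "i - int n" f g n] n0[of n] refl[of n]
    show "near i Q B (ennreal e) (push_iter n (i - int n) f) (push_iter n (i - int n) g)" by simp
  qed
qed

end

section \<open>The equivariant density\<close>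

text \<open>The Cauchy condition is stated additively because subtraction on \<open>ennreal\<close>
  truncates; the limit is expressed by \<open>liminf\<close> because the equivariant density is
  defined that way.\<close>

lemma ennreal_Cauchy_converges:
  fixes f :: "nat \<Rightarrow> ennreal"
  assumes bound: "\<And>n. f n \<le> ennreal B"
    and cauchy: "\<And>e. 0 < e \<Longrightarrow> \<exists>n0. \<forall>n\<ge>n0. \<forall>m\<ge>n0. f n \<le> f m + ennreal e"
  shows "f \<longlonglongrightarrow> liminf f"
proof -
  have fin: "f n < \<top>" for n using bound[of n] by (simp add: order.strict_trans1)
  have f: "f n = ennreal (enn2real (f n))" for n using fin[of n] by simp
  have "Cauchy (\<lambda>n. enn2real (f n))"
  proof (rule metric_CauchyI)
    fix e :: real assume e: "0 < e"
    then obtain n0 where n0: "\<And>n m. n \<ge> n0 \<Longrightarrow> m \<ge> n0 \<Longrightarrow> f n \<le> f m + ennreal (e / 2)"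
      using cauchy[of "e / 2"] by auto
    have le: "enn2real (f n) \<le> enn2real (f m) + e / 2" if "n \<ge> n0" "m \<ge> n0" for n m
    proof -
      have "ennreal (enn2real (f n)) \<le> ennreal (enn2real (f m) + e / 2)"
        using n0[OF that] e f[of n] f[of m] by (simp add: ennreal_plus)
      then show ?thesis by (subst (asm) ennreal_le_iff) (use e in simp_all)
    qed
    have "dist (enn2real (f m)) (enn2real (f n)) < e" if "m \<ge> n0" "n \<ge> n0" for m n
      using le[of m n] le[of n m] that e unfolding dist_real_def by linarith
    then show "\<exists>N. \<forall>m\<ge>N. \<forall>n\<ge>N. dist (enn2real (f m)) (enn2real (f n)) < e"
      by blast
  qed
  then obtain l where "(\<lambda>n. enn2real (f n)) \<longlonglongrightarrow> l"
    using Cauchy_convergent_iff convergent_def by blast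
  then have "(\<lambda>n. ennreal (enn2real (f n))) \<longlonglongrightarrow> ennreal l" by (rule tendsto_ennrealI)
  then have "f \<longlonglongrightarrow> ennreal l" using f by simp
  then show ?thesis using lim_imp_Liminf[OF sequentially_bot] by metis
qed

context tower_orbit
begin

text \<open>Twice the fixed point D / (1 - \<gamma>) of the map Q to \<gamma> Q + D, so that a push
  strictly improves the exponent on the base.\<close>

definition Qs :: real where "Qs = 2 * D / (1 - \<gamma>)"

lemma Qs: "0 \<le> Qs" "Qs \<le> Q \<Longrightarrow> \<gamma> * Q + D < Q"
proof -
  show "0 \<le> Qs" unfolding Qs_def using gamma D_pos by simp
  assume "Qs \<le> Q"
  then have "2 * D \<le> Q * (1 - \<gamma>)" using gamma unfolding Qs_def by (simp add: divide_le_eq)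
  then show "\<gamma> * Q + D < Q" using D_pos by (simp add: algebra_simps)
qed

definition base_one :: "'x \<times> nat \<Rightarrow> ennreal" where
  "base_one = (\<lambda>z. if snd z = 0 then 1 else 0)"

definition past :: "nat \<Rightarrow> int \<Rightarrow> 'x \<times> nat \<Rightarrow> ennreal" where
  "past n i = push_iter n (i - int n) base_one"

text \<open>On the tower the pull-backs converge; \<open>liminf\<close> supplies a value off the
  tower as well and makes the function measurable without further argument.\<close>

definition inv_dens :: "int \<Rightarrow> 'x \<times> nat \<Rightarrow> ennreal" where
  "inv_dens i z = liminf (\<lambda>n. past n i z)"

lemma mass_base_one: "mass i base_one = 1" and fm_base_one: "fm base_one"
proof -
  show fm: "fm base_one" unfolding fm_iff base_one_def by simp
  have "mass i base_one = (\<integral>\<^sup>+x. indicator (H i 0) x \<partial>Mb)"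
    unfolding mass_levels[OF fm] by (subst suminf_ennreal_split) (simp add: base_one_def)
  then show "mass i base_one = 1" by (simp add: H_0 Mb.emeasure_space_1)
qed

lemma density_class_base_one:
  assumes "0 \<le> Q" "1 \<le> B" shows "density_class i Q B base_one"
proof -
  have "1 \<le> ennreal (exp (Q * gb j x y))" for j x y
    using assms gb_bounds[of j x y] by simp
  moreover have "(1 :: ennreal) \<le> ennreal B" using assms by simp
  ultimately show ?thesis
    using fm_base_one mass_base_one by (auto simp: density_class_def log_regular_def base_one_def)
qed

lemma density_class_past: "density_class i Qs (exp Qs) (past n i)" and mass_past: "mass i (past n i) = 1"
proof -
  have c: "density_class (i - int n) Qs (exp Qs) base_one" using Qs(1) by (intro density_class_base_one) auto
  have "\<gamma> * Qs + D \<le> Qs" using Qs(2)[of Qs] by simp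
  from density_class_push_iter[OF c Qs(1) this, of n] show "density_class i Qs (exp Qs) (past n i)" unfolding past_def by simp
  show "mass i (past n i) = 1"
    unfolding past_def using mass_push_iter[OF fm_base_one, of "i - int n" n] mass_base_one by simp
qed

lemma fm_past: "fm (past n i)" using density_class_past by (simp add: density_class_def)

lemma push_past: "push i (past n i) = past (Suc n) (i + 1)"
  unfolding past_def by (simp add: algebra_simps)

text \<open>Pull-backs from two different depths become images of two different initial densities
  over the same n steps, to which \<open>memory_loss\<close> applies.\<close>

lemma past_add: "past (m + n) i = push_iter n (i - int n) (past m (i - int n))"
  unfolding past_def using push_iter_add[of m n "i - int n - int m" base_one] by (simp add: algebra_simps)

lemma past_level: "l \<le> n \<Longrightarrow> past n i (x, l) = past (n - l) (i - int l) (x, 0)"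
  unfolding past_def using push_iter_level[of "n - l" l "i - int n" base_one x] by (simp add: of_nat_diff)

lemma near_past:
  assumes "0 < e"
  shows "\<exists>n0. \<forall>n\<ge>n0. \<forall>m\<ge>n0. near i Qs (exp Qs) (ennreal e) (past n i) (past m i)"
proof -
  obtain n0 where n0: "\<And>n f g. n \<ge> n0 \<Longrightarrow> density_class (i - int n) Qs (exp Qs) f \<Longrightarrow> density_class (i - int n) Qs (exp Qs) g \<Longrightarrow>
      mass (i - int n) f = mass (i - int n) g \<Longrightarrow>
      near i Qs (exp Qs) (ennreal e) (push_iter n (i - int n) f) (push_iter n (i - int n) g)"
    using memory_loss(2)[OF Qs(1) Qs(2)[OF order_refl] order_refl assms] by blast
  have 1: "near i Qs (exp Qs) (ennreal e) (past n i) (past m i)" if nm: "n \<ge> n0" "m \<ge> n" for n m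
  proof -
    have "near i Qs (exp Qs) (ennreal e) (push_iter n (i - int n) base_one) (push_iter n (i - int n) (past (m - n) (i - int n)))"
      using nm Qs(1) by (intro n0 density_class_past density_class_base_one) (auto simp: mass_base_one mass_past)
    then show ?thesis using past_add[of "m - n" n i] nm by (simp add: past_def)
  qed
  show ?thesis
  proof (intro exI[of _ n0] allI impI)
    fix n m assume "n0 \<le> n" "n0 \<le> m"
    then show "near i Qs (exp Qs) (ennreal e) (past n i) (past m i)"
      using 1[of n m] near_sym[OF 1[of m n]] by (cases "n \<le> m") auto
  qed
qed

text \<open>The place where the unmatched parts must be log-regular: their base values are at most
  exp Q times their mass, so closeness in mass becomes pointwise closeness.\<close>

lemma near_base:
  assumes "near i Q B e F G" "0 \<le> Q" "x \<in> space Mb"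
  shows "F (x, 0) \<le> G (x, 0) + ennreal (exp Q) * e"
proof -
  obtain p f f' where p: "density_class i Q B f" "mass i f \<le> e" "\<And>z. z \<in> Dl i \<Longrightarrow> F z = p z + f z \<and> G z = p z + f' z"
    using assms(1) unfolding near_def by blast
  have z: "(x, 0) \<in> Dl i" using assms(3) by (simp add: Dl_H H_0)
  have "f (x, 0) \<le> ennreal (exp Q) * base_mass f"
    using p assms by (intro base_le_base_mass[where i = i]) (auto simp: density_class_def)
  also have "\<dots> \<le> ennreal (exp Q) * e"
    using p base_mass_le_mass[of f i] by (intro mult_left_mono) (auto simp: density_class_def)
  finally have "p (x, 0) + f (x, 0) \<le> (p (x, 0) + f' (x, 0)) + ennreal (exp Q) * e"
    by (metis add_increasing2 add_left_mono zero_le add.assoc add.commute)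
  then show ?thesis using p(3)[OF z] by simp
qed

text \<open>A value on level l of fibre i is a base value of fibre i - l, so the Cauchy property
  need only be known on the base; the tolerance is divided by exp Qs to compensate for
  \<open>near_base\<close>.\<close>

lemma past_converges:
  assumes z: "z \<in> Dl i" shows "(\<lambda>n. past n i z) \<longlonglongrightarrow> inv_dens i z"
  unfolding inv_dens_def
proof (rule ennreal_Cauchy_converges)
  show "past n i z \<le> ennreal (exp Qs)" for n using density_class_past[of i n] z by (auto simp: density_class_def)
  fix e :: real assume e: "0 < e"
  obtain x l where xl: "z = (x, l)" by (cases z)
  have x: "x \<in> space Mb" using z unfolding xl by (simp add: Dl_def)
  have e': "0 < e / exp Qs" using e by simp
  obtain n0 where n0: "\<And>n m. n \<ge> n0 \<Longrightarrow> m \<ge> n0 \<Longrightarrow>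
      near (i - int l) Qs (exp Qs) (ennreal (e / exp Qs)) (past n (i - int l)) (past m (i - int l))"
    using near_past[OF e', of "i - int l"] by blast
  show "\<exists>n0. \<forall>n\<ge>n0. \<forall>m\<ge>n0. past n i z \<le> past m i z + ennreal e"
  proof (intro exI[of _ "n0 + l"] allI impI)
    fix n m assume n: "n0 + l \<le> n" "n0 + l \<le> m"
    have "near (i - int l) Qs (exp Qs) (ennreal (e / exp Qs)) (past (n - l) (i - int l)) (past (m - l) (i - int l))"
      using n by (intro n0) simp_all
    from near_base[OF this Qs(1) x]
    have "past (n - l) (i - int l) (x, 0) \<le> past (m - l) (i - int l) (x, 0) + ennreal (exp Qs) * ennreal (e / exp Qs)" .
    also have "ennreal (exp Qs) * ennreal (e / exp Qs) = ennreal e"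
      using e by (simp add: ennreal_mult[symmetric])
    finally show "past n i z \<le> past m i z + ennreal e"
      using n past_level[of l n i x] past_level[of l m i x] unfolding xl by simp
  qed
qed

lemma fm_inv_dens: "fm (inv_dens i)"
proof -
  have "(\<lambda>z. liminf (\<lambda>n. past n i z)) \<in> borel_measurable (Mb \<Otimes>\<^sub>M count_space UNIV)"
    by (intro borel_measurable_liminf fm_past)
  then show ?thesis by (simp add: inv_dens_def[abs_def])
qed

lemma inv_dens_le: "z \<in> Dl i \<Longrightarrow> inv_dens i z \<le> ennreal (exp Qs)"
  using density_class_past by (intro LIMSEQ_le_const2[OF past_converges]) (auto simp: density_class_def)

lemma log_regular_inv_dens: "log_regular i Qs (inv_dens i)"
  unfolding log_regular_def
proof (intro allI ballI)
  fix l x y assume x: "x \<in> H i l" and y: "y \<in> H i l"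
  have 1: "(\<lambda>n. past n i (x, l)) \<longlonglongrightarrow> inv_dens i (x, l)"
    using x by (intro past_converges) (simp add: Dl_H)
  have "(\<lambda>n. past n i (y, l)) \<longlonglongrightarrow> inv_dens i (y, l)"
    using y by (intro past_converges) (simp add: Dl_H)
  then have 2: "(\<lambda>n. ennreal (exp (Qs * gb (i - int l) x y)) * past n i (y, l))
      \<longlonglongrightarrow> ennreal (exp (Qs * gb (i - int l) x y)) * inv_dens i (y, l)"
    by (intro ennreal_tendsto_cmult) auto
  show "inv_dens i (x, l) \<le> ennreal (exp (Qs * gb (i - int l) x y)) * inv_dens i (y, l)"
    using density_class_past[of i] x y by (intro LIMSEQ_le[OF 1 2]) (auto simp: density_class_def intro: regD)
qed

lemma emeasure_tw: "emeasure (tw i) (Dl i) \<le> ennreal M"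
proof -
  have "emeasure (tw i) (Dl i) = (\<integral>\<^sup>+z. 1 \<partial>tw i)" by (simp add: space_tw)
  also have "\<dots> = (\<Sum>l. emeasure Mb (H i l))" by (subst nn_integral_tw) auto
  also have "\<dots> \<le> ennreal M" using mass_bound[of i] by (simp add: H_def)
  finally show ?thesis .
qed

lemma finite_tw: "finite_measure (tw i)"
  by (rule finite_measureI) (use emeasure_tw[of i] in \<open>auto simp: space_tw top_unique\<close>)

lemma sets_tw: "A \<in> sets (tw i) \<longleftrightarrow> A \<subseteq> Dl i \<and> A \<in> sets (Mb \<Otimes>\<^sub>M count_space UNIV)"
  unfolding tw_def by (rule sets_restrict_space_iff) simp

text \<open>Bounded convergence: the pull-backs are bounded by exp Qs, and the tower has finite
  measure by (P6). Total mass and invariance pass to the limit in this way.\<close>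

lemma integral_past_converges:
  assumes \<phi>: "\<phi> \<in> borel_measurable (tw i)" "\<And>z. z \<in> Dl i \<Longrightarrow> \<phi> z \<le> 1"
  shows "(\<lambda>n. \<integral>\<^sup>+z. \<phi> z * past n i z \<partial>tw i) \<longlonglongrightarrow> (\<integral>\<^sup>+z. \<phi> z * inv_dens i z \<partial>tw i)"
proof (rule nn_integral_dominated_convergence[where w = "\<lambda>_. ennreal (exp Qs)"])
  show "(\<lambda>z. \<phi> z * past n i z) \<in> borel_measurable (tw i)" for n
    by (intro borel_measurable_times_ennreal \<phi> fm_tw fm_past)
  show "(\<lambda>z. \<phi> z * inv_dens i z) \<in> borel_measurable (tw i)"
    by (intro borel_measurable_times_ennreal \<phi> fm_tw fm_inv_dens)
  have "\<phi> z * past n i z \<le> 1 * ennreal (exp Qs)" if "z \<in> Dl i" for n z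
    using \<phi>(2)[OF that] density_class_past[of i n] that by (intro mult_mono) (auto simp: density_class_def)
  then show "AE z in tw i. \<phi> z * past n i z \<le> ennreal (exp Qs)" for n
    by (intro AE_I2) (simp add: space_tw)
  have "(\<integral>\<^sup>+z. ennreal (exp Qs) \<partial>tw i) \<le> ennreal (exp Qs) * ennreal M"
    using emeasure_tw[of i] by (simp add: space_tw mult_left_mono)
  then show "(\<integral>\<^sup>+z. ennreal (exp Qs) \<partial>tw i) < \<infinity>"
    by (rule order.strict_trans1) (simp add: ennreal_mult_less_top)
  show "AE z in tw i. (\<lambda>n. \<phi> z * past n i z) \<longlonglongrightarrow> \<phi> z * inv_dens i z"
  proof (intro AE_I2 ennreal_tendsto_cmult past_converges)
    fix z assume "z \<in> space (tw i)"
    then show "z \<in> Dl i" "\<phi> z < \<top>" using \<phi>(2)[of z] by (auto simp: space_tw order.strict_trans1)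
  qed
qed simp

lemma mass_inv_dens: "mass i (inv_dens i) = 1"
proof -
  have "(\<lambda>n. mass i (past n i)) \<longlonglongrightarrow> mass i (inv_dens i)"
    unfolding mass_def using integral_past_converges[of "\<lambda>_. 1" i] by simp
  then have "(\<lambda>n. 1) \<longlonglongrightarrow> mass i (inv_dens i)" by (simp add: mass_past)
  then show ?thesis by (simp add: LIMSEQ_const_iff)
qed

text \<open>Pushing the pull-back of depth n gives the pull-back of depth n + 1 on the next fibre;
  both sides are limits of the same sequence of integrals, up to an index shift.\<close>

lemma inv_dens_invariant:
  assumes \<phi>: "\<phi> \<in> borel_measurable (tw (i + 1))" "\<And>z. z \<in> Dl (i + 1) \<Longrightarrow> \<phi> z \<le> 1"
  shows "(\<integral>\<^sup>+z. \<phi> (Fm i z) * inv_dens i z \<partial>tw i) = (\<integral>\<^sup>+z. \<phi> z * inv_dens (i + 1) z \<partial>tw (i + 1))"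
proof (rule LIMSEQ_unique)
  show "(\<lambda>n. \<integral>\<^sup>+z. \<phi> (Fm i z) * past n i z \<partial>tw i) \<longlonglongrightarrow> (\<integral>\<^sup>+z. \<phi> (Fm i z) * inv_dens i z \<partial>tw i)"
    by (intro integral_past_converges measurable_compose[OF Fm_meas \<phi>(1)] \<phi>(2) Fm_in)
  have "(\<integral>\<^sup>+z. \<phi> (Fm i z) * past n i z \<partial>tw i) = (\<integral>\<^sup>+z. \<phi> z * past (Suc n) (i + 1) z \<partial>tw (i + 1))" for n
    using nn_integral_push[OF fm_past[of n i] \<phi>(1)] by (simp add: push_past)
  then show "(\<lambda>n. \<integral>\<^sup>+z. \<phi> (Fm i z) * past n i z \<partial>tw i) \<longlonglongrightarrow> (\<integral>\<^sup>+z. \<phi> z * inv_dens (i + 1) z \<partial>tw (i + 1))"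
    using LIMSEQ_Suc[OF integral_past_converges[OF \<phi>]] by simp
qed

lemma inv_dens_invariant_iter:
  "\<phi> \<in> borel_measurable (tw (i + int n)) \<Longrightarrow> (\<And>z. z \<in> Dl (i + int n) \<Longrightarrow> \<phi> z \<le> 1) \<Longrightarrow>
    (\<integral>\<^sup>+z. \<phi> (Fit n i z) * inv_dens i z \<partial>tw i) = (\<integral>\<^sup>+z. \<phi> z * inv_dens (i + int n) z \<partial>tw (i + int n))"
proof (induction n arbitrary: \<phi>)
  case (Suc n)
  have e: "i + int (Suc n) = i + int n + 1" by simp
  note \<phi> = Suc.prems[unfolded e]
  have "(\<integral>\<^sup>+z. \<phi> (Fit (Suc n) i z) * inv_dens i z \<partial>tw i) = (\<integral>\<^sup>+z. \<phi> (Fm (i + int n) z) * inv_dens (i + int n) z \<partial>tw (i + int n))"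
    using Suc.IH[OF measurable_compose[OF Fm_meas \<phi>(1)] \<phi>(2)[OF Fm_in]] by simp
  also have "\<dots> = (\<integral>\<^sup>+z. \<phi> z * inv_dens (i + int (Suc n)) z \<partial>tw (i + int (Suc n)))"
    unfolding e by (rule inv_dens_invariant[OF \<phi>])
  finally show ?case .
qed simp

lemma near_test:
  assumes "near i Q B e F G" and \<phi>: "\<phi> \<in> borel_measurable (tw i)" "\<And>z. z \<in> Dl i \<Longrightarrow> \<phi> z \<le> 1"
  shows "(\<integral>\<^sup>+z. \<phi> z * F z \<partial>tw i) \<le> (\<integral>\<^sup>+z. \<phi> z * G z \<partial>tw i) + e"
proof -
  obtain p f f' where p: "fm p" "fm f" "fm f'" "mass i f \<le> e" "\<And>z. z \<in> Dl i \<Longrightarrow> F z = p z + f z \<and> G z = p z + f' z"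
    using assms(1) unfolding near_def density_class_def by blast
  have m: "(\<lambda>z. \<phi> z * h z) \<in> borel_measurable (tw i)" if "fm h" for h
    by (intro borel_measurable_times_ennreal \<phi> fm_tw that)
  have "(\<integral>\<^sup>+z. \<phi> z * F z \<partial>tw i) = (\<integral>\<^sup>+z. \<phi> z * p z + \<phi> z * f z \<partial>tw i)"
    using p by (intro nn_integral_cong) (simp add: space_tw distrib_left)
  also have "\<dots> = (\<integral>\<^sup>+z. \<phi> z * p z \<partial>tw i) + (\<integral>\<^sup>+z. \<phi> z * f z \<partial>tw i)"
    by (intro nn_integral_add m p)
  also have "(\<integral>\<^sup>+z. \<phi> z * f z \<partial>tw i) \<le> mass i f"
    unfolding mass_def
  proof (intro nn_integral_mono)
    fix z assume "z \<in> space (tw i)"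
    then show "\<phi> z * f z \<le> f z" using mult_right_mono[OF \<phi>(2), of z "f z"] by (simp add: space_tw)
  qed
  also have "mass i f \<le> e" by (rule p)
  also have "(\<integral>\<^sup>+z. \<phi> z * p z \<partial>tw i) \<le> (\<integral>\<^sup>+z. \<phi> z * G z \<partial>tw i)"
    using p by (intro nn_integral_mono) (simp add: space_tw distrib_left)
  finally show ?thesis by (simp add: add_mono)
qed

text \<open>The density f is compared with its own mass times the equivariant density, whose images
  are known by invariance. The test function \<phi> appears only after the coupling is complete,
  hence the uniformity.\<close>

lemma density_class_forgets:
  assumes f: "density_class i Q B f" and Q: "Qs \<le> Q" "exp Q \<le> B" and e: "0 < e"
  shows "\<exists>n0. \<forall>n\<ge>n0. \<forall>\<phi>. \<phi> \<in> borel_measurable (tw (i + int n)) \<longrightarrow> (\<forall>z\<in>Dl (i + int n). \<phi> z \<le> 1) \<longrightarrow>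
    (\<integral>\<^sup>+z. \<phi> (Fit n i z) * f z \<partial>tw i) \<le> mass i f * (\<integral>\<^sup>+z. \<phi> z * inv_dens (i + int n) z \<partial>tw (i + int n)) + ennreal e \<and>
    mass i f * (\<integral>\<^sup>+z. \<phi> z * inv_dens (i + int n) z \<partial>tw (i + int n)) \<le> (\<integral>\<^sup>+z. \<phi> (Fit n i z) * f z \<partial>tw i) + ennreal e"
proof -
  \<comment> \<open>Equal mass is what \<open>memory_loss\<close> asks for; k lies in the class
    because Qs \<le> Q and the mass is at most 1.\<close>
  define k where "k = (\<lambda>z. mass i f * inv_dens i z)"
  have fm: "fm f" and m1: "mass i f \<le> 1" using f by (auto simp: density_class_def)
  have Q0: "0 \<le> Q" using Q Qs(1) by simp
  have fk: "fm k" unfolding k_def by (intro borel_measurable_times_ennreal fm_inv_dens) simp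
  have mk: "mass i k = mass i f"
  proof -
    have "mass i k = mass i f * mass i (inv_dens i)"
      unfolding k_def mass_def by (intro nn_integral_cmult fm_tw fm_inv_dens)
    then show ?thesis by (simp add: mass_inv_dens)
  qed
  have ck: "density_class i Q B k"
  proof -
    have "k z \<le> ennreal B" if "z \<in> Dl i" for z
    proof -
      have "k z \<le> 1 * ennreal (exp Qs)"
        unfolding k_def by (intro mult_mono m1 inv_dens_le that) auto
      also have "\<dots> \<le> ennreal B" using Q by (simp add: ennreal_leI order_trans[of _ "exp Q"])
      finally show ?thesis .
    qed
    moreover have "log_regular i Q k"
      using log_regular_mono[OF log_regular_inv_dens Q(1), of i] unfolding log_regular_def k_def
      by (metis mult.left_commute mult_left_mono zero_le)
    ultimately show ?thesis using fk mk m1 by (simp add: density_class_def)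
  qed
  obtain n0 where n0: "\<And>n. n \<ge> n0 \<Longrightarrow> near (i + int n) Q B (ennreal e) (push_iter n i f) (push_iter n i k)"
    using memory_loss(1)[OF Q0 Qs(2)[OF Q(1)] Q(2) e, of i] f ck mk by metis
  show ?thesis
  proof (intro exI[of _ n0] allI impI)
    fix n and \<phi> :: "'x \<times> nat \<Rightarrow> ennreal"
    assume n: "n0 \<le> n" and \<phi>: "\<phi> \<in> borel_measurable (tw (i + int n))" "\<forall>z\<in>Dl (i + int n). \<phi> z \<le> 1"
    have 1: "(\<integral>\<^sup>+z. \<phi> z * push_iter n i f z \<partial>tw (i + int n)) = (\<integral>\<^sup>+z. \<phi> (Fit n i z) * f z \<partial>tw i)"
      by (rule nn_integral_push_iter[OF fm \<phi>(1)])
    have "(\<integral>\<^sup>+z. \<phi> z * push_iter n i k z \<partial>tw (i + int n)) = (\<integral>\<^sup>+z. \<phi> (Fit n i z) * k z \<partial>tw i)"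
      by (rule nn_integral_push_iter[OF fk \<phi>(1)])
    also have "\<dots> = mass i f * (\<integral>\<^sup>+z. \<phi> (Fit n i z) * inv_dens i z \<partial>tw i)"
      unfolding k_def
      by (subst nn_integral_cmult[symmetric])
        (auto intro!: borel_measurable_times_ennreal measurable_compose[OF Fit_meas \<phi>(1)] fm_tw[OF fm_inv_dens]
          simp: ac_simps)
    also have "\<dots> = mass i f * (\<integral>\<^sup>+z. \<phi> z * inv_dens (i + int n) z \<partial>tw (i + int n))"
      using \<phi> by (subst inv_dens_invariant_iter) auto
    finally have 2: "(\<integral>\<^sup>+z. \<phi> z * push_iter n i k z \<partial>tw (i + int n)) = \<dots>" .
    show "(\<integral>\<^sup>+z. \<phi> (Fit n i z) * f z \<partial>tw i) \<le> mass i f * (\<integral>\<^sup>+z. \<phi> z * inv_dens (i + int n) z \<partial>tw (i + int n)) + ennreal e \<and>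
      mass i f * (\<integral>\<^sup>+z. \<phi> z * inv_dens (i + int n) z \<partial>tw (i + int n)) \<le> (\<integral>\<^sup>+z. \<phi> (Fit n i z) * f z \<partial>tw i) + ennreal e"
      using near_test[OF n0[OF n] \<phi>(1)] near_test[OF near_sym[OF n0[OF n]] \<phi>(1)] \<phi>(2)
      unfolding 1 2 by blast
  qed
qed

section \<open>Correlation errors, and their extension to integrable densities\<close>

definition inv_dens_real :: "int \<Rightarrow> 'x \<times> nat \<Rightarrow> real" where
  "inv_dens_real i z = enn2real (inv_dens i z)"

definition test_fun :: "int \<Rightarrow> ('x \<times> nat \<Rightarrow> real) \<Rightarrow> bool" where
  "test_fun i \<phi> \<longleftrightarrow> \<phi> \<in> borel_measurable (tw i) \<and> (\<forall>z\<in>Dl i. 0 \<le> \<phi> z \<and> \<phi> z \<le> 1)"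

text \<open>Here f is a signed density with respect to m, so the equivariant measure shows only in
  the average of \<phi>. An observable under the equivariant measure is covered by including its
  density in f.\<close>

definition err :: "nat \<Rightarrow> int \<Rightarrow> ('x \<times> nat \<Rightarrow> real) \<Rightarrow> ('x \<times> nat \<Rightarrow> real) \<Rightarrow> real" where
  "err n i \<phi> f = (\<integral>z. \<phi> (Fit n i z) * f z \<partial>tw i) -
     (\<integral>z. f z \<partial>tw i) * (\<integral>z. \<phi> z * inv_dens_real (i + int n) z \<partial>tw (i + int n))"

text \<open>Uniformity over all test functions on the target fibre is essential: for a tail set the
  test function is the indicator of a different set for each n.\<close>

definition loses :: "int \<Rightarrow> ('x \<times> nat \<Rightarrow> real) \<Rightarrow> bool" where
  "loses i f \<longleftrightarrow> integrable (tw i) f \<and>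
     (\<forall>e>0. \<exists>n0. \<forall>n\<ge>n0. \<forall>\<phi>. test_fun (i + int n) \<phi> \<longrightarrow> \<bar>err n i \<phi> f\<bar> \<le> e)"

lemma inv_dens_real: "inv_dens_real i \<in> borel_measurable (tw i)" "0 \<le> inv_dens_real i z" "z \<in> Dl i \<Longrightarrow> ennreal (inv_dens_real i z) = inv_dens i z"
proof -
  show "inv_dens_real i \<in> borel_measurable (tw i)"
    unfolding inv_dens_real_def[abs_def] by (intro measurable_compose[OF fm_tw[OF fm_inv_dens]]) auto
  show "0 \<le> inv_dens_real i z" by (simp add: inv_dens_real_def)
  assume "z \<in> Dl i"
  then have "inv_dens i z < \<top>" using inv_dens_le[of z i] by (simp add: order.strict_trans1)
  then show "ennreal (inv_dens_real i z) = inv_dens i z" by (simp add: inv_dens_real_def)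
qed

lemma integral_nonneg_inv_dens_real:
  assumes "\<phi> \<in> borel_measurable (tw i)" "\<And>z. z \<in> Dl i \<Longrightarrow> 0 \<le> \<phi> z"
  shows "(\<integral>z. \<phi> z * inv_dens_real i z \<partial>tw i) = enn2real (\<integral>\<^sup>+z. ennreal (\<phi> z) * inv_dens i z \<partial>tw i)"
proof -
  have "(\<integral>z. \<phi> z * inv_dens_real i z \<partial>tw i) = enn2real (\<integral>\<^sup>+z. ennreal (\<phi> z * inv_dens_real i z) \<partial>tw i)"
    using assms inv_dens_real(1,2) by (intro integral_eq_nn_integral) (auto simp: space_tw)
  also have "(\<integral>\<^sup>+z. ennreal (\<phi> z * inv_dens_real i z) \<partial>tw i) = (\<integral>\<^sup>+z. ennreal (\<phi> z) * inv_dens i z \<partial>tw i)"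
    using assms inv_dens_real by (intro nn_integral_cong) (simp add: space_tw ennreal_mult)
  finally show ?thesis .
qed

lemma nn_integral_inv_dens_le:
  assumes "\<And>z. z \<in> Dl i \<Longrightarrow> \<phi> z \<le> (1 :: ennreal)"
  shows "(\<integral>\<^sup>+z. \<phi> z * inv_dens i z \<partial>tw i) \<le> 1"
proof -
  have "(\<integral>\<^sup>+z. \<phi> z * inv_dens i z \<partial>tw i) \<le> (\<integral>\<^sup>+z. 1 * inv_dens i z \<partial>tw i)"
    using assms by (intro nn_integral_mono mult_right_mono) (auto simp: space_tw)
  then show ?thesis using mass_inv_dens[of i] by (simp add: mass_def)
qed

lemma test_fun_inv_dens_real: "test_fun i \<phi> \<Longrightarrow> 0 \<le> (\<integral>z. \<phi> z * inv_dens_real i z \<partial>tw i) \<and> (\<integral>z. \<phi> z * inv_dens_real i z \<partial>tw i) \<le> 1"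
proof -
  assume a: "test_fun i \<phi>"
  have "(\<integral>\<^sup>+z. ennreal (\<phi> z) * inv_dens i z \<partial>tw i) \<le> 1"
    using a by (intro nn_integral_inv_dens_le) (auto simp: test_fun_def)
  then have "enn2real (\<integral>\<^sup>+z. ennreal (\<phi> z) * inv_dens i z \<partial>tw i) \<le> 1"
    by (intro enn2real_leI) auto
  then show ?thesis using a by (subst (1 2) integral_nonneg_inv_dens_real) (auto simp: test_fun_def)
qed

lemma test_fun_integrable:
  assumes a: "test_fun (i + int n) \<phi>" and f: "integrable (tw i) f"
  shows "integrable (tw i) (\<lambda>z. \<phi> (Fit n i z) * f z)"
proof (rule Bochner_Integration.integrable_bound[OF f])
  have "(\<lambda>z. \<phi> (Fit n i z)) \<in> borel_measurable (tw i)"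
    using a by (intro measurable_compose[OF Fit_meas]) (auto simp: test_fun_def)
  then show "(\<lambda>z. \<phi> (Fit n i z) * f z) \<in> borel_measurable (tw i)"
    using f by measurable
  show "AE z in tw i. norm (\<phi> (Fit n i z) * f z) \<le> norm (f z)"
    using a Fit_in[of _ i n] by (intro AE_I2) (auto simp: test_fun_def space_tw abs_mult intro!: mult_left_le_one_le)
qed

lemma err_add:
  assumes "test_fun (i + int n) \<phi>" "integrable (tw i) f" "integrable (tw i) f'"
  shows "err n i \<phi> (\<lambda>z. f z + f' z) = err n i \<phi> f + err n i \<phi> f'"
  using assms test_fun_integrable[OF assms(1)] by (simp add: err_def distrib_left distrib_right)

lemma err_cmult: "err n i \<phi> (\<lambda>z. c * f z) = c * err n i \<phi> f"
  by (simp add: err_def mult.left_commute[of _ c] right_diff_distrib)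

lemma err_bound:
  assumes a: "test_fun (i + int n) \<phi>" and f: "integrable (tw i) f"
  shows "\<bar>err n i \<phi> f\<bar> \<le> 2 * (\<integral>z. \<bar>f z\<bar> \<partial>tw i)"
proof -
  have "\<bar>\<integral>z. \<phi> (Fit n i z) * f z \<partial>tw i\<bar> \<le> (\<integral>z. \<bar>\<phi> (Fit n i z) * f z\<bar> \<partial>tw i)"
    by (rule integral_abs_bound)
  also have "\<dots> \<le> (\<integral>z. \<bar>f z\<bar> \<partial>tw i)"
    using a Fit_in[of _ i n] f test_fun_integrable[OF a f]
    by (intro integral_mono integrable_abs) (auto simp: test_fun_def space_tw abs_mult intro!: mult_left_le_one_le)
  finally have 1: "\<bar>\<integral>z. \<phi> (Fit n i z) * f z \<partial>tw i\<bar> \<le> (\<integral>z. \<bar>f z\<bar> \<partial>tw i)" .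
  have "\<bar>\<integral>z. f z \<partial>tw i\<bar> * \<bar>\<integral>z. \<phi> z * inv_dens_real (i + int n) z \<partial>tw (i + int n)\<bar> \<le> (\<integral>z. \<bar>f z\<bar> \<partial>tw i) * 1"
    using test_fun_inv_dens_real[OF a] by (intro mult_mono integral_abs_bound) auto
  then have 2: "\<bar>(\<integral>z. f z \<partial>tw i) * (\<integral>z. \<phi> z * inv_dens_real (i + int n) z \<partial>tw (i + int n))\<bar> \<le> (\<integral>z. \<bar>f z\<bar> \<partial>tw i)"
    by (simp add: abs_mult)
  show ?thesis using 1 2 unfolding err_def by linarith
qed

lemma vanishing: "vanishing_functionals (tw i) (\<lambda>n. {\<phi>. test_fun (i + int n) \<phi>}) (\<lambda>n \<phi>. err n i \<phi>) 2"
  by (rule vanishing_functionals.intro)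
    (use finite_tw[of i] in \<open>simp_all add: err_add err_cmult err_bound\<close>)

lemma loses_vanishes:
  "loses i f \<longleftrightarrow> vanishing_functionals.vanishes (tw i) (\<lambda>n. {\<phi>. test_fun (i + int n) \<phi>}) (\<lambda>n \<phi>. err n i \<phi>) f"
  unfolding loses_def vanishing_functionals.vanishes_def[OF vanishing] by simp

lemmas loses_add = vanishing_functionals.vanishes_add[OF vanishing, folded loses_vanishes]
lemmas loses_cmult = vanishing_functionals.vanishes_cmult[OF vanishing, folded loses_vanishes]
lemmas loses_cong = vanishing_functionals.vanishes_cong[OF vanishing, folded loses_vanishes, unfolded space_tw]
lemmas loses_disjoint_UN = vanishing_functionals.vanishes_disjoint_UN[OF vanishing, folded loses_vanishes]

text \<open>Passage from the two one-sided \<open>ennreal\<close> estimates to an absolute value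
  over the reals, once all quantities are known to be finite.\<close>

lemma loses_density_class:
  assumes f: "density_class i Q B (\<lambda>z. ennreal (f z))" "\<And>z. 0 \<le> f z" and Q: "Qs \<le> Q" "exp Q \<le> B"
  shows "loses i f"
proof -
  have fm: "fm (\<lambda>z. ennreal (f z))" and m1: "mass i (\<lambda>z. ennreal (f z)) \<le> 1" using f by (auto simp: density_class_def)
  have "(\<lambda>z. enn2real (ennreal (f z))) \<in> borel_measurable (tw i)"
    by (intro measurable_compose[OF fm_tw[OF fm]]) auto
  then have fb [measurable]: "f \<in> borel_measurable (tw i)" using f(2) by simp
  have fint: "integrable (tw i) f"
    using m1 f(2) by (intro integrableI_nonneg) (auto simp: mass_def order.strict_trans1)
  have mf: "(\<integral>z. f z \<partial>tw i) = enn2real (mass i (\<lambda>z. ennreal (f z)))"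
    unfolding mass_def using f(2) by (intro integral_eq_nn_integral) auto
  show ?thesis unfolding loses_def
  proof (intro conjI allI impI fint)
    fix e :: real assume e: "0 < e"
    obtain n0 where n0: "\<And>n \<phi>. n \<ge> n0 \<Longrightarrow> \<phi> \<in> borel_measurable (tw (i + int n)) \<Longrightarrow> \<forall>z\<in>Dl (i + int n). \<phi> z \<le> 1 \<Longrightarrow>
      (\<integral>\<^sup>+z. \<phi> (Fit n i z) * ennreal (f z) \<partial>tw i) \<le>
        mass i (\<lambda>z. ennreal (f z)) * (\<integral>\<^sup>+z. \<phi> z * inv_dens (i + int n) z \<partial>tw (i + int n)) + ennreal e \<and>
      mass i (\<lambda>z. ennreal (f z)) * (\<integral>\<^sup>+z. \<phi> z * inv_dens (i + int n) z \<partial>tw (i + int n)) \<le>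
        (\<integral>\<^sup>+z. \<phi> (Fit n i z) * ennreal (f z) \<partial>tw i) + ennreal e"
      using density_class_forgets[OF f(1) Q e] by blast
    show "\<exists>n0. \<forall>n\<ge>n0. \<forall>\<phi>. test_fun (i + int n) \<phi> \<longrightarrow> \<bar>err n i \<phi> f\<bar> \<le> e"
    proof (intro exI[of _ n0] allI impI)
      fix n \<phi> assume n: "n0 \<le> n" and a: "test_fun (i + int n) \<phi>"
      define \<phi>' where "\<phi>' z = ennreal (\<phi> z)" for z
      have \<phi>': "\<phi>' \<in> borel_measurable (tw (i + int n))" "\<forall>z\<in>Dl (i + int n). \<phi>' z \<le> 1"
        using a unfolding test_fun_def \<phi>'_def by auto
      define X where "X = (\<integral>\<^sup>+z. \<phi>' (Fit n i z) * ennreal (f z) \<partial>tw i)"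
      define Y where "Y = (\<integral>\<^sup>+z. \<phi>' z * inv_dens (i + int n) z \<partial>tw (i + int n))"
      define m where "m = mass i (\<lambda>z. ennreal (f z))"
      have XY: "X \<le> m * Y + ennreal e" "m * Y \<le> X + ennreal e"
        using n0[OF n \<phi>'] unfolding X_def Y_def m_def by auto
      have Y: "Y \<le> 1" unfolding Y_def using \<phi>'(2) by (intro nn_integral_inv_dens_le) auto
      have "m * Y \<le> 1 * 1" using Y m1 unfolding m_def by (intro mult_mono) auto
      have "m * Y < \<top>" using \<open>m * Y \<le> 1 * 1\<close> by (auto simp: order.strict_trans1)
      then have "X < \<top>" using XY(1) by (auto simp: order.strict_trans1)
      then obtain x where x: "X = ennreal x" "0 \<le> x" by (cases X) auto
      obtain t where t: "m * Y = ennreal t" "0 \<le> t" using \<open>m * Y < \<top>\<close> by (cases "m * Y") auto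
      have xt: "x \<le> t + e" "t \<le> x + e"
        using XY x t e by (simp_all add: ennreal_plus[symmetric] ennreal_le_iff del: ennreal_plus)
      have "(\<integral>z. \<phi> (Fit n i z) * f z \<partial>tw i) = enn2real (\<integral>\<^sup>+z. ennreal (\<phi> (Fit n i z) * f z) \<partial>tw i)"
      proof (rule integral_eq_nn_integral)
        show "(\<lambda>z. \<phi> (Fit n i z) * f z) \<in> borel_measurable (tw i)"
          using test_fun_integrable[OF a fint] by auto
        show "AE z in tw i. 0 \<le> \<phi> (Fit n i z) * f z"
          using a f(2) Fit_in[of _ i n] by (intro AE_I2) (auto simp: space_tw test_fun_def)
      qed
      also have "(\<integral>\<^sup>+z. ennreal (\<phi> (Fit n i z) * f z) \<partial>tw i) = X"
        unfolding X_def \<phi>'_def using a f(2) Fit_in[of _ i n]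
        by (intro nn_integral_cong) (auto simp: space_tw test_fun_def ennreal_mult)
      finally have 1: "(\<integral>z. \<phi> (Fit n i z) * f z \<partial>tw i) = x" using x by simp
      have "(\<integral>z. \<phi> z * inv_dens_real (i + int n) z \<partial>tw (i + int n)) = enn2real Y"
        unfolding Y_def \<phi>'_def using a by (intro integral_nonneg_inv_dens_real) (auto simp: test_fun_def)
      then have 2: "(\<integral>z. f z \<partial>tw i) * (\<integral>z. \<phi> z * inv_dens_real (i + int n) z \<partial>tw (i + int n)) = t"
        using t unfolding mf m_def[symmetric] by (simp add: enn2real_mult[symmetric])
      show "\<bar>err n i \<phi> f\<bar> \<le> e" unfolding err_def 1 2 using xt by linarith
    qed
  qed
qed

text \<open>Separation time at least k, expressed by the itinerary over the first k returns. The
  recursion is needed because the orbit bundle knows separation only through the numbers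
  \<open>gb\<close>.\<close>

primrec eqv :: "nat \<Rightarrow> int \<Rightarrow> 'x \<Rightarrow> 'x \<Rightarrow> bool" where
  "eqv 0 i x y \<longleftrightarrow> True"
| "eqv (Suc k) i x y \<longleftrightarrow> (\<exists>A\<in>Pt i. x \<in> A \<and> y \<in> A) \<and> eqv k (i + int (R i x)) (g i x) (g i y)"

definition cyl :: "nat \<Rightarrow> int \<Rightarrow> 'x \<Rightarrow> 'x set" where
  "cyl k i x = {y \<in> space Mb. eqv k i x y}"

lemma Pt_unique: "A \<in> Pt i \<Longrightarrow> B \<in> Pt i \<Longrightarrow> x \<in> A \<Longrightarrow> x \<in> B \<Longrightarrow> A = B"
  using disjointD[OF partition_onD2[OF Pt_partition[of i]]] by blast

lemma eqv_refl: "x \<in> space Mb \<Longrightarrow> eqv k i x x"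
  by (induction k arbitrary: i x) (use Pt_cover g_space in auto)

lemma eqv_sym: "eqv k i x y \<Longrightarrow> eqv k i y x"
proof (induction k arbitrary: i x y)
  case (Suc k)
  then obtain A where A: "A \<in> Pt i" "x \<in> A" "y \<in> A" by auto
  with Suc show ?case using R_const[OF A] by auto
qed simp

lemma eqv_trans: "eqv k i x y \<Longrightarrow> eqv k i y z \<Longrightarrow> eqv k i x z"
proof (induction k arbitrary: i x y z)
  case (Suc k)
  obtain A where A: "A \<in> Pt i" "x \<in> A" "y \<in> A" using Suc.prems(1) by auto
  obtain B where B: "B \<in> Pt i" "y \<in> B" "z \<in> B" using Suc.prems(2) by auto
  have "A = B" by (rule Pt_unique[OF A(1) B(1) A(3) B(2)])
  moreover have "eqv k (i + int (R i x)) (g i x) (g i z)"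
    using Suc.IH[of "i + int (R i x)" "g i x" "g i y" "g i z"] Suc.prems R_const[OF A] by auto
  ultimately show ?case using A B by auto
qed simp

lemma eqv_Suc: "eqv (Suc k) i x y \<Longrightarrow> eqv k i x y"
proof (induction k arbitrary: i x y)
  case (Suc k)
  have "eqv (Suc k) (i + int (R i x)) (g i x) (g i y)" using Suc.prems by simp
  from Suc.IH[OF this] Suc.prems show ?case by (subst eqv.simps) simp
qed simp

lemma eqv_antimono: "k \<le> k' \<Longrightarrow> eqv k' i x y \<Longrightarrow> eqv k i x y"
  by (induction rule: dec_induct) (auto dest: eqv_Suc simp del: eqv.simps)

lemma gb_not_eqv:
  "x \<in> space Mb \<Longrightarrow> y \<in> space Mb \<Longrightarrow> \<not> eqv k i x y \<Longrightarrow> \<gamma> ^ k \<le> gb i x y"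
proof (induction k arbitrary: i x y)
  case (Suc k)
  show ?case
  proof (cases "\<exists>A\<in>Pt i. x \<in> A \<and> y \<in> A")
    case True
    then obtain A where A: "A \<in> Pt i" "x \<in> A" "y \<in> A" by auto
    have "\<gamma> ^ k \<le> gb (i + int (R i x)) (g i x) (g i y)"
      using Suc.prems True by (intro Suc.IH g_space) auto
    then show ?thesis using gb_same[OF A] gamma by simp
  next
    case False
    then have "gb i x y = 1" using Suc.prems by (intro gb_diff) auto
    then show ?thesis using power_le_one[of \<gamma> "Suc k"] gamma by simp
  qed
qed simp

lemma gb_eqv: "eqv k i x y \<Longrightarrow> gb i x y \<le> \<gamma> ^ k"
proof (induction k arbitrary: i x y)
  case 0 then show ?case using gb_bounds by simp
next
  case (Suc k)
  then obtain A where A: "A \<in> Pt i" "x \<in> A" "y \<in> A" by auto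
  have "gb (i + int (R i x)) (g i x) (g i y) \<le> \<gamma> ^ k" using Suc by simp
  then show ?case using gb_same[OF A] gamma by simp
qed

lemma cyl_Suc:
  assumes A: "A \<in> Pt i" "x \<in> A"
  shows "cyl (Suc k) i x = A \<inter> (g i -` cyl k (i + int (R i x)) (g i x) \<inter> space Mb)"
proof (intro set_eqI)
  fix y
  have "(\<exists>B\<in>Pt i. x \<in> B \<and> y \<in> B) \<longleftrightarrow> y \<in> A"
    using A Pt_unique by blast
  then show "y \<in> cyl (Suc k) i x \<longleftrightarrow> y \<in> A \<inter> (g i -` cyl k (i + int (R i x)) (g i x) \<inter> space Mb)"
    using g_space[of y i] by (auto simp: cyl_def)
qed

lemma cyl_sets: "x \<in> space Mb \<Longrightarrow> cyl k i x \<in> sets Mb"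
proof (induction k arbitrary: i x)
  case 0 then show ?case by (simp add: cyl_def)
next
  case (Suc k)
  then obtain A where A: "A \<in> Pt i" "x \<in> A" using Pt_cover by blast
  show ?case unfolding cyl_Suc[OF A]
    by (rule sets.Int[OF Pt_sets[OF A(1)] measurable_sets[OF g_meas Suc.IH[OF g_space[OF Suc.prems]]]])
qed

text \<open>A cylinder of depth k + 1 is cut out of one partition element by the preimage of a
  cylinder of depth k, and the fibre of the latter depends only on that element.\<close>

lemma cyl_countable: "countable (cyl k i ` space Mb)"
proof (induction k arbitrary: i)
  case 0
  have "cyl 0 i ` space Mb \<subseteq> {space Mb}" by (auto simp: cyl_def)
  then show ?case by (rule countable_subset) simp
next
  case (Suc k)
  have "cyl (Suc k) i ` space Mb \<subseteq> (\<Union>A\<in>Pt i. (\<lambda>Z. A \<inter> (g i -` Z \<inter> space Mb)) `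
      (cyl k (i + int (R i (SOME x. x \<in> A))) ` space Mb))"
  proof safe
    fix x assume x: "x \<in> space Mb"
    then obtain A where A: "A \<in> Pt i" "x \<in> A" using Pt_cover by blast
    \<comment> \<open>The return time is constant on A, so any chosen point of A determines the
      fibre reached.\<close>
    have Rx: "R i x = R i (SOME x. x \<in> A)"
      by (rule R_const[OF A someI[of "\<lambda>x. x \<in> A", OF A(2)]])
    have eq: "cyl (Suc k) i x = A \<inter> (g i -` cyl k (i + int (R i (SOME x. x \<in> A))) (g i x) \<inter> space Mb)"
      using cyl_Suc[OF A, of k] unfolding Rx .
    show "cyl (Suc k) i x \<in> (\<Union>A\<in>Pt i. (\<lambda>Z. A \<inter> (g i -` Z \<inter> space Mb)) `
      (cyl k (i + int (R i (SOME x. x \<in> A))) ` space Mb))"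
      by (rule UN_I[OF A(1)], rule image_eqI, rule eq, intro imageI g_space x)
  qed
  moreover have "countable (\<Union>A\<in>Pt i. (\<lambda>Z. A \<inter> (g i -` Z \<inter> space Mb)) `
      (cyl k (i + int (R i (SOME x. x \<in> A))) ` space Mb))"
    by (intro countable_UN countable_image Pt_countable Suc)
  ultimately show ?case by (rule countable_subset)
qed

definition cyls :: "int \<Rightarrow> 'x set set" where
  "cyls i = insert {} (\<Union>k. cyl k i ` space Mb)"

text \<open>Two cylinders that meet are nested, the deeper inside the shallower; disjoint ones are
  the reason for adding the empty set.\<close>

lemma cyls_Int_stable: "Int_stable (cyls i)"
proof (rule Int_stableI)
  fix a b assume a: "a \<in> cyls i" and b: "b \<in> cyls i"
  show "a \<inter> b \<in> cyls i"
  proof (cases "a \<inter> b = {}")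
    case True then show ?thesis by (simp add: cyls_def)
  next
    case False
    then obtain z where z: "z \<in> a" "z \<in> b" by auto
    have sub: "cyl k' i y \<subseteq> cyl k i x" if "k \<le> k'" "z \<in> cyl k i x" "z \<in> cyl k' i y" for k k' x y
    proof
      fix t assume t: "t \<in> cyl k' i y"
      have "eqv k' i z t" using t that eqv_trans eqv_sym unfolding cyl_def by blast
      then have "eqv k i z t" by (rule eqv_antimono[OF that(1)])
      then show "t \<in> cyl k i x" using t that eqv_trans unfolding cyl_def by blast
    qed
    obtain k x where kx: "a = cyl k i x" using a z unfolding cyls_def by auto
    obtain k' y where ky: "b = cyl k' i y" using b z unfolding cyls_def by auto
    have "a \<subseteq> b \<or> b \<subseteq> a" using sub z unfolding kx ky by (meson nle_le)
    then show ?thesis using a b by (auto simp: Int_absorb1 Int_absorb2)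
  qed
qed

lemma cyls_sets: "cyls i \<subseteq> sets Mb"
  unfolding cyls_def using cyl_sets by auto

lemma cyls_Pow: "cyls i \<subseteq> Pow (space Mb)"
  unfolding cyls_def by (auto simp: cyl_def)

text \<open>Deep cylinders around a point are small by \<open>gen\<close>, so an open set is the
  union of the cylinders contained in it, and there are only countably many of these.\<close>

lemma cyls_generate: "sets Mb = sigma_sets (space Mb) (cyls i)"
proof
  define N where "N = sigma (space Mb) (cyls i)"
  have N: "space N = space Mb" "sets N = sigma_sets (space Mb) (cyls i)" unfolding N_def using cyls_Pow[of i] by auto
  have "(\<lambda>x. x) \<in> borel_measurable N"
  proof (rule borel_measurableI)
    fix U :: "'x set" assume U: "open U"
    have cyl_N: "cyl k i x \<in> sets N" if "x \<in> space Mb" for k x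
      unfolding N using that by (intro sigma_sets.Basic) (auto simp: cyls_def)
    define I where "I = {Z \<in> (\<Union>k. cyl k i ` space Mb). Z \<subseteq> U}"
    have "countable I" unfolding I_def
      by (rule countable_subset[of _ "\<Union>k. cyl k i ` space Mb"]) (use cyl_countable in auto)
    have "U \<inter> space Mb = \<Union>I"
    proof
      show "\<Union>I \<subseteq> U \<inter> space Mb" unfolding I_def by (auto simp: cyl_def)
      show "U \<inter> space Mb \<subseteq> \<Union>I"
      proof
        fix x assume x: "x \<in> U \<inter> space Mb"
        obtain e where e: "0 < e" "ball x e \<subseteq> U" using U x by (meson IntD1 openE)
        obtain r where r: "0 < r" "\<And>x y. x \<in> space Mb \<Longrightarrow> y \<in> space Mb \<Longrightarrow> gb i x y < r \<Longrightarrow> dist x y < e"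
          using gen[OF e(1)] by blast
        obtain k where k: "\<gamma> ^ k < r" using real_arch_pow_inv[OF r(1) gamma(2)] by blast
        have "cyl k i x \<subseteq> U"
        proof
          fix y assume y: "y \<in> cyl k i x"
          then have "gb i x y < r" using gb_eqv[of k i x y] k by (simp add: cyl_def)
          then show "y \<in> U" using r(2)[of x y] y x e by (auto simp: cyl_def)
        qed
        moreover have "x \<in> cyl k i x" using x eqv_refl by (simp add: cyl_def)
        ultimately show "x \<in> \<Union>I" using x unfolding I_def by blast
      qed
    qed
    also have "\<Union>I \<in> sets N"
      using \<open>countable I\<close> cyl_N unfolding I_def by (intro sets.countable_Union) auto
    finally show "(\<lambda>x. x) -` U \<inter> space N \<in> sets N" by (simp add: N)
  qed
  then show "sets Mb \<subseteq> sigma_sets (space Mb) (cyls i)"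
    unfolding N(2)[symmetric] sets_Mb sets_restrict_space
    by (auto simp: N(1) Int_commute dest: measurable_sets)
  show "sigma_sets (space Mb) (cyls i) \<subseteq> sets Mb"
    by (intro sets.sigma_sets_subset cyls_sets)
qed

lemma level_sets: "C \<in> sets Mb \<Longrightarrow> C \<times> {l} \<inter> Dl i \<in> sets (tw i)"
  unfolding sets_tw by auto

text \<open>
  A cylinder indicator vanishes somewhere, so it is not log-regular, but \<open>1_C + 1\<close> and \<open>1\<close> both are
  (with an exponent depending on the depth of the cylinder) and their difference is \<open>1_C\<close>.
\<close>
lemma loses_cyl:
  assumes x0: "x0 \<in> space Mb"
  shows "loses i (indicator (cyl k (i - int l) x0 \<times> {l} \<inter> Dl i))"
proof -
  define C where "C = cyl k (i - int l) x0"
  \<comment> \<open>Functions bounded by 2 s have mass at most 1, since the tower has measure at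
    most M; \<open>max M 1\<close> keeps s positive and at most 1 / 2.\<close>
  define s where "s = 1 / (2 * max M 1)"
  have s: "0 < s" "s \<le> 1 / 2" unfolding s_def by (auto simp: field_simps)
  \<comment> \<open>Points in different cylinders of depth k have \<open>gb\<close> at least
    \<gamma>^k, so that Q times \<open>gb\<close> is at least 1 and its exponential at least 2, the
    largest ratio between values of 1 plus an indicator.\<close>
  define Q where "Q = max Qs (1 / \<gamma> ^ k)"
  have Q0: "0 \<le> Q" "Qs \<le> Q" using Qs(1) unfolding Q_def by auto
  have C [measurable]: "C \<in> sets Mb" unfolding C_def by (rule cyl_sets[OF x0])
  define f where "f b z = s * (b * indicator (C \<times> {l}) z + 1)" for b :: real and z :: "'x \<times> nat"
  have cl: "density_class i Q (exp Q) (\<lambda>z. ennreal (f b z))" if b: "b = 0 \<or> b = 1" for b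
  proof -
    have fle: "0 \<le> f b z" "f b z \<le> 2 * s" for z
      using b s by (auto simp: f_def indicator_def)
    have "fm (\<lambda>z. ennreal (f b z))" unfolding f_def
      by (intro measurable_compose[OF _ measurable_ennreal] borel_measurable_times borel_measurable_add
          borel_measurable_const borel_measurable_indicator) auto
    moreover have "log_regular i Q (\<lambda>z. ennreal (f b z))" unfolding log_regular_def
    proof (intro allI ballI)
      fix l' x y assume x: "x \<in> H i l'" and y: "y \<in> H i l'"
      have sp: "x \<in> space Mb" "y \<in> space Mb" using x y H_space by auto
      have "f b (x, l') \<le> exp (Q * gb (i - int l') x y) * f b (y, l')"
      proof (cases "l' = l \<and> \<not> eqv k (i - int l) x y")
        case True
        then have "\<gamma> ^ k \<le> gb (i - int l') x y" using gb_not_eqv[OF sp] by blast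
        then have "1 / \<gamma> ^ k * \<gamma> ^ k \<le> Q * gb (i - int l') x y"
          using gamma Q0 unfolding Q_def by (intro mult_mono) auto
        then have "1 \<le> Q * gb (i - int l') x y" using gamma by simp
        then have "2 \<le> exp (Q * gb (i - int l') x y)"
          using exp_ge_add_one_self[of "Q * gb (i - int l') x y"] by linarith
        then have "2 * s \<le> exp (Q * gb (i - int l') x y) * f b (y, l')"
          using b s by (intro mult_mono) (auto simp: f_def indicator_def)
        then show ?thesis using fle(2)[of "(x, l')"] by linarith
      next
        case False
        have "f b (x, l') = f b (y, l')"
        proof (cases "l' = l")
          case True
          with False have "eqv k (i - int l) x y" by simp
          then have "x \<in> C \<longleftrightarrow> y \<in> C" unfolding C_def cyl_def using sp eqv_trans eqv_sym by blast
          then show ?thesis by (simp add: f_def indicator_def)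
        qed (simp add: f_def indicator_def)
        moreover have "1 * f b (y, l') \<le> exp (Q * gb (i - int l') x y) * f b (y, l')"
          using fle Q0 gb_bounds by (intro mult_right_mono) auto
        ultimately show ?thesis by simp
      qed
      then show "ennreal (f b (x, l')) \<le> ennreal (exp (Q * gb (i - int l') x y)) * ennreal (f b (y, l'))"
        using fle by (simp add: ennreal_mult[symmetric] ennreal_leI)
    qed
    moreover have "ennreal (f b z) \<le> ennreal (exp Q)" for z
    proof (rule ennreal_leI)
      have "f b z \<le> 1" using fle(2)[of z] s by simp
      also have "1 \<le> exp Q" using Q0 by simp
      finally show "f b z \<le> exp Q" .
    qed
    moreover have "mass i (\<lambda>z. ennreal (f b z)) \<le> 1"
    proof -
      have "mass i (\<lambda>z. ennreal (f b z)) \<le> (\<integral>\<^sup>+z. ennreal (2 * s) \<partial>tw i)"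
        unfolding mass_def by (intro nn_integral_mono ennreal_leI fle)
      also have "\<dots> \<le> ennreal (2 * s) * ennreal (max M 1)"
        using emeasure_tw[of i]
        by (auto simp: space_tw intro!: mult_left_mono order_trans[OF emeasure_tw] ennreal_leI)
      also have "\<dots> = 1"
      proof -
        have "2 * s * max M 1 = 1" unfolding s_def by (simp add: field_simps)
        then show ?thesis using s by (simp add: ennreal_mult[symmetric])
      qed
      finally show ?thesis .
    qed
    ultimately show ?thesis by (simp add: density_class_def)
  qed
  have lf: "loses i (f b)" if "b = 0 \<or> b = 1" for b
    by (rule loses_density_class[OF cl[OF that] _ Q0(2) order_refl]) (use that s in \<open>auto simp: f_def\<close>)
  have "loses i (\<lambda>z. (1 / s) * (f 1 z + (-1) * f 0 z))"
    by (intro loses_cmult loses_add lf) auto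
  then show ?thesis
    by (rule loses_cong) (use s in \<open>auto simp: f_def C_def indicator_def field_simps\<close>)
qed

text \<open>Dynkin's argument inside one level. The cylinders are those of fibre i - l, where the
  column of level l starts; a cylinder of depth 0 serves as the whole level when complements are
  taken.\<close>

lemma loses_level:
  assumes "C \<in> sets Mb" shows "loses i (indicator (C \<times> {l} \<inter> Dl i))"
proof -
  have "C \<in> sigma_sets (space Mb) (cyls (i - int l))" using assms cyls_generate by simp
  then show ?thesis
  proof (rule sigma_sets_induct_disjoint[OF cyls_Int_stable cyls_Pow])
    have empty: "loses i (indicator {})"
    proof -
      obtain x0 where x0: "x0 \<in> space Mb" using Mb.not_empty by blast
      show ?thesis by (rule loses_cong[OF loses_cmult[OF loses_cyl[OF x0, of i 0 0], of 0]]) simp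
    qed
    then show "loses i (indicator ({} \<times> {l} \<inter> Dl i))" by simp
    show "loses i (indicator (A \<times> {l} \<inter> Dl i))" if "A \<in> cyls (i - int l)" for A
      using that empty loses_cyl unfolding cyls_def by auto
    show "loses i (indicator ((space Mb - A) \<times> {l} \<inter> Dl i))" if "loses i (indicator (A \<times> {l} \<inter> Dl i))" "A \<in> sigma_sets (space Mb) (cyls (i - int l))" for A
    proof -
      have "A \<in> sets Mb" using that(2) cyls_generate by simp
      then have "A \<subseteq> space Mb" by (rule sets.sets_into_space)
      obtain x0 where x0: "x0 \<in> space Mb" using Mb.not_empty by blast
      have "loses i (\<lambda>z. indicator (cyl 0 (i - int l) x0 \<times> {l} \<inter> Dl i) z + (-1) * indicator (A \<times> {l} \<inter> Dl i) z)"
        by (intro loses_add loses_cmult loses_cyl that x0)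
      then show ?thesis
        by (rule loses_cong) (use \<open>A \<subseteq> space Mb\<close> in \<open>auto simp: indicator_def cyl_def Dl_def\<close>)
    qed
    fix A :: "nat \<Rightarrow> 'x set"
    assume A: "disjoint_family A" "range A \<subseteq> sigma_sets (space Mb) (cyls (i - int l))"
      "\<And>n. loses i (indicator (A n \<times> {l} \<inter> Dl i))"
    have "loses i (indicator (\<Union>n. A n \<times> {l} \<inter> Dl i))"
    proof (rule loses_disjoint_UN[OF _ A(3)])
      show "disjoint_family (\<lambda>n. A n \<times> {l} \<inter> Dl i)" using A(1) by (auto simp: disjoint_family_on_def)
      show "A n \<times> {l} \<inter> Dl i \<in> sets (tw i)" for n
        using A(2) cyls_generate by (intro level_sets) auto
    qed
    moreover have "(\<Union>n. A n \<times> {l} \<inter> Dl i) = (\<Union>n. A n) \<times> {l} \<inter> Dl i" by auto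
    ultimately show "loses i (indicator ((\<Union>n. A n) \<times> {l} \<inter> Dl i))" by simp
  qed
qed

lemma loses_set:
  assumes "B \<in> sets (tw i)" shows "loses i (indicator B)"
proof -
  define C where "C l = (\<lambda>x. (x, l)) -` B \<inter> space Mb" for l
  have B: "B \<in> sets (Mb \<Otimes>\<^sub>M count_space UNIV)" "B \<subseteq> Dl i" using assms by (auto simp: sets_tw)
  have C: "C l \<in> sets Mb" for l
    unfolding C_def by (rule measurable_sets[OF _ B(1)]) (simp add: measurable_Pair2')
  have "loses i (indicator (\<Union>l. C l \<times> {l} \<inter> Dl i))"
    by (intro loses_disjoint_UN loses_level C level_sets) (auto simp: disjoint_family_on_def)
  moreover have "(\<Union>l. C l \<times> {l} \<inter> Dl i) = B" using B(2) by (auto simp: C_def Dl_def)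
  ultimately show ?thesis by simp
qed

lemma loses_integrable:
  assumes "integrable (tw i) f" shows "loses i f"
  using vanishing_functionals.vanishes_integrable[OF vanishing, folded loses_vanishes, OF loses_set assms] .

end

section \<open>Random towers as orbit bundles\<close>

lemma shift_shift [simp]: "shift i (shift j \<omega>) = shift (i + j) \<omega>"
  by (simp add: shift_def fun_eq_iff algebra_simps)

lemma shift_0 [simp]: "shift 0 \<omega> = \<omega>"
  by (simp add: shift_def)

lemma INF_enat_Collect:
  "(INF n\<in>{n. \<not> P n}. enat n) = (if \<forall>n. P n then \<infinity> else enat (LEAST n. \<not> P n))"
proof (cases "\<forall>n. P n")
  case True then show ?thesis by (simp add: top_enat_def)
next
  case False
  then obtain n where "\<not> P n" by blast
  then have L: "\<not> P (LEAST n. \<not> P n)" by (rule LeastI)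
  have "(INF n\<in>{n. \<not> P n}. enat n) = enat (LEAST n. \<not> P n)"
  proof (rule antisym)
    show "(INF n\<in>{n. \<not> P n}. enat n) \<le> enat (LEAST n. \<not> P n)"
      using L by (intro INF_lower) simp
    show "enat (LEAST n. \<not> P n) \<le> (INF n\<in>{n. \<not> P n}. enat n)"
      by (intro INF_greatest) (auto intro: Least_le)
  qed
  then show ?thesis using False by simp
qed

lemma sep_0:
  assumes "\<not> same_cell T p q"
  shows "sep T p q = 0"
proof -
  have "sep T p q \<le> enat 0"
    unfolding sep_def using assms by (intro INF_lower) simp
  then show ?thesis by (simp add: zero_enat_def[symmetric])
qed

text \<open>Points in a common cell pass the test at n = 0, so the first failure moves by exactly
  one return; the infinite case is included.\<close>

lemma sep_Suc:
  assumes "same_cell T p q"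
  shows "sep T p q = eSuc (sep T (return_map T p) (return_map T q))"
proof -
  define P where "P n = same_cell T ((return_map T ^^ n) p) ((return_map T ^^ n) q)" for n
  have P0: "P 0" unfolding P_def using assms by simp
  have PS: "P (Suc n) = same_cell T ((return_map T ^^ n) (return_map T p)) ((return_map T ^^ n) (return_map T q))" for n
    unfolding P_def by (simp only: funpow_Suc_right o_apply)
  have 1: "sep T p q = (if \<forall>n. P n then \<infinity> else enat (LEAST n. \<not> P n))"
    unfolding sep_def P_def[symmetric] by (rule INF_enat_Collect)
  have 2: "sep T (return_map T p) (return_map T q) = (if \<forall>n. P (Suc n) then \<infinity> else enat (LEAST n. \<not> P (Suc n)))"
    unfolding sep_def PS[symmetric] by (rule INF_enat_Collect)
  have iff: "(\<forall>n. P n) \<longleftrightarrow> (\<forall>n. P (Suc n))" using P0 by (metis not0_implies_Suc)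
  show ?thesis
  proof (cases "\<forall>n. P n")
    case True then show ?thesis unfolding 1 2 by simp
  next
    case False
    then obtain n where "\<not> P n" by blast
    then have "(LEAST n. \<not> P n) = Suc (LEAST n. \<not> P (Suc n))"
      using P0 by (intro Least_Suc) auto
    then show ?thesis using False iff unfolding 1 2 by (simp add: eSuc_enat)
  qed
qed

lemma same_cell_sym: "same_cell T p q = same_cell T q p"
  unfolding same_cell_def by (auto split: prod.splits)

lemma sep_sym: "sep T p q = sep T q p"
  unfolding sep_def by (subst same_cell_sym) simp

lemma gpow_eSuc: "gpow \<gamma> (eSuc s) = \<gamma> * gpow \<gamma> s"
  by (cases s) (simp_all add: gpow_def eSuc_enat)

lemma gpow_bounds: "0 < \<gamma> \<Longrightarrow> \<gamma> < 1 \<Longrightarrow> 0 \<le> gpow \<gamma> s \<and> gpow \<gamma> s \<le> 1"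
  by (cases s) (simp_all add: gpow_def power_le_one)

lemma gpow_0 [simp]: "gpow \<gamma> 0 = 1"
  by (simp add: gpow_def zero_enat_def)

lemma gpow_less: "0 < \<gamma> \<Longrightarrow> \<gamma> < 1 \<Longrightarrow> gpow \<gamma> s < \<gamma> ^ n \<Longrightarrow> enat n < s"
  by (cases s) (auto simp: gpow_def power_strict_decreasing_iff)

lemma Fiter_climb: "l + k < rtime T \<omega> x \<Longrightarrow> Fiter T k (shift (int l) \<omega>) (x, l) = (x, l + k)"
  by (induction k) (simp_all add: Fmap_def)

lemma Fiter_return:
  assumes "l < rtime T \<omega> x"
  shows "Fiter T (rtime T \<omega> x - l) (shift (int l) \<omega>) (x, l) = (fiter T (rtime T \<omega> x) \<omega> x, 0)"
proof -
  obtain k where k: "rtime T \<omega> x - l = Suc k" using assms by (cases "rtime T \<omega> x - l") auto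
  then have R: "rtime T \<omega> x = Suc (l + k)" by simp
  have "Fiter T k (shift (int l) \<omega>) (x, l) = (x, l + k)" by (rule Fiter_climb) (simp add: R)
  then show ?thesis unfolding k by (simp add: Fmap_def R add.commute)
qed

lemma base_return_eq: "1 \<le> rtime T \<omega> x \<Longrightarrow> base_return T \<omega> x = fiter T (rtime T \<omega> x) \<omega> x"
  using Fiter_return[of 0 T \<omega> x] by (simp add: base_return_def)

lemma Fiter_add: "Fiter T (m + n) \<omega> z = Fiter T n (shift (int m) \<omega>) (Fiter T m \<omega> z)"
  by (induction n) (simp_all add: add.commute)

text \<open>From level l the first time at level 0, not counting the present, is R - l. It leads to
  the same base point from every level of the column.\<close>

lemma return_map_eq:
  assumes "l < rtime T \<omega> x"
  shows "return_map T (shift (int l) \<omega>, (x, l)) = (shift (int (rtime T \<omega> x)) \<omega>, (base_return T \<omega> x, 0))"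
proof -
  let ?R = "rtime T \<omega> x"
  have "(LEAST k. 1 \<le> k \<and> snd (Fiter T k (shift (int l) \<omega>) (x, l)) = 0) = ?R - l"
  proof (rule Least_equality)
    show "1 \<le> ?R - l \<and> snd (Fiter T (?R - l) (shift (int l) \<omega>) (x, l)) = 0"
      using assms Fiter_return[OF assms] by simp
    fix k assume k: "1 \<le> k \<and> snd (Fiter T k (shift (int l) \<omega>) (x, l)) = 0"
    show "?R - l \<le> k"
    proof (rule ccontr)
      assume "\<not> ?R - l \<le> k"
      then have "l + k < ?R" by simp
      with k Fiter_climb[of l k T \<omega> x] show False by auto
    qed
  qed
  then show ?thesis
    using assms by (simp add: return_map_def Fiter_return base_return_eq of_nat_diff)
qed

lemma cells_eq:
  "cells T \<omega> = {A \<times> {l} | A l. A \<in> part T (shift (- int l) \<omega>) \<and> (\<forall>x\<in>A. l < rtime T (shift (- int l) \<omega>) x)}"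
proof -
  have img: "Fiter T l (shift (- int l) \<omega>) ` (A \<times> {0}) = A \<times> {l}"
    if l: "\<forall>x\<in>A. l < rtime T (shift (- int l) \<omega>) x" for A l
  proof -
    have *: "Fiter T l (shift (- int l) \<omega>) (x, 0) = (x, l)" if "x \<in> A" for x
      using Fiter_climb[of 0 l T "shift (- int l) \<omega>" x] l that by simp
    have "Fiter T l (shift (- int l) \<omega>) ` (A \<times> {0}) = (\<lambda>x. Fiter T l (shift (- int l) \<omega>) (x, 0)) ` A"
      by (auto simp: image_iff)
    also have "\<dots> = (\<lambda>x. (x, l)) ` A" by (intro image_cong * refl)
    also have "\<dots> = A \<times> {l}" by auto
    finally show ?thesis .
  qed
  show ?thesis unfolding cells_def
  proof (rule Collect_cong, intro ex_cong1)
    fix I A l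
    show "(I = Fiter T l (shift (- int l) \<omega>) ` (A \<times> {0}) \<and> A \<in> part T (shift (- int l) \<omega>) \<and>
        (\<forall>x\<in>A. l + 1 \<le> rtime T (shift (- int l) \<omega>) x)) \<longleftrightarrow>
      (I = A \<times> {l} \<and> A \<in> part T (shift (- int l) \<omega>) \<and> (\<forall>x\<in>A. l < rtime T (shift (- int l) \<omega>) x))"
    proof (cases "\<forall>x\<in>A. l < rtime T (shift (- int l) \<omega>) x")
      case True then show ?thesis by (simp add: Suc_le_eq img[OF True])
    next
      case False then show ?thesis by (auto simp: Suc_le_eq)
    qed
  qed
qed

text \<open>The Jacobian identity for images says that g carries the measure with density J on A to
  the measure on B. Cancelling J places the factor 1 / J at the preimage.\<close>

lemma nn_integral_branch:
  assumes A: "A \<in> sets M" and B: "B \<in> sets M" and AB: "A \<subseteq> B"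
    and g: "bij_betw g A B" "g \<in> measurable (restrict_space M A) (restrict_space M B)"
    and gi: "inv_into A g \<in> measurable (restrict_space M B) (restrict_space M A)"
    and J: "jacobian_on M A g J"
    and \<phi>: "\<phi> \<in> borel_measurable (restrict_space M B)"
  shows "(\<integral>\<^sup>+x. \<phi> x * indicator A x \<partial>restrict_space M B) =
    (\<integral>\<^sup>+y. \<phi> (inv_into A g y) * ennreal (1 / J (inv_into A g y)) \<partial>restrict_space M B)"
proof -
  define N where "N = restrict_space M A"
  define K where "K = restrict_space M B"
  have Jm: "J \<in> borel_measurable N" and Jpos: "\<And>x. x \<in> A \<Longrightarrow> 0 < J x"
    and Jint: "\<And>X. X \<in> sets M \<Longrightarrow> X \<subseteq> A \<Longrightarrow> emeasure M (g ` X) = (\<integral>\<^sup>+x\<in>X. ennreal (J x) \<partial>M)"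
    using J unfolding jacobian_on_def N_def by auto
  have sN: "space N = A"
    unfolding N_def K_def using A B sets.sets_into_space by (auto simp: space_restrict_space)
  have g': "g \<in> measurable N K" and gi': "inv_into A g \<in> measurable K N"
    using g gi unfolding N_def K_def by auto
  \<comment> \<open>Weighting the source by J makes g measure-preserving onto B, which is checked on
    sets through their images.\<close>
  define V where "V = density N (\<lambda>x. ennreal (J x))"
  have dV: "distr V K g = K"
  proof (rule measure_eqI)
    fix X assume "X \<in> sets (distr V K g)"
    then have X: "X \<in> sets K" by simp
    then have XB: "X \<subseteq> B" "X \<in> sets M" using B unfolding K_def by (auto simp: sets_restrict_space_iff)
    define Y where "Y = g -` X \<inter> A"
    have YN: "Y \<in> sets N" using measurable_sets[OF g' X] unfolding Y_def sN .
    then have Y: "Y \<in> sets M" "Y \<subseteq> A" using A unfolding N_def by (auto simp: sets_restrict_space_iff)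
    have gY: "g ` Y = X" unfolding Y_def using g(1) XB(1) by (auto simp: bij_betw_def)
    have "emeasure (distr V K g) X = emeasure V Y"
      using g' X unfolding Y_def by (subst emeasure_distr) (auto simp: V_def sN)
    also have "\<dots> = (\<integral>\<^sup>+x. ennreal (J x) * indicator Y x \<partial>N)"
      unfolding V_def using Jm YN by (intro emeasure_density) auto
    also have "\<dots> = (\<integral>\<^sup>+x. ennreal (J x) * indicator Y x * indicator A x \<partial>M)"
      unfolding N_def using A by (intro nn_integral_restrict_space) auto
    also have "\<dots> = (\<integral>\<^sup>+x\<in>Y. ennreal (J x) \<partial>M)"
      using Y(2) by (intro nn_integral_cong) (auto simp: indicator_def)
    also have "\<dots> = emeasure M X" using Jint[OF Y] gY by simp
    also have "\<dots> = emeasure K X" unfolding K_def using B XB by (intro emeasure_restrict_space[symmetric]) auto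
    finally show "emeasure (distr V K g) X = emeasure K X" .
  qed simp
  have \<phi>A: "\<phi> \<in> borel_measurable N"
  proof -
    have "N = restrict_space K A" unfolding N_def K_def using AB by (simp add: restrict_restrict_space Int_absorb1 A B)
    then show ?thesis using \<phi> unfolding K_def by (simp add: measurable_restrict_space1)
  qed
  have \<psi>m: "(\<lambda>y. \<phi> (inv_into A g y) * ennreal (1 / J (inv_into A g y))) \<in> borel_measurable K"
    using measurable_compose[OF gi' \<phi>A] measurable_compose[OF gi' Jm] by measurable
  have "(\<integral>\<^sup>+y. \<phi> (inv_into A g y) * ennreal (1 / J (inv_into A g y)) \<partial>K) =
      (\<integral>\<^sup>+y. \<phi> (inv_into A g y) * ennreal (1 / J (inv_into A g y)) \<partial>distr V K g)"
    by (simp only: dV)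
  also have "\<dots> = (\<integral>\<^sup>+x. \<phi> (inv_into A g (g x)) * ennreal (1 / J (inv_into A g (g x))) \<partial>V)"
    using g' \<psi>m by (intro nn_integral_distr) (simp_all add: V_def)
  also have "\<dots> = (\<integral>\<^sup>+x. ennreal (J x) * (\<phi> (inv_into A g (g x)) * ennreal (1 / J (inv_into A g (g x)))) \<partial>N)"
    unfolding V_def using measurable_compose[OF g' \<psi>m] Jm by (intro nn_integral_density) auto
  also have "\<dots> = (\<integral>\<^sup>+x. \<phi> x \<partial>N)"
  proof (intro nn_integral_cong)
    fix x assume "x \<in> space N"
    then have x: "x \<in> A" by (simp add: sN)
    have "inv_into A g (g x) = x" using g(1) x by (auto simp: bij_betw_def)
    moreover have "ennreal (J x) * ennreal (1 / J x) = 1"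
      using Jpos[OF x] by (simp add: ennreal_mult[symmetric])
    ultimately show "ennreal (J x) * (\<phi> (inv_into A g (g x)) * ennreal (1 / J (inv_into A g (g x)))) = \<phi> x"
      by (metis mult.left_commute mult.right_neutral)
  qed
  also have "\<dots> = (\<integral>\<^sup>+x. \<phi> x * indicator A x \<partial>M)"
    unfolding N_def using A by (intro nn_integral_restrict_space) auto
  also have "\<dots> = (\<integral>\<^sup>+x. \<phi> x * indicator A x * indicator B x \<partial>M)"
    using AB by (intro nn_integral_cong) (auto simp: indicator_def)
  also have "\<dots> = (\<integral>\<^sup>+x. \<phi> x * indicator A x \<partial>K)"
    unfolding K_def using B by (intro nn_integral_restrict_space[symmetric]) auto
  finally show ?thesis unfolding K_def by simp
qed

definition branch_jac :: "('a, 'x) random_tower \<Rightarrow> real \<Rightarrow> real \<Rightarrow> (int \<Rightarrow> 'a) \<Rightarrow> 'x set \<Rightarrow> ('x \<Rightarrow> real) \<Rightarrow> bool" where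
  "branch_jac T \<gamma> D \<omega> A J \<longleftrightarrow> jacobian_on (ref T) A (base_return T \<omega>) J \<and>
     (\<forall>x\<in>A. \<forall>y\<in>A. \<bar>J x / J y - 1\<bar> \<le> D * gpow \<gamma> (sep T
        (shift (int (rtime T \<omega> x)) \<omega>, Fiter T (rtime T \<omega> x) \<omega> (x, 0))
        (shift (int (rtime T \<omega> y)) \<omega>, Fiter T (rtime T \<omega> y) \<omega> (y, 0))))"

text \<open>One Jacobian is selected for every fibre and branch, as a function of the fibre alone.
  Nothing is claimed about measurability in \<omega>.\<close>

definition jac :: "('a, 'x) random_tower \<Rightarrow> real \<Rightarrow> real \<Rightarrow> (int \<Rightarrow> 'a) \<Rightarrow> 'x set \<Rightarrow> 'x \<Rightarrow> real" where
  "jac T \<gamma> D \<omega> A = (SOME J. branch_jac T \<gamma> D \<omega> A J)"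

definition level_tail :: "('a, 'x) random_tower \<Rightarrow> nat \<Rightarrow> (int \<Rightarrow> 'a) \<Rightarrow> ennreal" where
  "level_tail T L \<omega> = (\<Sum>l. emeasure (base_measure T)
     {x \<in> space (base_measure T). l + L < rtime T (shift (- int (l + L)) \<omega>) x})"

text \<open>The almost sure hypotheses at a single \<omega>, with the constants of (P2), (P5) and
  (P6) as parameters because they must be common to all fibres, together with the recurrence of
  small tails in both time directions.\<close>

definition good_fibre ::
  "('a, 'x :: metric_space) random_tower \<Rightarrow> real \<Rightarrow> real \<Rightarrow> real \<Rightarrow> nat \<Rightarrow> (nat \<Rightarrow> nat) \<Rightarrow> (nat \<Rightarrow> real) \<Rightarrow> (int \<Rightarrow> 'a) \<Rightarrow> bool" where
  "good_fibre T \<gamma> D M N t \<epsilon> \<omega> \<longleftrightarrow>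
     \<omega> \<in> space (Pm T) \<and>
     countable (part T \<omega>) \<and> partition_on (base T) (part T \<omega>) \<and> part T \<omega> \<subseteq> sets (ref T) \<and>
     (\<forall>A\<in>part T \<omega>. rtime T \<omega> constant_on A) \<and> (\<forall>x\<in>base T. 1 \<le> rtime T \<omega> x) \<and>
     (\<forall>A\<in>part T \<omega>. bij_betw (base_return T \<omega>) A (base T)) \<and>
     (\<forall>A\<in>part T \<omega>. nonsingular (restrict_space (ref T) A) (base_measure T) (base_return T \<omega>) \<and>
       nonsingular (base_measure T) (restrict_space (ref T) A) (inv_into A (base_return T \<omega>)) \<and>
       (\<exists>J. branch_jac T \<gamma> D \<omega> A J)) \<and>
     (\<forall>e>0. \<exists>n0. \<forall>n\<ge>n0. \<forall>E\<in>cell_join T n \<omega>. bounded (fst ` E) \<and> diameter (fst ` E) \<le> e) \<and>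
     (\<forall>i\<in>{1..N}. \<epsilon> i < measure (ref T) {x \<in> base T. rtime T \<omega> x = t i}) \<and>
     emeasure (tower_measure T \<omega>) (Delta T \<omega>) \<le> ennreal M \<and>
     (\<forall>\<delta>>0. \<exists>L. infinite {n::nat. level_tail T L (shift (int n) \<omega>) \<le> ennreal \<delta>} \<and>
        infinite {n::nat. level_tail T L (shift (- int n) \<omega>) \<le> ennreal \<delta>})"

definition good_orbit where
  "good_orbit T \<gamma> D M N t \<epsilon> \<omega> \<longleftrightarrow> (\<forall>k. good_fibre T \<gamma> D M N t \<epsilon> (shift k \<omega>))"

lemma good_orbit_fibre: "good_orbit T \<gamma> D M N t \<epsilon> \<omega> \<Longrightarrow> good_fibre T \<gamma> D M N t \<epsilon> (shift k \<omega>)"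
  by (simp add: good_orbit_def)

abbreviation orbit_return where "orbit_return T \<omega> \<equiv> (\<lambda>i. base_return T (shift i \<omega>))"
abbreviation orbit_inv where "orbit_inv T \<omega> \<equiv> (\<lambda>i A. inv_into A (base_return T (shift i \<omega>)))"
abbreviation orbit_weight where
  "orbit_weight T \<gamma> D \<omega> \<equiv> (\<lambda>i A y. ennreal (1 / jac T \<gamma> D (shift i \<omega>) A (inv_into A (base_return T (shift i \<omega>)) y)))"
abbreviation orbit_sep where
  "orbit_sep T \<gamma> \<omega> \<equiv> (\<lambda>i x y. gpow \<gamma> (sep T (shift i \<omega>, (x, 0)) (shift i \<omega>, (y, 0))))"

lemma constant_onD: "f constant_on A \<Longrightarrow> x \<in> A \<Longrightarrow> y \<in> A \<Longrightarrow> f x = f y"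
  by (auto simp: constant_on_def)

section \<open>A good orbit as an instance of the bundle of towers\<close>

context
  fixes T :: "('a :: topological_space, 'x :: metric_space) random_tower"
  assumes setting: "tower_setting T"
begin

lemma noise_prob: "prob_space (noise T)" and sets_ref: "sets (ref T) = sets borel"
  and base_sets: "base T \<in> sets (ref T)" and base_mass: "emeasure (ref T) (base T) = 1"
  and rtime_joint: "(\<lambda>(\<omega>, x). rtime T \<omega> x) \<in> measurable (Pm T \<Otimes>\<^sub>M base_measure T) (count_space UNIV)"
  using setting unfolding tower_setting_def by auto

lemma space_ref: "space (ref T) = UNIV"
  using sets_eq_imp_space_eq[OF sets_ref] by simp

lemma space_base: "space (base_measure T) = base T"
  by (simp add: base_measure_def space_restrict_space space_ref)

lemma prob_base: "prob_space (base_measure T)"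
proof
  show "emeasure (base_measure T) (space (base_measure T)) = 1"
    unfolding space_base using base_mass base_sets
    by (simp add: base_measure_def emeasure_restrict_space space_ref)
qed

lemma sets_base: "sets (base_measure T) = sets (restrict_space borel (space (base_measure T)))"
  unfolding space_base unfolding base_measure_def by (rule sets_restrict_space_cong[OF sets_ref])

lemma base_sets_iff: "A \<in> sets (base_measure T) \<longleftrightarrow> A \<subseteq> base T \<and> A \<in> sets (ref T)"
  unfolding base_measure_def by (rule sets_restrict_space_iff) (use base_sets space_ref in auto)

lemma rtime_meas: "\<omega> \<in> space (Pm T) \<Longrightarrow> rtime T \<omega> \<in> measurable (base_measure T) (count_space UNIV)"
  using measurable_compose[OF measurable_Pair1' rtime_joint, of \<omega>] by simp

lemma Delta_eq:
  assumes "\<And>l. partition_on (base T) (part T (shift (- int l) \<omega>))"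
  shows "Delta T \<omega> = {(x, l). x \<in> base T \<and> l < rtime T (shift (- int l) \<omega>) x}"
  using assms by (auto simp: Delta_def partition_on_def)

lemma emeasure_tower:
  assumes p: "\<And>l. partition_on (base T) (part T (shift (- int l) \<omega>))"
    and sp: "\<And>l. shift (- int l) \<omega> \<in> space (Pm T)"
  shows "emeasure (tower_measure T \<omega>) (Delta T \<omega>) = level_tail T 0 \<omega>"
proof -
  define H where "H l = {x \<in> space (base_measure T). l < rtime T (shift (- int l) \<omega>) x}" for l
  have Hs: "H l \<in> sets (base_measure T)" for l
  proof -
    have [measurable]: "rtime T (shift (- int l) \<omega>) \<in> measurable (base_measure T) (count_space UNIV)"
      by (rule rtime_meas[OF sp])
    show ?thesis unfolding H_def by measurable
  qed
  interpret prob_space "base_measure T" by (rule prob_base)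
  interpret C: sigma_finite_measure "count_space (UNIV :: nat set)" by (rule sigma_finite_measure_count_space)
  have D: "Delta T \<omega> = (\<Union>l. H l \<times> {l})"
    unfolding Delta_eq[OF p] H_def space_base by auto
  have Ds: "H l \<times> {l} \<in> sets (base_measure T \<Otimes>\<^sub>M count_space UNIV)" for l using Hs by simp
  have "emeasure (tower_measure T \<omega>) (Delta T \<omega>) = emeasure (base_measure T \<Otimes>\<^sub>M count_space UNIV) (Delta T \<omega>)"
    unfolding tower_measure_def D using Ds by (intro emeasure_restrict_space) auto
  also have "\<dots> = (\<Sum>l. emeasure (base_measure T \<Otimes>\<^sub>M count_space UNIV) (H l \<times> {l}))"
    unfolding D using Ds by (intro suminf_emeasure[symmetric]) (auto simp: disjoint_family_on_def)
  also have "\<dots> = (\<Sum>l. emeasure (base_measure T) (H l))"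
    using Hs by (intro suminf_cong) (simp add: C.emeasure_pair_measure_Times)
  finally show ?thesis by (simp add: level_tail_def H_def)
qed

context
  fixes \<gamma> D M :: real and N :: nat and t :: "nat \<Rightarrow> nat" and \<epsilon> :: "nat \<Rightarrow> real" and \<omega> :: "int \<Rightarrow> 'a"
  assumes good: "good_orbit T \<gamma> D M N t \<epsilon> \<omega>"
    and gam: "0 < \<gamma>" "\<gamma> < 1" and D0: "0 < D"
    and tG: "Gcd (t ` {1..N}) = 1" and eps: "\<forall>i\<in>{1..N}. 0 < \<epsilon> i"
begin

lemma gf: "good_fibre T \<gamma> D M N t \<epsilon> (shift k \<omega>)"
  using good by (rule good_orbit_fibre)

lemma gf_space: "shift k \<omega> \<in> space (Pm T)"
  using gf[of k] unfolding good_fibre_def nonsingular_def by (elim conjE)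

lemma gf_countable: "countable (part T (shift k \<omega>))"
  using gf[of k] unfolding good_fibre_def nonsingular_def by (elim conjE)

lemma gf_partition: "partition_on (base T) (part T (shift k \<omega>))"
  using gf[of k] unfolding good_fibre_def nonsingular_def by (elim conjE)

lemma gf_sets: "A \<in> part T (shift k \<omega>) \<Longrightarrow> A \<in> sets (ref T)"
  using gf[of k] unfolding good_fibre_def nonsingular_def by (elim conjE) blast

lemma gf_const: "A \<in> part T (shift k \<omega>) \<Longrightarrow> x \<in> A \<Longrightarrow> y \<in> A \<Longrightarrow> rtime T (shift k \<omega>) x = rtime T (shift k \<omega>) y"
  using gf[of k] unfolding good_fibre_def nonsingular_def by (elim conjE) (blast dest: constant_onD)

lemma gf_pos: "x \<in> base T \<Longrightarrow> 1 \<le> rtime T (shift k \<omega>) x"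
  using gf[of k] unfolding good_fibre_def nonsingular_def by (elim conjE) blast

lemma gf_bij: "A \<in> part T (shift k \<omega>) \<Longrightarrow> bij_betw (base_return T (shift k \<omega>)) A (base T)"
  using gf[of k] unfolding good_fibre_def nonsingular_def by (elim conjE) blast

lemma gf_meas: "A \<in> part T (shift k \<omega>) \<Longrightarrow> base_return T (shift k \<omega>) \<in> measurable (restrict_space (ref T) A) (base_measure T)"
  using gf[of k] unfolding good_fibre_def nonsingular_def by (elim conjE) blast

lemma gf_inv_meas: "A \<in> part T (shift k \<omega>) \<Longrightarrow> inv_into A (base_return T (shift k \<omega>)) \<in> measurable (base_measure T) (restrict_space (ref T) A)"
  using gf[of k] unfolding good_fibre_def nonsingular_def by (elim conjE) blast

lemma gf_diam: "0 < e \<Longrightarrow> \<exists>n0. \<forall>n\<ge>n0. \<forall>E\<in>cell_join T n (shift k \<omega>). bounded (fst ` E) \<and> diameter (fst ` E) \<le> e"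
  using gf[of k] unfolding good_fibre_def nonsingular_def by (elim conjE) blast

lemma gf_mass: "emeasure (tower_measure T (shift k \<omega>)) (Delta T (shift k \<omega>)) \<le> ennreal M"
  using gf[of k] unfolding good_fibre_def nonsingular_def by (elim conjE)

lemma gf_tail: "0 < \<delta> \<Longrightarrow> \<exists>L. infinite {n::nat. level_tail T L (shift (int n) (shift k \<omega>)) \<le> ennreal \<delta>} \<and>
        infinite {n::nat. level_tail T L (shift (- int n) (shift k \<omega>)) \<le> ennreal \<delta>}"
  using gf[of k] unfolding good_fibre_def nonsingular_def by (elim conjE) blast

lemma gf_eps: "i \<in> {1..N} \<Longrightarrow> \<epsilon> i < measure (ref T) {x \<in> base T. rtime T (shift k \<omega>) x = t i}"
  using gf[of k] unfolding good_fibre_def nonsingular_def by (elim conjE) blast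

lemma gf_jac: "A \<in> part T (shift k \<omega>) \<Longrightarrow> branch_jac T \<gamma> D (shift k \<omega>) A (jac T \<gamma> D (shift k \<omega>) A)"
proof -
  assume A: "A \<in> part T (shift k \<omega>)"
  have "\<exists>J. branch_jac T \<gamma> D (shift k \<omega>) A J"
    using gf[of k] A unfolding good_fibre_def by (elim conjE) blast
  then show ?thesis unfolding jac_def by (rule someI_ex)
qed

lemma part_subset: "A \<in> part T (shift k \<omega>) \<Longrightarrow> A \<subseteq> base T"
  using gf_partition[of k] by (auto simp: partition_on_def)

lemma Delta_orbit: "Delta T (shift k \<omega>) = {(x, l). x \<in> base T \<and> l < rtime T (shift (k - int l) \<omega>) x}"
  using Delta_eq[of "shift k \<omega>"] gf_partition by simp

lemma base_return_base: "x \<in> base T \<Longrightarrow> base_return T (shift k \<omega>) x \<in> base T"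
proof -
  assume "x \<in> base T"
  then obtain A where "A \<in> part T (shift k \<omega>)" "x \<in> A" using gf_partition[of k] by (auto simp: partition_on_def)
  then show ?thesis using bij_betwE[OF gf_bij[of A k]] by blast
qed

lemma same_cell_iff:
  assumes x: "(x, l) \<in> Delta T (shift k \<omega>)" and y: "(y, l') \<in> Delta T (shift k \<omega>)"
  shows "same_cell T (shift k \<omega>, (x, l)) (shift k \<omega>, (y, l')) \<longleftrightarrow>
    l = l' \<and> (\<exists>A\<in>part T (shift (k - int l) \<omega>). x \<in> A \<and> y \<in> A)"
proof
  assume "same_cell T (shift k \<omega>, (x, l)) (shift k \<omega>, (y, l'))"
  then show "l = l' \<and> (\<exists>A\<in>part T (shift (k - int l) \<omega>). x \<in> A \<and> y \<in> A)"
    by (auto simp: same_cell_def cells_eq)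
next
  assume "l = l' \<and> (\<exists>A\<in>part T (shift (k - int l) \<omega>). x \<in> A \<and> y \<in> A)"
  then obtain A where A: "l = l'" "A \<in> part T (shift (k - int l) \<omega>)" "x \<in> A" "y \<in> A" by blast
  have "l < rtime T (shift (k - int l) \<omega>) z" if "z \<in> A" for z
    using gf_const[OF A(2) that A(3)] x by (simp add: Delta_orbit)
  then have "A \<times> {l} \<in> cells T (shift k \<omega>)"
    unfolding cells_eq using A(2) by (intro CollectI exI[of _ A] exI[of _ l]) simp
  then show "same_cell T (shift k \<omega>, (x, l)) (shift k \<omega>, (y, l'))"
    unfolding same_cell_def prod.case using A by (intro conjI refl bexI[of _ "A \<times> {l}"]) simp_all
qed

text \<open>Two points in the same cell of level l return to the base at the same time and at the
  same places as the points below them, so one application of \<open>return_map\<close> yields base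
  points whatever l is.\<close>

lemma sep_level:
  assumes A: "A \<in> part T (shift (k - int l) \<omega>)" "x \<in> A" "y \<in> A"
    and l: "l < rtime T (shift (k - int l) \<omega>) x"
  shows "sep T (shift k \<omega>, (x, l)) (shift k \<omega>, (y, l)) =
    eSuc (sep T (shift (k - int l + int (rtime T (shift (k - int l) \<omega>) x)) \<omega>, (base_return T (shift (k - int l) \<omega>) x, 0))
       (shift (k - int l + int (rtime T (shift (k - int l) \<omega>) x)) \<omega>, (base_return T (shift (k - int l) \<omega>) y, 0)))"
proof -
  have ly: "l < rtime T (shift (k - int l) \<omega>) y" using l gf_const[OF A] by simp
  have D: "(x, l) \<in> Delta T (shift k \<omega>)" "(y, l) \<in> Delta T (shift k \<omega>)"
    using l ly A part_subset[OF A(1)] by (auto simp: Delta_orbit)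
  have "same_cell T (shift k \<omega>, (x, l)) (shift k \<omega>, (y, l))"
    using A unfolding same_cell_iff[OF D] by blast
  then have "sep T (shift k \<omega>, (x, l)) (shift k \<omega>, (y, l)) =
      eSuc (sep T (return_map T (shift k \<omega>, (x, l))) (return_map T (shift k \<omega>, (y, l))))"
    by (rule sep_Suc)
  then show ?thesis
    using return_map_eq[OF l] return_map_eq[OF ly] gf_const[OF A] by (simp add: add.commute)
qed

lemma sep_diff:
  assumes "(x, l) \<in> Delta T (shift k \<omega>)" "(y, l') \<in> Delta T (shift k \<omega>)"
    "\<not> (l = l' \<and> (\<exists>A\<in>part T (shift (k - int l) \<omega>). x \<in> A \<and> y \<in> A))"
  shows "sep T (shift k \<omega>, (x, l)) (shift k \<omega>, (y, l')) = 0"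
  using assms same_cell_iff[OF assms(1,2)] by (intro sep_0) simp

lemma base_Delta: "x \<in> base T \<Longrightarrow> (x, 0) \<in> Delta T (shift k \<omega>)"
  using gf_pos[of x k] by (simp add: Delta_orbit Suc_le_eq)

text \<open>Separation counts returns, whereas the joins in (P3) count time steps. A return takes at
  least one step, so separation beyond j returns keeps the two points in common cells up to time
  j.\<close>

lemma sep_same_cells:
  assumes "x \<in> base T" "y \<in> base T" "enat j < sep T (shift k \<omega>, (x, 0)) (shift k \<omega>, (y, 0))"
  shows "\<exists>I\<in>cells T (shift (k + int j) \<omega>). Fiter T j (shift k \<omega>) (x, 0) \<in> I \<and> Fiter T j (shift k \<omega>) (y, 0) \<in> I"
  using assms
proof (induction j arbitrary: k x y rule: less_induct)
  case (less j)
  have "same_cell T (shift k \<omega>, (x, 0)) (shift k \<omega>, (y, 0))"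
    using less.prems(3) sep_0[of T "(shift k \<omega>, (x, 0))" "(shift k \<omega>, (y, 0))"] by (cases "same_cell T (shift k \<omega>, (x, 0)) (shift k \<omega>, (y, 0))") (auto simp: zero_enat_def)
  then obtain A where A: "A \<in> part T (shift k \<omega>)" "x \<in> A" "y \<in> A"
    using same_cell_iff[OF base_Delta[OF less.prems(1)] base_Delta[OF less.prems(2)]] by auto
  define R where "R = rtime T (shift k \<omega>) x"
  have Ry: "R = rtime T (shift k \<omega>) y" unfolding R_def by (rule gf_const[OF A])
  have R1: "1 \<le> R" unfolding R_def by (rule gf_pos[OF less.prems(1)])
  show ?case
  proof (cases "j < R")
    case True
    have "j < rtime T (shift k \<omega>) z" if "z \<in> A" for z using gf_const[OF A(1) that A(2)] True by (simp add: R_def)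
    then have "A \<times> {j} \<in> cells T (shift (k + int j) \<omega>)"
      unfolding cells_eq using A(1) by (intro CollectI exI[of _ A] exI[of _ j]) simp
    then show ?thesis
      using Fiter_climb[of 0 j T "shift k \<omega>" x] Fiter_climb[of 0 j T "shift k \<omega>" y] True A R_def Ry
      by (intro bexI[of _ "A \<times> {j}"]) auto
  next
    case False
    define x' y' where "x' = base_return T (shift k \<omega>) x" and "y' = base_return T (shift k \<omega>) y"
    have b: "x' \<in> base T" "y' \<in> base T" unfolding x'_def y'_def using less.prems by (auto intro: base_return_base)
    have "sep T (shift k \<omega>, (x, 0)) (shift k \<omega>, (y, 0)) = eSuc (sep T (shift (k + int R) \<omega>, (x', 0)) (shift (k + int R) \<omega>, (y', 0)))"
      using sep_level[of A k 0 x y] A R1 unfolding x'_def y'_def R_def by simp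
    then have "enat j < eSuc (sep T (shift (k + int R) \<omega>, (x', 0)) (shift (k + int R) \<omega>, (y', 0)))"
      using less.prems(3) by simp
    \<comment> \<open>One return is used up on the separation side and R \<ge> 1 steps on the time
      side.\<close>
    then have "enat (j - R) < sep T (shift (k + int R) \<omega>, (x', 0)) (shift (k + int R) \<omega>, (y', 0))"
      using False R1 by (cases "sep T (shift (k + int R) \<omega>, (x', 0)) (shift (k + int R) \<omega>, (y', 0))") (auto simp: eSuc_enat)
    then have "\<exists>I\<in>cells T (shift (k + int R + int (j - R)) \<omega>). Fiter T (j - R) (shift (k + int R) \<omega>) (x', 0) \<in> I \<and> Fiter T (j - R) (shift (k + int R) \<omega>) (y', 0) \<in> I"
      using False R1 b by (intro less.IH) auto
    moreover have "Fiter T j (shift k \<omega>) (x, 0) = Fiter T (j - R) (shift (k + int R) \<omega>) (x', 0)"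
      using Fiter_add[of T R "j - R" "shift k \<omega>" "(x, 0)"] Fiter_return[of 0 T "shift k \<omega>" x] base_return_eq[of T "shift k \<omega>" x] R1 False
      unfolding x'_def R_def by (simp add: add.commute)
    moreover have "Fiter T j (shift k \<omega>) (y, 0) = Fiter T (j - R) (shift (k + int R) \<omega>) (y', 0)"
      using Fiter_add[of T R "j - R" "shift k \<omega>" "(y, 0)"] Fiter_return[of 0 T "shift k \<omega>" y] base_return_eq[of T "shift k \<omega>" y] R1 False
      unfolding y'_def Ry by (simp add: add.commute)
    moreover have "k + int R + int (j - R) = k + int j" using False by simp
    ultimately show ?thesis by simp
  qed
qed

text \<open>By (P3) a single n makes the cells of the join smaller than e, and separation beyond n
  puts two base points into one of these cells; the radius is \<gamma>^n.\<close>

lemma sep_generates: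
  assumes e: "0 < e"
  shows "\<exists>r>0. \<forall>x\<in>base T. \<forall>y\<in>base T. orbit_sep T \<gamma> \<omega> k x y < r \<longrightarrow> dist x y < e"
proof -
  obtain n where n: "\<And>E. E \<in> cell_join T n (shift k \<omega>) \<Longrightarrow> bounded (fst ` E) \<and> diameter (fst ` E) \<le> e / 2"
    using gf_diam[of "e / 2" k] e by (meson half_gt_zero order_refl)
  have "dist x y < e" if x: "x \<in> base T" and y: "y \<in> base T" and s: "orbit_sep T \<gamma> \<omega> k x y < \<gamma> ^ n" for x y
  proof -
    have sn: "enat n < sep T (shift k \<omega>, (x, 0)) (shift k \<omega>, (y, 0))" by (rule gpow_less[OF gam s])
    have "\<exists>I. j \<le> n \<longrightarrow> I \<in> cells T (shift (k + int j) \<omega>) \<and> Fiter T j (shift k \<omega>) (x, 0) \<in> I \<and> Fiter T j (shift k \<omega>) (y, 0) \<in> I" for j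
    proof (cases "j \<le> n")
      case True
      then have "enat j < sep T (shift k \<omega>, (x, 0)) (shift k \<omega>, (y, 0))"
        using sn by (meson enat_ord_simps(1) le_less_trans)
      then show ?thesis using sep_same_cells[OF x y] by blast
    qed simp
    then obtain I where I: "\<And>j. j \<le> n \<Longrightarrow> I j \<in> cells T (shift (k + int j) \<omega>) \<and> Fiter T j (shift k \<omega>) (x, 0) \<in> I j \<and> Fiter T j (shift k \<omega>) (y, 0) \<in> I j"
      by metis
    define E where "E = {z \<in> Delta T (shift k \<omega>). \<forall>j\<le>n. Fiter T j (shift k \<omega>) z \<in> I j}"
    have "E \<in> cell_join T n (shift k \<omega>)" unfolding cell_join_def E_def using I by (auto simp: add.commute)
    then have E: "bounded (fst ` E)" "diameter (fst ` E) \<le> e / 2" using n by auto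
    have "(x, 0) \<in> E" "(y, 0) \<in> E" unfolding E_def using I x y base_Delta by auto
    then have "x \<in> fst ` E" "y \<in> fst ` E" by force+
    then have "dist x y \<le> diameter (fst ` E)" by (rule diameter_bounded_bound[OF E(1)])
    then show ?thesis using E(2) e by simp
  qed
  then show ?thesis using gam by (intro exI[of _ "\<gamma> ^ n"]) auto
qed

lemma base_return_meas: "base_return T (shift k \<omega>) \<in> measurable (base_measure T) (base_measure T)"
proof (rule measurable_piecewise_restrict[OF gf_countable[of k]])
  fix A assume A: "A \<in> part T (shift k \<omega>)"
  have As: "A \<in> sets (base_measure T)" using gf_sets[OF A] part_subset[OF A] by (simp add: base_sets_iff)
  then show "A \<inter> space (base_measure T) \<in> sets (base_measure T)" by simp
  have "restrict_space (base_measure T) A = restrict_space (ref T) A"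
    unfolding base_measure_def using part_subset[OF A] base_sets gf_sets[OF A]
    by (simp add: restrict_restrict_space Int_absorb1)
  then show "base_return T (shift k \<omega>) \<in> measurable (restrict_space (base_measure T) A) (base_measure T)"
    using gf_meas[OF A] by simp
next
  show "space (base_measure T) \<subseteq> \<Union> (part T (shift k \<omega>))"
    using gf_partition[of k] unfolding space_base by (simp add: partition_on_def)
qed

text \<open>Weights are inverse Jacobians at preimages, so (P2) is applied with the preimages of z
  and y in reversed order. Both return at the time of x, because the return time is constant on
  A.\<close>

lemma branch_weight_dist:
  assumes A: "A \<in> part T (shift i \<omega>)" and x: "x \<in> A" and y: "y \<in> base T" and z: "z \<in> base T"
  shows "orbit_weight T \<gamma> D \<omega> i A y \<le>
    ennreal (1 + D * orbit_sep T \<gamma> \<omega> (i + int (rtime T (shift i \<omega>) x)) y z) * orbit_weight T \<gamma> D \<omega> i A z"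
proof -
  let ?g = "base_return T (shift i \<omega>)" and ?J = "jac T \<gamma> D (shift i \<omega>) A" and ?R = "rtime T (shift i \<omega>)"
  define p q where "p = inv_into A ?g y" and "q = inv_into A ?g z"
  have b: "bij_betw ?g A (base T)" by (rule gf_bij[OF A])
  have pq: "p \<in> A" "q \<in> A" "?g p = y" "?g q = z"
    unfolding p_def q_def using b y z by (auto simp: bij_betw_def inv_into_into f_inv_into_f)
  have ret: "Fiter T (?R s) (shift i \<omega>) (s, 0) = (?g s, 0)" if "s \<in> A" for s
    using Fiter_return[of 0 T "shift i \<omega>" s] base_return_eq[of T "shift i \<omega>" s] gf_pos[of s i] part_subset[OF A] that
    by auto
  note bj = gf_jac[OF A, unfolded branch_jac_def]
  have Jp: "0 < ?J p" "0 < ?J q" using bj pq unfolding jacobian_on_def by auto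
  have R: "?R p = ?R x" "?R q = ?R x" using gf_const[OF A _ x] pq by auto
  define G where "G = gpow \<gamma> (sep T (shift (i + int (?R x)) \<omega>, (z, 0)) (shift (i + int (?R x)) \<omega>, (y, 0)))"
  have "\<bar>?J q / ?J p - 1\<bar> \<le> D * gpow \<gamma> (sep T
        (shift (int (?R q)) (shift i \<omega>), Fiter T (?R q) (shift i \<omega>) (q, 0))
        (shift (int (?R p)) (shift i \<omega>), Fiter T (?R p) (shift i \<omega>) (p, 0)))"
    using bj pq by blast
  then have "\<bar>?J q / ?J p - 1\<bar> \<le> D * G"
    using ret[OF pq(1)] ret[OF pq(2)] unfolding pq(3,4) R shift_shift G_def by (simp add: add.commute)
  then have "?J q / ?J p \<le> 1 + D * G" by linarith
  then have "?J q / ?J p * (1 / ?J q) \<le> (1 + D * G) * (1 / ?J q)" using Jp by (intro mult_right_mono) auto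
  then have le: "1 / ?J p \<le> (1 + D * G) * (1 / ?J q)" using Jp by simp
  have G: "orbit_sep T \<gamma> \<omega> (i + int (?R x)) y z = G" unfolding G_def by (simp add: sep_sym)
  have "0 \<le> G" unfolding G_def using gpow_bounds[OF gam] by blast
  then have "ennreal (1 / ?J p) \<le> ennreal (1 + D * G) * ennreal (1 / ?J q)"
    using le Jp D0 by (subst ennreal_mult[symmetric]) (auto intro!: ennreal_leI add_nonneg_nonneg)
  then show ?thesis unfolding G p_def[symmetric] q_def[symmetric] .
qed

lemma tower_orbit:
  "tower_orbit (base_measure T) (\<lambda>i. part T (shift i \<omega>)) (\<lambda>i. rtime T (shift i \<omega>))
     (orbit_return T \<omega>) (orbit_inv T \<omega>) (orbit_weight T \<gamma> D \<omega>) (orbit_sep T \<gamma> \<omega>) \<gamma> D M (t ` {1..N})"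
proof (rule tower_orbit.intro)
  fix i :: int
  show "countable (part T (shift i \<omega>))" by (rule gf_countable)
  show "partition_on (space (base_measure T)) (part T (shift i \<omega>))" unfolding space_base by (rule gf_partition)
  show "rtime T (shift i \<omega>) \<in> measurable (base_measure T) (count_space UNIV)"
    by (rule rtime_meas[OF gf_space])
  show "base_return T (shift i \<omega>) \<in> measurable (base_measure T) (base_measure T)" by (rule base_return_meas)
  show "1 \<le> rtime T (shift i \<omega>) x" if "x \<in> space (base_measure T)" for x
    using gf_pos that by (simp add: space_base)
  fix A assume A: "A \<in> part T (shift i \<omega>)"
  have b: "bij_betw (base_return T (shift i \<omega>)) A (base T)" by (rule gf_bij[OF A])
  show As: "A \<in> sets (base_measure T)" using gf_sets[OF A] part_subset[OF A] by (simp add: base_sets_iff)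
  show "rtime T (shift i \<omega>) x = rtime T (shift i \<omega>) y" if "x \<in> A" "y \<in> A" for x y
    by (rule gf_const[OF A that])
  show "inv_into A (base_return T (shift i \<omega>)) y \<in> A" if "y \<in> space (base_measure T)" for y
    using b that by (auto simp: bij_betw_def inv_into_into space_base)
  show "base_return T (shift i \<omega>) (inv_into A (base_return T (shift i \<omega>)) y) = y" if "y \<in> space (base_measure T)" for y
    using b that by (auto simp: bij_betw_def f_inv_into_f space_base)
  have rs: "restrict_space (base_measure T) A = restrict_space (ref T) A"
    unfolding base_measure_def using part_subset[OF A] base_sets gf_sets[OF A]
    by (simp add: restrict_restrict_space Int_absorb1)
  have inv: "inv_into A (base_return T (shift i \<omega>)) \<in> measurable (base_measure T) (restrict_space (base_measure T) A)"
    unfolding rs by (rule gf_inv_meas[OF A])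
  show "inv_into A (base_return T (shift i \<omega>)) \<in> measurable (base_measure T) (base_measure T)"
    using inv As by (simp add: measurable_restrict_space2_iff)
  have Jm: "jac T \<gamma> D (shift i \<omega>) A \<in> borel_measurable (restrict_space (ref T) A)"
    using gf_jac[OF A] unfolding branch_jac_def jacobian_on_def by blast
  show "(\<lambda>y. orbit_weight T \<gamma> D \<omega> i A y) \<in> borel_measurable (base_measure T)"
    using measurable_compose[OF gf_inv_meas[OF A] Jm] by measurable
  show "(\<integral>\<^sup>+x. \<phi> x * indicator A x \<partial>base_measure T) =
      (\<integral>\<^sup>+y. \<phi> (inv_into A (base_return T (shift i \<omega>)) y) * orbit_weight T \<gamma> D \<omega> i A y \<partial>base_measure T)"
    if "\<phi> \<in> borel_measurable (base_measure T)" for \<phi>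
    using nn_integral_branch[OF gf_sets[OF A] base_sets part_subset[OF A] b _ _ _ , of "jac T \<gamma> D (shift i \<omega>) A" \<phi>]
      gf_meas[OF A] gf_inv_meas[OF A] gf_jac[OF A] that unfolding branch_jac_def base_measure_def by blast
  show "orbit_weight T \<gamma> D \<omega> i A y \<le>
      ennreal (1 + D * orbit_sep T \<gamma> \<omega> (i + int (rtime T (shift i \<omega>) x)) y z) * orbit_weight T \<gamma> D \<omega> i A z"
    if "x \<in> A" "y \<in> space (base_measure T)" "z \<in> space (base_measure T)" for x y z
    using branch_weight_dist[OF A] that unfolding space_base by blast
  show "orbit_sep T \<gamma> \<omega> i x y = \<gamma> * orbit_sep T \<gamma> \<omega> (i + int (rtime T (shift i \<omega>) x))
      (base_return T (shift i \<omega>) x) (base_return T (shift i \<omega>) y)" if "x \<in> A" "y \<in> A" for x y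
    using sep_level[of A i 0 x y] A that gf_pos[of x i] part_subset[OF A] by (auto simp: gpow_eSuc Suc_le_eq)
next
  show "orbit_sep T \<gamma> \<omega> i x y = 1"
    if "x \<in> space (base_measure T)" "y \<in> space (base_measure T)"
      "\<nexists>A. A \<in> part T (shift i \<omega>) \<and> x \<in> A \<and> y \<in> A" for i x y
    using sep_diff[of x 0 i y 0] that base_Delta[of x i] base_Delta[of y i] by (auto simp: space_base)
  show "\<exists>e>0. \<forall>i. ennreal e \<le> emeasure (base_measure T) {x \<in> space (base_measure T). rtime T (shift i \<omega>) x = s}"
    if s: "s \<in> t ` {1..N}" for s
  proof -
    obtain j where j: "j \<in> {1..N}" "s = t j" using s by blast
    have "ennreal (\<epsilon> j) \<le> emeasure (base_measure T) {x \<in> space (base_measure T). rtime T (shift i \<omega>) x = s}" for i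
    proof -
      let ?E = "{x \<in> base T. rtime T (shift i \<omega>) x = t j}"
      have "ennreal (\<epsilon> j) \<le> ennreal (measure (ref T) ?E)"
        using gf_eps[OF j(1), of i] by (intro ennreal_leI) simp
      also have "\<dots> \<le> emeasure (ref T) ?E"
        by (cases "emeasure (ref T) ?E") (auto simp: measure_def)
      also have "\<dots> = emeasure (base_measure T) ?E"
        unfolding base_measure_def using base_sets by (intro emeasure_restrict_space[symmetric]) auto
      finally show ?thesis by (simp add: space_base j)
    qed
    moreover have "0 < \<epsilon> j" using eps j(1) by blast
    ultimately show ?thesis by blast
  qed
  show "\<exists>L. infinite {n. (\<Sum>l. emeasure (base_measure T) {x \<in> space (base_measure T).
        l + L < rtime T (shift (i + int n - int (l + L)) \<omega>) x}) \<le> ennreal \<delta>} \<and>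
      infinite {n. (\<Sum>l. emeasure (base_measure T) {x \<in> space (base_measure T).
        l + L < rtime T (shift (i - int n - int (l + L)) \<omega>) x}) \<le> ennreal \<delta>}" if "0 < \<delta>" for i \<delta>
    using gf_tail[OF that, of i] by (simp add: level_tail_def algebra_simps)
  show "(\<Sum>l. emeasure (base_measure T) {x \<in> space (base_measure T). l < rtime T (shift (i - int l) \<omega>) x}) \<le> ennreal M" for i
    using gf_mass[of i] gf_partition gf_space by (subst (asm) emeasure_tower) (auto simp: level_tail_def)
  show "\<exists>r>0. \<forall>x\<in>space (base_measure T). \<forall>y\<in>space (base_measure T). orbit_sep T \<gamma> \<omega> i x y < r \<longrightarrow> dist x y < e"
    if "0 < e" for e i
    unfolding space_base by (rule sep_generates[OF that])
  show "prob_space (base_measure T)" by (rule prob_base)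
  show "sets (base_measure T) = sets (restrict_space borel (space (base_measure T)))" by (rule sets_base)
  show "0 \<le> orbit_sep T \<gamma> \<omega> i x y" "orbit_sep T \<gamma> \<omega> i x y \<le> 1" for i x y
    using gpow_bounds[OF gam] by blast+
  show "0 < \<gamma>" "\<gamma> < 1" "0 < D" "Gcd (t ` {1..N}) = 1" by (fact gam D0 tG)+
qed

end

end

section \<open>The random tower over the Bernoulli shift\<close>

text \<open>Dominated convergence for the counting measure, with the whole series as
  majorant.\<close>

lemma suminf_ennreal_tail_tendsto_0:
  fixes a :: "nat \<Rightarrow> ennreal"
  assumes "(\<Sum>l. a l) < \<top>"
  shows "(\<lambda>L. \<Sum>l. a (l + L)) \<longlonglongrightarrow> 0"
proof -
  have eq: "(\<Sum>l. a (l + L)) = (\<integral>\<^sup>+n. a n * indicator {L..} n \<partial>count_space UNIV)" for L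
  proof -
    have "(\<Sum>n. a n * indicator {L..} n) = (\<Sum>l. a (l + L) * indicator {L..} (l + L)) + (\<Sum>l<L. a l * indicator {L..} l)"
      by (rule suminf_offset) auto
    then show ?thesis by (simp add: nn_integral_count_space_nat)
  qed
  have "(\<lambda>L. \<integral>\<^sup>+n. a n * indicator {L..} n \<partial>count_space UNIV) \<longlonglongrightarrow> (\<integral>\<^sup>+n. 0 \<partial>count_space (UNIV :: nat set))"
  proof (rule nn_integral_dominated_convergence[where w = a])
    show "(\<integral>\<^sup>+n. a n \<partial>count_space UNIV) < \<infinity>" using assms by (simp add: nn_integral_count_space_nat)
    show "AE n in count_space UNIV. (\<lambda>L. a n * indicator {L..} n) \<longlonglongrightarrow> 0"
    proof (intro AE_I2 tendsto_eventually)
      fix n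
      show "\<forall>\<^sub>F L in sequentially. a n * indicator {L..} n = 0"
        unfolding eventually_sequentially by (intro exI[of _ "Suc n"]) auto
    qed
  qed (auto simp: indicator_def)
  then show ?thesis by (simp add: eq)
qed

context
  fixes T :: "('a :: topological_space, 'x :: metric_space) random_tower"
  assumes setting: "tower_setting T"
begin

lemma prob_Pm: "prob_space (Pm T)"
  unfolding Pm_def by (intro prob_space_PiM noise_prob[OF setting])

lemma shift_measurable: "shift k \<in> measurable (Pm T) (Pm T)"
proof -
  have "(\<lambda>\<omega> i. \<omega> (i + k)) \<in> measurable (PiM UNIV (\<lambda>_. noise T)) (PiM UNIV (\<lambda>_. noise T))"
    by (rule measurable_PiM_single') (auto simp: space_PiM intro!: measurable_component_singleton)
  then show ?thesis by (simp add: Pm_def shift_def[abs_def])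
qed

lemma distr_shift: "distr (Pm T) (Pm T) (shift k) = Pm T"
proof -
  have "distr (PiM UNIV (\<lambda>_. noise T)) (PiM UNIV (\<lambda>i. noise T)) (\<lambda>\<omega>. \<lambda>n\<in>UNIV. \<omega> (n + k)) = PiM UNIV (\<lambda>i. noise T)"
    by (rule distr_PiM_reindex) (auto simp: inj_on_def noise_prob[OF setting])
  then show ?thesis by (simp add: Pm_def shift_def[abs_def] restrict_UNIV)
qed

lemma AE_all_shifts:
  assumes "AE \<omega> in Pm T. Q \<omega>" shows "AE \<omega> in Pm T. \<forall>k. Q (shift k \<omega>)"
proof -
  have "AE \<omega> in Pm T. Q (shift k \<omega>)" for k
  proof (rule AE_distrD[OF shift_measurable])
    show "AE \<omega> in distr (Pm T) (Pm T) (shift k). Q \<omega>" unfolding distr_shift by (rule assms)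
  qed
  then show ?thesis by (simp add: AE_all_countable)
qed

text \<open>Sets depending on finitely many coordinates become independent after finitely many
  shifts, and they form a generating pi-system.\<close>

lemma shift_mixing:
  assumes f: "integrable (Pm T) f" and g: "g \<in> borel_measurable (Pm T)" "\<And>\<omega>. \<omega> \<in> space (Pm T) \<Longrightarrow> \<bar>g \<omega>\<bar> \<le> (c :: real)"
  shows "(\<lambda>n. \<integral>\<omega>. f (shift (int n) \<omega>) * g \<omega> \<partial>Pm T) \<longlonglongrightarrow> (\<integral>\<omega>. f \<omega> \<partial>Pm T) * (\<integral>\<omega>. g \<omega> \<partial>Pm T)"
proof -
  interpret Pr: prob_space "Pm T" by (rule prob_Pm)
  interpret N: prob_space "noise T" by (rule noise_prob[OF setting])
  interpret product_prob_space "\<lambda>_. noise T" "UNIV :: int set" ..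
  let ?G = "prod_algebra (UNIV :: int set) (\<lambda>_. noise T)"
  have Gs: "sigma_sets (space (Pm T)) ?G = sets (Pm T)"
    by (simp add: Pm_def sets_PiM space_PiM)
  show ?thesis
  proof (rule Pr.mixing_from_generator[OF shift_measurable distr_shift _ _ Gs _ f g])
    show "Int_stable ?G" by (rule Int_stable_prod_algebra)
    show "?G \<subseteq> Pow (space (Pm T))" using prod_algebra_sets_into_space by (simp add: Pm_def space_PiM)
    fix A B assume A: "A \<in> ?G" and B: "B \<in> ?G"
    obtain J E where JE: "A = prod_emb UNIV (\<lambda>_. noise T) J (Pi\<^sub>E J E)" "finite J" "\<And>i. i \<in> J \<Longrightarrow> E i \<in> sets (noise T)"
      using prod_algebraE[OF A] by metis
    obtain K F where KF: "B = prod_emb UNIV (\<lambda>_. noise T) K (Pi\<^sub>E K F)" "finite K" "\<And>i. i \<in> K \<Longrightarrow> F i \<in> sets (noise T)"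
      using prod_algebraE[OF B] by metis
    define b where "b = Max (insert 0 (abs ` (J \<union> K)))"
    have b: "\<bar>j\<bar> \<le> b" if "j \<in> J \<union> K" for j
      unfolding b_def using that JE(2) KF(2) by (intro Max_ge) auto
    have emb: "prod_emb UNIV (\<lambda>_. noise T) J' (Pi\<^sub>E J' E') = {\<omega> \<in> space (Pm T). \<forall>i\<in>J'. \<omega> i \<in> E' i}" for J' E'
      by (auto simp: prod_emb_def Pm_def space_PiM PiE_iff)
    \<comment> \<open>From this n on every moved index of K is greater than b and every index of J
      at most b, so the coordinates involved are disjoint and the identity is exact.\<close>
    have "Pr.prob (A \<inter> (shift (int n) -` B \<inter> space (Pm T))) = Pr.prob A * Pr.prob B" if n: "nat (2 * b + 1) \<le> n" for n
    proof -
      define K' where "K' = (\<lambda>k. k + int n) ` K"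
      have dis: "J \<inter> K' = {}"
      proof (rule equals0I)
        fix j assume "j \<in> J \<inter> K'"
        then obtain k where k: "j \<in> J" "k \<in> K" "j = k + int n" unfolding K'_def by blast
        then show False using b[of j] b[of k] n by auto
      qed
      have finK': "finite K'" unfolding K'_def using KF(2) by simp
      \<comment> \<open>One family of conditions for both events; on the moved indices the original
        condition is read back by subtracting n.\<close>
      define E' where "E' i = (if i \<in> J then E i else F (i - int n))" for i
      have E's: "E' i \<in> sets (noise T)" if "i \<in> J \<union> K'" for i
        using that JE(3) KF(3) unfolding E'_def K'_def by auto
      have sh: "shift (int n) \<omega> \<in> space (Pm T)" if "\<omega> \<in> space (Pm T)" for \<omega>
        by (rule measurable_space[OF shift_measurable that])
      have "A \<inter> (shift (int n) -` B \<inter> space (Pm T)) = prod_emb UNIV (\<lambda>_. noise T) (J \<union> K') (Pi\<^sub>E (J \<union> K') E')"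
      proof (rule set_eqI)
        fix \<omega>
        have "(\<forall>i\<in>J \<union> K'. \<omega> i \<in> E' i) \<longleftrightarrow> (\<forall>i\<in>J. \<omega> i \<in> E i) \<and> (\<forall>k\<in>K. \<omega> (k + int n) \<in> F k)"
          using dis unfolding E'_def K'_def by (auto simp: ball_Un)
        then show "\<omega> \<in> A \<inter> (shift (int n) -` B \<inter> space (Pm T)) \<longleftrightarrow> \<omega> \<in> prod_emb UNIV (\<lambda>_. noise T) (J \<union> K') (Pi\<^sub>E (J \<union> K') E')"
          unfolding JE(1) KF(1) emb using sh[of \<omega>] by (auto simp: shift_def)
      qed
      then have "Pr.prob (A \<inter> (shift (int n) -` B \<inter> space (Pm T))) = (\<Prod>i\<in>J \<union> K'. N.prob (E' i))"
        using measure_PiM_emb[of "J \<union> K'" E'] JE(2) finK' E's unfolding Pm_def by simp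
      also have "\<dots> = (\<Prod>i\<in>J. N.prob (E' i)) * (\<Prod>i\<in>K'. N.prob (E' i))"
        by (rule prod.union_disjoint[OF JE(2) finK' dis])
      also have "(\<Prod>i\<in>J. N.prob (E' i)) = (\<Prod>i\<in>J. N.prob (E i))" by (simp add: E'_def)
      also have "(\<Prod>i\<in>K'. N.prob (E' i)) = (\<Prod>i\<in>K'. N.prob (F (i - int n)))"
        using dis by (intro prod.cong) (auto simp: E'_def)
      also have "\<dots> = (\<Prod>k\<in>K. N.prob (F k))"
        unfolding K'_def by (subst prod.reindex) (auto simp: inj_on_def)
      finally show ?thesis
        unfolding JE(1) KF(1) using measure_PiM_emb[of J E] measure_PiM_emb[of K F] JE KF by (simp add: Pm_def)
    qed
    then show "(\<lambda>n. Pr.prob (A \<inter> (shift (int n) -` B \<inter> space (Pm T)))) \<longlonglongrightarrow> Pr.prob A * Pr.prob B"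
      by (intro tendsto_eventually) (auto simp: eventually_sequentially)
  qed
qed

text \<open>Rests on the joint measurability of the return time: the sections of a
  product-measurable set have measurable measure.\<close>

lemma level_tail_measurable: "level_tail T L \<in> borel_measurable (Pm T)"
proof -
  interpret B: prob_space "base_measure T" by (rule prob_base[OF setting])
  have "(\<lambda>\<omega>. emeasure (base_measure T) {x \<in> space (base_measure T). m < rtime T \<omega> x}) \<in> borel_measurable (Pm T)" for m
  proof -
    define Q where "Q = (\<lambda>(\<omega>, x). rtime T \<omega> x) -` {m<..} \<inter> space (Pm T \<Otimes>\<^sub>M base_measure T)"
    have "Q \<in> sets (Pm T \<Otimes>\<^sub>M base_measure T)"
      unfolding Q_def by (rule measurable_sets[OF rtime_joint[OF setting]]) simp
    then have "(\<lambda>\<omega>. emeasure (base_measure T) (Pair \<omega> -` Q)) \<in> borel_measurable (Pm T)"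
      by (rule B.measurable_emeasure_Pair)
    moreover have "Pair \<omega> -` Q = {x \<in> space (base_measure T). m < rtime T \<omega> x}" if "\<omega> \<in> space (Pm T)" for \<omega>
      using that by (auto simp: Q_def space_pair_measure)
    ultimately show ?thesis by (simp cong: measurable_cong)
  qed
  from measurable_compose[OF shift_measurable this] show ?thesis
    unfolding level_tail_def[abs_def] by (intro borel_measurable_suminf_order)
qed

lemma level_tail_mono: "L \<le> L' \<Longrightarrow> level_tail T L' \<omega> \<le> level_tail T L \<omega>"
proof -
  assume "L \<le> L'"
  then obtain d where d: "L' = L + d" using le_Suc_ex by blast
  define a where "a l = emeasure (base_measure T) {x \<in> space (base_measure T). l < rtime T (shift (- int l) \<omega>) x}" for l
  have eq: "level_tail T L \<omega> = (\<Sum>l. a (l + L))" for L by (simp add: level_tail_def a_def)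
  have "(\<Sum>l. a (l + L)) = (\<Sum>l. a ((l + d) + L)) + (\<Sum>l<d. a (l + L))"
    by (rule suminf_offset) auto
  then show ?thesis unfolding eq d by (simp add: add.assoc add.commute[of d L])
qed

text \<open>Finiteness of the tower makes its tails tend to 0, and the recurrence lemma is applied
  to the forward and to the backward shifts.\<close>

lemma AE_visits:
  assumes "AE \<omega> in Pm T. level_tail T 0 \<omega> < \<top>"
  shows "AE \<omega> in Pm T. \<forall>\<delta>>0. \<exists>L. infinite {n::nat. level_tail T L (shift (int n) \<omega>) \<le> ennreal \<delta>} \<and>
        infinite {n::nat. level_tail T L (shift (- int n) \<omega>) \<le> ennreal \<delta>}"
proof -
  interpret P: prob_space "Pm T" by (rule prob_Pm)
  have lim: "AE \<omega> in Pm T. (\<lambda>L. level_tail T L \<omega>) \<longlonglongrightarrow> 0"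
    using assms
  proof eventually_elim
    case (elim \<omega>)
    then show ?case
      using suminf_ennreal_tail_tendsto_0[of "\<lambda>l. emeasure (base_measure T) {x \<in> space (base_measure T). l < rtime T (shift (- int l) \<omega>) x}"]
      by (simp add: level_tail_def[abs_def] level_tail_def)
  qed
  note io = P.AE_infinitely_often_small[OF _ _ level_tail_measurable level_tail_mono lim]
  have "AE \<omega> in Pm T. \<forall>\<delta>>0. \<exists>L. infinite {n::nat. level_tail T L (shift (int n) \<omega>) \<le> ennreal \<delta>}"
    by (rule io[of "\<lambda>n. shift (int n)"]) (rule shift_measurable distr_shift)+
  moreover have "AE \<omega> in Pm T. \<forall>\<delta>>0. \<exists>L. infinite {n::nat. level_tail T L (shift (- int n) \<omega>) \<le> ennreal \<delta>}"
    by (rule io[of "\<lambda>n. shift (- int n)"]) (rule shift_measurable distr_shift)+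
  ultimately show ?thesis
  proof eventually_elim
    case (elim \<omega>)
    show ?case
    proof (intro allI impI)
      fix \<delta> :: real assume \<delta>: "0 < \<delta>"
      obtain L1 where L1: "infinite {n::nat. level_tail T L1 (shift (int n) \<omega>) \<le> ennreal \<delta>}" using elim(1) \<delta> by blast
      obtain L2 where L2: "infinite {n::nat. level_tail T L2 (shift (- int n) \<omega>) \<le> ennreal \<delta>}" using elim(2) \<delta> by blast
      \<comment> \<open>The two directions give different thresholds; by monotonicity the larger one
        serves for both.\<close>
      have "infinite {n::nat. level_tail T (max L1 L2) (shift (int n) \<omega>) \<le> ennreal \<delta>}"
        by (rule infinite_super[OF _ L1]) (auto intro: order_trans[OF level_tail_mono[OF max.cobounded1]])
      moreover have "infinite {n::nat. level_tail T (max L1 L2) (shift (- int n) \<omega>) \<le> ennreal \<delta>}"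
        by (rule infinite_super[OF _ L2]) (auto intro: order_trans[OF level_tail_mono[OF max.cobounded2]])
      ultimately show "\<exists>L. infinite {n::nat. level_tail T L (shift (int n) \<omega>) \<le> ennreal \<delta>} \<and>
        infinite {n::nat. level_tail T L (shift (- int n) \<omega>) \<le> ennreal \<delta>}" by blast
    qed
  qed
qed

end

text \<open>An exactly invariant set \<open>Z\<close> of full measure replaces almost sure
  statements: for \<omega> in \<open>Z\<close> the orbit bundle exists at \<omega> and at each of
  its shifts.\<close>

locale good_tower =
  fixes T :: "('a :: topological_space, 'x :: metric_space) random_tower"
    and \<gamma> D M :: real and N :: nat and t :: "nat \<Rightarrow> nat" and \<epsilon> :: "nat \<Rightarrow> real"
    and Z :: "(int \<Rightarrow> 'a) set"
  assumes setting: "tower_setting T"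
    and gam: "0 < \<gamma>" "\<gamma> < 1" and D0: "0 < D"
    and tG: "Gcd (t ` {1..N}) = 1" and eps: "\<forall>i\<in>{1..N}. 0 < \<epsilon> i"
    and Z_sets: "Z \<in> sets (Pm T)" and Z_AE: "AE \<omega> in Pm T. \<omega> \<in> Z"
    and Z_good: "\<omega> \<in> Z \<Longrightarrow> good_orbit T \<gamma> D M N t \<epsilon> \<omega>"
    and Z_shift: "\<omega> \<in> Z \<Longrightarrow> shift k \<omega> \<in> Z"
begin

text \<open>The locale constant is applied outside its locale, which makes it a total function of
  \<omega>; its properties are available for \<omega> in \<open>Z\<close>. Index 0 is the fibre of
  \<omega> itself.\<close>

definition dens :: "(int \<Rightarrow> 'a) \<Rightarrow> 'x \<times> nat \<Rightarrow> real" where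
  "dens \<omega> = tower_orbit.inv_dens_real (\<lambda>i. part T (shift i \<omega>)) (\<lambda>i. rtime T (shift i \<omega>)) (orbit_inv T \<omega>) (orbit_weight T \<gamma> D \<omega>) 0"

text \<open>Extension by 0 makes the fibre measure null for \<omega> outside \<open>Z\<close>, so
  that integrals over such fibres vanish and no measurability question arises there.\<close>

definition h :: "(int \<Rightarrow> 'a) \<Rightarrow> 'x \<times> nat \<Rightarrow> real" where
  "h \<omega> z = (if \<omega> \<in> Z \<and> z \<in> Delta T \<omega> then dens \<omega> z else 0)"

abbreviation \<nu> :: "(int \<Rightarrow> 'a) \<Rightarrow> ('x \<times> nat) measure" where
  "\<nu> \<equiv> fibre_measure T h"

definition Q :: real where "Q = 2 * D / (1 - \<gamma>)"

lemma space_tower: "space (tower_measure T \<omega>) = Delta T \<omega>"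
  unfolding tower_measure_def
  by (auto simp: space_restrict_space space_pair_measure space_base[OF setting] Delta_def)

lemma space_nu: "space (\<nu> \<omega>) = Delta T \<omega>" and sets_nu: "sets (\<nu> \<omega>) = sets (tower_measure T \<omega>)"
  by (simp_all add: fibre_measure_def space_tower)

lemma nu_outside: "\<omega> \<notin> Z \<Longrightarrow> emeasure (\<nu> \<omega>) A = 0"
proof -
  assume "\<omega> \<notin> Z"
  then have "h \<omega> = (\<lambda>_. 0)" by (simp add: h_def fun_eq_iff)
  then show ?thesis unfolding fibre_measure_def
    by (cases "A \<in> sets (tower_measure T \<omega>)") (auto simp: emeasure_density emeasure_notin_sets)
qed

lemma orbit: "\<omega> \<in> Z \<Longrightarrow> tower_orbit (base_measure T) (\<lambda>i. part T (shift i \<omega>)) (\<lambda>i. rtime T (shift i \<omega>))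
     (orbit_return T \<omega>) (orbit_inv T \<omega>) (orbit_weight T \<gamma> D \<omega>) (orbit_sep T \<gamma> \<omega>) \<gamma> D M (t ` {1..N})"
  by (rule tower_orbit[OF setting Z_good gam D0 tG eps])

section \<open>Translation between the fibres and the orbit bundle\<close>

context
  fixes \<omega> assumes \<omega>: "\<omega> \<in> Z"
begin

interpretation O: tower_orbit "base_measure T" "\<lambda>i. part T (shift i \<omega>)" "\<lambda>i. rtime T (shift i \<omega>)"
  "orbit_return T \<omega>" "orbit_inv T \<omega>" "orbit_weight T \<gamma> D \<omega>" "orbit_sep T \<gamma> \<omega>" \<gamma> D M "t ` {1..N}"
  by (rule orbit[OF \<omega>])

lemmas fibre_context = setting Z_good[OF \<omega>] gam D0 tG eps

lemma O_Dl: "O.Dl k = Delta T (shift k \<omega>)"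
  unfolding O.Dl_def Delta_orbit[OF fibre_context] space_base[OF setting] ..

lemma O_tw: "O.tw k = tower_measure T (shift k \<omega>)"
  unfolding O.tw_def tower_measure_def O_Dl ..

lemma O_Fm: "z \<in> Delta T (shift k \<omega>) \<Longrightarrow> Fmap T (shift k \<omega>) z = O.Fm k z"
proof -
  assume z: "z \<in> Delta T (shift k \<omega>)"
  obtain x l where xl: "z = (x, l)" by (cases z)
  have l: "x \<in> base T" "l < rtime T (shift (k - int l) \<omega>) x"
    using z unfolding xl Delta_orbit[OF fibre_context] by auto
  show ?thesis
  proof (cases "Suc l < rtime T (shift (k - int l) \<omega>) x")
    case True then show ?thesis by (simp add: xl Fmap_def O.Fm_def)
  next
    case False
    then have R: "rtime T (shift (k - int l) \<omega>) x = Suc l" using l by simp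
    then have "base_return T (shift (k - int l) \<omega>) x = fiter T (Suc l) (shift (k - int l) \<omega>) x"
      using base_return_eq[of T "shift (k - int l) \<omega>" x] by simp
    with R show ?thesis by (simp add: xl Fmap_def O.Fm_def)
  qed
qed

lemma O_Fit: "z \<in> Delta T (shift k \<omega>) \<Longrightarrow> Fiter T n (shift k \<omega>) z = O.Fit n k z"
proof (induction n)
  case (Suc n)
  have "O.Fit n k z \<in> Delta T (shift (k + int n) \<omega>)"
    using O.Fit_in[of z k n] Suc.prems unfolding O_Dl .
  from O_Fm[OF this] Suc show ?case by (simp add: add.commute)
qed simp

lemma Fiter_Delta: "z \<in> Delta T (shift k \<omega>) \<Longrightarrow> Fiter T n (shift k \<omega>) z \<in> Delta T (shift (k + int n) \<omega>)"
  using O_Fit[of z k n] O.Fit_in[of z k n] unfolding O_Dl by simp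

text \<open>The bundles over \<omega> and over its shift differ by a translation of the index. Their
  weights agree because the Jacobians were selected as functions of the fibre alone, and so all
  constructions agree term by term.\<close>

lemma dens_shift: "dens (shift k \<omega>) z = O.inv_dens_real k z"
proof -
  interpret S: tower_orbit "base_measure T" "\<lambda>i. part T (shift i (shift k \<omega>))" "\<lambda>i. rtime T (shift i (shift k \<omega>))"
    "orbit_return T (shift k \<omega>)" "orbit_inv T (shift k \<omega>)" "orbit_weight T \<gamma> D (shift k \<omega>)"
    "orbit_sep T \<gamma> (shift k \<omega>)" \<gamma> D M "t ` {1..N}"
    by (rule orbit[OF Z_shift[OF \<omega>]])
  have push: "S.push i f = O.push (i + k) f" for i f
    by (subst S.push_def, subst O.push_def) (simp only: shift_shift diff_add_eq)
  have push_iter: "S.push_iter n i f = O.push_iter n (i + k) f" for n i f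
  proof (induction n)
    case 0 show ?case unfolding S.push_iter.simps(1) O.push_iter.simps(1) ..
  next
    case (Suc n)
    have e: "i + int n + k = i + k + int n" by simp
    show ?case unfolding S.push_iter.simps(2) O.push_iter.simps(2) Suc push e ..
  qed
  have u: "S.past n i = O.past n (i + k)" for n i
    unfolding S.past_def O.past_def push_iter diff_add_eq ..
  have inv_dens: "S.inv_dens i z = O.inv_dens (i + k) z" for i
    unfolding S.inv_dens_def O.inv_dens_def u ..
  show ?thesis unfolding dens_def S.inv_dens_real_def O.inv_dens_real_def inv_dens by simp
qed

lemma h_shift: "z \<in> Delta T (shift k \<omega>) \<Longrightarrow> h (shift k \<omega>) z = O.inv_dens_real k z"
  using Z_shift[OF \<omega>] by (simp add: h_def dens_shift)

lemma h_measurable: "h (shift k \<omega>) \<in> borel_measurable (tower_measure T (shift k \<omega>))"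
proof -
  have "O.inv_dens_real k \<in> borel_measurable (tower_measure T (shift k \<omega>))" using O.inv_dens_real(1)[of k] unfolding O_tw .
  then show ?thesis
    by (rule measurable_cong[THEN iffD1, rotated]) (simp add: space_tower h_shift)
qed

lemma h_nonneg: "0 \<le> h (shift k \<omega>) z"
  using Z_shift[OF \<omega>] O.inv_dens_real(2) by (auto simp: h_def dens_shift)

lemma h_inv_dens: "z \<in> Delta T (shift k \<omega>) \<Longrightarrow> ennreal (h (shift k \<omega>) z) = O.inv_dens k z"
  using O.inv_dens_real(3)[of z k] unfolding O_Dl by (simp add: h_shift)

lemma nn_integral_nu:
  assumes "\<phi> \<in> borel_measurable (tower_measure T (shift k \<omega>))"
  shows "(\<integral>\<^sup>+z. \<phi> z \<partial>\<nu> (shift k \<omega>)) = (\<integral>\<^sup>+z. \<phi> z * O.inv_dens k z \<partial>O.tw k)"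
proof -
  have "(\<integral>\<^sup>+z. \<phi> z \<partial>\<nu> (shift k \<omega>)) = (\<integral>\<^sup>+z. ennreal (h (shift k \<omega>) z) * \<phi> z \<partial>tower_measure T (shift k \<omega>))"
    unfolding fibre_measure_def using assms h_measurable[of k] by (intro nn_integral_density) auto
  also have "\<dots> = (\<integral>\<^sup>+z. \<phi> z * O.inv_dens k z \<partial>O.tw k)"
    unfolding O_tw by (intro nn_integral_cong) (simp add: space_tower h_inv_dens mult.commute)
  finally show ?thesis .
qed

lemma prob_nu: "prob_space (\<nu> (shift k \<omega>))"
proof
  have "emeasure (\<nu> (shift k \<omega>)) (space (\<nu> (shift k \<omega>))) = (\<integral>\<^sup>+z. 1 \<partial>\<nu> (shift k \<omega>))" by simp
  also have "\<dots> = 1" using O.mass_inv_dens[of k] by (subst nn_integral_nu) (auto simp: O.mass_def)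
  finally show "emeasure (\<nu> (shift k \<omega>)) (space (\<nu> (shift k \<omega>))) = 1" .
qed

lemma Fiter_measurable: "Fiter T n (shift k \<omega>) \<in> measurable (tower_measure T (shift k \<omega>)) (tower_measure T (shift (k + int n) \<omega>))"
proof -
  have "O.Fit n k \<in> measurable (tower_measure T (shift k \<omega>)) (tower_measure T (shift (k + int n) \<omega>))"
    using O.Fit_meas[of n k] unfolding O_tw .
  then show ?thesis
    by (rule measurable_cong[THEN iffD1, rotated]) (simp add: space_tower O_Fit)
qed

lemma emeasure_nu_Fiter:
  assumes A: "A \<in> sets (tower_measure T (shift (k + int n) \<omega>))"
  shows "emeasure (\<nu> (shift k \<omega>)) (Fiter T n (shift k \<omega>) -` A \<inter> Delta T (shift k \<omega>)) = emeasure (\<nu> (shift (k + int n) \<omega>)) A"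
proof -
  have B: "Fiter T n (shift k \<omega>) -` A \<inter> Delta T (shift k \<omega>) \<in> sets (tower_measure T (shift k \<omega>))"
    using measurable_sets[OF Fiter_measurable A] by (simp add: space_tower)
  have "emeasure (\<nu> (shift k \<omega>)) (Fiter T n (shift k \<omega>) -` A \<inter> Delta T (shift k \<omega>)) =
      (\<integral>\<^sup>+z. indicator (Fiter T n (shift k \<omega>) -` A \<inter> Delta T (shift k \<omega>)) z \<partial>\<nu> (shift k \<omega>))"
    using B by (simp add: sets_nu)
  also have "\<dots> = (\<integral>\<^sup>+z. indicator (Fiter T n (shift k \<omega>) -` A \<inter> Delta T (shift k \<omega>)) z * O.inv_dens k z \<partial>O.tw k)"
    using B by (intro nn_integral_nu) simp
  also have "\<dots> = (\<integral>\<^sup>+z. indicator A (O.Fit n k z) * O.inv_dens k z \<partial>O.tw k)"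
    by (intro nn_integral_cong) (simp add: O_tw space_tower O_Fit indicator_def)
  also have "\<dots> = (\<integral>\<^sup>+z. indicator A z * O.inv_dens (k + int n) z \<partial>O.tw (k + int n))"
    using A by (intro O.inv_dens_invariant_iter) (auto simp: O_tw indicator_def)
  also have "\<dots> = (\<integral>\<^sup>+z. indicator A z \<partial>\<nu> (shift (k + int n) \<omega>))"
    using A by (intro nn_integral_nu[symmetric]) simp
  also have "\<dots> = emeasure (\<nu> (shift (k + int n) \<omega>)) A" using A by (simp add: sets_nu)
  finally show ?thesis .
qed

text \<open>
  The Jacobians are chosen fibre by fibre, so that \<open>h\<close> need not be jointly measurable; measurability of
  \<open>\<omega> \<mapsto> \<nu>\<^sub>\<omega>(A)\<close> comes from this limit instead, in which only the maps occur.
\<close>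
lemma emeasure_nu_limit:
  assumes A: "A \<in> sets (tower_measure T \<omega>)"
  shows "(\<lambda>n. emeasure (base_measure T) {x \<in> base T. Fiter T n (shift (- int n) \<omega>) (x, 0) \<in> A}) \<longlonglongrightarrow> emeasure (\<nu> \<omega>) A"
proof -
  have A0: "A \<in> sets (O.tw 0)" using A by (simp add: O_tw)
  have "(\<lambda>n. \<integral>\<^sup>+z. indicator A z * O.past n 0 z \<partial>O.tw 0) \<longlonglongrightarrow> (\<integral>\<^sup>+z. indicator A z * O.inv_dens 0 z \<partial>O.tw 0)"
    using A0 by (intro O.integral_past_converges) (auto simp: indicator_def)
  also have "(\<integral>\<^sup>+z. indicator A z * O.inv_dens 0 z \<partial>O.tw 0) = emeasure (\<nu> \<omega>) A"
    using nn_integral_nu[of "indicator A" 0] A by (simp add: sets_nu)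
  finally have lim: "(\<lambda>n. \<integral>\<^sup>+z. indicator A z * O.past n 0 z \<partial>O.tw 0) \<longlonglongrightarrow> emeasure (\<nu> \<omega>) A" .
  have eq: "(\<integral>\<^sup>+z. indicator A z * O.past n 0 z \<partial>O.tw 0) =
      emeasure (base_measure T) {x \<in> base T. Fiter T n (shift (- int n) \<omega>) (x, 0) \<in> A}" for n
  proof -
    let ?B = "{x \<in> base T. Fiter T n (shift (- int n) \<omega>) (x, 0) \<in> A}"
    have k0: "- int n + int n = 0" by simp
    have ind: "indicator A \<in> borel_measurable (O.tw (- int n + int n))" using A0 by simp
    have m: "(\<lambda>z. indicator A (O.Fit n (- int n) z) * O.base_one z) \<in> borel_measurable (O.tw (- int n))"
      by (intro borel_measurable_times_ennreal measurable_compose[OF O.Fit_meas ind] O.fm_tw O.fm_base_one)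
    have "(\<integral>\<^sup>+z. indicator A z * O.past n 0 z \<partial>O.tw 0) =
       (\<integral>\<^sup>+z. indicator A z * O.push_iter n (- int n) O.base_one z \<partial>O.tw (- int n + int n))"
      unfolding O.past_def by simp
    also have "\<dots> = (\<integral>\<^sup>+z. indicator A (O.Fit n (- int n) z) * O.base_one z \<partial>O.tw (- int n))"
      by (rule O.nn_integral_push_iter[OF O.fm_base_one ind])
    also have "\<dots> = (\<Sum>l. \<integral>\<^sup>+x. indicator A (O.Fit n (- int n) (x, l)) * O.base_one (x, l) * indicator (O.H (- int n) l) x \<partial>base_measure T)"
      by (rule O.nn_integral_tw[OF m])
    also have "\<dots> = (\<integral>\<^sup>+x. indicator A (O.Fit n (- int n) (x, 0)) * indicator (O.H (- int n) 0) x \<partial>base_measure T)"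
      by (subst suminf_ennreal_split) (simp add: O.base_one_def)
    also have "\<dots> = (\<integral>\<^sup>+x. indicator ?B x \<partial>base_measure T)"
    proof (intro nn_integral_cong)
      fix x assume "x \<in> space (base_measure T)"
      then have x: "x \<in> base T" by (simp add: space_base[OF setting])
      then have "(x, 0) \<in> Delta T (shift (- int n) \<omega>)" by (rule base_Delta[OF fibre_context])
      from O_Fit[OF this] x show "indicator A (O.Fit n (- int n) (x, 0)) * indicator (O.H (- int n) 0) x = (indicator ?B x :: ennreal)"
        by (simp add: O.H_0 space_base[OF setting] indicator_def)
    qed
    also have "\<dots> = emeasure (base_measure T) ?B"
    proof (rule nn_integral_indicator)
      have "(\<lambda>x. (x, 0)) \<in> measurable (base_measure T) (O.tw (- int n))"
        unfolding O.tw_def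
        by (rule measurable_restrict_space2)
          (auto simp: O_Dl space_base[OF setting] intro: base_Delta[OF fibre_context] measurable_Pair2')
      from measurable_compose[OF this O.Fit_meas, of n] have "(\<lambda>x. O.Fit n (- int n) (x, 0)) -` A \<inter> space (base_measure T) \<in> sets (base_measure T)"
        using A0 by (intro measurable_sets) auto
      moreover have "(\<lambda>x. O.Fit n (- int n) (x, 0)) -` A \<inter> space (base_measure T) = ?B"
        using O_Fit[OF base_Delta[OF fibre_context]] by (auto simp: space_base[OF setting])
      ultimately show "?B \<in> sets (base_measure T)" by simp
    qed
    finally show ?thesis .
  qed
  show ?thesis using lim unfolding eq .
qed

text \<open>Loss of memory for the integrable density \<psi> h, rewritten with the fibre
  measures.\<close>

lemma fibre_memory_loss:
  assumes \<psi>: "\<psi> \<in> borel_measurable (tower_measure T \<omega>)" "\<And>z. z \<in> Delta T \<omega> \<Longrightarrow> \<bar>\<psi> z\<bar> \<le> (c :: real)" and e: "0 < e"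
  shows "\<exists>n0. \<forall>n\<ge>n0. \<forall>\<phi>. \<phi> \<in> borel_measurable (tower_measure T (shift (int n) \<omega>)) \<longrightarrow>
    (\<forall>z\<in>Delta T (shift (int n) \<omega>). 0 \<le> \<phi> z \<and> \<phi> z \<le> 1) \<longrightarrow>
    \<bar>(\<integral>z. \<phi> (Fiter T n \<omega> z) * \<psi> z \<partial>\<nu> \<omega>) - (\<integral>z. \<psi> z \<partial>\<nu> \<omega>) * (\<integral>z. \<phi> z \<partial>\<nu> (shift (int n) \<omega>))\<bar> \<le> e"
proof -
  have hm: "h (shift k \<omega>) \<in> borel_measurable (tower_measure T (shift k \<omega>))" for k by (rule h_measurable)
  have h0: "h \<omega> \<in> borel_measurable (tower_measure T \<omega>)" using hm[of 0] by simp
  have hint: "integrable (tower_measure T \<omega>) (h \<omega>)"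
  proof -
    have "(\<integral>\<^sup>+z. ennreal (h \<omega> z) \<partial>tower_measure T \<omega>) = (\<integral>\<^sup>+z. O.inv_dens 0 z \<partial>O.tw 0)"
      unfolding O_tw shift_0 by (intro nn_integral_cong) (use h_inv_dens[of _ 0] in \<open>simp add: space_tower\<close>)
    also have "\<dots> = 1" using O.mass_inv_dens[of 0] by (simp add: O.mass_def)
    finally show ?thesis using h0 h_nonneg[of 0] by (intro integrableI_nonneg) auto
  qed
  have lin: "(\<integral>z. p z \<partial>\<nu> (shift k \<omega>)) = (\<integral>z. p z * h (shift k \<omega>) z \<partial>tower_measure T (shift k \<omega>))"
    if "p \<in> borel_measurable (tower_measure T (shift k \<omega>))" for p :: "'x \<times> nat \<Rightarrow> real" and k
    unfolding fibre_measure_def using that hm[of k] h_nonneg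
    by (subst integral_density) (auto simp: mult.commute)
  define f where "f z = \<psi> z * h \<omega> z" for z
  have fint: "integrable (O.tw 0) f"
  proof (rule Bochner_Integration.integrable_bound[of _ "\<lambda>z. c * h \<omega> z"])
    show "integrable (O.tw 0) (\<lambda>z. c * h \<omega> z)" using hint by (simp add: O_tw)
    show "f \<in> borel_measurable (O.tw 0)" unfolding f_def using \<psi>(1) h0 by (simp add: O_tw)
    show "AE z in O.tw 0. norm (f z) \<le> norm (c * h \<omega> z)"
    proof (intro AE_I2)
      fix z assume "z \<in> space (O.tw 0)"
      then have z: "z \<in> Delta T \<omega>" by (simp add: O_tw space_tower)
      have "\<bar>\<psi> z\<bar> * h \<omega> z \<le> \<bar>c\<bar> * h \<omega> z"
        using \<psi>(2)[OF z] h_nonneg[of 0 z] by (intro mult_right_mono) auto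
      then show "norm (f z) \<le> norm (c * h \<omega> z)" using h_nonneg[of 0 z] by (simp add: f_def abs_mult)
    qed
  qed
  obtain n0 where n0: "\<And>n \<phi>. n \<ge> n0 \<Longrightarrow> O.test_fun (0 + int n) \<phi> \<Longrightarrow> \<bar>O.err n 0 \<phi> f\<bar> \<le> e"
    using O.loses_integrable[OF fint] e unfolding O.loses_def by blast
  show ?thesis
  proof (intro exI[of _ n0] allI impI)
    fix n \<phi> assume n: "n0 \<le> n" and \<phi>: "\<phi> \<in> borel_measurable (tower_measure T (shift (int n) \<omega>))"
      "\<forall>z\<in>Delta T (shift (int n) \<omega>). 0 \<le> \<phi> z \<and> \<phi> z \<le> (1 :: real)"
    have a: "O.test_fun (0 + int n) \<phi>" unfolding O.test_fun_def O_tw O_Dl using \<phi> by simp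
    have Fm: "(\<lambda>z. \<phi> (Fiter T n \<omega> z)) \<in> borel_measurable (tower_measure T \<omega>)"
      using measurable_compose[OF Fiter_measurable[of n 0], of \<phi> borel] \<phi>(1) by simp
    have 1: "(\<integral>z. \<phi> (Fiter T n \<omega> z) * \<psi> z \<partial>\<nu> \<omega>) = (\<integral>z. \<phi> (O.Fit n 0 z) * f z \<partial>O.tw 0)"
    proof -
      have "(\<integral>z. \<phi> (Fiter T n \<omega> z) * \<psi> z \<partial>\<nu> \<omega>) = (\<integral>z. \<phi> (Fiter T n \<omega> z) * \<psi> z * h \<omega> z \<partial>tower_measure T \<omega>)"
        using lin[of "\<lambda>z. \<phi> (Fiter T n \<omega> z) * \<psi> z" 0] Fm \<psi>(1) by simp
      also have "\<dots> = (\<integral>z. \<phi> (O.Fit n 0 z) * f z \<partial>O.tw 0)"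
        using O_Fit[of _ 0 n] by (intro Bochner_Integration.integral_cong) (auto simp: O_tw space_tower f_def)
      finally show ?thesis .
    qed
    have 2: "(\<integral>z. \<psi> z \<partial>\<nu> \<omega>) = (\<integral>z. f z \<partial>O.tw 0)"
      using lin[of \<psi> 0] \<psi>(1) by (simp add: O_tw f_def[abs_def])
    have 3: "(\<integral>z. \<phi> z \<partial>\<nu> (shift (int n) \<omega>)) = (\<integral>z. \<phi> z * O.inv_dens_real (0 + int n) z \<partial>O.tw (0 + int n))"
    proof -
      have "(\<integral>z. \<phi> z \<partial>\<nu> (shift (int n) \<omega>)) = (\<integral>z. \<phi> z * h (shift (int n) \<omega>) z \<partial>tower_measure T (shift (int n) \<omega>))"
        by (rule lin[OF \<phi>(1)])
      also have "\<dots> = (\<integral>z. \<phi> z * O.inv_dens_real (0 + int n) z \<partial>O.tw (0 + int n))"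
        by (intro Bochner_Integration.integral_cong) (auto simp: O_tw space_tower h_shift)
      finally show ?thesis .
    qed
    show "\<bar>(\<integral>z. \<phi> (Fiter T n \<omega> z) * \<psi> z \<partial>\<nu> \<omega>) - (\<integral>z. \<psi> z \<partial>\<nu> \<omega>) * (\<integral>z. \<phi> z \<partial>\<nu> (shift (int n) \<omega>))\<bar> \<le> e"
      using n0[OF n a] unfolding 1 2 3 O.err_def by simp
  qed
qed

lemma h_bounded: "h \<omega> z \<le> exp Q"
proof (cases "z \<in> Delta T \<omega>")
  case True
  have "ennreal (h \<omega> z) \<le> ennreal (exp Q)"
    using h_inv_dens[of z 0] O.inv_dens_le[of z 0] True unfolding O_Dl by (simp add: Q_def O.Qs_def)
  then show ?thesis by (simp add: ennreal_le_iff)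
qed (simp add: h_def)

text \<open>Log-regularity refers to base points, the function spaces to points of the tower; the
  separation times coincide.\<close>

lemma sep_base:
  assumes "(x, l) \<in> Delta T \<omega>" "(y, l) \<in> Delta T \<omega>"
  shows "sep T (\<omega>, (x, l)) (\<omega>, (y, l)) = sep T (shift (- int l) \<omega>, (x, 0)) (shift (- int l) \<omega>, (y, 0))"
proof -
  have D: "(x, l) \<in> Delta T (shift 0 \<omega>)" "(y, l) \<in> Delta T (shift 0 \<omega>)" using assms by simp_all
  then have l: "x \<in> base T" "y \<in> base T" "l < rtime T (shift (0 - int l) \<omega>) x" unfolding Delta_orbit[OF fibre_context] by auto
  show ?thesis
  proof (cases "\<exists>A\<in>part T (shift (0 - int l) \<omega>). x \<in> A \<and> y \<in> A")
    case True
    then obtain A where A: "A \<in> part T (shift (0 - int l) \<omega>)" "x \<in> A" "y \<in> A" by blast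
    have A': "A \<in> part T (shift (- int l - int 0) \<omega>)" using A(1) by simp
    have l': "0 < rtime T (shift (- int l - int 0) \<omega>) x" using l(3) by simp
    show ?thesis
      using sep_level[OF fibre_context A l(3)] sep_level[OF fibre_context A' A(2,3) l'] by simp
  next
    case False
    have b: "(x, 0) \<in> Delta T (shift (- int l) \<omega>)" "(y, 0) \<in> Delta T (shift (- int l) \<omega>)"
      using base_Delta[OF fibre_context] l by auto
    show ?thesis
      using sep_diff[OF fibre_context D] sep_diff[OF fibre_context b] False by simp
  qed
qed

lemma h_ratio:
  assumes "(x, l) \<in> Delta T \<omega>" "(y, l) \<in> Delta T \<omega>"
  shows "h \<omega> (x, l) \<le> exp (Q * gpow \<gamma> (sep T (\<omega>, (x, l)) (\<omega>, (y, l)))) * h \<omega> (y, l)"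
proof -
  have H: "x \<in> O.H 0 l" "y \<in> O.H 0 l" using assms O_Dl[of 0] by (auto simp: O.Dl_H[symmetric])
  have "O.inv_dens 0 (x, l) \<le> ennreal (exp (O.Qs * gpow \<gamma> (sep T (shift (0 - int l) \<omega>, (x, 0)) (shift (0 - int l) \<omega>, (y, 0))))) * O.inv_dens 0 (y, l)"
    by (rule O.regD[OF O.log_regular_inv_dens H])
  then have "ennreal (h \<omega> (x, l)) \<le> ennreal (exp (Q * gpow \<gamma> (sep T (\<omega>, (x, l)) (\<omega>, (y, l))))) * ennreal (h \<omega> (y, l))"
    using h_inv_dens[of "(x, l)" 0] h_inv_dens[of "(y, l)" 0] assms sep_base[OF assms] by (simp add: Q_def O.Qs_def)
  then show ?thesis using h_nonneg[of 0] by (simp add: ennreal_mult[symmetric] ennreal_le_iff)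
qed

end

end

text \<open>Fubini for a kernel and a real function, by treating positive and negative parts
  separately. Integrability makes both inner integrals finite almost everywhere.\<close>

lemma (in prob_space) integral_bind_kernel:
  fixes q :: "'b \<Rightarrow> real"
  assumes \<kappa>: "\<kappa> \<in> measurable M (subprob_algebra N)"
    and q: "q \<in> borel_measurable N" "integrable (M \<bind> \<kappa>) q"
  shows "(\<integral>p. q p \<partial>(M \<bind> \<kappa>)) = (\<integral>x. (\<integral>p. q p \<partial>\<kappa> x) \<partial>M)"
proof -
  define a b where "a x = (\<integral>\<^sup>+p. ennreal (q p) \<partial>\<kappa> x)" and "b x = (\<integral>\<^sup>+p. ennreal (- q p) \<partial>\<kappa> x)" for x
  have sets_\<kappa>: "sets (\<kappa> x) = sets N" if "x \<in> space M" for x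
    using measurable_space[OF \<kappa> that] by (simp add: space_subprob_algebra)
  have am: "a \<in> borel_measurable M" and base_mass: "b \<in> borel_measurable M"
    unfolding a_def[abs_def] b_def[abs_def]
    using measurable_compose[OF \<kappa> nn_integral_measurable_subprob_algebra, of "\<lambda>p. ennreal (q p)"]
      measurable_compose[OF \<kappa> nn_integral_measurable_subprob_algebra, of "\<lambda>p. ennreal (- q p)"] q(1) by auto
  have aM: "(\<integral>\<^sup>+p. ennreal (q p) \<partial>(M \<bind> \<kappa>)) = (\<integral>\<^sup>+x. a x \<partial>M)"
    unfolding a_def using q(1) by (intro nn_integral_bind[OF _ \<kappa>]) auto
  have bM: "(\<integral>\<^sup>+p. ennreal (- q p) \<partial>(M \<bind> \<kappa>)) = (\<integral>\<^sup>+x. b x \<partial>M)"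
    unfolding b_def using q(1) by (intro nn_integral_bind[OF _ \<kappa>]) auto
  have fin: "(\<integral>\<^sup>+x. a x \<partial>M) < \<top>" "(\<integral>\<^sup>+x. b x \<partial>M) < \<top>"
    using q(2) aM bM by (auto simp: real_integrable_def top.not_eq_extremum)
  have afin: "AE x in M. a x < \<top>" and bfin: "AE x in M. b x < \<top>"
    using nn_integral_PInf_AE[OF am] nn_integral_PInf_AE[OF base_mass] fin by (auto simp: top.not_eq_extremum)
  have ai: "integrable M (\<lambda>x. enn2real (a x))" "(\<integral>x. enn2real (a x) \<partial>M) = enn2real (\<integral>\<^sup>+x. a x \<partial>M)"
    and bi: "integrable M (\<lambda>x. enn2real (b x))" "(\<integral>x. enn2real (b x) \<partial>M) = enn2real (\<integral>\<^sup>+x. b x \<partial>M)"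
  proof -
    have 1: "(\<integral>\<^sup>+x. ennreal (enn2real (a x)) \<partial>M) = (\<integral>\<^sup>+x. a x \<partial>M)"
      using afin by (intro nn_integral_cong_AE) auto
    have 2: "(\<integral>\<^sup>+x. ennreal (enn2real (b x)) \<partial>M) = (\<integral>\<^sup>+x. b x \<partial>M)"
      using bfin by (intro nn_integral_cong_AE) auto
    show "integrable M (\<lambda>x. enn2real (a x))" "integrable M (\<lambda>x. enn2real (b x))"
      using am base_mass 1 2 fin by (auto intro!: integrableI_nonneg)
    show "(\<integral>x. enn2real (a x) \<partial>M) = enn2real (\<integral>\<^sup>+x. a x \<partial>M)"
      unfolding 1[symmetric] using am by (intro integral_eq_nn_integral) auto
    show "(\<integral>x. enn2real (b x) \<partial>M) = enn2real (\<integral>\<^sup>+x. b x \<partial>M)"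
      unfolding 2[symmetric] using base_mass by (intro integral_eq_nn_integral) auto
  qed
  define J where "J x = (\<integral>p. q p \<partial>\<kappa> x)" for x
  have J_eq: "J x = enn2real (a x) - enn2real (b x)" if "x \<in> space M" "a x < \<top>" "b x < \<top>" for x
  proof -
    have "q \<in> borel_measurable (\<kappa> x)" using q(1) sets_\<kappa>[OF that(1)] by (simp cong: measurable_cong_sets)
    then have "integrable (\<kappa> x) q" using that unfolding real_integrable_def a_def b_def by auto
    then show ?thesis unfolding J_def a_def b_def by (rule real_lebesgue_integral_def)
  qed
  \<comment> \<open>Where one of the parts is infinite, q is not integrable for the kernel and its
    integral is 0 by convention; hence \<open>J\<close> is measurable on all of M.\<close>
  have J_if: "J x = (if a x < \<top> \<and> b x < \<top> then enn2real (a x) - enn2real (b x) else 0)" if x: "x \<in> space M" for x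
  proof (cases "a x < \<top> \<and> b x < \<top>")
    case False
    then have "\<not> integrable (\<kappa> x) q" unfolding real_integrable_def a_def b_def by (auto simp: top.not_eq_extremum)
    then show ?thesis unfolding J_def if_not_P[OF False] by (rule not_integrable_integral_eq)
  qed (use J_eq x in auto)
  have Jm: "J \<in> borel_measurable M"
    using am base_mass by (subst measurable_cong[OF J_if]) auto
  have "(\<integral>x. J x \<partial>M) = (\<integral>x. enn2real (a x) - enn2real (b x) \<partial>M)"
  proof (rule integral_cong_AE)
    show "AE x in M. J x = enn2real (a x) - enn2real (b x)"
      using afin bfin AE_space by eventually_elim (rule J_eq)
  qed (use Jm am base_mass in auto)
  also have "\<dots> = enn2real (\<integral>\<^sup>+x. a x \<partial>M) - enn2real (\<integral>\<^sup>+x. b x \<partial>M)" using ai bi by simp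
  also have "\<dots> = (\<integral>p. q p \<partial>(M \<bind> \<kappa>))"
    unfolding aM[symmetric] bM[symmetric] by (rule real_lebesgue_integral_def[OF q(2), symmetric])
  finally show ?thesis unfolding J_def ..
qed

section \<open>Joint measurability over the invariant set, and exactness\<close>

context good_tower
begin

abbreviation Mb where "Mb \<equiv> base_measure T"
abbreviation Y where "Y \<equiv> Mb \<Otimes>\<^sub>M count_space (UNIV :: nat set)"
abbreviation W where "W \<equiv> restrict_space (Pm T) Z"

lemma W_space: "space W = Z"
  using sets.sets_into_space[OF Z_sets] by (auto simp: space_restrict_space)

lemma W_incl: "(\<lambda>\<omega>. \<omega>) \<in> measurable W (Pm T)"
  by (rule measurable_restrict_space1) simp

lemma shift_W: "shift k \<in> measurable W W"
  by (rule measurable_restrict_space3[OF shift_measurable[OF setting]]) (use Z_shift in auto)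

lemma Mb_incl: "(\<lambda>x. x) \<in> measurable Mb (ref T)"
  unfolding base_measure_def by (rule measurable_restrict_space1) simp

lemma fiter_joint: "(\<lambda>(x, \<omega>). (fiter T n \<omega> x, shift (int n) \<omega>)) \<in> measurable (ref T \<Otimes>\<^sub>M Pm T) (ref T \<Otimes>\<^sub>M Pm T)"
proof (induction n)
  case 0 show ?case by (simp add: measurable_ident_sets split_beta')
next
  case (Suc n)
  have S: "(\<lambda>(x, \<omega>). (fmap T (\<omega> 0) x, shift 1 \<omega>)) \<in> measurable (ref T \<Otimes>\<^sub>M Pm T) (ref T \<Otimes>\<^sub>M Pm T)"
    using setting unfolding tower_setting_def by blast
  from measurable_compose[OF Suc S]
  show ?case by (simp add: split_beta' add.commute)
qed

lemma rtime_W: "(\<lambda>p. rtime T (fst p) (snd p)) \<in> measurable (W \<Otimes>\<^sub>M Mb) (count_space UNIV)"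
proof -
  have "(\<lambda>p. (fst p, snd p)) \<in> measurable (W \<Otimes>\<^sub>M Mb) (Pm T \<Otimes>\<^sub>M Mb)"
    by (intro measurable_Pair measurable_compose[OF measurable_fst W_incl] measurable_snd)
  from measurable_compose[OF this rtime_joint[OF setting]] show ?thesis by simp
qed

text \<open>The return time has countably many values, and the iterate is jointly measurable for
  each of them. Over \<open>Z\<close> the image lies in the base, which allows \<open>Mb\<close> as
  target.\<close>

lemma base_return_W: "(\<lambda>p. base_return T (fst p) (snd p)) \<in> measurable (W \<Otimes>\<^sub>M Mb) Mb"
proof -
  have 1: "(\<lambda>p. (snd p, fst p)) \<in> measurable (W \<Otimes>\<^sub>M Mb) (ref T \<Otimes>\<^sub>M Pm T)"
    by (intro measurable_Pair measurable_compose[OF measurable_fst W_incl] measurable_compose[OF measurable_snd Mb_incl])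
  have "(\<lambda>p. fiter T n (fst p) (snd p)) \<in> measurable (W \<Otimes>\<^sub>M Mb) (ref T)" for n
    using measurable_compose[OF measurable_compose[OF 1 fiter_joint[of n]] measurable_fst] by simp
  from measurable_compose_countable[OF this rtime_W]
  have 2: "(\<lambda>p. fiter T (rtime T (fst p) (snd p)) (fst p) (snd p)) \<in> measurable (W \<Otimes>\<^sub>M Mb) (ref T)" .
  have sp: "fst p \<in> Z \<and> snd p \<in> base T" if "p \<in> space (W \<Otimes>\<^sub>M Mb)" for p
    using that by (auto simp: space_pair_measure W_space space_base[OF setting])
  have "base_return T (fst p) (snd p) = fiter T (rtime T (fst p) (snd p)) (fst p) (snd p)" if "p \<in> space (W \<Otimes>\<^sub>M Mb)" for p
    using gf_pos[OF setting Z_good gam D0 tG eps, of "fst p" "snd p" 0] sp[OF that] by (intro base_return_eq) simp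
  then have 3: "(\<lambda>p. base_return T (fst p) (snd p)) \<in> measurable (W \<Otimes>\<^sub>M Mb) (ref T)"
    using 2 by (simp cong: measurable_cong)
  have "(\<lambda>p. base_return T (fst p) (snd p)) \<in> measurable (W \<Otimes>\<^sub>M Mb) (restrict_space (ref T) (base T))"
  proof (rule measurable_restrict_space2[OF _ 3])
    show "(\<lambda>p. base_return T (fst p) (snd p)) \<in> space (W \<Otimes>\<^sub>M Mb) \<rightarrow> base T"
      using base_return_base[OF setting Z_good gam D0 tG eps, of _ _ 0] sp by auto
  qed
  then show ?thesis by (simp add: base_measure_def)
qed

text \<open>Off the tower \<open>Fmap\<close> could leave the base, as it iterates for a number of
  steps unrelated to the return time. Using \<open>base_return\<close> gives a map that agrees on
  the tower and preserves the whole product over \<open>Z\<close>.\<close>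

definition Fmap_joint :: "(int \<Rightarrow> 'a) \<times> ('x \<times> nat) \<Rightarrow> 'x \<times> nat" where
  "Fmap_joint p = (if Suc (snd (snd p)) < rtime T (shift (- int (snd (snd p))) (fst p)) (fst (snd p))
     then (fst (snd p), Suc (snd (snd p)))
     else (base_return T (shift (- int (snd (snd p))) (fst p)) (fst (snd p)), 0))"

definition skew :: "(int \<Rightarrow> 'a) \<times> ('x \<times> nat) \<Rightarrow> (int \<Rightarrow> 'a) \<times> ('x \<times> nat)" where
  "skew p = (shift 1 (fst p), Fmap_joint p)"

lemma level_W: "(\<lambda>p. snd (snd p)) \<in> measurable (W \<Otimes>\<^sub>M Y) (count_space UNIV)"
  by (rule measurable_compose[OF measurable_snd measurable_snd])

lemma fibre_point_W: "(\<lambda>p. (shift (- int l) (fst p), fst (snd p))) \<in> measurable (W \<Otimes>\<^sub>M Y) (W \<Otimes>\<^sub>M Mb)"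
  by (intro measurable_Pair measurable_compose[OF measurable_fst shift_W]
      measurable_compose[OF measurable_snd measurable_fst])

lemma Fmap_joint_measurable: "Fmap_joint \<in> measurable (W \<Otimes>\<^sub>M Y) Y"
proof -
  have "(\<lambda>p. if Suc l < rtime T (shift (- int l) (fst p)) (fst (snd p))
     then (fst (snd p), Suc l) else (base_return T (shift (- int l) (fst p)) (fst (snd p)), 0)) \<in> measurable (W \<Otimes>\<^sub>M Y) Y" for l
  proof (rule measurable_If)
    show "(\<lambda>p. (fst (snd p), Suc l)) \<in> measurable (W \<Otimes>\<^sub>M Y) Y"
      by (intro measurable_Pair measurable_compose[OF measurable_snd measurable_fst]) simp
    show "(\<lambda>p. (base_return T (shift (- int l) (fst p)) (fst (snd p)), 0)) \<in> measurable (W \<Otimes>\<^sub>M Y) Y"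
      using measurable_compose[OF fibre_point_W base_return_W] by (intro measurable_Pair) simp_all
    have "(\<lambda>p. rtime T (shift (- int l) (fst p)) (fst (snd p))) \<in> measurable (W \<Otimes>\<^sub>M Y) (count_space UNIV)"
      using measurable_compose[OF fibre_point_W rtime_W] by simp
    then show "{p \<in> space (W \<Otimes>\<^sub>M Y). Suc l < rtime T (shift (- int l) (fst p)) (fst (snd p))} \<in> sets (W \<Otimes>\<^sub>M Y)"
      by measurable
  qed
  from measurable_compose_countable[OF this level_W] show ?thesis
    unfolding Fmap_joint_def[abs_def] .
qed

lemma skew_measurable: "skew \<in> measurable (W \<Otimes>\<^sub>M Y) (W \<Otimes>\<^sub>M Y)"
  unfolding skew_def[abs_def]
  by (intro measurable_Pair measurable_compose[OF measurable_fst shift_W] Fmap_joint_measurable)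

lemma skew_iter_measurable: "skew ^^ n \<in> measurable (W \<Otimes>\<^sub>M Y) (W \<Otimes>\<^sub>M Y)"
  by (rule measurable_compose_n) (rule skew_measurable)

lemma skew_eq:
  assumes "\<omega> \<in> Z" "z \<in> Delta T \<omega>" shows "skew (\<omega>, z) = (shift 1 \<omega>, Fmap T \<omega> z)"
proof -
  interpret O: tower_orbit "base_measure T" "\<lambda>i. part T (shift i \<omega>)" "\<lambda>i. rtime T (shift i \<omega>)"
    "orbit_return T \<omega>" "orbit_inv T \<omega>" "orbit_weight T \<gamma> D \<omega>" "orbit_sep T \<gamma> \<omega>" \<gamma> D M "t ` {1..N}"
    by (rule orbit[OF assms(1)])
  have "Fmap T (shift 0 \<omega>) z = O.Fm 0 z" by (rule O_Fm[OF assms(1)]) (use assms in simp)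
  then show ?thesis by (cases z) (simp add: skew_def Fmap_joint_def O.Fm_def)
qed

lemma skew_iter:
  assumes "\<omega> \<in> Z" "z \<in> Delta T \<omega>"
  shows "(skew ^^ n) (\<omega>, z) = (shift (int n) \<omega>, Fiter T n \<omega> z)"
proof (induction n)
  case (Suc n)
  have "Fiter T n \<omega> z \<in> Delta T (shift (int n) \<omega>)"
    using Fiter_Delta[OF assms(1), of z 0 n] assms(2) by simp
  from skew_eq[OF Z_shift[OF assms(1)] this] Suc show ?case by (simp add: add.commute)
qed simp

lemma W_Y_incl: "(\<lambda>p. p) \<in> measurable (W \<Otimes>\<^sub>M Y) (Pm T \<Otimes>\<^sub>M Y)"
proof -
  have "(\<lambda>p. (fst p, snd p)) \<in> measurable (W \<Otimes>\<^sub>M Y) (Pm T \<Otimes>\<^sub>M Y)"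
    by (intro measurable_Pair measurable_compose[OF measurable_fst W_incl] measurable_snd)
  then show ?thesis by simp
qed

definition total_space :: "((int \<Rightarrow> 'a) \<times> ('x \<times> nat)) measure" where
  "total_space = restrict_space (Pm T \<Otimes>\<^sub>M Y) (total_tower T)"

lemma total_tower_subset: "total_tower T \<subseteq> space (Pm T \<Otimes>\<^sub>M Y)"
  unfolding total_tower_def by (auto simp: space_pair_measure space_base[OF setting] Delta_def)

lemma total_space: "space total_space = total_tower T" "sets total_space = joint_sets T"
  using total_tower_subset unfolding total_space_def joint_sets_def by (auto simp: space_restrict_space)

lemma Pair_measurable: "\<omega> \<in> space (Pm T) \<Longrightarrow> Pair \<omega> \<in> measurable (tower_measure T \<omega>) total_space"
  unfolding total_space_def tower_measure_def
  by (rule measurable_restrict_space3) (auto simp: total_tower_def intro: measurable_Pair1')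

lemma section_sets: "\<omega> \<in> space (Pm T) \<Longrightarrow> A \<in> sets total_space \<Longrightarrow> Pair \<omega> -` A \<in> sets (tower_measure T \<omega>)"
proof -
  assume \<omega>: "\<omega> \<in> space (Pm T)" and A: "A \<in> sets total_space"
  have "Pair \<omega> -` A \<inter> space (tower_measure T \<omega>) = Pair \<omega> -` A"
    using sets.sets_into_space[OF A] by (auto simp: total_space total_tower_def space_tower)
  then show ?thesis using measurable_sets[OF Pair_measurable[OF \<omega>] A] by simp
qed

lemma Z_space: "\<omega> \<in> Z \<Longrightarrow> \<omega> \<in> space (Pm T)"
  using sets.sets_into_space[OF Z_sets] by blast

lemma prob_nu0: "\<omega> \<in> Z \<Longrightarrow> prob_space (\<nu> \<omega>)"
  using prob_nu[of \<omega> 0] by simp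

text \<open>The limit formula for the fibre measure expresses it through the measure of base points
  whose images, started n steps back, lie in the section. These are sections of a jointly measurable
  set, and \<open>liminf\<close> preserves measurability.\<close>

lemma measurable_family_nu: "measurable_family T \<nu>"
  unfolding measurable_family_def
proof
  fix A assume "A \<in> joint_sets T"
  then have A: "A \<in> sets total_space" by (simp add: total_space)
  obtain B where B: "A = total_tower T \<inter> B" "B \<in> sets (Pm T \<Otimes>\<^sub>M Y)"
    using A unfolding total_space_def by (auto simp: sets_restrict_space)
  define a where "a n \<omega> = emeasure Mb {x \<in> base T. Fiter T n (shift (- int n) \<omega>) (x, 0) \<in> Pair \<omega> -` A}" for n \<omega>
  interpret B: prob_space Mb by (rule prob_base[OF setting])
  have am: "a n \<in> borel_measurable W" for n
  proof -
    have "(\<lambda>p. (shift (- int n) (fst p), (snd p, 0))) \<in> measurable (W \<Otimes>\<^sub>M Mb) (W \<Otimes>\<^sub>M Y)"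
      by (intro measurable_Pair measurable_compose[OF measurable_fst shift_W] measurable_snd) simp
    from measurable_compose[OF measurable_compose[OF this skew_iter_measurable] W_Y_incl, of n]
    have g: "(\<lambda>p. (skew ^^ n) (shift (- int n) (fst p), (snd p, 0))) \<in> measurable (W \<Otimes>\<^sub>M Mb) (Pm T \<Otimes>\<^sub>M Y)" .
    define C where "C = (\<lambda>p. (skew ^^ n) (shift (- int n) (fst p), (snd p, 0))) -` B \<inter> space (W \<Otimes>\<^sub>M Mb)"
    have "C \<in> sets (W \<Otimes>\<^sub>M Mb)" unfolding C_def by (rule measurable_sets[OF g B(2)])
    then have "(\<lambda>\<omega>. emeasure Mb (Pair \<omega> -` C)) \<in> borel_measurable W" by (rule B.measurable_emeasure_Pair)
    moreover have "emeasure Mb (Pair \<omega> -` C) = a n \<omega>" if "\<omega> \<in> space W" for \<omega>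
    proof -
      have \<omega>: "\<omega> \<in> Z" using that by (simp add: W_space)
      have "Pair \<omega> -` C = {x \<in> base T. Fiter T n (shift (- int n) \<omega>) (x, 0) \<in> Pair \<omega> -` A}"
      proof (rule set_eqI)
        fix x
        have "x \<in> base T \<Longrightarrow> (\<omega>, x) \<in> C \<longleftrightarrow> (\<omega>, Fiter T n (shift (- int n) \<omega>) (x, 0)) \<in> B"
        proof -
          assume x: "x \<in> base T"
          have D: "(x, 0) \<in> Delta T (shift (- int n) \<omega>)"
            by (rule base_Delta[OF setting Z_good[OF \<omega>] gam D0 tG eps x])
          show ?thesis
            using skew_iter[OF Z_shift[OF \<omega>] D, of n] \<omega> x
            by (simp add: C_def space_pair_measure W_space space_base[OF setting])
        qed
        moreover have "x \<in> base T \<Longrightarrow> (\<omega>, Fiter T n (shift (- int n) \<omega>) (x, 0)) \<in> total_tower T"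
        proof -
          assume x: "x \<in> base T"
          have "Fiter T n (shift (- int n) \<omega>) (x, 0) \<in> Delta T (shift (- int n + int n) \<omega>)"
            by (rule Fiter_Delta[OF \<omega> base_Delta[OF setting Z_good[OF \<omega>] gam D0 tG eps x]])
          then show ?thesis using Z_space[OF \<omega>] by (simp add: total_tower_def)
        qed
        ultimately show "x \<in> Pair \<omega> -` C \<longleftrightarrow> x \<in> {x \<in> base T. Fiter T n (shift (- int n) \<omega>) (x, 0) \<in> Pair \<omega> -` A}"
          unfolding B(1) by (auto simp: C_def space_pair_measure space_base[OF setting])
      qed
      then show ?thesis unfolding a_def by simp
    qed
    ultimately show ?thesis by (simp cong: measurable_cong)
  qed
  have "(\<lambda>\<omega>. liminf (\<lambda>n. a n \<omega>)) \<in> borel_measurable W" by (intro borel_measurable_liminf am)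
  moreover have "liminf (\<lambda>n. a n \<omega>) = emeasure (\<nu> \<omega>) (Pair \<omega> -` A)" if "\<omega> \<in> space W" for \<omega>
  proof -
    have \<omega>: "\<omega> \<in> Z" using that by (simp add: W_space)
    have "(\<lambda>n. a n \<omega>) \<longlonglongrightarrow> emeasure (\<nu> \<omega>) (Pair \<omega> -` A)"
      unfolding a_def by (rule emeasure_nu_limit[OF \<omega> section_sets[OF Z_space[OF \<omega>] A]])
    then show ?thesis by (rule lim_imp_Liminf[OF sequentially_bot])
  qed
  ultimately have "(\<lambda>\<omega>. emeasure (\<nu> \<omega>) (Pair \<omega> -` A)) \<in> borel_measurable W" by (simp cong: measurable_cong)
  \<comment> \<open>The extension from \<open>Z\<close> to the whole space is by 0, which agrees
    with the null fibre measures outside.\<close>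
  then have "(\<lambda>\<omega>. emeasure (\<nu> \<omega>) (Pair \<omega> -` A) * indicator Z \<omega>) \<in> borel_measurable (Pm T)"
    using Z_sets by (subst (asm) borel_measurable_restrict_space_iff_ennreal) (auto intro: sets.Int)
  moreover have "emeasure (\<nu> \<omega>) (Pair \<omega> -` A) * indicator Z \<omega> = emeasure (\<nu> \<omega>) (Pair \<omega> -` A)" for \<omega>
    using nu_outside[of \<omega>] by (cases "\<omega> \<in> Z") auto
  ultimately show "(\<lambda>\<omega>. emeasure (\<nu> \<omega>) (Pair \<omega> -` A)) \<in> borel_measurable (Pm T)" by simp
qed

lemma Fiter_1: "Fiter T 1 \<omega> = Fmap T \<omega>"
  by (rule ext) simp

lemma equivariant_nu: "equivariant T \<nu>"
  unfolding equivariant_def using Z_AE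
proof eventually_elim
  case (elim \<omega>)
  have F: "Fmap T \<omega> \<in> measurable (tower_measure T \<omega>) (tower_measure T (shift 1 \<omega>))"
    using Fiter_measurable[OF elim, of 1 0, unfolded Fiter_1] by simp
  have "distr (\<nu> \<omega>) (tower_measure T (shift 1 \<omega>)) (Fmap T \<omega>) = \<nu> (shift 1 \<omega>)"
  proof (rule measure_eqI)
    fix A assume "A \<in> sets (distr (\<nu> \<omega>) (tower_measure T (shift 1 \<omega>)) (Fmap T \<omega>))"
    then have A: "A \<in> sets (tower_measure T (shift 1 \<omega>))" by simp
    have "Fmap T \<omega> \<in> measurable (\<nu> \<omega>) (tower_measure T (shift 1 \<omega>))"
      using F by (simp add: fibre_measure_def)
    then show "emeasure (distr (\<nu> \<omega>) (tower_measure T (shift 1 \<omega>)) (Fmap T \<omega>)) A = emeasure (\<nu> (shift 1 \<omega>)) A"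
      using A emeasure_nu_Fiter[OF elim, of A 0 1, unfolded Fiter_1] by (simp add: emeasure_distr space_nu)
  qed (simp add: sets_nu)
  with F show ?case by simp
qed

text \<open>In fibre \<omega> the section A of a tail set is the n-th preimage of a set
  \<open>B' n\<close>. With the indicator of that set as test function every integral in
  \<open>fibre_memory_loss\<close> equals the measure a of A, so |a - a * a| is below every positive
  e.\<close>

lemma exact_nu: "exact_system T \<nu>"
  unfolding exact_system_def
proof
  fix B assume B: "B \<in> tail_algebra T"
  have "\<forall>n. \<exists>B'. B' \<in> fibre_algebra T \<and> B = {(\<omega>, z) \<in> total_tower T. (shift (int n) \<omega>, Fiter T n \<omega> z) \<in> B'}"
    using B unfolding tail_algebra_def by blast
  from choice[OF this] obtain B' where B': "\<And>n. B' n \<in> fibre_algebra T"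
    "\<And>n. B = {(\<omega>, z) \<in> total_tower T. (shift (int n) \<omega>, Fiter T n \<omega> z) \<in> B' n}" by blast
  \<comment> \<open>The case n = 0 presents B as a member of the fibre algebra, which makes its
    sections measurable.\<close>
  have B0: "B = B' 0" using B'(2)[of 0] B'(1)[of 0] by (auto simp: fibre_algebra_def)
  show "AE \<omega> in Pm T. emeasure (\<nu> \<omega>) (Pair \<omega> -` B) = 0 \<or> emeasure (\<nu> \<omega>) (Pair \<omega> -` B) = 1"
    using Z_AE
  proof eventually_elim
    case (elim \<omega>)
    interpret P: prob_space "\<nu> \<omega>" by (rule prob_nu0[OF elim])
    define A where "A = Pair \<omega> -` B"
    have As: "A \<in> sets (tower_measure T \<omega>)"
      unfolding A_def B0 using B'(1)[of 0] Z_space[OF elim] by (simp add: fibre_algebra_def)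
    have An: "A \<subseteq> Delta T \<omega>" using sets.sets_into_space[OF As] by (simp add: space_tower)
    define a where "a = P.prob A"
    have "\<bar>a - a * a\<bar> \<le> e" if e: "0 < e" for e
    proof -
      obtain n \<phi> where n: "\<phi> \<in> borel_measurable (tower_measure T (shift (int n) \<omega>))"
        "\<forall>z\<in>Delta T (shift (int n) \<omega>). 0 \<le> \<phi> z \<and> \<phi> z \<le> (1 :: real)"
        "\<phi> = indicator (Pair (shift (int n) \<omega>) -` B' n)"
        "\<bar>(\<integral>z. \<phi> (Fiter T n \<omega> z) * indicator A z \<partial>\<nu> \<omega>) - (\<integral>z. indicator A z \<partial>\<nu> \<omega>) * (\<integral>z. \<phi> z \<partial>\<nu> (shift (int n) \<omega>))\<bar> \<le> e"
      proof -
        obtain n0 where n0: "\<And>n \<phi>. n \<ge> n0 \<Longrightarrow> \<phi> \<in> borel_measurable (tower_measure T (shift (int n) \<omega>)) \<Longrightarrow>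
          (\<forall>z\<in>Delta T (shift (int n) \<omega>). 0 \<le> \<phi> z \<and> \<phi> z \<le> 1) \<Longrightarrow>
          \<bar>(\<integral>z. \<phi> (Fiter T n \<omega> z) * indicator A z \<partial>\<nu> \<omega>) - (\<integral>z. indicator A z \<partial>\<nu> \<omega>) * (\<integral>z. \<phi> z \<partial>\<nu> (shift (int n) \<omega>))\<bar> \<le> e"
          using fibre_memory_loss[OF elim _ _ e, of "indicator A" 1] As by (auto simp: indicator_def)
        have "Pair (shift (int n0) \<omega>) -` B' n0 \<in> sets (tower_measure T (shift (int n0) \<omega>))"
          using B'(1)[of n0] Z_space[OF Z_shift[OF elim]] by (simp add: fibre_algebra_def)
        then have m: "(indicator (Pair (shift (int n0) \<omega>) -` B' n0) :: _ \<Rightarrow> real) \<in> borel_measurable (tower_measure T (shift (int n0) \<omega>))"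
          by simp
        show ?thesis by (rule that[OF m _ refl n0[OF order_refl m]]) (auto simp: indicator_def)
      qed
      have iff: "(shift (int n) \<omega>, Fiter T n \<omega> z) \<in> B' n \<longleftrightarrow> z \<in> A" if "z \<in> Delta T \<omega>" for z
        using that Z_space[OF elim] B'(2)[of n] unfolding A_def by (auto simp: total_tower_def)
      have \<phi>F: "\<phi> (Fiter T n \<omega> z) = indicator A z" if "z \<in> Delta T \<omega>" for z
        using iff[OF that] unfolding n(3) by (simp add: indicator_def)
      have A\<nu>: "A \<in> sets (\<nu> \<omega>)" using As by (simp add: sets_nu)
      have sp: "A \<inter> space (\<nu> \<omega>) = A" using An by (auto simp: space_nu)
      have 1: "(\<integral>z. \<phi> (Fiter T n \<omega> z) * indicator A z \<partial>\<nu> \<omega>) = a"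
      proof -
        have "(\<integral>z. \<phi> (Fiter T n \<omega> z) * indicator A z \<partial>\<nu> \<omega>) = (\<integral>z. indicator A z \<partial>\<nu> \<omega>)"
          using \<phi>F by (intro Bochner_Integration.integral_cong) (auto simp: space_nu indicator_def)
        then show ?thesis using sp by (simp add: a_def)
      qed
      have 2: "(\<integral>z. indicator A z \<partial>\<nu> \<omega>) = a" using sp by (simp add: a_def)
      \<comment> \<open>Equivariance: the measure of the set over the later fibre is that of its
        preimage, which is A.\<close>
      have 3: "(\<integral>z. \<phi> z \<partial>\<nu> (shift (int n) \<omega>)) = a"
      proof -
        let ?C = "Pair (shift (int n) \<omega>) -` B' n"
        have C: "?C \<in> sets (tower_measure T (shift (int n) \<omega>))"
          using B'(1)[of n] Z_space[OF Z_shift[OF elim]] by (simp add: fibre_algebra_def)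
        have "Fiter T n \<omega> -` ?C \<inter> Delta T \<omega> = A"
        proof (rule set_eqI)
          fix z
          show "z \<in> Fiter T n \<omega> -` ?C \<inter> Delta T \<omega> \<longleftrightarrow> z \<in> A"
            using An iff[of z] by (cases "z \<in> Delta T \<omega>") auto
        qed
        then have "emeasure (\<nu> \<omega>) A = emeasure (\<nu> (shift (int n) \<omega>)) ?C"
          using emeasure_nu_Fiter[OF elim, of ?C 0 n] C by simp
        moreover have "?C \<inter> space (\<nu> (shift (int n) \<omega>)) = ?C"
          using sets.sets_into_space[OF C] by (auto simp: space_nu space_tower)
        ultimately show ?thesis unfolding n(3) by (simp add: a_def measure_def)
      qed
      show ?thesis using n(4) unfolding 1 2 3 .
    qed
    then have "\<bar>a - a * a\<bar> \<le> 0" by (rule field_le_epsilon) simp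
    then have "a * (1 - a) = 0" by (simp add: algebra_simps)
    then have "a = 0 \<or> a = 1" by auto
    then show "emeasure (\<nu> \<omega>) (Pair \<omega> -` B) = 0 \<or> emeasure (\<nu> \<omega>) (Pair \<omega> -` B) = 1"
      unfolding A_def[symmetric] P.emeasure_eq_measure a_def[symmetric] by auto
  qed
qed

section \<open>The total measure and the skew product\<close>

definition kern :: "(int \<Rightarrow> 'a) \<Rightarrow> ((int \<Rightarrow> 'a) \<times> ('x \<times> nat)) measure" where
  "kern \<omega> = distr (\<nu> \<omega>) total_space (Pair \<omega>)"

text \<open>The total measure as the mixture of a kernel. This form brings sigma-additivity and
  iterated integrals with it; the identification is by values on joint sets.\<close>

definition \<tau> :: "((int \<Rightarrow> 'a) \<times> ('x \<times> nat)) measure" where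
  "\<tau> = Pm T \<bind> kern"

lemma Pair_nu: "\<omega> \<in> space (Pm T) \<Longrightarrow> Pair \<omega> \<in> measurable (\<nu> \<omega>) total_space"
  using Pair_measurable[of \<omega>] by (simp add: fibre_measure_def)

lemma emeasure_kern: "\<omega> \<in> space (Pm T) \<Longrightarrow> A \<in> sets total_space \<Longrightarrow> emeasure (kern \<omega>) A = emeasure (\<nu> \<omega>) (Pair \<omega> -` A)"
proof -
  assume \<omega>: "\<omega> \<in> space (Pm T)" and A: "A \<in> sets total_space"
  have "Pair \<omega> -` A \<inter> space (\<nu> \<omega>) = Pair \<omega> -` A"
    using sets.sets_into_space[OF section_sets[OF \<omega> A]] by (auto simp: space_nu space_tower)
  then show ?thesis unfolding kern_def using Pair_nu[OF \<omega>] A by (simp add: emeasure_distr)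
qed

lemma Pm_not_empty: "space (Pm T) \<noteq> {}"
  using prob_space.not_empty[OF prob_Pm[OF setting]] .

text \<open>Outside \<open>Z\<close> the kernel is the null measure, hence only a subprobability. A
  fibre over \<open>Z\<close> shows that the underlying space is not empty.\<close>

lemma subprob_nu: "\<omega> \<in> space (Pm T) \<Longrightarrow> subprob_space (kern \<omega>)"
proof -
  assume \<omega>: "\<omega> \<in> space (Pm T)"
  show ?thesis
  proof (cases "\<omega> \<in> Z")
    case True
    then have "prob_space (kern \<omega>)"
      unfolding kern_def using Pair_nu[OF \<omega>] by (intro prob_space.prob_space_distr prob_nu0)
    then show ?thesis by (rule prob_space_imp_subprob_space)
  next
    case False
    obtain \<omega>' where \<omega>': "\<omega>' \<in> Z"
    proof -
      have "Z \<noteq> {}" using Z_AE prob_space.AE_False[OF prob_Pm[OF setting]] by auto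
      then show ?thesis using that by blast
    qed
    have "emeasure (kern \<omega>) (space (kern \<omega>)) = 0"
      unfolding kern_def using Pair_nu[OF \<omega>] nu_outside[OF False] by (simp add: emeasure_distr)
    moreover have "space (kern \<omega>) \<noteq> {}"
      using prob_space.not_empty[OF prob_nu0[OF \<omega>']] Z_space[OF \<omega>']
      by (auto simp: kern_def total_space total_tower_def space_nu)
    ultimately show ?thesis by (intro subprob_spaceI) auto
  qed
qed

lemma kern_measurable: "kern \<in> measurable (Pm T) (subprob_algebra total_space)"
proof (rule measurable_subprob_algebra)
  show "subprob_space (kern \<omega>)" if "\<omega> \<in> space (Pm T)" for \<omega> by (rule subprob_nu[OF that])
  show "sets (kern \<omega>) = sets total_space" for \<omega> by (simp add: kern_def)
  fix A assume A: "A \<in> sets total_space"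
  have "(\<lambda>\<omega>. emeasure (\<nu> \<omega>) (Pair \<omega> -` A)) \<in> borel_measurable (Pm T)"
    using measurable_family_nu A by (simp add: measurable_family_def total_space)
  then show "(\<lambda>\<omega>. emeasure (kern \<omega>) A) \<in> borel_measurable (Pm T)"
    by (rule measurable_cong[THEN iffD1, rotated]) (simp add: emeasure_kern A)
qed

lemma sets_tau: "sets \<tau> = sets total_space" and space_tau: "space \<tau> = total_tower T"
proof -
  show "sets \<tau> = sets total_space"
    unfolding \<tau>_def by (rule sets_bind[OF _ Pm_not_empty]) (simp add: kern_def)
  then show "space \<tau> = total_tower T" using sets_eq_imp_space_eq total_space(1) by metis
qed

lemma emeasure_tau: "A \<in> sets total_space \<Longrightarrow> emeasure \<tau> A = (\<integral>\<^sup>+\<omega>. emeasure (\<nu> \<omega>) (Pair \<omega> -` A) \<partial>Pm T)"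
  unfolding \<tau>_def
  by (subst emeasure_bind[OF Pm_not_empty kern_measurable]) (auto intro!: nn_integral_cong simp: emeasure_kern)

lemma total_measure_tau: "total_measure T \<nu> = \<tau>"
proof -
  have "total_measure T \<nu> = measure_of (space \<tau>) (sets \<tau>) (emeasure \<tau>)"
    unfolding total_measure_def space_tau sets_tau
  proof (rule trans[OF _ measure_of_eq])
    show "measure_of (total_tower T) (joint_sets T) (\<lambda>A. \<integral>\<^sup>+\<omega>. emeasure (\<nu> \<omega>) (Pair \<omega> -` A) \<partial>Pm T) =
      measure_of (total_tower T) (sets total_space) (\<lambda>A. \<integral>\<^sup>+\<omega>. emeasure (\<nu> \<omega>) (Pair \<omega> -` A) \<partial>Pm T)" by (simp add: total_space)
    show "sets total_space \<subseteq> Pow (total_tower T)" using sets.sets_into_space[of _ total_space] by (auto simp: total_space(1))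
    fix A assume "A \<in> sigma_sets (total_tower T) (sets total_space)"
    then have "A \<in> sets total_space" using sets.sigma_sets_eq[of total_space] by (simp add: total_space(1))
    then show "(\<integral>\<^sup>+\<omega>. emeasure (\<nu> \<omega>) (Pair \<omega> -` A) \<partial>Pm T) = emeasure \<tau> A" by (simp add: emeasure_tau)
  qed
  then show ?thesis by (simp add: measure_of_of_measure)
qed

lemma prob_tau: "prob_space \<tau>"
proof
  have "emeasure \<tau> (space \<tau>) = (\<integral>\<^sup>+\<omega>. emeasure (\<nu> \<omega>) (Pair \<omega> -` space total_space) \<partial>Pm T)"
    by (simp add: space_tau total_space(1)[symmetric] emeasure_tau)
  also have "\<dots> = (\<integral>\<^sup>+\<omega>. 1 \<partial>Pm T)"
  proof (rule nn_integral_cong_AE)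
    show "AE \<omega> in Pm T. emeasure (\<nu> \<omega>) (Pair \<omega> -` space total_space) = 1"
      using Z_AE
    proof eventually_elim
      case (elim \<omega>)
      have "Pair \<omega> -` space total_space = space (\<nu> \<omega>)"
        using Z_space[OF elim] by (auto simp: total_space(1) total_tower_def space_nu)
      then show ?case using prob_space.emeasure_space_1[OF prob_nu0[OF elim]] by simp
    qed
  qed
  also have "\<dots> = 1" using prob_space.emeasure_space_1[OF prob_Pm[OF setting]] by simp
  finally show "emeasure \<tau> (space \<tau>) = 1" .
qed

text \<open>The identity off \<open>Z\<close> makes this a measurable self-map of the total tower
  that can be iterated everywhere; the fibres concerned carry no mass.\<close>

definition \<Psi> :: "(int \<Rightarrow> 'a) \<times> ('x \<times> nat) \<Rightarrow> (int \<Rightarrow> 'a) \<times> ('x \<times> nat)" where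
  "\<Psi> p = (if fst p \<in> Z then skew p else p)"

lemma Psi_iter:
  assumes "\<omega> \<in> Z" "z \<in> Delta T \<omega>"
  shows "(\<Psi> ^^ n) (\<omega>, z) = (shift (int n) \<omega>, Fiter T n \<omega> z)"
proof -
  have "(\<Psi> ^^ n) (\<omega>, z) = (skew ^^ n) (\<omega>, z)"
  proof (induction n)
    case (Suc n)
    then show ?case using Z_shift[OF assms(1)] by (simp add: skew_iter[OF assms] \<Psi>_def)
  qed simp
  then show ?thesis by (simp add: skew_iter[OF assms])
qed

lemma Psi_measurable: "\<Psi> \<in> measurable total_space total_space"
proof -
  define X where "X = {p \<in> space total_space. fst p \<in> Z}"
  have fstm: "fst \<in> measurable total_space (Pm T)"
    unfolding total_space_def by (rule measurable_restrict_space1[OF measurable_fst])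
  have Xs: "X \<in> sets total_space"
  proof -
    have "X = fst -` Z \<inter> space total_space" unfolding X_def by auto
    then show ?thesis using measurable_sets[OF fstm Z_sets] by simp
  qed
  have XZ: "X = {(\<omega>, z). \<omega> \<in> Z \<and> z \<in> Delta T \<omega>}" unfolding X_def total_space(1) total_tower_def using Z_space by auto
  have skewX: "skew \<in> measurable (restrict_space total_space X) total_space"
  proof -
    have inX: "(\<lambda>p. (fst p, snd p)) \<in> measurable (restrict_space total_space X) (W \<Otimes>\<^sub>M Y)"
    proof (rule measurable_Pair)
      show "fst \<in> measurable (restrict_space total_space X) W"
        by (rule measurable_restrict_space2[OF _ measurable_restrict_space1[OF fstm]])
          (auto simp: space_restrict_space X_def)
      show "snd \<in> measurable (restrict_space total_space X) Y"
        unfolding total_space_def by (intro measurable_restrict_space1 measurable_snd)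
    qed
    have "(\<lambda>p. skew (fst p, snd p)) \<in> measurable (restrict_space total_space X) (Pm T \<Otimes>\<^sub>M Y)"
      by (rule measurable_compose[OF measurable_compose[OF inX skew_measurable] W_Y_incl])
    then have m: "skew \<in> measurable (restrict_space total_space X) (Pm T \<Otimes>\<^sub>M Y)" by simp
    have "skew p \<in> total_tower T" if p: "p \<in> X" for p
    proof -
      obtain \<omega> z where q: "p = (\<omega>, z)" "\<omega> \<in> Z" "z \<in> Delta T \<omega>" using p unfolding XZ by auto
      have "Fiter T 1 (shift 0 \<omega>) z \<in> Delta T (shift (0 + int 1) \<omega>)"
        by (rule Fiter_Delta[OF q(2)]) (use q in simp)
      then show ?thesis
        using Z_space[OF Z_shift[OF q(2)], of 1] unfolding q(1) skew_eq[OF q(2,3)] by (simp add: total_tower_def)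
    qed
    then show ?thesis
      unfolding total_space_def[of] using m unfolding total_space_def
      by (intro measurable_restrict_space2) (auto simp: space_restrict_space)
  qed
  show ?thesis
  proof (rule measurable_piecewise_restrict[of "{X, space total_space - X}"])
    show "\<Psi> \<in> measurable (restrict_space total_space \<Omega>) total_space" if "\<Omega> \<in> {X, space total_space - X}" for \<Omega>
    proof (cases "\<Omega> = X")
      case True
      have "\<Psi> p = skew p" if "p \<in> space (restrict_space total_space X)" for p
        using that by (simp add: \<Psi>_def space_restrict_space X_def)
      then show ?thesis unfolding True using skewX by (simp cong: measurable_cong)
    next
      case False
      then have \<Omega>: "\<Omega> = space total_space - X" using that by auto
      have "\<Psi> p = p" if "p \<in> space (restrict_space total_space \<Omega>)" for p
        using that by (simp add: \<Omega> \<Psi>_def space_restrict_space X_def)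
      moreover have "(\<lambda>p. p) \<in> measurable (restrict_space total_space \<Omega>) total_space"
        by (rule measurable_restrict_space1) simp
      ultimately show ?thesis by (simp cong: measurable_cong)
    qed
    show "\<Omega> \<inter> space total_space \<in> sets total_space" if "\<Omega> \<in> {X, space total_space - X}" for \<Omega>
      using that Xs by auto
  qed auto
qed

text \<open>Equivariance moves the fibre measures from \<omega> to its shift, and invariance of the
  Bernoulli measure removes the shift from the outer integral.\<close>

lemma distr_Psi: "distr \<tau> \<tau> \<Psi> = \<tau>"
proof (rule measure_eqI)
  fix A assume "A \<in> sets (distr \<tau> \<tau> \<Psi>)"
  then have A: "A \<in> sets total_space" by (simp add: sets_tau)
  have \<Psi>m: "\<Psi> \<in> measurable \<tau> \<tau>" using Psi_measurable by (simp cong: measurable_cong_sets add: sets_tau)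
  have pre: "\<Psi> -` A \<inter> space total_space \<in> sets total_space" by (rule measurable_sets[OF Psi_measurable A])
  have gm: "(\<lambda>\<omega>. emeasure (\<nu> \<omega>) (Pair \<omega> -` A)) \<in> borel_measurable (Pm T)"
    using measurable_family_nu A by (simp add: measurable_family_def total_space)
  have "emeasure (distr \<tau> \<tau> \<Psi>) A = emeasure \<tau> (\<Psi> -` A \<inter> space total_space)"
    using \<Psi>m A by (simp add: emeasure_distr sets_tau space_tau total_space(1))
  also have "\<dots> = (\<integral>\<^sup>+\<omega>. emeasure (\<nu> \<omega>) (Pair \<omega> -` (\<Psi> -` A \<inter> space total_space)) \<partial>Pm T)"
    by (rule emeasure_tau[OF pre])
  also have "\<dots> = (\<integral>\<^sup>+\<omega>. emeasure (\<nu> (shift 1 \<omega>)) (Pair (shift 1 \<omega>) -` A) \<partial>Pm T)"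
  proof (rule nn_integral_cong_AE)
    show "AE \<omega> in Pm T. emeasure (\<nu> \<omega>) (Pair \<omega> -` (\<Psi> -` A \<inter> space total_space)) = emeasure (\<nu> (shift 1 \<omega>)) (Pair (shift 1 \<omega>) -` A)"
      using Z_AE
    proof eventually_elim
      case (elim \<omega>)
      let ?C = "Pair (shift 1 \<omega>) -` A"
      have C: "?C \<in> sets (tower_measure T (shift 1 \<omega>))"
        by (rule section_sets[OF Z_space[OF Z_shift[OF elim]] A])
      have "Pair \<omega> -` (\<Psi> -` A \<inter> space total_space) = Fiter T 1 \<omega> -` ?C \<inter> Delta T \<omega>"
      proof (rule set_eqI)
        fix z
        show "z \<in> Pair \<omega> -` (\<Psi> -` A \<inter> space total_space) \<longleftrightarrow> z \<in> Fiter T 1 \<omega> -` ?C \<inter> Delta T \<omega>"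
          using Psi_iter[OF elim, of z 1] Z_space[OF elim] by (auto simp: total_space(1) total_tower_def)
      qed
      then show ?case using emeasure_nu_Fiter[OF elim, of ?C 0 1] C by simp
    qed
  qed
  also have "\<dots> = (\<integral>\<^sup>+\<omega>. emeasure (\<nu> \<omega>) (Pair \<omega> -` A) \<partial>distr (Pm T) (Pm T) (shift 1))"
    by (rule nn_integral_distr[OF shift_measurable[OF setting], symmetric]) (use gm in simp)
  also have "\<dots> = emeasure \<tau> A" by (simp add: distr_shift[OF setting] emeasure_tau[OF A])
  finally show "emeasure (distr \<tau> \<tau> \<Psi>) A = emeasure \<tau> A" .
qed simp

lemma Psi_tau: "\<Psi> ^^ n \<in> measurable \<tau> \<tau>" and distr_Psi_iter: "distr \<tau> \<tau> (\<Psi> ^^ n) = \<tau>"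
proof -
  have \<Psi>m: "\<Psi> \<in> measurable \<tau> \<tau>" using Psi_measurable by (simp cong: measurable_cong_sets add: sets_tau)
  show m: "\<Psi> ^^ n \<in> measurable \<tau> \<tau>" for n by (rule measurable_compose_n[OF \<Psi>m])
  show "distr \<tau> \<tau> (\<Psi> ^^ n) = \<tau>"
  proof (induction n)
    case 0 show ?case by (simp add: id_def distr_id)
  next
    case (Suc n)
    have "distr \<tau> \<tau> (\<Psi> ^^ Suc n) = distr (distr \<tau> \<tau> (\<Psi> ^^ n)) \<tau> \<Psi>"
      by (simp only: distr_distr[OF \<Psi>m m] funpow.simps)
    then show ?case unfolding Suc distr_Psi .
  qed
qed

lemma integral_kern:
  fixes q :: "(int \<Rightarrow> 'a) \<times> ('x \<times> nat) \<Rightarrow> real"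
  assumes "\<omega> \<in> space (Pm T)" "q \<in> borel_measurable total_space"
  shows "(\<integral>p. q p \<partial>kern \<omega>) = (\<integral>z. q (\<omega>, z) \<partial>\<nu> \<omega>)"
  unfolding kern_def by (rule integral_distr[OF Pair_nu[OF assms(1)] assms(2)])

lemma integral_tau:
  fixes q :: "(int \<Rightarrow> 'a) \<times> ('x \<times> nat) \<Rightarrow> real"
  assumes "q \<in> borel_measurable total_space" "integrable \<tau> q"
  shows "(\<integral>p. q p \<partial>\<tau>) = (\<integral>\<omega>. (\<integral>z. q (\<omega>, z) \<partial>\<nu> \<omega>) \<partial>Pm T)"
proof -
  interpret P: prob_space "Pm T" by (rule prob_Pm[OF setting])
  have "(\<integral>p. q p \<partial>\<tau>) = (\<integral>\<omega>. (\<integral>p. q p \<partial>kern \<omega>) \<partial>Pm T)"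
    unfolding \<tau>_def by (rule P.integral_bind_kernel[OF kern_measurable assms(1)]) (use assms(2) in \<open>simp add: \<tau>_def\<close>)
  also have "\<dots> = (\<integral>\<omega>. (\<integral>z. q (\<omega>, z) \<partial>\<nu> \<omega>) \<partial>Pm T)"
    by (intro Bochner_Integration.integral_cong) (simp_all add: integral_kern assms(1))
  finally show ?thesis .
qed

lemma integral_nu_outside: "\<omega> \<notin> Z \<Longrightarrow> (\<integral>z. q z \<partial>\<nu> \<omega>) = (0 :: real)"
proof (rule integral_eq_zero_AE)
  assume "\<omega> \<notin> Z"
  then have "h \<omega> = (\<lambda>_. 0)" by (simp add: h_def fun_eq_iff)
  then show "AE z in \<nu> \<omega>. q z = 0" unfolding fibre_measure_def by (simp add: AE_density)
qed

text \<open>Measurability in \<omega> is read off the kernel: the integrals of the positive and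
  negative parts are measurable, and boundedness makes them finite.\<close>

lemma fibre_integral_measurable:
  fixes q :: "(int \<Rightarrow> 'a) \<times> ('x \<times> nat) \<Rightarrow> real"
  assumes q: "q \<in> borel_measurable total_space" "\<And>p. \<bar>q p\<bar> \<le> c"
  shows "(\<lambda>\<omega>. \<integral>z. q (\<omega>, z) \<partial>\<nu> \<omega>) \<in> borel_measurable (Pm T)"
    and "\<bar>\<integral>z. q (\<omega>, z) \<partial>\<nu> \<omega>\<bar> \<le> c"
proof -
  have bound: "\<bar>\<integral>z. q (\<omega>, z) \<partial>\<nu> \<omega>\<bar> \<le> c" for \<omega>
  proof (cases "\<omega> \<in> Z")
    case True
    interpret P: prob_space "\<nu> \<omega>" by (rule prob_nu0[OF True])
    have m: "(\<lambda>z. q (\<omega>, z)) \<in> borel_measurable (\<nu> \<omega>)"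
      by (rule measurable_compose[OF Pair_nu[OF Z_space[OF True]] q(1)])
    have i: "integrable (\<nu> \<omega>) (\<lambda>z. q (\<omega>, z))"
      by (rule P.integrable_const_bound[where B = c]) (use q m in auto)
    have "\<bar>\<integral>z. q (\<omega>, z) \<partial>\<nu> \<omega>\<bar> \<le> (\<integral>z. \<bar>q (\<omega>, z)\<bar> \<partial>\<nu> \<omega>)" by (rule integral_abs_bound)
    also have "\<dots> \<le> (\<integral>z. c \<partial>\<nu> \<omega>)" using i q by (intro integral_mono) auto
    finally show ?thesis by (simp add: P.prob_space)
  next
    case False
    then show ?thesis using q(2)[of undefined] by (simp add: integral_nu_outside)
  qed
  then show "\<bar>\<integral>z. q (\<omega>, z) \<partial>\<nu> \<omega>\<bar> \<le> c" .
  define a b where "a \<omega> = (\<integral>\<^sup>+p. ennreal (q p) \<partial>kern \<omega>)" and "b \<omega> = (\<integral>\<^sup>+p. ennreal (- q p) \<partial>kern \<omega>)" for \<omega>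
  have am: "a \<in> borel_measurable (Pm T)" and base_mass: "b \<in> borel_measurable (Pm T)"
    unfolding a_def[abs_def] b_def[abs_def]
    using measurable_compose[OF kern_measurable nn_integral_measurable_subprob_algebra, of "\<lambda>p. ennreal (q p)"]
      measurable_compose[OF kern_measurable nn_integral_measurable_subprob_algebra, of "\<lambda>p. ennreal (- q p)"] q(1) by auto
  have "(\<integral>z. q (\<omega>, z) \<partial>\<nu> \<omega>) = enn2real (a \<omega>) - enn2real (b \<omega>)" if \<omega>: "\<omega> \<in> space (Pm T)" for \<omega>
  proof -
    interpret S: subprob_space "kern \<omega>" by (rule subprob_nu[OF \<omega>])
    have "integrable (kern \<omega>) q"
      by (rule S.integrable_const_bound[where B = c]) (use q in \<open>auto simp: kern_def\<close>)
    then show ?thesis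
      unfolding a_def b_def integral_kern[OF \<omega> q(1), symmetric] by (rule real_lebesgue_integral_def)
  qed
  then show "(\<lambda>\<omega>. \<integral>z. q (\<omega>, z) \<partial>\<nu> \<omega>) \<in> borel_measurable (Pm T)"
    using am base_mass by (simp cong: measurable_cong)
qed

text \<open>The inner correlation \<open>I n\<close> is asymptotic to a product of fibre averages
  for every \<omega> in \<open>Z\<close>, dominated convergence integrates this, and the product is
  a correlation for the shift.\<close>

lemma mixing_bounded:
  fixes f g :: "(int \<Rightarrow> 'a) \<times> ('x \<times> nat) \<Rightarrow> real"
  assumes f: "f \<in> borel_measurable \<tau>" "\<And>p. \<bar>f p\<bar> \<le> c" and g: "g \<in> borel_measurable \<tau>" "\<And>p. \<bar>g p\<bar> \<le> c"
  shows "(\<lambda>n. \<integral>p. f ((\<Psi> ^^ n) p) * g p \<partial>\<tau>) \<longlonglongrightarrow> (\<integral>p. f p \<partial>\<tau>) * (\<integral>p. g p \<partial>\<tau>)"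
proof -
  interpret \<tau>: prob_space \<tau> by (rule prob_tau)
  interpret P: prob_space "Pm T" by (rule prob_Pm[OF setting])
  have fN: "f \<in> borel_measurable total_space" and gN: "g \<in> borel_measurable total_space"
    using f g by (simp_all cong: measurable_cong_sets add: sets_tau)
  have c0: "0 \<le> c" using f(2)[of undefined] by linarith
  have \<Psi>N: "\<Psi> ^^ n \<in> measurable total_space total_space" for n by (rule measurable_compose_n[OF Psi_measurable])
  define d where "d = c + 1"
  have d: "0 < d" using c0 by (simp add: d_def)
  define F G where "F \<omega> = (\<integral>z. f (\<omega>, z) \<partial>\<nu> \<omega>)" and "G \<omega> = (\<integral>z. g (\<omega>, z) \<partial>\<nu> \<omega>)" for \<omega>
  define q where "q n p = f ((\<Psi> ^^ n) p) * g p" for n p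
  have qm: "q n \<in> borel_measurable total_space" for n
    unfolding q_def[abs_def] by (intro borel_measurable_times measurable_compose[OF \<Psi>N fN] gN)
  have qb: "\<bar>q n p\<bar> \<le> c * c" for n p
    unfolding q_def abs_mult using f(2) g(2) c0 by (intro mult_mono) auto
  define I where "I n \<omega> = (\<integral>z. q n (\<omega>, z) \<partial>\<nu> \<omega>)" for n \<omega>
  have Im: "I n \<in> borel_measurable (Pm T)" and Ib: "\<bar>I n \<omega>\<bar> \<le> c * c" for n \<omega>
    unfolding I_def using fibre_integral_measurable[OF qm qb] by auto
  have Fm: "F \<in> borel_measurable (Pm T)" and Fb: "\<bar>F \<omega>\<bar> \<le> c" and Gm: "G \<in> borel_measurable (Pm T)" and Gb: "\<bar>G \<omega>\<bar> \<le> c" for \<omega>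
    unfolding F_def G_def using fibre_integral_measurable[OF fN f(2)] fibre_integral_measurable[OF gN g(2)] by auto
  have Fsm: "(\<lambda>\<omega>. F (shift (int n) \<omega>)) \<in> borel_measurable (Pm T)" for n
    by (rule measurable_compose[OF shift_measurable[OF setting] Fm])
  have lim: "(\<lambda>n. I n \<omega> - F (shift (int n) \<omega>) * G \<omega>) \<longlonglongrightarrow> 0" if \<omega>: "\<omega> \<in> Z" for \<omega>
  proof (rule LIMSEQ_I)
    fix r :: real assume r: "0 < r"
    interpret N0: prob_space "\<nu> \<omega>" by (rule prob_nu0[OF \<omega>])
    have g\<omega>: "(\<lambda>z. g (\<omega>, z)) \<in> borel_measurable (tower_measure T \<omega>)"
      by (rule measurable_compose[OF Pair_measurable[OF Z_space[OF \<omega>]] gN])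
    have g\<nu>: "(\<lambda>z. g (\<omega>, z)) \<in> borel_measurable (\<nu> \<omega>)"
      by (rule measurable_compose[OF Pair_nu[OF Z_space[OF \<omega>]] gN])
    have "0 < r / (4 * d)" using r d by simp
    then obtain n0 where n0: "\<And>n \<phi>. n \<ge> n0 \<Longrightarrow> \<phi> \<in> borel_measurable (tower_measure T (shift (int n) \<omega>)) \<Longrightarrow>
        \<forall>z\<in>Delta T (shift (int n) \<omega>). 0 \<le> \<phi> z \<and> \<phi> z \<le> 1 \<Longrightarrow>
        \<bar>(\<integral>z. \<phi> (Fiter T n \<omega> z) * g (\<omega>, z) \<partial>\<nu> \<omega>) - (\<integral>z. g (\<omega>, z) \<partial>\<nu> \<omega>) * (\<integral>z. \<phi> z \<partial>\<nu> (shift (int n) \<omega>))\<bar> \<le> r / (4 * d)"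
      using fibre_memory_loss[OF \<omega> g\<omega> g(2), of "r / (4 * d)"] by blast
    show "\<exists>n0. \<forall>n\<ge>n0. norm (I n \<omega> - F (shift (int n) \<omega>) * G \<omega> - 0) < r"
    proof (intro exI[of _ n0] allI impI)
      fix n assume n: "n0 \<le> n"
      let ?s = "shift (int n) \<omega>"
      interpret N1: prob_space "\<nu> ?s" by (rule prob_nu0[OF Z_shift[OF \<omega>]])
      \<comment> \<open>An affine change brings f into the range of test functions; the additive
        constant contributes equally to both terms and cancels. With d = c + 1 the divisor is
        positive even when c = 0.\<close>
      define \<phi> where "\<phi> z = (f (?s, z) + d) / (2 * d)" for z
      have fs: "(\<lambda>z. f (?s, z)) \<in> borel_measurable (tower_measure T ?s)"
        by (rule measurable_compose[OF Pair_measurable[OF Z_space[OF Z_shift[OF \<omega>]]] fN])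
      have fs\<nu>: "(\<lambda>z. f (?s, z)) \<in> borel_measurable (\<nu> ?s)"
        by (rule measurable_compose[OF Pair_nu[OF Z_space[OF Z_shift[OF \<omega>]]] fN])
      have \<phi>m: "\<phi> \<in> borel_measurable (tower_measure T ?s)" unfolding \<phi>_def[abs_def] using fs by measurable
      have \<phi>b: "0 \<le> \<phi> z \<and> \<phi> z \<le> 1" for z
        using f(2)[of "(?s, z)"] d unfolding \<phi>_def d_def by (auto simp: divide_simps)
      have f_\<phi>: "f (?s, z) = 2 * d * \<phi> z - d" for z using d by (simp add: \<phi>_def)
      have fiint: "integrable (\<nu> ?s) (\<lambda>z. f (?s, z))"
        by (rule N1.integrable_const_bound[where B = c]) (use f fs\<nu> in auto)
      have \<phi>int: "integrable (\<nu> ?s) \<phi>" unfolding \<phi>_def[abs_def] using fiint by simp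
      have gint: "integrable (\<nu> \<omega>) (\<lambda>z. g (\<omega>, z))"
        by (rule N0.integrable_const_bound[where B = c]) (use g g\<nu> in auto)
      have \<phi>Fm: "(\<lambda>z. \<phi> (Fiter T n \<omega> z)) \<in> borel_measurable (\<nu> \<omega>)"
        using measurable_compose[OF Fiter_measurable[OF \<omega>, of n 0], of \<phi> borel] \<phi>m by (simp add: fibre_measure_def)
      have pint: "integrable (\<nu> \<omega>) (\<lambda>z. \<phi> (Fiter T n \<omega> z) * g (\<omega>, z))"
      proof (rule N0.integrable_const_bound[where B = "1 * c"])
        show "AE z in \<nu> \<omega>. norm (\<phi> (Fiter T n \<omega> z) * g (\<omega>, z)) \<le> 1 * c"
          using \<phi>b g(2) unfolding norm_mult by (intro AE_I2 mult_mono) auto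
      qed (use \<phi>Fm g\<nu> in measurable)
      have F_eq: "F ?s = 2 * d * (\<integral>z. \<phi> z \<partial>\<nu> ?s) - d"
        unfolding F_def f_\<phi> using \<phi>int by (simp add: N1.prob_space)
      have "I n \<omega> = (\<integral>z. 2 * d * (\<phi> (Fiter T n \<omega> z) * g (\<omega>, z)) - d * g (\<omega>, z) \<partial>\<nu> \<omega>)"
        unfolding I_def q_def
        by (intro Bochner_Integration.integral_cong) (auto simp: space_nu Psi_iter[OF \<omega>] f_\<phi> algebra_simps)
      also have "\<dots> = 2 * d * (\<integral>z. \<phi> (Fiter T n \<omega> z) * g (\<omega>, z) \<partial>\<nu> \<omega>) - d * G \<omega>"
        unfolding G_def using pint gint by simp
      finally have "I n \<omega> - F ?s * G \<omega> = 2 * d * ((\<integral>z. \<phi> (Fiter T n \<omega> z) * g (\<omega>, z) \<partial>\<nu> \<omega>) - G \<omega> * (\<integral>z. \<phi> z \<partial>\<nu> ?s))"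
        unfolding F_eq by (simp add: algebra_simps)
      then have "\<bar>I n \<omega> - F ?s * G \<omega>\<bar> = 2 * d * \<bar>(\<integral>z. \<phi> (Fiter T n \<omega> z) * g (\<omega>, z) \<partial>\<nu> \<omega>) - G \<omega> * (\<integral>z. \<phi> z \<partial>\<nu> ?s)\<bar>"
        using d by (simp add: abs_mult)
      also have "\<dots> \<le> 2 * d * (r / (4 * d))"
        using n0[OF n \<phi>m] \<phi>b d unfolding G_def by (intro mult_left_mono) auto
      also have "\<dots> < r" using d r by simp
      finally show "norm (I n \<omega> - F ?s * G \<omega> - 0) < r" by simp
    qed
  qed
  have "(\<lambda>n. \<integral>\<omega>. I n \<omega> - F (shift (int n) \<omega>) * G \<omega> \<partial>Pm T) \<longlonglongrightarrow> (\<integral>\<omega>. 0 \<partial>Pm T)"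
  proof (rule integral_dominated_convergence[where w = "\<lambda>_. 2 * (c * c)"])
    show "(\<lambda>\<omega>. I n \<omega> - F (shift (int n) \<omega>) * G \<omega>) \<in> borel_measurable (Pm T)" for n
      using Im[of n] Fsm[of n] Gm by measurable
    show "AE \<omega> in Pm T. (\<lambda>n. I n \<omega> - F (shift (int n) \<omega>) * G \<omega>) \<longlonglongrightarrow> 0"
      using Z_AE by eventually_elim (rule lim)
    show "AE \<omega> in Pm T. norm (I n \<omega> - F (shift (int n) \<omega>) * G \<omega>) \<le> 2 * (c * c)" for n
    proof (intro AE_I2)
      fix \<omega>
      have "\<bar>F (shift (int n) \<omega>) * G \<omega>\<bar> \<le> c * c"
        unfolding abs_mult using Fb Gb c0 by (intro mult_mono) auto
      then show "norm (I n \<omega> - F (shift (int n) \<omega>) * G \<omega>) \<le> 2 * (c * c)"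
        using Ib[of n \<omega>] by simp
    qed
  qed auto
  moreover have "(\<lambda>n. \<integral>\<omega>. F (shift (int n) \<omega>) * G \<omega> \<partial>Pm T) \<longlonglongrightarrow> (\<integral>\<omega>. F \<omega> \<partial>Pm T) * (\<integral>\<omega>. G \<omega> \<partial>Pm T)"
  proof (rule shift_mixing[OF setting _ Gm Gb])
    show "integrable (Pm T) F" by (rule P.integrable_const_bound[where B = c]) (use Fb Fm in auto)
  qed
  ultimately have "(\<lambda>n. (\<integral>\<omega>. I n \<omega> - F (shift (int n) \<omega>) * G \<omega> \<partial>Pm T) + (\<integral>\<omega>. F (shift (int n) \<omega>) * G \<omega> \<partial>Pm T))
      \<longlonglongrightarrow> 0 + (\<integral>\<omega>. F \<omega> \<partial>Pm T) * (\<integral>\<omega>. G \<omega> \<partial>Pm T)"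
    by (intro tendsto_add) simp_all
  moreover have "(\<integral>\<omega>. I n \<omega> - F (shift (int n) \<omega>) * G \<omega> \<partial>Pm T) + (\<integral>\<omega>. F (shift (int n) \<omega>) * G \<omega> \<partial>Pm T) = (\<integral>p. f ((\<Psi> ^^ n) p) * g p \<partial>\<tau>)" for n
  proof -
    have Ii: "integrable (Pm T) (I n)"
      by (rule P.integrable_const_bound[where B = "c * c"]) (use Ib Im in auto)
    have FGi: "integrable (Pm T) (\<lambda>\<omega>. F (shift (int n) \<omega>) * G \<omega>)"
    proof (rule P.integrable_const_bound[where B = "c * c"])
      show "AE \<omega> in Pm T. norm (F (shift (int n) \<omega>) * G \<omega>) \<le> c * c"
        unfolding norm_mult using Fb Gb c0 by (intro AE_I2 mult_mono) auto
    qed (use Fsm[of n] Gm in measurable)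
    have "integrable \<tau> (q n)"
      by (rule \<tau>.integrable_const_bound[where B = "c * c"]) (use qb qm in \<open>auto simp: sets_tau cong: measurable_cong_sets\<close>)
    from integral_tau[OF qm this] have "(\<integral>p. f ((\<Psi> ^^ n) p) * g p \<partial>\<tau>) = (\<integral>\<omega>. I n \<omega> \<partial>Pm T)"
      unfolding I_def[abs_def] q_def[abs_def] .
    then show ?thesis using Bochner_Integration.integral_diff[OF Ii FGi] by simp
  qed
  moreover have "(\<integral>\<omega>. F \<omega> \<partial>Pm T) = (\<integral>p. f p \<partial>\<tau>)" "(\<integral>\<omega>. G \<omega> \<partial>Pm T) = (\<integral>p. g p \<partial>\<tau>)"
  proof -
    have "integrable \<tau> f" "integrable \<tau> g"
      by (rule \<tau>.integrable_const_bound[where B = c]; use f g in auto)+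
    then show "(\<integral>\<omega>. F \<omega> \<partial>Pm T) = (\<integral>p. f p \<partial>\<tau>)" "(\<integral>\<omega>. G \<omega> \<partial>Pm T) = (\<integral>p. g p \<partial>\<tau>)"
      using integral_tau[OF fN] integral_tau[OF gN] by (simp_all add: F_def G_def)
  qed
  ultimately show ?thesis by simp
qed

text \<open>Over \<open>Z\<close> the iterates of the skew product are those of the tower maps.
  Outside, the maps may differ, but both inner integrals are 0 because the fibre measure is
  null.\<close>

lemma mixing_nu: "mixing_system T \<nu>"
  unfolding mixing_system_def total_measure_tau
proof (intro ballI)
  interpret \<tau>: prob_space \<tau> by (rule prob_tau)
  fix \<phi> \<psi> assume "\<phi> \<in> L2 \<tau>" "\<psi> \<in> L2 \<tau>"
  then have \<phi>: "\<phi> \<in> borel_measurable \<tau>" "integrable \<tau> (\<lambda>p. (\<phi> p)\<^sup>2)"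
    and \<psi>: "\<psi> \<in> borel_measurable \<tau>" "integrable \<tau> (\<lambda>p. (\<psi> p)\<^sup>2)" by (auto simp: L2_def)
  have int: "integrable \<tau> (\<lambda>p. \<phi> ((\<Psi> ^^ n) p) * \<psi> p)" for n
    by (rule \<tau>.mixing_L2_from_bounded(1)[OF Psi_tau distr_Psi_iter mixing_bounded \<phi> \<psi>])
  have lim: "(\<lambda>n. \<integral>p. \<phi> ((\<Psi> ^^ n) p) * \<psi> p \<partial>\<tau>) \<longlonglongrightarrow> (\<integral>p. \<phi> p \<partial>\<tau>) * (\<integral>p. \<psi> p \<partial>\<tau>)"
    by (rule \<tau>.mixing_L2_from_bounded(2)[OF Psi_tau distr_Psi_iter mixing_bounded \<phi> \<psi>])
  have \<phi>N: "\<phi> \<in> borel_measurable total_space" and \<psi>N: "\<psi> \<in> borel_measurable total_space"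
    using \<phi> \<psi> by (simp_all cong: measurable_cong_sets add: sets_tau)
  have "(\<integral>\<omega>. (\<integral>z. \<phi> (shift (int n) \<omega>, Fiter T n \<omega> z) * \<psi> (\<omega>, z) \<partial>\<nu> \<omega>) \<partial>Pm T) = (\<integral>p. \<phi> ((\<Psi> ^^ n) p) * \<psi> p \<partial>\<tau>)" for n
  proof -
    have "(\<integral>p. \<phi> ((\<Psi> ^^ n) p) * \<psi> p \<partial>\<tau>) = (\<integral>\<omega>. (\<integral>z. \<phi> ((\<Psi> ^^ n) (\<omega>, z)) * \<psi> (\<omega>, z) \<partial>\<nu> \<omega>) \<partial>Pm T)"
      by (intro integral_tau borel_measurable_times \<psi>N
          measurable_compose[OF measurable_compose_n[OF Psi_measurable] \<phi>N] int)
    also have "\<dots> = (\<integral>\<omega>. (\<integral>z. \<phi> (shift (int n) \<omega>, Fiter T n \<omega> z) * \<psi> (\<omega>, z) \<partial>\<nu> \<omega>) \<partial>Pm T)"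
    proof (rule Bochner_Integration.integral_cong[OF refl])
      fix \<omega>
      show "(\<integral>z. \<phi> ((\<Psi> ^^ n) (\<omega>, z)) * \<psi> (\<omega>, z) \<partial>\<nu> \<omega>) = (\<integral>z. \<phi> (shift (int n) \<omega>, Fiter T n \<omega> z) * \<psi> (\<omega>, z) \<partial>\<nu> \<omega>)"
      proof (cases "\<omega> \<in> Z")
        case True
        then show ?thesis
          by (intro Bochner_Integration.integral_cong refl) (simp add: space_nu Psi_iter)
      qed (simp add: integral_nu_outside)
    qed
    finally show ?thesis ..
  qed
  moreover have "(\<integral>\<omega>. (\<integral>z. \<phi> (\<omega>, z) \<partial>\<nu> \<omega>) \<partial>Pm T) = (\<integral>p. \<phi> p \<partial>\<tau>)"
    using integral_tau[OF \<phi>N \<tau>.square_integrable_integrable[OF \<phi>]] ..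
  moreover have "(\<integral>\<omega>. (\<integral>z. \<psi> (\<omega>, z) \<partial>\<nu> \<omega>) \<partial>Pm T) = (\<integral>p. \<psi> p \<partial>\<tau>)"
    using integral_tau[OF \<psi>N \<tau>.square_integrable_integrable[OF \<psi>]] ..
  ultimately show "(\<lambda>n. \<bar>(\<integral>\<omega>. (\<integral>z. \<phi> (shift (int n) \<omega>, Fiter T n \<omega> z) * \<psi> (\<omega>, z) \<partial>\<nu> \<omega>) \<partial>Pm T) -
      (\<integral>\<omega>. (\<integral>z. \<phi> (\<omega>, z) \<partial>\<nu> \<omega>) \<partial>Pm T) * (\<integral>\<omega>. (\<integral>z. \<psi> (\<omega>, z) \<partial>\<nu> \<omega>) \<partial>Pm T)\<bar>) \<longlonglongrightarrow> 0"
    using tendsto_rabs_zero[OF LIM_zero[OF lim]] by simp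
qed

section \<open>Membership of the density in the function spaces\<close>

lemma cell_points:
  assumes \<omega>: "\<omega> \<in> Z" and I: "I \<in> cells T \<omega>"
  obtains l where "\<And>p. p \<in> I \<Longrightarrow> \<exists>x. p = (x, l) \<and> (x, l) \<in> Delta T \<omega>"
proof -
  obtain A l where A: "I = A \<times> {l}" "A \<in> part T (shift (- int l) \<omega>)"
    "\<And>x. x \<in> A \<Longrightarrow> l < rtime T (shift (- int l) \<omega>) x"
    using I unfolding cells_eq by auto
  have "(x, l) \<in> Delta T \<omega>" if "x \<in> A" for x
    using A that part_subset[OF setting Z_good[OF \<omega>] gam D0 tG eps A(2)]
      Delta_orbit[OF setting Z_good[OF \<omega>] gam D0 tG eps, of 0] by auto
  then show ?thesis using A(1) by (intro that[of l]) auto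
qed

lemma Q_pos: "0 < Q"
  unfolding Q_def using gam D0 by simp

text \<open>The ratio bound spreads a zero of h over its cell, which gives the alternative in
  \<open>F_plus\<close>; where h is positive, the bound in both orders controls the absolute value
  of the logarithm.\<close>

lemma h_F_plus: "h \<in> F_plus T \<gamma>"
  unfolding F_plus_def
proof (rule CollectI, intro exI conjI)
  show "0 < Q" by (rule Q_pos)
  show "AE \<omega> in Pm T. \<forall>I\<in>cells T \<omega>. (\<forall>x\<in>I. h \<omega> x = 0) \<or>
     ((\<forall>x\<in>I. h \<omega> x > 0) \<and> (\<forall>x\<in>I. \<forall>y\<in>I. \<bar>ln (h \<omega> x / h \<omega> y)\<bar> \<le> Q * gpow \<gamma> (sep T (\<omega>, x) (\<omega>, y))))"
    using Z_AE
  proof eventually_elim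
    case (elim \<omega>)
    show ?case
    proof
      fix I assume "I \<in> cells T \<omega>"
      then obtain l where l: "\<And>p. p \<in> I \<Longrightarrow> \<exists>x. p = (x, l) \<and> (x, l) \<in> Delta T \<omega>"
        using cell_points[OF elim] by blast
      have nn: "0 \<le> h \<omega> p" for p using h_nonneg[OF elim, of 0 p] by simp
      have ratio: "h \<omega> p \<le> exp (Q * gpow \<gamma> (sep T (\<omega>, p) (\<omega>, q))) * h \<omega> q" if "p \<in> I" "q \<in> I" for p q
        using l[OF that(1)] l[OF that(2)] h_ratio[OF elim] by blast
      show "(\<forall>x\<in>I. h \<omega> x = 0) \<or>
        ((\<forall>x\<in>I. h \<omega> x > 0) \<and> (\<forall>x\<in>I. \<forall>y\<in>I. \<bar>ln (h \<omega> x / h \<omega> y)\<bar> \<le> Q * gpow \<gamma> (sep T (\<omega>, x) (\<omega>, y))))"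
      proof (cases "\<exists>q\<in>I. h \<omega> q = 0")
        case True
        then obtain q where q: "q \<in> I" "h \<omega> q = 0" by blast
        have "h \<omega> p = 0" if "p \<in> I" for p
          using ratio[OF that q(1)] q(2) nn[of p] by simp
        then show ?thesis by blast
      next
        case False
        then have pos: "0 < h \<omega> p" if "p \<in> I" for p using nn[of p] that by (auto simp: less_le)
        have up: "ln (h \<omega> p / h \<omega> q) \<le> Q * gpow \<gamma> (sep T (\<omega>, p) (\<omega>, q))" if "p \<in> I" "q \<in> I" for p q
        proof -
          have "h \<omega> p / h \<omega> q \<le> exp (Q * gpow \<gamma> (sep T (\<omega>, p) (\<omega>, q)))"
            using ratio[OF that] pos[OF that(2)] by (simp add: pos_divide_le_eq)
          then have "ln (h \<omega> p / h \<omega> q) \<le> ln (exp (Q * gpow \<gamma> (sep T (\<omega>, p) (\<omega>, q))))"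
            using pos that by (subst ln_le_cancel_iff) auto
          then show ?thesis by simp
        qed
        have "\<bar>ln (h \<omega> p / h \<omega> q)\<bar> \<le> Q * gpow \<gamma> (sep T (\<omega>, p) (\<omega>, q))" if "p \<in> I" "q \<in> I" for p q
        proof -
          have "- ln (h \<omega> p / h \<omega> q) = ln (h \<omega> q / h \<omega> p)"
            using pos that by (simp add: ln_div)
          also have "\<dots> \<le> Q * gpow \<gamma> (sep T (\<omega>, p) (\<omega>, q))"
            using up[OF that(2,1)] by (simp add: sep_sym)
          finally show ?thesis using up[OF that] by linarith
        qed
        then show ?thesis using pos by blast
      qed
    qed
  qed
qed

text \<open>On one level the ratio bound leaves (exp (Q s) - 1) exp Q, with s the power of \<gamma>,
  and convexity of exp makes this linear in s. On different levels the separation time is 0, so the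
  uniform bound on h suffices.\<close>

lemma h_F_gamma: "h \<in> F_gamma T \<gamma> (\<lambda>_. 1)"
  unfolding F_gamma_def
proof (rule CollectI, intro conjI exI)
  show "h \<in> L_inf T (\<lambda>_. 1)"
    unfolding L_inf_def
  proof (rule CollectI, intro conjI exI)
    show "0 < exp Q" by simp
    show "AE \<omega> in Pm T. \<forall>x\<in>Delta T \<omega>. \<bar>h \<omega> x\<bar> \<le> exp Q * 1"
      using Z_AE
    proof eventually_elim
      case (elim \<omega>)
      show ?case using h_bounded[OF elim] h_nonneg[OF elim, of 0] by simp
    qed
  qed
  show "0 < exp Q * exp Q" by simp
  show "AE \<omega> in Pm T. \<forall>x\<in>Delta T \<omega>. \<forall>y\<in>Delta T \<omega>.
     \<bar>h \<omega> x - h \<omega> y\<bar> \<le> exp Q * exp Q * 1 * gpow \<gamma> (sep T (\<omega>, x) (\<omega>, y))"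
    using Z_AE
  proof eventually_elim
    case (elim \<omega>)
    have nn: "0 \<le> h \<omega> p" for p using h_nonneg[OF elim, of 0 p] by simp
    have up: "h \<omega> p - h \<omega> q \<le> exp Q * exp Q * gpow \<gamma> (sep T (\<omega>, p) (\<omega>, q))"
      if D: "p \<in> Delta T \<omega>" "q \<in> Delta T \<omega>" for p q
    proof (cases "snd p = snd q")
      case True
      then obtain x y l where pq: "p = (x, l)" "q = (y, l)" by (metis prod.collapse)
      define s where "s = gpow \<gamma> (sep T (\<omega>, p) (\<omega>, q))"
      have s: "0 \<le> s" "s \<le> 1" unfolding s_def using gpow_bounds[OF gam] by auto
      have "h \<omega> p \<le> exp (Q * s) * h \<omega> q"
        using h_ratio[OF elim] D unfolding s_def pq by blast
      then have "h \<omega> p - h \<omega> q \<le> (exp (Q * s) - 1) * h \<omega> q" by (simp add: algebra_simps)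
      also have "\<dots> \<le> (s * (exp Q - 1)) * exp Q"
        using exp_minus_one_le[OF s, of Q] h_bounded[OF elim] nn s Q_pos by (intro mult_mono) auto
      also have "\<dots> \<le> (s * exp Q) * exp Q" using s by (intro mult_right_mono mult_left_mono) auto
      finally show ?thesis by (simp add: s_def ac_simps)
    next
      case False
      then obtain x l y l' where pq: "p = (x, l)" "q = (y, l')" "l \<noteq> l'" by (metis prod.collapse snd_conv)
      have "sep T (shift 0 \<omega>, p) (shift 0 \<omega>, q) = 0"
        unfolding pq by (rule sep_diff[OF setting Z_good[OF elim] gam D0 tG eps]) (use D pq in auto)
      then have g: "gpow \<gamma> (sep T (\<omega>, p) (\<omega>, q)) = 1" by simp
      have "h \<omega> p - h \<omega> q \<le> exp Q" using h_bounded[OF elim, of p] nn[of q] by simp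
      also have "\<dots> \<le> exp Q * exp Q" using mult_left_mono[of 1 "exp Q" "exp Q"] Q_pos by simp
      finally show ?thesis unfolding g by simp
    qed
    show ?case
    proof (intro ballI)
      fix p q assume D: "p \<in> Delta T \<omega>" "q \<in> Delta T \<omega>"
      show "\<bar>h \<omega> p - h \<omega> q\<bar> \<le> exp Q * exp Q * 1 * gpow \<gamma> (sep T (\<omega>, p) (\<omega>, q))"
        using up[OF D] up[OF D(2,1)] sep_sym[of T "(\<omega>, p)" "(\<omega>, q)"] by simp
    qed
  qed
qed

lemma h_density:
  "AE \<omega> in Pm T. h \<omega> \<in> borel_measurable (tower_measure T \<omega>) \<and>
     (\<forall>z\<in>Delta T \<omega>. 0 \<le> h \<omega> z) \<and> prob_space (fibre_measure T h \<omega>)"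
  using Z_AE
proof eventually_elim
  case (elim \<omega>)
  show ?case using h_measurable[OF elim, of 0] h_nonneg[OF elim, of 0] prob_nu0[OF elim] by simp
qed

end

section \<open>The main theorem\<close>

lemma AE_good_fibre:
  fixes T :: "('a :: topological_space, 'x :: metric_space) random_tower"
  assumes setting: "tower_setting T" and "P1 T" and "P2 T \<gamma>" and "P3 T" and "P5 T" and "P6 T"
  obtains D M N t \<epsilon> where "0 < D" "Gcd (t ` {1..N}) = 1" "\<forall>i\<in>{1..N}. 0 < \<epsilon> i"
    "AE \<omega> in Pm T. good_fibre T \<gamma> D M N t \<epsilon> \<omega>"
proof -
  obtain D where D: "0 < D" "AE \<omega> in Pm T. \<forall>A\<in>part T \<omega>.
     nonsingular (restrict_space (ref T) A) (base_measure T) (base_return T \<omega>) \<and>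
     nonsingular (base_measure T) (restrict_space (ref T) A) (inv_into A (base_return T \<omega>)) \<and>
     (\<exists>J. branch_jac T \<gamma> D \<omega> A J)"
    using \<open>P2 T \<gamma>\<close> unfolding P2_def branch_jac_def by blast
  obtain N :: nat and t :: "nat \<Rightarrow> nat" and \<epsilon> :: "nat \<Rightarrow> real" where t: "Gcd (t ` {1..N}) = 1" "\<forall>i\<in>{1..N}. 0 < \<epsilon> i"
     "AE \<omega> in Pm T. \<forall>i\<in>{1..N}. measure (ref T) {x \<in> base T. rtime T \<omega> x = t i} > \<epsilon> i"
    using \<open>P5 T\<close> unfolding P5_def by blast
  obtain M where M: "AE \<omega> in Pm T. emeasure (tower_measure T \<omega>) (Delta T \<omega>) \<le> ennreal M"
    using \<open>P6 T\<close> unfolding P6_def by blast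
  have part: "AE \<omega> in Pm T. countable (part T \<omega>) \<and> partition_on (base T) (part T \<omega>) \<and>
        part T \<omega> \<subseteq> sets (ref T) \<and> (\<forall>A\<in>part T \<omega>. rtime T \<omega> constant_on A) \<and> (\<forall>x\<in>base T. 1 \<le> rtime T \<omega> x)"
    using setting unfolding tower_setting_def by blast
  then have "AE \<omega> in Pm T. partition_on (base T) (part T \<omega>)" by (auto elim: eventually_mono)
  \<comment> \<open>The level sets over \<omega> come from the partitions of earlier fibres, so
    writing the tower measure as a sum over levels needs the partition property along the whole
    orbit.\<close>
  from AE_all_shifts[OF setting this] M AE_space
  have "AE \<omega> in Pm T. level_tail T 0 \<omega> < \<top>"
  proof eventually_elim
    case (elim \<omega>)
    have "emeasure (tower_measure T \<omega>) (Delta T \<omega>) = level_tail T 0 \<omega>"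
      using elim measurable_space[OF shift_measurable[OF setting]] by (intro emeasure_tower[OF setting]) auto
    then show ?case using elim(2) by (auto simp: order.strict_trans1)
  qed
  note visits = AE_visits[OF setting this]
  have bij: "AE \<omega> in Pm T. \<forall>A\<in>part T \<omega>. bij_betw (base_return T \<omega>) A (base T)"
    using \<open>P1 T\<close> unfolding P1_def .
  have diam: "AE \<omega> in Pm T. \<forall>e>0. \<exists>n0. \<forall>n\<ge>n0. \<forall>E\<in>cell_join T n \<omega>. bounded (fst ` E) \<and> diameter (fst ` E) \<le> e"
    using \<open>P3 T\<close> unfolding P3_def .
  have "AE \<omega> in Pm T. good_fibre T \<gamma> D M N t \<epsilon> \<omega>"
    using AE_space part bij D(2) diam t(3) M visits
  proof eventually_elim
    case (elim \<omega>)
    then show ?case unfolding good_fibre_def by (elim conjE) (intro conjI; assumption)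
  qed
  then show ?thesis using that D(1) t(1,2) by blast
qed

text \<open>The good set itself may fail to be measurable; the complement of a null set is not, and
  intersecting its countably many shifts gives an invariant one.\<close>

lemma AE_invariant_set:
  fixes T :: "('a :: topological_space, 'x :: metric_space) random_tower"
  assumes setting: "tower_setting T" and good: "AE \<omega> in Pm T. Q \<omega>"
  obtains Z where "Z \<in> sets (Pm T)" "AE \<omega> in Pm T. \<omega> \<in> Z"
    "\<And>\<omega> k. \<omega> \<in> Z \<Longrightarrow> Q (shift k \<omega>)" "\<And>\<omega> k. \<omega> \<in> Z \<Longrightarrow> shift k \<omega> \<in> Z"
proof -
  obtain N where N: "\<And>\<omega>. \<omega> \<in> space (Pm T) - N \<Longrightarrow> Q \<omega>" "N \<in> null_sets (Pm T)"
    using AE_E3[OF good] by blast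
  have Ns: "N \<in> sets (Pm T)" using N(2) by auto
  define Z where "Z = {\<omega> \<in> space (Pm T). \<forall>k. shift k \<omega> \<notin> N}"
  have sp: "shift k \<omega> \<in> space (Pm T)" if "\<omega> \<in> space (Pm T)" for k \<omega>
    by (rule measurable_space[OF shift_measurable[OF setting] that])
  have "Z = space (Pm T) - (\<Union>k. shift k -` N \<inter> space (Pm T))" unfolding Z_def by auto
  moreover have "(\<Union>k. shift k -` N \<inter> space (Pm T)) \<in> sets (Pm T)"
    using measurable_sets[OF shift_measurable[OF setting] Ns] by (intro sets.countable_UN) auto
  ultimately have Zs: "Z \<in> sets (Pm T)" by auto
  have "AE \<omega> in Pm T. \<omega> \<notin> N" by (rule AE_not_in[OF N(2)])
  from AE_all_shifts[OF setting this] AE_space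
  have "AE \<omega> in Pm T. \<omega> \<in> Z" by eventually_elim (simp add: Z_def)
  then show ?thesis
    using Zs N(1) sp by (intro that[of Z]) (auto simp: Z_def)
qed

theorem theorem4p1:
  fixes T :: "('a :: topological_space, 'x :: metric_space) random_tower"
    and \<gamma> a u v :: real
  assumes "tower_setting T"
    and "P1 T" and "P2 T \<gamma>" and "P3 T" and "P4 T a u v" and "P5 T" and "P6 T" and "P7 T a"
  shows "\<exists>h.
      (AE \<omega> in Pm T. h \<omega> \<in> borel_measurable (tower_measure T \<omega>) \<and>
         (\<forall>z\<in>Delta T \<omega>. 0 \<le> h \<omega> z) \<and> prob_space (fibre_measure T h \<omega>)) \<and>
      measurable_family T (fibre_measure T h) \<and>
      equivariant T (fibre_measure T h) \<and>
      exact_system T (fibre_measure T h) \<and>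
      mixing_system T (fibre_measure T h) \<and>
      (\<exists>K :: (int \<Rightarrow> 'a) \<Rightarrow> real. K \<in> borel_measurable (Pm T) \<and>
         (\<forall>\<omega>\<in>space (Pm T). 0 \<le> K \<omega>) \<and> 0 < (INF \<omega>\<in>space (Pm T). K \<omega>) \<and>
         (\<forall>n::nat. measure (Pm T) {\<omega> \<in> space (Pm T). K \<omega> > real n} \<le> exp (- u * real n powr v)) \<and>
         h \<in> F_gamma T \<gamma> K \<inter> F_plus T \<gamma>)"
proof -
  obtain D M N t \<epsilon> where par: "0 < D" "Gcd (t ` {1..N}) = 1" "\<forall>i\<in>{1..N}. 0 < \<epsilon> i"
    and good: "AE \<omega> in Pm T. good_fibre T \<gamma> D M N t \<epsilon> \<omega>"
    using AE_good_fibre[OF assms(1,2,3,4,6,7)] by metis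
  obtain Z where Z: "Z \<in> sets (Pm T)" "AE \<omega> in Pm T. \<omega> \<in> Z"
    "\<And>\<omega> k. \<omega> \<in> Z \<Longrightarrow> good_fibre T \<gamma> D M N t \<epsilon> (shift k \<omega>)" "\<And>\<omega> k. \<omega> \<in> Z \<Longrightarrow> shift k \<omega> \<in> Z"
    using AE_invariant_set[OF assms(1) good] by metis
  have gam: "0 < \<gamma>" "\<gamma> < 1" using assms(3) by (auto simp: P2_def)
  interpret G: good_tower T \<gamma> D M N t \<epsilon> Z
    by (rule good_tower.intro) (use assms(1) gam par Z in \<open>auto simp: good_orbit_def\<close>)
  interpret P: prob_space "Pm T" by (rule prob_Pm[OF assms(1)])
  show ?thesis
  proof (intro exI[of _ G.h] conjI)
    show "\<exists>K :: (int \<Rightarrow> 'a) \<Rightarrow> real. K \<in> borel_measurable (Pm T) \<and>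
         (\<forall>\<omega>\<in>space (Pm T). 0 \<le> K \<omega>) \<and> 0 < (INF \<omega>\<in>space (Pm T). K \<omega>) \<and>
         (\<forall>n::nat. measure (Pm T) {\<omega> \<in> space (Pm T). K \<omega> > real n} \<le> exp (- u * real n powr v)) \<and>
         G.h \<in> F_gamma T \<gamma> K \<inter> F_plus T \<gamma>"
    \<comment> \<open>The bounds on h were uniform over the fibres, so the constant random variable
      1 is admissible.\<close>
    proof (intro exI[of _ "\<lambda>_. 1"] conjI allI IntI)
      show "0 < (INF \<omega>\<in>space (Pm T). 1 :: real)" using P.not_empty by simp
      fix n :: nat
      show "measure (Pm T) {\<omega> \<in> space (Pm T). 1 > real n} \<le> exp (- u * real n powr v)"
        \<comment> \<open>For n = 0 the event has probability 1 and the right side is exp 0, as 0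
          \<open>powr\<close> v is 0; for larger n the event is empty.\<close>
        by (cases "n = 0") (simp_all add: P.prob_space)
    qed (auto intro: G.h_F_gamma G.h_F_plus)
  qed (rule G.h_density G.measurable_family_nu G.equivariant_nu G.exact_nu G.mixing_nu)+
qed

end
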